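(* Consider $H=H(G,\chi,\eta,b,c,\beta)$. (1) A $\mathbb{K}$-basis for $H$ is $\{gx^iy^j\mid g\in G,\ i,j\ge0\}$. (2) $H$ falls into one of two isomorphism classes: if $\beta(1-bc)=0$ (i.e. $\beta=0$ or $c=b^{-1}$), then $H\simeq H(G,\chi,\eta,b,c,0)$; if $\beta(1-bc)\neq0$ (i.e. $\beta\ne0$ and $c\neq b^{-1}$), then necessarily $\eta=\chi^{-1}$ and $H\simeq H(G,\chi,\chi^{-1},b,c,1)$. (3) $H$ is Noetherian provided $G$ is polycyclic-by-finite. (4) $H$ is a domain if and only if $\mathbb{K}[G]$ is a domain. (5) If $G$ is a finitely generated group with $\mathrm{GKdim}(\mathbb{K}[G])=d<\infty$, then $H$ is an affine algebra of Gelfand-Kirillov dimension $d+2$. (6) The antipode $S$ of $H$ satisfies $S^2|_G=\mathrm{id}$ and $S^2(x)=\chi(b)x$, $S^2(y)=\eta(c)y$. In particular, $S$ has finite order if and only if $\chi(b)$ and $\eta(c)$ are roots of unity. (7) $H$ is a pointed Hopf algebra with group of group-like elements $G(H)=G$.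
   Context: $\mathbb{K}$ is an algebraically closed field of characteristic zero. For a group $G$, $Z(G)$ is its center and $\widehat{G}$ the group of homomorphisms $G\to\mathbb{K}^\times$. Let $(\chi,b),(\eta,c)\in\widehat{G}\times Z(G)$ with $\eta(b)=\chi(c)^{-1}$ and $\beta\in\mathbb{K}$. The Hopf algebra $H(G,\chi,\eta,b,c,\beta)$ is, as an algebra, the iterated Ore extension $\mathbb{K}[G][x;\tau_\chi][y;\tau_\eta,\delta]$ (convention: $R[x;\sigma,\delta]$ is free as a left $R$-module on the powers of $x$ with $xr=\sigma(r)x+\delta(r)$), where $\tau_\chi(g)=\chi(g)g$, $\tau_\eta(g)=\eta(g)g$ for $g\in G$, $\tau_\eta(x)=\eta(b)x$, and $\delta$ is the $\tau_\eta$-derivation with $\delta(g)=0$ for $g\in G$ and $\delta(x)=\beta(1-cb)$ (the data being such that this derivation exists). Thus $xg=\chi(g)gx$, $yg=\eta(g)gy$ and $yx=\eta(b)xy+\beta(1-cb)$. The elements of $G$ are group-like, $\Delta(x)=x\otimes1+b\otimes x$, $\Delta(y)=y\otimes 1+c\otimes y$, $\epsilon(x)=\epsilon(y)=0$. $\mathrm{GKdim}$ denotes Gelfand-Kirillov dimension; affine means finitely generated as a $\mathbb{K}$-algebra. *)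

theory Defs
  imports
    "HOL-Algebra.Elementary_Groups"
    "HOL-Algebra.Algebraic_Closure_Type"
    "HOL-Algebra.UnivPoly"
    "HOL-Library.Poly_Mapping"
    "HOL-Library.Extended_Real"
begin

section \<open>Algebras over a field\<close>

text \<open>The ground field is a type of class \<open>field\<close>; groups, rings and algebras are records.\<close>

abbreviation scalar_ring :: "'k::field ring" where
  "scalar_ring \<equiv> ring_of_type_algebra"

text \<open>The locale \<open>algebra\<close> of the library is for commutative algebras only, hence the following.\<close>

definition k_algebra :: "('k::field, 'a, 'm) module_scheme \<Rightarrow> bool" where
  "k_algebra A \<longleftrightarrow> Ring.ring A \<and> Module.module scalar_ring A \<and>
     (\<forall>k. \<forall>u\<in>carrier A. \<forall>v\<in>carrier A.
        (k \<odot>\<^bsub>A\<^esub> u) \<otimes>\<^bsub>A\<^esub> v = k \<odot>\<^bsub>A\<^esub> (u \<otimes>\<^bsub>A\<^esub> v) \<and>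
        u \<otimes>\<^bsub>A\<^esub> (k \<odot>\<^bsub>A\<^esub> v) = k \<odot>\<^bsub>A\<^esub> (u \<otimes>\<^bsub>A\<^esub> v))"

definition k_linear_maps ::
  "('k::field, 'a, 'm) module_scheme \<Rightarrow> ('k, 'b, 'n) module_scheme \<Rightarrow> ('a \<Rightarrow> 'b) set" where
  "k_linear_maps A B = {f \<in> carrier A \<rightarrow> carrier B.
     (\<forall>u\<in>carrier A. \<forall>v\<in>carrier A. f (u \<oplus>\<^bsub>A\<^esub> v) = f u \<oplus>\<^bsub>B\<^esub> f v) \<and>
     (\<forall>k. \<forall>u\<in>carrier A. f (k \<odot>\<^bsub>A\<^esub> u) = k \<odot>\<^bsub>B\<^esub> f u)}"

definition k_algebra_homs ::
  "('k::field, 'a, 'm) module_scheme \<Rightarrow> ('k, 'b, 'n) module_scheme \<Rightarrow> ('a \<Rightarrow> 'b) set" where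
  "k_algebra_homs A B = ring_hom A B \<inter> k_linear_maps A B"

definition k_span :: "('k::field, 'a, 'm) module_scheme \<Rightarrow> 'a set \<Rightarrow> 'a set" where
  "k_span A S = \<Inter>{V. submodule V scalar_ring A \<and> S \<subseteq> V}"

text \<open>The copy of the ground field inside a unital algebra; dimensions of subspaces are the
  library's \<open>ring.dimension\<close> over this subfield.\<close>

definition scalars :: "('k::field, 'a, 'm) module_scheme \<Rightarrow> 'a set" where
  "scalars A = range (\<lambda>k. k \<odot>\<^bsub>A\<^esub> \<one>\<^bsub>A\<^esub>)"

definition lin_comb ::
  "('k::field, 'a, 'm) module_scheme \<Rightarrow> ('i \<Rightarrow> 'a) \<Rightarrow> ('i \<Rightarrow>\<^sub>0 'k) \<Rightarrow> 'a" where
  "lin_comb A f a = (\<Oplus>\<^bsub>A\<^esub>i\<in>Poly_Mapping.keys a. Poly_Mapping.lookup a i \<odot>\<^bsub>A\<^esub> f i)"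

text \<open>The family \<open>(f i)\<close>, \<open>i \<in> I\<close>, is a basis: linearly independent and spanning.\<close>

definition is_k_basis ::
  "('k::field, 'a, 'm) module_scheme \<Rightarrow> ('i \<Rightarrow> 'a) \<Rightarrow> 'i set \<Rightarrow> bool" where
  "is_k_basis A f I \<longleftrightarrow> f \<in> I \<rightarrow> carrier A \<and>
     (\<forall>a :: 'i \<Rightarrow>\<^sub>0 'k. Poly_Mapping.keys a \<subseteq> I \<and> lin_comb A f a = \<zero>\<^bsub>A\<^esub> \<longrightarrow> a = 0) \<and>
     (\<forall>h\<in>carrier A. \<exists>a :: 'i \<Rightarrow>\<^sub>0 'k. Poly_Mapping.keys a \<subseteq> I \<and> h = lin_comb A f a)"

text \<open>Affine: finitely generated as an algebra.\<close>

definition affine_algebra :: "('k::field, 'a, 'm) module_scheme \<Rightarrow> bool" where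
  "affine_algebra A \<longleftrightarrow> (\<exists>S\<subseteq>carrier A. finite S \<and>
     (\<forall>B. subring B A \<and> submodule B scalar_ring A \<and> S \<subseteq> B \<longrightarrow> B = carrier A))"

text \<open>\<open>power_space A V n\<close> is the sum of the subspaces \<open>V^i\<close> with \<open>i \<le> n\<close> (where \<open>V^0\<close> is spanned by 1).\<close>

definition power_space :: "('k::field, 'a, 'm) module_scheme \<Rightarrow> 'a set \<Rightarrow> nat \<Rightarrow> 'a set" where
  "power_space A V n =
     k_span A {foldr (monoid.mult A) vs \<one>\<^bsub>A\<^esub> | vs. set vs \<subseteq> V \<and> length vs \<le> n}"

definition GKdim :: "('k::field, 'a, 'm) module_scheme \<Rightarrow> ereal" where
  "GKdim A =
     (SUP V \<in> {V. submodule V scalar_ring A \<and> ring.finite_dimension A (scalars A) V}.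
        limsup (\<lambda>n. ereal (ln (real (ring.dim A (scalars A) (power_space A V n))) / ln (real n))))"


section \<open>Noncommutative rings\<close>

text \<open>The library's \<open>domain\<close> is commutative, and its \<open>noetherian_ring\<close> is about two-sided ideals.\<close>

definition nc_domain :: "('a, 'm) ring_scheme \<Rightarrow> bool" where
  "nc_domain R \<longleftrightarrow> Ring.ring R \<and> \<one>\<^bsub>R\<^esub> \<noteq> \<zero>\<^bsub>R\<^esub> \<and>
     (\<forall>u\<in>carrier R. \<forall>v\<in>carrier R. u \<otimes>\<^bsub>R\<^esub> v = \<zero>\<^bsub>R\<^esub> \<longrightarrow> u = \<zero>\<^bsub>R\<^esub> \<or> v = \<zero>\<^bsub>R\<^esub>)"

definition left_ideal :: "'a set \<Rightarrow> ('a, 'm) ring_scheme \<Rightarrow> bool" where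
  "left_ideal I R \<longleftrightarrow> additive_subgroup I R \<and> (\<forall>r\<in>carrier R. \<forall>a\<in>I. r \<otimes>\<^bsub>R\<^esub> a \<in> I)"

definition right_ideal :: "'a set \<Rightarrow> ('a, 'm) ring_scheme \<Rightarrow> bool" where
  "right_ideal I R \<longleftrightarrow> additive_subgroup I R \<and> (\<forall>r\<in>carrier R. \<forall>a\<in>I. a \<otimes>\<^bsub>R\<^esub> r \<in> I)"

definition ascending_chain_condition :: "('a set \<Rightarrow> bool) \<Rightarrow> bool" where
  "ascending_chain_condition P \<longleftrightarrow>
     (\<forall>C :: nat \<Rightarrow> 'a set. (\<forall>n. P (C n)) \<and> (\<forall>n. C n \<subseteq> C (Suc n)) \<longrightarrow> (\<exists>N. \<forall>n\<ge>N. C n = C N))"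

definition nc_noetherian :: "('a, 'm) ring_scheme \<Rightarrow> bool" where
  "nc_noetherian R \<longleftrightarrow> Ring.ring R \<and>
     ascending_chain_condition (\<lambda>I. left_ideal I R) \<and>
     ascending_chain_condition (\<lambda>I. right_ideal I R)"


section \<open>Groups\<close>

definition group_center :: "('g, 'm) monoid_scheme \<Rightarrow> 'g set" where
  "group_center G = {z \<in> carrier G. \<forall>g\<in>carrier G. z \<otimes>\<^bsub>G\<^esub> g = g \<otimes>\<^bsub>G\<^esub> z}"

definition finitely_generated_group :: "('g, 'm) monoid_scheme \<Rightarrow> bool" where
  "finitely_generated_group G \<longleftrightarrow> (\<exists>S\<subseteq>carrier G. finite S \<and> generate G S = carrier G)"

text \<open>Patterned after \<open>solvable_seq\<close> of the library, with cyclic factors.\<close>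

inductive polycyclic_seq :: "('g, 'm) monoid_scheme \<Rightarrow> 'g set \<Rightarrow> bool" for G where
  unity: "polycyclic_seq G {\<one>\<^bsub>G\<^esub>}"
| extension: "\<lbrakk> polycyclic_seq G K; K \<lhd> (G \<lparr> carrier := H \<rparr>); subgroup H G;
                cyclic_group ((G \<lparr> carrier := H \<rparr>) Mod K) \<rbrakk> \<Longrightarrow> polycyclic_seq G H"

definition polycyclic_by_finite :: "('g, 'm) monoid_scheme \<Rightarrow> bool" where
  "polycyclic_by_finite G \<longleftrightarrow>
     (\<exists>N. N \<lhd> G \<and> polycyclic_seq G N \<and> finite (carrier (G Mod N)))"

abbreviation characters :: "('g, 'm) monoid_scheme \<Rightarrow> ('g \<Rightarrow> 'k::field) set" where
  "characters G \<equiv> hom G (mult_of scalar_ring)"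


section \<open>Monoid algebras and tensor products\<close>

definition monoid_algebra :: "('g, 'm) monoid_scheme \<Rightarrow> ('k::field, 'g \<Rightarrow>\<^sub>0 'k) module" where
  "monoid_algebra G =
     \<lparr> carrier = {p. Poly_Mapping.keys p \<subseteq> carrier G},
       monoid.mult = (\<lambda>p q. \<Sum>g\<in>Poly_Mapping.keys p. \<Sum>h\<in>Poly_Mapping.keys q.
         Poly_Mapping.single (g \<otimes>\<^bsub>G\<^esub> h) (Poly_Mapping.lookup p g * Poly_Mapping.lookup q h)),
       one = Poly_Mapping.single \<one>\<^bsub>G\<^esub> 1,
       ring.zero = 0,
       add = (+),
       module.smult = (\<lambda>k. Poly_Mapping.map ((*) k)) \<rparr>"

text \<open>The tensor product \<open>A \<otimes> B\<close> of two algebras over the ground field is the monoid algebra of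
  the multiplicative monoid \<open>A \<times> B\<close>, i.e. the vector space with basis \<open>A \<times> B\<close> and product
  \<open>(a, b) (a', b') = (a a', b b')\<close>, modulo the bilinearity relations. (The span of these relations
  is stable under multiplication by basis elements, so the ideal they generate is just their span.)\<close>

definition tensor_cover ::
  "('k::field, 'a, 'm) module_scheme \<Rightarrow> ('k, 'b, 'n) module_scheme \<Rightarrow> ('k, 'a \<times> 'b \<Rightarrow>\<^sub>0 'k) module" where
  "tensor_cover A B = monoid_algebra (A \<times>\<times> B)"

definition bilinearity_relations ::
  "('k::field, 'a, 'm) module_scheme \<Rightarrow> ('k, 'b, 'n) module_scheme \<Rightarrow> ('a \<times> 'b \<Rightarrow>\<^sub>0 'k) set" where
  "bilinearity_relations A B =
     {Poly_Mapping.single (a \<oplus>\<^bsub>A\<^esub> a', b) 1 - Poly_Mapping.single (a, b) 1 - Poly_Mapping.single (a', b) 1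
       | a a' b. a \<in> carrier A \<and> a' \<in> carrier A \<and> b \<in> carrier B} \<union>
     {Poly_Mapping.single (a, b \<oplus>\<^bsub>B\<^esub> b') 1 - Poly_Mapping.single (a, b) 1 - Poly_Mapping.single (a, b') 1
       | a b b'. a \<in> carrier A \<and> b \<in> carrier B \<and> b' \<in> carrier B} \<union>
     {Poly_Mapping.single (k \<odot>\<^bsub>A\<^esub> a, b) 1 - Poly_Mapping.single (a, b) k
       | k a b. a \<in> carrier A \<and> b \<in> carrier B} \<union>
     {Poly_Mapping.single (a, k \<odot>\<^bsub>B\<^esub> b) 1 - Poly_Mapping.single (a, b) k
       | k a b. a \<in> carrier A \<and> b \<in> carrier B}"

definition tensor_ideal ::
  "('k::field, 'a, 'm) module_scheme \<Rightarrow> ('k, 'b, 'n) module_scheme \<Rightarrow> ('a \<times> 'b \<Rightarrow>\<^sub>0 'k) set" where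
  "tensor_ideal A B = genideal (tensor_cover A B) (bilinearity_relations A B)"

definition tensor_algebra ::
  "('k::field, 'a, 'm) module_scheme \<Rightarrow> ('k, 'b, 'n) module_scheme \<Rightarrow>
   ('k, ('a \<times> 'b \<Rightarrow>\<^sub>0 'k) set) module" where
  "tensor_algebra A B =
     ring.extend (tensor_cover A B Quot tensor_ideal A B)
       (module.fields (\<lambda>k Z. \<Union>t\<in>Z.
          tensor_ideal A B +>\<^bsub>tensor_cover A B\<^esub> (k \<odot>\<^bsub>tensor_cover A B\<^esub> t)))"

definition pure_tensor ::
  "('k::field, 'a, 'm) module_scheme \<Rightarrow> ('k, 'b, 'n) module_scheme \<Rightarrow> 'a \<Rightarrow> 'b \<Rightarrow>
   ('a \<times> 'b \<Rightarrow>\<^sub>0 'k) set" where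
  "pure_tensor A B a b = tensor_ideal A B +>\<^bsub>tensor_cover A B\<^esub> Poly_Mapping.single (a, b) 1"

text \<open>For bilinear \<open>\<phi>\<close> with values in \<open>W\<close>, \<open>tensor_lift W \<phi>\<close> is the linear map on the tensor product
  with \<open>a \<otimes> b \<mapsto> \<phi> a b\<close>; it is evaluated on the representatives of a class, which for bilinear \<open>\<phi>\<close>
  all give the same value. In Sweedler notation, \<open>tensor_lift W \<phi> (\<Delta> h)\<close> is the sum of the
  \<open>\<phi> h\<^sub>1 h\<^sub>2\<close>.\<close>

definition tensor_lift ::
  "('k::field, 'w, 'm) module_scheme \<Rightarrow> ('a \<Rightarrow> 'b \<Rightarrow> 'w) \<Rightarrow> ('a \<times> 'b \<Rightarrow>\<^sub>0 'k) set \<Rightarrow> 'w" where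
  "tensor_lift W \<phi> Z = the_elem (lin_comb W (\<lambda>(a, b). \<phi> a b) ` Z)"


section \<open>Hopf algebras\<close>

record (overloaded) ('k::zero, 'a) bialgebra = "('k, 'a) module" +
  comult :: "'a \<Rightarrow> ('a \<times> 'a \<Rightarrow>\<^sub>0 'k) set"
  counit :: "'a \<Rightarrow> 'k"

definition is_bialgebra :: "('k::field, 'a, 'm) bialgebra_scheme \<Rightarrow> bool" where
  "is_bialgebra H \<longleftrightarrow> k_algebra H \<and>
     comult H \<in> k_algebra_homs H (tensor_algebra H H) \<and>
     counit H \<in> ring_hom H scalar_ring \<and>
     (\<forall>k. \<forall>h\<in>carrier H. counit H (k \<odot>\<^bsub>H\<^esub> h) = k * counit H h) \<and>
     \<comment> \<open>coassociativity, in \<open>H \<otimes> (H \<otimes> H)\<close>\<close>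
     (\<forall>h\<in>carrier H.
        tensor_lift (tensor_algebra H (tensor_algebra H H))
          (\<lambda>u v. tensor_lift (tensor_algebra H (tensor_algebra H H))
             (\<lambda>u\<^sub>1 u\<^sub>2. pure_tensor H (tensor_algebra H H) u\<^sub>1 (pure_tensor H H u\<^sub>2 v)) (comult H u))
          (comult H h) =
        tensor_lift (tensor_algebra H (tensor_algebra H H))
          (\<lambda>u v. pure_tensor H (tensor_algebra H H) u (comult H v))
          (comult H h)) \<and>
     (\<forall>h\<in>carrier H. tensor_lift H (\<lambda>u v. counit H u \<odot>\<^bsub>H\<^esub> v) (comult H h) = h) \<and>
     (\<forall>h\<in>carrier H. tensor_lift H (\<lambda>u v. counit H v \<odot>\<^bsub>H\<^esub> u) (comult H h) = h)"

definition is_antipode :: "('k::field, 'a, 'm) bialgebra_scheme \<Rightarrow> ('a \<Rightarrow> 'a) \<Rightarrow> bool" where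
  "is_antipode H S \<longleftrightarrow> S \<in> k_linear_maps H H \<and>
     (\<forall>h\<in>carrier H. tensor_lift H (\<lambda>u v. S u \<otimes>\<^bsub>H\<^esub> v) (comult H h) = counit H h \<odot>\<^bsub>H\<^esub> \<one>\<^bsub>H\<^esub>) \<and>
     (\<forall>h\<in>carrier H. tensor_lift H (\<lambda>u v. u \<otimes>\<^bsub>H\<^esub> S v) (comult H h) = counit H h \<odot>\<^bsub>H\<^esub> \<one>\<^bsub>H\<^esub>)"

definition is_hopf_algebra :: "('k::field, 'a, 'm) bialgebra_scheme \<Rightarrow> bool" where
  "is_hopf_algebra H \<longleftrightarrow> is_bialgebra H \<and> (\<exists>S. is_antipode H S)"

text \<open>Unique on the carrier, being the convolution inverse of the identity.\<close>

definition antipode :: "('k::field, 'a, 'm) bialgebra_scheme \<Rightarrow> 'a \<Rightarrow> 'a" where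
  "antipode H = (SOME S. is_antipode H S)"

definition finite_order_on :: "'a set \<Rightarrow> ('a \<Rightarrow> 'a) \<Rightarrow> bool" where
  "finite_order_on C S \<longleftrightarrow> (\<exists>n>0. \<forall>h\<in>C. (S ^^ n) h = h)"

definition root_of_unity :: "'k::field \<Rightarrow> bool" where
  "root_of_unity q \<longleftrightarrow> (\<exists>n>0. q ^ n = 1)"

text \<open>Isomorphism of Hopf algebras (a bialgebra isomorphism automatically respects antipodes).\<close>

definition hopf_isomorphic ::
  "('k::field, 'a, 'm) bialgebra_scheme \<Rightarrow> ('k, 'b, 'n) bialgebra_scheme \<Rightarrow> bool" where
  "hopf_isomorphic H H' \<longleftrightarrow>
     (\<exists>f\<in>k_algebra_homs H H'. bij_betw f (carrier H) (carrier H') \<and>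
        (\<forall>h\<in>carrier H.
           tensor_lift (tensor_algebra H' H') (\<lambda>u v. pure_tensor H' H' (f u) (f v)) (comult H h) =
             comult H' (f h) \<and>
           counit H' (f h) = counit H h))"

definition group_likes :: "('k::field, 'a, 'm) bialgebra_scheme \<Rightarrow> 'a set" where
  "group_likes H = {g \<in> carrier H. g \<noteq> \<zero>\<^bsub>H\<^esub> \<and> comult H g = pure_tensor H H g g}"

definition subcoalgebra :: "'a set \<Rightarrow> ('k::field, 'a, 'm) bialgebra_scheme \<Rightarrow> bool" where
  "subcoalgebra C H \<longleftrightarrow> submodule C scalar_ring H \<and>
     comult H ` C \<subseteq> k_span (tensor_algebra H H) {pure_tensor H H u v | u v. u \<in> C \<and> v \<in> C}"

definition simple_subcoalgebra :: "'a set \<Rightarrow> ('k::field, 'a, 'm) bialgebra_scheme \<Rightarrow> bool" where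
  "simple_subcoalgebra C H \<longleftrightarrow> subcoalgebra C H \<and> C \<noteq> {\<zero>\<^bsub>H\<^esub>} \<and>
     (\<forall>D\<subseteq>C. subcoalgebra D H \<longrightarrow> D = {\<zero>\<^bsub>H\<^esub>} \<or> D = C)"

definition pointed :: "('k::field, 'a, 'm) bialgebra_scheme \<Rightarrow> bool" where
  "pointed H \<longleftrightarrow> (\<forall>C. simple_subcoalgebra C H \<longrightarrow> ring.dimension H 1 (scalars H) C)"


section \<open>Ore extensions\<close>

definition skew_derivations ::
  "('k::field, 'a, 'm) module_scheme \<Rightarrow> ('a \<Rightarrow> 'a) \<Rightarrow> ('a \<Rightarrow> 'a) set" where
  "skew_derivations R \<sigma> = {\<delta> \<in> k_linear_maps R R.
     \<forall>u\<in>carrier R. \<forall>v\<in>carrier R. \<delta> (u \<otimes>\<^bsub>R\<^esub> v) = (\<sigma> u \<otimes>\<^bsub>R\<^esub> \<delta> v) \<oplus>\<^bsub>R\<^esub> (\<delta> u \<otimes>\<^bsub>R\<^esub> v)}"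

text \<open>An element \<open>p\<close> of \<open>R[x; \<sigma>, \<delta>]\<close> is the coefficient sequence of the sum of the \<open>p i x^i\<close>, with
  finitely many nonzero coefficients (\<open>up R\<close>). From \<open>x r = \<sigma>(r) x + \<delta>(r)\<close>, left multiplication by \<open>x\<close>
  sends the sum of the \<open>q n x^n\<close> to the sum of the \<open>\<sigma>(q n) x^(n+1) + \<delta>(q n) x^n\<close>, and the product
  \<open>p q\<close> is the sum of the \<open>p i (x^i q)\<close>.\<close>

definition ore_shift ::
  "('k::field, 'a, 'm) module_scheme \<Rightarrow> ('a \<Rightarrow> 'a) \<Rightarrow> ('a \<Rightarrow> 'a) \<Rightarrow> (nat \<Rightarrow> 'a) \<Rightarrow> nat \<Rightarrow> 'a" where
  "ore_shift R \<sigma> \<delta> q n = (case n of 0 \<Rightarrow> \<delta> (q 0) | Suc m \<Rightarrow> \<sigma> (q m) \<oplus>\<^bsub>R\<^esub> \<delta> (q (Suc m)))"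

definition ore_extension ::
  "('k::field, 'a, 'm) module_scheme \<Rightarrow> ('a \<Rightarrow> 'a) \<Rightarrow> ('a \<Rightarrow> 'a) \<Rightarrow> ('k, nat \<Rightarrow> 'a) module" where
  "ore_extension R \<sigma> \<delta> =
     \<lparr> carrier = up R,
       monoid.mult = (\<lambda>p q n. \<Oplus>\<^bsub>R\<^esub>i\<in>{i. p i \<noteq> \<zero>\<^bsub>R\<^esub>}. p i \<otimes>\<^bsub>R\<^esub> (ore_shift R \<sigma> \<delta> ^^ i) q n),
       one = (\<lambda>n. if n = 0 then \<one>\<^bsub>R\<^esub> else \<zero>\<^bsub>R\<^esub>),
       ring.zero = (\<lambda>n. \<zero>\<^bsub>R\<^esub>),
       add = (\<lambda>p q n. p n \<oplus>\<^bsub>R\<^esub> q n),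
       module.smult = (\<lambda>k p n. k \<odot>\<^bsub>R\<^esub> p n) \<rparr>"

definition ore_const :: "('k::field, 'a, 'm) module_scheme \<Rightarrow> 'a \<Rightarrow> nat \<Rightarrow> 'a" where
  "ore_const R r n = (if n = 0 then r else \<zero>\<^bsub>R\<^esub>)"

definition ore_var :: "('k::field, 'a, 'm) module_scheme \<Rightarrow> nat \<Rightarrow> 'a" where
  "ore_var R n = (if n = 1 then \<one>\<^bsub>R\<^esub> else \<zero>\<^bsub>R\<^esub>)"


section \<open>The Hopf algebras $H(G,\chi,\eta,b,c,\beta)$\<close>

definition twist :: "('g \<Rightarrow> 'k::field) \<Rightarrow> ('g \<Rightarrow>\<^sub>0 'k) \<Rightarrow> ('g \<Rightarrow>\<^sub>0 'k)" where
  "twist \<chi> = Poly_Mapping.mapp (\<lambda>g a. \<chi> g * a)"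

definition H_base :: "('g, 'm) monoid_scheme \<Rightarrow> ('g \<Rightarrow> 'k::field) \<Rightarrow> ('k, nat \<Rightarrow> 'g \<Rightarrow>\<^sub>0 'k) module" where
  "H_base G \<chi> = ore_extension (monoid_algebra G) (twist \<chi>) (\<lambda>_. 0)"

text \<open>The algebra automorphism of \<open>H_base G \<chi>\<close> with \<open>g \<mapsto> \<eta>(g) g\<close> and \<open>x \<mapsto> \<eta>(b) x\<close>; by
  multiplicativity it maps \<open>r x^i\<close> to \<open>\<eta>(b)^i \<tau>(r) x^i\<close> for \<open>r\<close> in the group algebra.\<close>

definition H_twist :: "('g \<Rightarrow> 'k::field) \<Rightarrow> 'g \<Rightarrow> (nat \<Rightarrow> 'g \<Rightarrow>\<^sub>0 'k) \<Rightarrow> nat \<Rightarrow> 'g \<Rightarrow>\<^sub>0 'k" where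
  "H_twist \<eta> b p i = Poly_Mapping.map ((*) (\<eta> b ^ i)) (twist \<eta> (p i))"

text \<open>The element \<open>\<beta>(1 - cb)\<close> of the group algebra.\<close>

definition beta_elt :: "('g, 'm) monoid_scheme \<Rightarrow> 'g \<Rightarrow> 'g \<Rightarrow> 'k::field \<Rightarrow> 'g \<Rightarrow>\<^sub>0 'k" where
  "beta_elt G b c \<beta> = \<beta> \<odot>\<^bsub>monoid_algebra G\<^esub>
     (Poly_Mapping.single \<one>\<^bsub>G\<^esub> 1 \<ominus>\<^bsub>monoid_algebra G\<^esub> Poly_Mapping.single (c \<otimes>\<^bsub>G\<^esub> b) 1)"

text \<open>The derivations \<open>\<delta>\<close> with \<open>\<delta>(g) = 0\<close> and \<open>\<delta>(x) = \<beta>(1 - cb)\<close>: at most one up to values outside the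
  carrier, since \<open>G\<close> and \<open>x\<close> generate \<open>H_base G \<chi>\<close> as an algebra.\<close>

definition H_derivations ::
  "('g, 'm) monoid_scheme \<Rightarrow> ('g \<Rightarrow> 'k::field) \<Rightarrow> ('g \<Rightarrow> 'k) \<Rightarrow> 'g \<Rightarrow> 'g \<Rightarrow> 'k \<Rightarrow>
   ((nat \<Rightarrow> 'g \<Rightarrow>\<^sub>0 'k) \<Rightarrow> nat \<Rightarrow> 'g \<Rightarrow>\<^sub>0 'k) set" where
  "H_derivations G \<chi> \<eta> b c \<beta> = {\<delta> \<in> skew_derivations (H_base G \<chi>) (H_twist \<eta> b).
     (\<forall>g\<in>carrier G. \<delta> (ore_const (monoid_algebra G) (Poly_Mapping.single g 1)) = \<zero>\<^bsub>H_base G \<chi>\<^esub>) \<and>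
     \<delta> (ore_var (monoid_algebra G)) = ore_const (monoid_algebra G) (beta_elt G b c \<beta>)}"

locale H_datum = group G for G (structure) +
  fixes \<chi> \<eta> :: "'a \<Rightarrow> 'k::field" and b c :: 'a and \<beta> :: 'k
  assumes chi_character: "\<chi> \<in> characters G"
    and eta_character: "\<eta> \<in> characters G"
    and b_central: "b \<in> group_center G"
    and c_central: "c \<in> group_center G"
    and eta_b: "\<eta> b = inverse (\<chi> c)"
    and derivation_exists: "H_derivations G \<chi> \<eta> b c \<beta> \<noteq> {}"

definition H_algebra ::
  "('g, 'm) monoid_scheme \<Rightarrow> ('g \<Rightarrow> 'k::field) \<Rightarrow> ('g \<Rightarrow> 'k) \<Rightarrow> 'g \<Rightarrow> 'g \<Rightarrow> 'k \<Rightarrow>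
   ('k, nat \<Rightarrow> nat \<Rightarrow> 'g \<Rightarrow>\<^sub>0 'k) module" where
  "H_algebra G \<chi> \<eta> b c \<beta> =
     ore_extension (H_base G \<chi>) (H_twist \<eta> b) (SOME \<delta>. \<delta> \<in> H_derivations G \<chi> \<eta> b c \<beta>)"

definition H_group_elt :: "('g, 'm) monoid_scheme \<Rightarrow> ('g \<Rightarrow> 'k::field) \<Rightarrow> 'g \<Rightarrow> nat \<Rightarrow> nat \<Rightarrow> 'g \<Rightarrow>\<^sub>0 'k" where
  "H_group_elt G \<chi> g =
     ore_const (H_base G \<chi>) (ore_const (monoid_algebra G) (Poly_Mapping.single g 1))"

definition H_x :: "('g, 'm) monoid_scheme \<Rightarrow> ('g \<Rightarrow> 'k::field) \<Rightarrow> nat \<Rightarrow> nat \<Rightarrow> 'g \<Rightarrow>\<^sub>0 'k" where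
  "H_x G \<chi> = ore_const (H_base G \<chi>) (ore_var (monoid_algebra G))"

definition H_y :: "('g, 'm) monoid_scheme \<Rightarrow> ('g \<Rightarrow> 'k::field) \<Rightarrow> nat \<Rightarrow> nat \<Rightarrow> 'g \<Rightarrow>\<^sub>0 'k" where
  "H_y G \<chi> = ore_var (H_base G \<chi>)"

text \<open>The coalgebra structure is prescribed on the algebra generators.\<close>

definition H_hopf ::
  "('g, 'm) monoid_scheme \<Rightarrow> ('g \<Rightarrow> 'k::field) \<Rightarrow> ('g \<Rightarrow> 'k) \<Rightarrow> 'g \<Rightarrow> 'g \<Rightarrow> 'k \<Rightarrow>
   ('k, nat \<Rightarrow> nat \<Rightarrow> 'g \<Rightarrow>\<^sub>0 'k) bialgebra" where
  "H_hopf G \<chi> \<eta> b c \<beta> =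
     (let A = H_algebra G \<chi> \<eta> b c \<beta>;
          T = tensor_algebra A A;
          gg = H_group_elt G \<chi>; x = H_x G \<chi>; y = H_y G \<chi>
      in module.extend A (bialgebra.fields
          (SOME \<Delta>. \<Delta> \<in> k_algebra_homs A T \<and>
             (\<forall>g\<in>carrier G. \<Delta> (gg g) = pure_tensor A A (gg g) (gg g)) \<and>
             \<Delta> x = pure_tensor A A x \<one>\<^bsub>A\<^esub> \<oplus>\<^bsub>T\<^esub> pure_tensor A A (gg b) x \<and>
             \<Delta> y = pure_tensor A A y \<one>\<^bsub>A\<^esub> \<oplus>\<^bsub>T\<^esub> pure_tensor A A (gg c) y)
          (SOME \<epsilon>. \<epsilon> \<in> ring_hom A scalar_ring \<and>
             (\<forall>k. \<forall>h\<in>carrier A. \<epsilon> (k \<odot>\<^bsub>A\<^esub> h) = k * \<epsilon> h) \<and>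
             (\<forall>g\<in>carrier G. \<epsilon> (gg g) = 1) \<and> \<epsilon> x = 0 \<and> \<epsilon> y = 0)))"

end

theory Submission
  imports Defs
begin

text \<open>
  All the statements are derived from a presentation of \<open>H\<close>: commutation relations for \<open>g\<close>, \<open>x\<close>, \<open>y\<close>
  together with the basis \<open>g x^i y^j\<close>, which comes from the Ore extensions. By the basis, an algebra
  map out of \<open>H\<close> is the same as a choice of images of the generators that satisfies the relations;
  this yields the coproduct, the counit, the antipode and, with \<open>y \<mapsto> \<beta> y\<close>, the isomorphism classes.
  Expanding \<open>y x g\<close> in two ways gives \<open>\<eta> = \<chi>\<^sup>-\<^sup>1\<close> if \<open>\<beta>(1 - bc) \<noteq> 0\<close>.

  Noetherianity is Hilbert's basis theorem for subalgebras: each infinite cyclic factor of \<open>G\<close> is a skew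
  Laurent extension, each finite factor a finite module extension, and \<open>x\<close>, \<open>y\<close> are skew polynomial
  extensions. For the growth, filter \<open>H\<close> by the spans of the \<open>g x^i y^j\<close> with \<open>g\<close> a word of length \<open>r\<close>
  and \<open>r + i + j \<le> n\<close>: up to rescaling \<open>n\<close>, the dimension is the size of the ball of radius \<open>n\<close>
  in \<open>G\<close> times \<open>n^2\<close>, whence the summand 2.

  A subcoalgebra is closed under applying functionals to tensor factors of \<open>\<Delta>\<close>. In \<open>\<Delta>(g x^i y^j)\<close> the
  only summand whose left factor has full degree is \<open>g x^i y^j \<otimes> g\<close>, so evaluating at a monomial of
  maximal degree shows that every nonzero subcoalgebra contains an element of \<open>G\<close>. Hence \<open>H\<close> is pointed
  and its group-like elements are those of \<open>G\<close>.
\<close>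

section \<open>Linear algebra over the ground field\<close>

text \<open>The derivation, coproduct, counit and antipode are all chosen by \<open>SOME\<close>, so
  only their characteristic properties can be used. This shapes the proof:
  \<open>H_presentation\<close> forgets the Ore extension and keeps the relations and the basis, and
  the chosen maps are handled through their values on generators. The antipode needs uniqueness for
  that; instead of the convolution algebra, induction on the degree of a monomial is used, which
  rests on the same leading term of \<Delta> as pointedness. The obstacle behind the tensor product
  is its definition as a quotient by a two-sided ideal: that a bilinear map descends has to be
  proved for the ideal and not just for the span of the relations. For (3), all algebras are
  subalgebras of one ambient algebra and the powers of the adjoined element may be dependent, so
  that one extension principle covers cyclic factors of either kind and both variables; right-hand
  versions are left-hand ones for the opposite algebra. The weights for (5) count c b as a group
  generator because the relation for y x produces it.\<close>

abbreviation "keys \<equiv> Poly_Mapping.keys"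
abbreviation "lookup \<equiv> Poly_Mapping.lookup"

lemma scalar_ring_simps [simp]:
  "carrier (scalar_ring :: 'k::field ring) = UNIV"
  "monoid.mult (scalar_ring :: 'k ring) = (*)"
  "one (scalar_ring :: 'k ring) = 1"
  "ring.zero (scalar_ring :: 'k ring) = 0"
  "add (scalar_ring :: 'k ring) = (+)"
  by (simp_all add: ring_of_type_algebra_def fun_eq_iff)

lemma lookup_map_mult [simp]:
  "lookup (Poly_Mapping.map ((*) k) p) i = k * lookup (p :: 'i \<Rightarrow>\<^sub>0 'k::field) i"
  by (simp add: Poly_Mapping.map.rep_eq "when_def")

lemma keys_map_mult: "keys (Poly_Mapping.map ((*) k) p) \<subseteq> keys (p :: 'i \<Rightarrow>\<^sub>0 'k::field)"
  by (auto simp: in_keys_iff)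

text \<open>Finitely supported functions play the part of formal linear combinations. Each
  \<open>single\<close> carries its own coefficient, so no separate scalar step occurs, and both
  summands keep their support in \<open>I\<close>, which preserves membership in the carrier during
  inductions.\<close>

lemma poly_mapping_span_induct [consumes 1, case_names zero single add]:
  fixes p :: "'i \<Rightarrow>\<^sub>0 'k::comm_monoid_add"
  assumes "keys p \<subseteq> I" "P 0" "\<And>i k. i \<in> I \<Longrightarrow> P (Poly_Mapping.single i k)"
    "\<And>p q. keys p \<subseteq> I \<Longrightarrow> keys q \<subseteq> I \<Longrightarrow> P p \<Longrightarrow> P q \<Longrightarrow> P (p + q)"
  shows "P p"
proof -
  have expand: "p = (\<Sum>i\<in>keys p. Poly_Mapping.single i (lookup p i))"
  proof (rule poly_mapping_eqI)
    fix i
    have "(\<Sum>j\<in>keys p. lookup (Poly_Mapping.single j (lookup p j)) i) = lookup p i"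
      by (simp add: lookup_single "when_def" in_keys_iff)
    then show "lookup p i = lookup (\<Sum>i\<in>keys p. Poly_Mapping.single i (lookup p i)) i"
      by (simp add: lookup_sum)
  qed
  \<comment> \<open>The support of the partial sum is carried along because the addition step asks
    for it.\<close>
  have "P (\<Sum>i\<in>J. Poly_Mapping.single i (lookup p i)) \<and>
      keys (\<Sum>i\<in>J. Poly_Mapping.single i (lookup p i)) \<subseteq> I" if "J \<subseteq> I" "finite J" for J
    using that(2,1)
  proof (induction J)
    case (insert j J)
    let ?s = "Poly_Mapping.single j (lookup p j)" and ?r = "\<Sum>i\<in>J. Poly_Mapping.single i (lookup p i)"
    have 1: "keys ?s \<subseteq> I" "P ?s" using insert assms(3) by auto
    have 2: "keys ?r \<subseteq> I" "P ?r" using insert by auto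
    have "keys (?s + ?r) \<subseteq> I" using 1 2 keys_add[of ?s ?r] by blast
    then show ?case using insert(1,2) assms(4)[OF 1(1) 2(1) 1(2) 2(2)] by simp
  qed (use assms(2) in simp)
  from this[OF assms(1) finite_keys] show ?thesis using expand by simp
qed

locale k_alg =
  fixes A :: "('k::field, 'a, 'm) module_scheme" (structure)
  assumes k_algebra: "k_algebra A"

sublocale k_alg \<subseteq> ring A
  using k_algebra by (simp add: k_algebra_def)

lemma k_algebraI:
  assumes "Ring.ring A"
    and "\<And>k u. u \<in> carrier A \<Longrightarrow> k \<odot>\<^bsub>A\<^esub> u \<in> carrier A"
    and "\<And>k l u. u \<in> carrier A \<Longrightarrow> (k + l) \<odot>\<^bsub>A\<^esub> u = k \<odot>\<^bsub>A\<^esub> u \<oplus>\<^bsub>A\<^esub> l \<odot>\<^bsub>A\<^esub> u"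
    and "\<And>k u v. u \<in> carrier A \<Longrightarrow> v \<in> carrier A \<Longrightarrow> k \<odot>\<^bsub>A\<^esub> (u \<oplus>\<^bsub>A\<^esub> v) = k \<odot>\<^bsub>A\<^esub> u \<oplus>\<^bsub>A\<^esub> k \<odot>\<^bsub>A\<^esub> v"
    and "\<And>k l u. u \<in> carrier A \<Longrightarrow> (k * l) \<odot>\<^bsub>A\<^esub> u = k \<odot>\<^bsub>A\<^esub> (l \<odot>\<^bsub>A\<^esub> u)"
    and "\<And>u. u \<in> carrier A \<Longrightarrow> 1 \<odot>\<^bsub>A\<^esub> u = u"
    and "\<And>k u v. u \<in> carrier A \<Longrightarrow> v \<in> carrier A \<Longrightarrow> (k \<odot>\<^bsub>A\<^esub> u) \<otimes>\<^bsub>A\<^esub> v = k \<odot>\<^bsub>A\<^esub> (u \<otimes>\<^bsub>A\<^esub> v)"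
    and "\<And>k u v. u \<in> carrier A \<Longrightarrow> v \<in> carrier A \<Longrightarrow> u \<otimes>\<^bsub>A\<^esub> (k \<odot>\<^bsub>A\<^esub> v) = k \<odot>\<^bsub>A\<^esub> (u \<otimes>\<^bsub>A\<^esub> v)"
  shows "k_algebra (A :: ('k::field, 'a, 'm) module_scheme)"
proof -
  have "Module.module scalar_ring A"
    by (rule moduleI) (use assms(1-6) in \<open>auto simp: Ring.ring_def\<close>)
  then show ?thesis using assms by (simp add: k_algebra_def)
qed

context k_alg
begin

lemma module_scalar_ring: "Module.module scalar_ring A"
  using k_algebra by (simp add: k_algebra_def)

lemma smult_closed [simp, intro]: "u \<in> carrier A \<Longrightarrow> k \<odot> u \<in> carrier A"
  using module.smult_closed[OF module_scalar_ring] by simp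

lemma smult_add_left: "u \<in> carrier A \<Longrightarrow> (k + l) \<odot> u = k \<odot> u \<oplus> l \<odot> u"
  using module.smult_l_distr[OF module_scalar_ring] by simp

lemma smult_add_right: "u \<in> carrier A \<Longrightarrow> v \<in> carrier A \<Longrightarrow> k \<odot> (u \<oplus> v) = k \<odot> u \<oplus> k \<odot> v"
  using module.smult_r_distr[OF module_scalar_ring] by simp

lemma smult_smult: "u \<in> carrier A \<Longrightarrow> k \<odot> (l \<odot> u) = (k * l) \<odot> u"
  using module.smult_assoc1[OF module_scalar_ring] by simp

lemma smult_left_commute: "u \<in> carrier A \<Longrightarrow> k \<odot> (l \<odot> u) = l \<odot> (k \<odot> u)"
  by (simp add: smult_smult mult.commute)

lemma smult_one [simp]: "u \<in> carrier A \<Longrightarrow> 1 \<odot> u = u"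
  using module.smult_one[OF module_scalar_ring] by simp

lemma smult_zero_left [simp]: "u \<in> carrier A \<Longrightarrow> 0 \<odot> u = \<zero>"
  using module.smult_l_null[OF module_scalar_ring] by simp

lemma smult_zero_right [simp]: "k \<odot> \<zero> = \<zero>"
  using module.smult_r_null[OF module_scalar_ring] by simp

lemma smult_minus: "u \<in> carrier A \<Longrightarrow> k \<odot> (\<ominus> u) = \<ominus> (k \<odot> u)"
  using module.smult_r_minus[OF module_scalar_ring] by simp

text \<open>Once negation is a scalar multiple, subspaces and linear maps need only be tested on
  sums and multiples.\<close>

lemma minus_eq_smult: 
  assumes "u \<in> carrier A" 
  shows "\<ominus> u = (-1) \<odot> u"
proof (rule minus_equality)
  show "(-1) \<odot> u \<oplus> u = \<zero>" using smult_add_left[of u "-1" 1] assms by simp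
qed (use assms in auto)

lemma smult_minus_left: "u \<in> carrier A \<Longrightarrow> (- k) \<odot> u = \<ominus> (k \<odot> u)"
  by (simp add: minus_eq_smult smult_smult)

lemma mult_smult_left: "u \<in> carrier A \<Longrightarrow> v \<in> carrier A \<Longrightarrow> (k \<odot> u) \<otimes> v = k \<odot> (u \<otimes> v)"
  using k_algebra by (simp add: k_algebra_def)

lemma mult_smult_right: "u \<in> carrier A \<Longrightarrow> v \<in> carrier A \<Longrightarrow> u \<otimes> (k \<odot> v) = k \<odot> (u \<otimes> v)"
  using k_algebra by (simp add: k_algebra_def)

lemma smult_eq_zero_iff:
  assumes "u \<in> carrier A"
  shows "k \<odot> u = \<zero> \<longleftrightarrow> k = 0 \<or> u = \<zero>"
proof
  assume *: "k \<odot> u = \<zero>"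
  have "inverse k \<odot> (k \<odot> u) = (inverse k * k) \<odot> u" by (rule smult_smult[OF assms])
  then show "k = 0 \<or> u = \<zero>" using * assms by (cases "k = 0") auto
qed (use assms in auto)

lemma submoduleI:
  assumes "V \<subseteq> carrier A" "\<zero> \<in> V" "\<And>u v. u \<in> V \<Longrightarrow> v \<in> V \<Longrightarrow> u \<oplus> v \<in> V"
    "\<And>k u. u \<in> V \<Longrightarrow> k \<odot> u \<in> V"
  shows "submodule V scalar_ring A"
  by (rule module.submoduleI[OF module_scalar_ring]) (use assms minus_eq_smult in auto)

lemma submoduleD:
  assumes "submodule V scalar_ring A"
  shows "V \<subseteq> carrier A" "\<zero> \<in> V" "\<And>u v. u \<in> V \<Longrightarrow> v \<in> V \<Longrightarrow> u \<oplus> v \<in> V"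
    "\<And>k u. u \<in> V \<Longrightarrow> k \<odot> u \<in> V" "\<And>u. u \<in> V \<Longrightarrow> \<ominus> u \<in> V"
proof -
  note E = module.submoduleE[OF module_scalar_ring assms]
  show "V \<subseteq> carrier A" "\<And>u v. u \<in> V \<Longrightarrow> v \<in> V \<Longrightarrow> u \<oplus> v \<in> V" "\<And>k u. u \<in> V \<Longrightarrow> k \<odot> u \<in> V"
    "\<And>u. u \<in> V \<Longrightarrow> \<ominus> u \<in> V"
    using E by simp_all
  obtain u where "u \<in> V" using E(2) by auto
  then show "\<zero> \<in> V" using E(4)[of 0 u] E(1) by auto
qed

lemma submodule_finsum:
  assumes V: "submodule V scalar_ring A" and "finite I" "\<And>i. i \<in> I \<Longrightarrow> f i \<in> V"
  shows "finsum A f I \<in> V"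
  using assms(2,3)
proof (induction I)
  case (insert i I)
  then have "f \<in> insert i I \<rightarrow> carrier A" using submoduleD(1)[OF V] by blast
  then show ?case using insert submoduleD[OF V] by (simp add: Pi_iff)
qed (use submoduleD[OF V] in simp)

lemma carrier_submodule: "submodule (carrier A) scalar_ring A"
  by (rule submoduleI) auto

lemma k_span_submodule:
  assumes "S \<subseteq> carrier A"
  shows "submodule (k_span A S) scalar_ring A"
proof (rule submoduleI)
  show "k_span A S \<subseteq> carrier A" using assms carrier_submodule by (auto simp: k_span_def)
qed (auto simp: k_span_def submoduleD)

lemma k_span_base: "s \<in> S \<Longrightarrow> s \<in> k_span A S"
  by (auto simp: k_span_def)

lemma k_span_least: "submodule V scalar_ring A \<Longrightarrow> S \<subseteq> V \<Longrightarrow> k_span A S \<subseteq> V"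
  by (auto simp: k_span_def)

lemma k_span_mono: "S \<subseteq> S' \<Longrightarrow> k_span A S \<subseteq> k_span A S'"
  by (auto simp: k_span_def)

lemma k_span_carrier: "S \<subseteq> carrier A \<Longrightarrow> k_span A S \<subseteq> carrier A"
  by (rule k_span_least[OF carrier_submodule])

text \<open>The elements of the span with property \<open>P\<close> form a subspace containing
  \<open>S\<close>, and the span is the least such.\<close>

lemma k_span_induct [consumes 2, case_names zero base add smult]:
  assumes "h \<in> k_span A S" "S \<subseteq> carrier A" "P \<zero>" "\<And>s. s \<in> S \<Longrightarrow> P s"
    "\<And>u v. u \<in> k_span A S \<Longrightarrow> v \<in> k_span A S \<Longrightarrow> P u \<Longrightarrow> P v \<Longrightarrow> P (u \<oplus> v)"
    "\<And>k u. u \<in> k_span A S \<Longrightarrow> P u \<Longrightarrow> P (k \<odot> u)"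
  shows "P h"
proof -
  note * = submoduleD[OF k_span_submodule[OF assms(2)]]
  have "submodule {h \<in> k_span A S. P h} scalar_ring A"
    by (rule submoduleI) (use assms * in auto)
  from k_span_least[OF this, of S] assms(1,4) show ?thesis
    by (auto intro: k_span_base)
qed

text \<open>Two nested span inductions, one per factor. This reduces closure of a span under
  products, and multiplicativity of a filtration, to products of generators.\<close>

lemma k_span_mult:
  assumes S: "S \<subseteq> carrier A" "T \<subseteq> carrier A" and V: "submodule V scalar_ring A"
    and st: "\<And>s t. s \<in> S \<Longrightarrow> t \<in> T \<Longrightarrow> s \<otimes> t \<in> V"
    and "u \<in> k_span A S" "v \<in> k_span A T"
  shows "u \<otimes> v \<in> V"
  using assms(5,1)
proof (induction rule: k_span_induct)
  case zero
  then show ?case using submoduleD[OF V] k_span_carrier[OF S(2)] assms(6) by (simp add: subset_iff)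
next
  case (base s)
  note vc = subsetD[OF k_span_carrier[OF S(2)]]
  from assms(6) S(2) show ?case
    by (induction rule: k_span_induct)
      (use base st submoduleD[OF V] S vc in \<open>auto simp: r_distr mult_smult_right subset_iff\<close>)
next
  case (add u u')
  then show ?case using k_span_carrier[OF S(1)] k_span_carrier[OF S(2)] assms(6) submoduleD[OF V]
    by (simp add: l_distr subset_iff)
next
  case (smult k u)
  then show ?case using k_span_carrier[OF S(1)] k_span_carrier[OF S(2)] assms(6) submoduleD[OF V]
    by (simp add: mult_smult_left subset_iff)
qed

text \<open>Indices outside the support contribute zero. A common finite index set is what allows
  combinations with different supports to be added.\<close>

lemma lin_comb_superset:
  assumes "f \<in> I \<rightarrow> carrier A" "keys a \<subseteq> J" "J \<subseteq> I" "finite J"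
  shows "lin_comb A f a = (\<Oplus>i\<in>J. lookup a i \<odot> f i)"
  unfolding lin_comb_def
  by (rule add.finprod_mono_neutral_cong_left)
    (use assms in \<open>auto simp: in_keys_iff Pi_iff subset_iff\<close>)

lemma lin_comb_closed [simp]: "f \<in> I \<rightarrow> carrier A \<Longrightarrow> keys a \<subseteq> I \<Longrightarrow> lin_comb A f a \<in> carrier A"
  unfolding lin_comb_def by (rule finsum_closed) auto

lemma lin_comb_zero [simp]: "lin_comb A f 0 = \<zero>"
  by (simp add: lin_comb_def)

lemma lin_comb_add:
  assumes f: "f \<in> I \<rightarrow> carrier A" and "keys a \<subseteq> I" "keys a' \<subseteq> I"
  shows "lin_comb A f (a + a') = lin_comb A f a \<oplus> lin_comb A f a'"
proof -
  let ?J = "keys a \<union> keys a'"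
  have *: "keys (a + a') \<subseteq> ?J" by (rule keys_add)
  have fc: "i \<in> ?J \<Longrightarrow> f i \<in> carrier A" for i using assms by blast
  have "lin_comb A f (a + a') = (\<Oplus>i\<in>?J. lookup (a + a') i \<odot> f i)"
    by (rule lin_comb_superset[OF f]) (use assms * in auto)
  also have "\<dots> = (\<Oplus>i\<in>?J. lookup a i \<odot> f i \<oplus> lookup a' i \<odot> f i)"
    by (rule finsum_cong') (use fc in \<open>auto simp: lookup_add smult_add_left\<close>)
  also have "\<dots> = (\<Oplus>i\<in>?J. lookup a i \<odot> f i) \<oplus> (\<Oplus>i\<in>?J. lookup a' i \<odot> f i)"
    by (rule finsum_addf) (use fc in auto)
  also have "\<dots> = lin_comb A f a \<oplus> lin_comb A f a'"
    using lin_comb_superset[OF f, of a ?J] lin_comb_superset[OF f, of a' ?J] assms by auto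
  finally show ?thesis .
qed

lemma lin_comb_single [simp]:
  assumes "f i \<in> carrier A"
  shows "lin_comb A f (Poly_Mapping.single i k) = k \<odot> f i"
  using assms by (simp add: lin_comb_def)

lemma lin_comb_smult:
  assumes f: "f \<in> I \<rightarrow> carrier A" and "keys a \<subseteq> I"
  shows "lin_comb A f (Poly_Mapping.map ((*) k) a) = k \<odot> lin_comb A f a"
proof -
  have fc: "i \<in> keys a \<Longrightarrow> f i \<in> carrier A" for i using assms by blast
  have "lin_comb A f (Poly_Mapping.map ((*) k) a) = (\<Oplus>i\<in>keys a. k \<odot> (lookup a i \<odot> f i))"
    by (subst lin_comb_superset[OF f keys_map_mult])
      (use assms fc in \<open>auto intro!: finsum_cong' simp: smult_smult\<close>)
  also have "\<dots> = k \<odot> lin_comb A f a"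
    unfolding lin_comb_def by (rule module.finsum_smult_ldistr[OF module_scalar_ring, symmetric]) (use fc in auto)
  finally show ?thesis .
qed

lemma lin_comb_cong:
  assumes "keys a \<subseteq> I" "f \<in> I \<rightarrow> carrier A" "\<And>i. i \<in> I \<Longrightarrow> f i = f' i"
  shows "lin_comb A f a = lin_comb A f' a"
proof -
  have "f i \<in> carrier A" "f i = f' i" if "i \<in> keys a" for i
    using assms(1) that assms(3)[of i] funcset_mem[OF assms(2), of i] by auto
  then show ?thesis
    unfolding lin_comb_def by (intro finsum_cong') auto
qed

lemma lin_comb_in_span:
  assumes "keys a \<subseteq> I" "f \<in> I \<rightarrow> carrier A"
  shows "lin_comb A f a \<in> k_span A (f ` I)"
proof -
  have "f ` I \<subseteq> carrier A" using assms by auto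
  note V = submoduleD[OF k_span_submodule[OF this]]
  show ?thesis unfolding lin_comb_def
    by (rule submodule_finsum[OF k_span_submodule]) (use assms in \<open>auto intro!: V(4) intro: k_span_base\<close>)
qed

end

lemma k_linear_mapsI:
  assumes "\<And>u. u \<in> carrier A \<Longrightarrow> f u \<in> carrier B"
    "\<And>u v. u \<in> carrier A \<Longrightarrow> v \<in> carrier A \<Longrightarrow> f (u \<oplus>\<^bsub>A\<^esub> v) = f u \<oplus>\<^bsub>B\<^esub> f v"
    "\<And>k u. u \<in> carrier A \<Longrightarrow> f (k \<odot>\<^bsub>A\<^esub> u) = k \<odot>\<^bsub>B\<^esub> f u"
  shows "f \<in> k_linear_maps A B"
  using assms by (auto simp: k_linear_maps_def)

lemma k_linear_mapsD:
  assumes "f \<in> k_linear_maps A B"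
  shows "\<And>u. u \<in> carrier A \<Longrightarrow> f u \<in> carrier B"
    "\<And>u v. u \<in> carrier A \<Longrightarrow> v \<in> carrier A \<Longrightarrow> f (u \<oplus>\<^bsub>A\<^esub> v) = f u \<oplus>\<^bsub>B\<^esub> f v"
    "\<And>k u. u \<in> carrier A \<Longrightarrow> f (k \<odot>\<^bsub>A\<^esub> u) = k \<odot>\<^bsub>B\<^esub> f u"
  using assms by (auto simp: k_linear_maps_def)

lemma k_linear_maps_comp:
  "f \<in> k_linear_maps A B \<Longrightarrow> g \<in> k_linear_maps B C \<Longrightarrow> (\<lambda>u. g (f u)) \<in> k_linear_maps A C"
  by (simp add: k_linear_maps_def Pi_iff)

lemma k_algebra_homsI:
  assumes "f \<in> k_linear_maps A B"
    "\<And>u v. u \<in> carrier A \<Longrightarrow> v \<in> carrier A \<Longrightarrow> f (u \<otimes>\<^bsub>A\<^esub> v) = f u \<otimes>\<^bsub>B\<^esub> f v"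
    "f \<one>\<^bsub>A\<^esub> = \<one>\<^bsub>B\<^esub>"
  shows "f \<in> k_algebra_homs A B"
  using assms by (auto simp: k_algebra_homs_def k_linear_maps_def intro!: ring_hom_memI)

lemma k_algebra_homsD:
  assumes "f \<in> k_algebra_homs A B"
  shows "f \<in> k_linear_maps A B" "\<And>u. u \<in> carrier A \<Longrightarrow> f u \<in> carrier B"
    "\<And>u v. u \<in> carrier A \<Longrightarrow> v \<in> carrier A \<Longrightarrow> f (u \<oplus>\<^bsub>A\<^esub> v) = f u \<oplus>\<^bsub>B\<^esub> f v"
    "\<And>k u. u \<in> carrier A \<Longrightarrow> f (k \<odot>\<^bsub>A\<^esub> u) = k \<odot>\<^bsub>B\<^esub> f u"
    "\<And>u v. u \<in> carrier A \<Longrightarrow> v \<in> carrier A \<Longrightarrow> f (u \<otimes>\<^bsub>A\<^esub> v) = f u \<otimes>\<^bsub>B\<^esub> f v"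
    "f \<one>\<^bsub>A\<^esub> = \<one>\<^bsub>B\<^esub>"
  using assms by (auto simp: k_algebra_homs_def k_linear_maps_def ring_hom_def)

lemma k_algebra_homs_comp:
  "f \<in> k_algebra_homs A B \<Longrightarrow> g \<in> k_algebra_homs B C \<Longrightarrow> (\<lambda>u. g (f u)) \<in> k_algebra_homs A C"
  by (rule k_algebra_homsI)
    (simp_all add: k_algebra_homsD k_linear_maps_comp[OF k_algebra_homsD(1) k_algebra_homsD(1)])

locale k_linear = A: k_alg A + B: k_alg B
  for A :: "('k::field, 'a, 'm) module_scheme" and B :: "('k, 'b, 'n) module_scheme" +
  fixes F
  assumes lin: "F \<in> k_linear_maps A B"
begin

lemma map_closed: "u \<in> carrier A \<Longrightarrow> F u \<in> carrier B"
  and map_add: "u \<in> carrier A \<Longrightarrow> v \<in> carrier A \<Longrightarrow> F (u \<oplus>\<^bsub>A\<^esub> v) = F u \<oplus>\<^bsub>B\<^esub> F v"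
  and map_smult: "u \<in> carrier A \<Longrightarrow> F (k \<odot>\<^bsub>A\<^esub> u) = k \<odot>\<^bsub>B\<^esub> F u"
  using k_linear_mapsD[OF lin] by auto

lemma map_zero: "F \<zero>\<^bsub>A\<^esub> = \<zero>\<^bsub>B\<^esub>"
  using map_smult[of "\<zero>\<^bsub>A\<^esub>" 0] map_closed[of "\<zero>\<^bsub>A\<^esub>"] by simp

lemma map_minus: "u \<in> carrier A \<Longrightarrow> F (\<ominus>\<^bsub>A\<^esub> u) = \<ominus>\<^bsub>B\<^esub> F u"
  using map_closed by (simp add: A.minus_eq_smult B.minus_eq_smult map_smult)

lemma preimage_submodule:
  assumes "submodule V scalar_ring B"
  shows "submodule {u \<in> carrier A. F u \<in> V} scalar_ring A"
  by (rule A.submoduleI) (use B.submoduleD[OF assms] in \<open>auto simp: map_zero map_add map_smult\<close>)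

lemma span_into:
  assumes "S \<subseteq> carrier A" "submodule V scalar_ring B" "\<And>s. s \<in> S \<Longrightarrow> F s \<in> V" "u \<in> k_span A S"
  shows "F u \<in> V"
  using A.k_span_least[OF preimage_submodule[OF assms(2)], of S] assms by auto

lemma eq_on_span:
  assumes G: "G \<in> k_linear_maps A B" and "S \<subseteq> carrier A" "\<And>s. s \<in> S \<Longrightarrow> F s = G s" "u \<in> k_span A S"
  shows "F u = G u"
proof -
  interpret G: k_linear A B G by unfold_locales (fact G)
  show ?thesis using assms(4,2)
  proof (induction rule: A.k_span_induct)
    case (add u v)
    then have "u \<in> carrier A" "v \<in> carrier A" using A.k_span_carrier[OF assms(2)] by auto
    then show ?case using add by (simp add: map_add G.map_add)
  next
    case (smult k u)
    then have "u \<in> carrier A" using A.k_span_carrier[OF assms(2)] by auto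
    then show ?case using smult by (simp add: map_smult G.map_smult)
  qed (use assms in \<open>simp_all add: map_zero G.map_zero\<close>)
qed

end

lemma k_linearI: "k_algebra A \<Longrightarrow> k_algebra B \<Longrightarrow> F \<in> k_linear_maps A B \<Longrightarrow> k_linear A B F"
  by (simp add: k_linear_def k_alg_def k_linear_axioms_def)

section \<open>Bases, coordinates and linear extension\<close>

locale k_basis = k_alg A for A :: "('k::field, 'a, 'm) module_scheme" (structure) +
  fixes e :: "'i \<Rightarrow> 'a" and I :: "'i set"
  assumes basis: "is_k_basis A e I"
begin

lemma basis_closed [simp]: "i \<in> I \<Longrightarrow> e i \<in> carrier A"
  and basis_funcset: "e \<in> I \<rightarrow> carrier A"
  using basis by (auto simp: is_k_basis_def)

lemma basis_spans: "h \<in> carrier A \<Longrightarrow> \<exists>a :: 'i \<Rightarrow>\<^sub>0 'k. keys a \<subseteq> I \<and> h = lin_comb A e a"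
  using basis unfolding is_k_basis_def by (elim conjE) (erule bspec)

lemma basis_span: "k_span A (e ` I) = carrier A"
proof
  show "k_span A (e ` I) \<subseteq> carrier A" by (rule k_span_carrier) auto
  show "carrier A \<subseteq> k_span A (e ` I)"
  proof
    fix h assume "h \<in> carrier A"
    then obtain a :: "'i \<Rightarrow>\<^sub>0 'k" where "keys a \<subseteq> I" "h = lin_comb A e a"
      using basis_spans by blast
    then show "h \<in> k_span A (e ` I)" by (simp add: lin_comb_in_span[OF _ basis_funcset])
  qed
qed

text \<open>The definition speaks only of combinations equal to zero, so the difference is formed;
  it is written as a sum with the (-1)-multiple, since \<open>lin_comb\<close> is known to respect
  sums and multiples.\<close>

lemma basis_independent:
  assumes "keys a \<subseteq> I" "keys a' \<subseteq> I" "lin_comb A e a = lin_comb A e a'"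
  shows "a = a'"
proof -
  let ?m = "Poly_Mapping.map ((*) (- 1)) a'"
  have m: "keys ?m \<subseteq> I" by (rule subset_trans[OF keys_map_mult assms(2)])
  have "lin_comb A e (a + ?m) = lin_comb A e a \<oplus> (- 1) \<odot> lin_comb A e a'"
    by (simp only: lin_comb_add[OF basis_funcset assms(1) m] lin_comb_smult[OF basis_funcset assms(2)])
  also have "\<dots> = \<zero>"
    using lin_comb_closed[OF basis_funcset assms(2)] unfolding assms(3)
    by (simp add: minus_eq_smult[symmetric] r_neg)
  finally have "lin_comb A e (a + ?m) = \<zero>" .
  moreover have "keys (a + ?m) \<subseteq> I"
    by (rule subset_trans[OF keys_add]) (use m assms(1) in simp)
  moreover have "keys p \<subseteq> I \<and> lin_comb A e p = \<zero> \<longrightarrow> p = 0" for p :: "'i \<Rightarrow>\<^sub>0 'k"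
    using basis unfolding is_k_basis_def by (elim conjE) (erule spec)
  ultimately have "a + ?m = 0" by simp
  then have "lookup (a + ?m) i = 0" for i by simp
  then have "lookup a i + - lookup a' i = 0" for i by (simp add: lookup_add)
  then show ?thesis by (intro poly_mapping_eqI) (simp add: eq_neg_iff_add_eq_0[symmetric])
qed

text \<open>The coordinate functional at \<open>i\<close> is \<open>lookup (coord h) i\<close>;
  keeping all coordinates in one finitely supported function lets them be fed back into
  \<open>lin_comb\<close>.\<close>

definition coord :: "'a \<Rightarrow> 'i \<Rightarrow>\<^sub>0 'k" where
  "coord h = (THE a. keys a \<subseteq> I \<and> h = lin_comb A e a)"

lemma coord_unique: "keys a \<subseteq> I \<Longrightarrow> coord (lin_comb A e a) = a"
  unfolding coord_def by (rule the_equality) (auto intro: basis_independent)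

lemma coord:
  assumes "h \<in> carrier A"
  shows "keys (coord h) \<subseteq> I" "lin_comb A e (coord h) = h"
proof -
  obtain a :: "'i \<Rightarrow>\<^sub>0 'k" where "keys a \<subseteq> I" "h = lin_comb A e a"
    using assms basis_spans by blast
  then show "keys (coord h) \<subseteq> I" "lin_comb A e (coord h) = h" by (auto simp: coord_unique)
qed

lemma coord_add:
  assumes "u \<in> carrier A" "v \<in> carrier A"
  shows "coord (u \<oplus> v) = coord u + coord v"
proof -
  have "keys (coord u + coord v) \<subseteq> I"
    using keys_add[of "coord u" "coord v"] coord(1) assms by blast
  moreover have "lin_comb A e (coord u + coord v) = u \<oplus> v"
    by (simp only: lin_comb_add[OF basis_funcset coord(1) coord(1)] coord(2) assms)
  ultimately show ?thesis using coord_unique by metis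
qed

lemma coord_smult:
  assumes "u \<in> carrier A"
  shows "coord (k \<odot> u) = Poly_Mapping.map ((*) k) (coord u)"
proof -
  have "keys (Poly_Mapping.map ((*) k) (coord u)) \<subseteq> I"
    using keys_map_mult[of k "coord u"] coord(1) assms by blast
  moreover have "lin_comb A e (Poly_Mapping.map ((*) k) (coord u)) = k \<odot> u"
    by (simp only: lin_comb_smult[OF basis_funcset coord(1)] coord(2) assms)
  ultimately show ?thesis using coord_unique by metis
qed

lemma coord_basis: "i \<in> I \<Longrightarrow> coord (e i) = Poly_Mapping.single i 1"
  using coord_unique[of "Poly_Mapping.single i 1"] by simp

text \<open>Supplies the linear maps from which \<open>hom_extension\<close> later builds algebra
  maps.\<close>

lemma basis_extension:
  assumes "k_algebra B" and w: "w \<in> I \<rightarrow> carrier B"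
  shows "\<exists>F \<in> k_linear_maps A B. \<forall>i\<in>I. F (e i) = w i"
proof -
  interpret B: k_alg B by unfold_locales (fact assms)
  have "(\<lambda>h. lin_comb B w (coord h)) \<in> k_linear_maps A B"
    by (rule k_linear_mapsI)
      (simp_all add: coord_add coord_smult B.lin_comb_add[OF w coord(1) coord(1)]
        B.lin_comb_smult[OF w coord(1)] B.lin_comb_closed[OF w coord(1)])
  moreover have "lin_comb B w (coord (e i)) = w i" if "i \<in> I" for i
    using that funcset_mem[OF w that] by (simp add: coord_basis)
  ultimately show ?thesis by (intro bexI[where x="\<lambda>h. lin_comb B w (coord h)"] ballI)
qed

lemma basis_linear_eq:
  assumes "k_algebra B" "F \<in> k_linear_maps A B" "F' \<in> k_linear_maps A B"
    "\<And>i. i \<in> I \<Longrightarrow> F (e i) = F' (e i)" "h \<in> carrier A"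
  shows "F h = F' h"
proof -
  interpret F: k_linear A B F using k_algebra assms(1,2) by (rule k_linearI)
  have "F s = F' s" if "s \<in> e ` I" for s using assms(4) that by auto
  then show ?thesis
    by (rule F.eq_on_span[OF assms(3), of "e ` I", rotated]) (use assms(5) in \<open>auto simp: basis_span\<close>)
qed

end

section \<open>Monoid algebras\<close>

lemma monoid_algebra_simps:
  "carrier (monoid_algebra M :: ('k::field, 'g \<Rightarrow>\<^sub>0 'k) module) = {p. keys p \<subseteq> carrier M}"
  "one (monoid_algebra M :: ('k, 'g \<Rightarrow>\<^sub>0 'k) module) = Poly_Mapping.single \<one>\<^bsub>M\<^esub> 1"
  "ring.zero (monoid_algebra M :: ('k, 'g \<Rightarrow>\<^sub>0 'k) module) = 0"
  "add (monoid_algebra M :: ('k, 'g \<Rightarrow>\<^sub>0 'k) module) = (+)"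
  "module.smult (monoid_algebra M :: ('k, 'g \<Rightarrow>\<^sub>0 'k) module) = (\<lambda>k. Poly_Mapping.map ((*) k))"
  by (simp_all add: monoid_algebra_def)

text \<open>The definition sums over the two supports; larger finite sets are allowed here so that
  the products with \<open>p\<close>, \<open>p'\<close> and \<open>p + p'\<close> can be compared
  term by term.\<close>

lemma monoid_algebra_mult:
  assumes "finite P" "finite Q" "keys p \<subseteq> P" "keys q \<subseteq> Q"
  shows "p \<otimes>\<^bsub>monoid_algebra M\<^esub> (q :: 'g \<Rightarrow>\<^sub>0 'k::field) =
    (\<Sum>g\<in>P. \<Sum>h\<in>Q. Poly_Mapping.single (g \<otimes>\<^bsub>M\<^esub> h) (lookup p g * lookup q h))"
proof -
  have "(\<Sum>h\<in>keys q. Poly_Mapping.single (g \<otimes>\<^bsub>M\<^esub> h) (lookup p g * lookup q h)) =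
      (\<Sum>h\<in>Q. Poly_Mapping.single (g \<otimes>\<^bsub>M\<^esub> h) (lookup p g * lookup q h))" for g
    by (rule sum.mono_neutral_left) (use assms in \<open>auto simp: in_keys_iff\<close>)
  moreover have "(\<Sum>g\<in>keys p. \<Sum>h\<in>Q. Poly_Mapping.single (g \<otimes>\<^bsub>M\<^esub> h) (lookup p g * lookup q h)) =
      (\<Sum>g\<in>P. \<Sum>h\<in>Q. Poly_Mapping.single (g \<otimes>\<^bsub>M\<^esub> h) (lookup p g * lookup q h))"
    by (rule sum.mono_neutral_left) (use assms in \<open>auto simp: in_keys_iff\<close>)
  ultimately show ?thesis by (simp add: monoid_algebra_def)
qed

lemma keys_add_subset: "keys p \<subseteq> I \<Longrightarrow> keys q \<subseteq> I \<Longrightarrow> keys (p + q) \<subseteq> I"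
  using keys_add[of p q] by blast

lemma monoid_algebra_mult_add_left:
  "(p + p') \<otimes>\<^bsub>monoid_algebra M\<^esub> (q :: 'g \<Rightarrow>\<^sub>0 'k::field) =
     p \<otimes>\<^bsub>monoid_algebra M\<^esub> q + p' \<otimes>\<^bsub>monoid_algebra M\<^esub> q"
proof -
  let ?P = "keys p \<union> keys p'"
  have "keys (p + p') \<subseteq> ?P" by (rule keys_add)
  then show ?thesis
    by (simp add: monoid_algebra_mult[of ?P "keys q"] lookup_add distrib_right single_add sum.distrib)
qed

lemma monoid_algebra_mult_add_right:
  "(q :: 'g \<Rightarrow>\<^sub>0 'k::field) \<otimes>\<^bsub>monoid_algebra M\<^esub> (p + p') =
     q \<otimes>\<^bsub>monoid_algebra M\<^esub> p + q \<otimes>\<^bsub>monoid_algebra M\<^esub> p'"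
proof -
  let ?P = "keys p \<union> keys p'"
  have "keys (p + p') \<subseteq> ?P" by (rule keys_add)
  then show ?thesis
    by (simp add: monoid_algebra_mult[of "keys q" ?P] lookup_add distrib_left single_add sum.distrib)
qed

lemma monoid_algebra_mult_zero [simp]:
  "0 \<otimes>\<^bsub>monoid_algebra M\<^esub> (q :: 'g \<Rightarrow>\<^sub>0 'k::field) = 0"
  "(q :: 'g \<Rightarrow>\<^sub>0 'k::field) \<otimes>\<^bsub>monoid_algebra M\<^esub> 0 = 0"
  by (simp_all add: monoid_algebra_def)

lemma monoid_algebra_mult_single:
  "Poly_Mapping.single g k \<otimes>\<^bsub>monoid_algebra M\<^esub> Poly_Mapping.single h (l :: 'k::field) =
    Poly_Mapping.single (g \<otimes>\<^bsub>M\<^esub> h) (k * l)"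
  by (subst monoid_algebra_mult[of "{g}" "{h}"]) auto

lemma map_mult_poly_mapping:
  "Poly_Mapping.map ((*) k) (p + q) = Poly_Mapping.map ((*) k) p + Poly_Mapping.map ((*) k) (q :: 'g \<Rightarrow>\<^sub>0 'k::field)"
  "Poly_Mapping.map ((*) (k + l)) p = Poly_Mapping.map ((*) k) p + Poly_Mapping.map ((*) l) p"
  "Poly_Mapping.map ((*) (k * l)) p = Poly_Mapping.map ((*) k) (Poly_Mapping.map ((*) l) p)"
  "Poly_Mapping.map ((*) 1) p = p"
  "Poly_Mapping.map ((*) k) 0 = (0 :: 'g \<Rightarrow>\<^sub>0 'k)"
  "Poly_Mapping.map ((*) k) (Poly_Mapping.single g l) = Poly_Mapping.single g (k * l)"
  by (rule poly_mapping_eqI; simp add: lookup_add algebra_simps lookup_single "when_def")+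

lemma monoid_algebra_mult_smult:
  "Poly_Mapping.map ((*) k) p \<otimes>\<^bsub>monoid_algebra M\<^esub> q = Poly_Mapping.map ((*) k) (p \<otimes>\<^bsub>monoid_algebra M\<^esub> (q :: 'g \<Rightarrow>\<^sub>0 'k::field))"
  "p \<otimes>\<^bsub>monoid_algebra M\<^esub> Poly_Mapping.map ((*) k) q = Poly_Mapping.map ((*) k) (p \<otimes>\<^bsub>monoid_algebra M\<^esub> q)"
proof -
  \<comment> \<open>The product is defined on all finitely supported functions, so the induction may
    range over the whole type and no carrier conditions arise.\<close>
  have q: "keys p \<subseteq> UNIV" "keys q \<subseteq> UNIV" by auto
  have 1: "Poly_Mapping.single g (k * l) \<otimes>\<^bsub>monoid_algebra M\<^esub> q =
      Poly_Mapping.map ((*) k) (Poly_Mapping.single g l \<otimes>\<^bsub>monoid_algebra M\<^esub> q)" for g l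
    using q(2) by (induction q rule: poly_mapping_span_induct)
      (simp_all add: monoid_algebra_mult_add_right map_mult_poly_mapping monoid_algebra_mult_single mult.assoc)
  show "Poly_Mapping.map ((*) k) p \<otimes>\<^bsub>monoid_algebra M\<^esub> q = Poly_Mapping.map ((*) k) (p \<otimes>\<^bsub>monoid_algebra M\<^esub> q)"
    using q(1) by (induction p rule: poly_mapping_span_induct)
      (simp_all add: monoid_algebra_mult_add_left map_mult_poly_mapping(1,2,3,4,5) 1)
  have 2: "Poly_Mapping.single g l \<otimes>\<^bsub>monoid_algebra M\<^esub> Poly_Mapping.map ((*) k) q =
      Poly_Mapping.map ((*) k) (Poly_Mapping.single g l \<otimes>\<^bsub>monoid_algebra M\<^esub> q)" for g l
    using q(2) by (induction q rule: poly_mapping_span_induct)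
      (simp_all add: monoid_algebra_mult_add_right map_mult_poly_mapping monoid_algebra_mult_single mult.left_commute)
  show "p \<otimes>\<^bsub>monoid_algebra M\<^esub> Poly_Mapping.map ((*) k) q = Poly_Mapping.map ((*) k) (p \<otimes>\<^bsub>monoid_algebra M\<^esub> q)"
    using q(1) by (induction p rule: poly_mapping_span_induct)
      (simp_all add: monoid_algebra_mult_add_left map_mult_poly_mapping(1,2,3,4,5) 2)
qed

context Group.monoid
begin

lemma monoid_algebra_mult_closed:
  assumes "keys p \<subseteq> carrier G" "keys q \<subseteq> carrier G"
  shows "keys (p \<otimes>\<^bsub>monoid_algebra G\<^esub> (q :: 'a \<Rightarrow>\<^sub>0 'k::field)) \<subseteq> carrier G"
proof -
  have "keys (p \<otimes>\<^bsub>monoid_algebra G\<^esub> q) \<subseteq>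
      (\<Union>g\<in>keys p. \<Union>h\<in>keys q. keys (Poly_Mapping.single (g \<otimes> h) (lookup p g * lookup q h)))"
    unfolding monoid_algebra_mult[OF finite_keys finite_keys order_refl order_refl]
    by (rule order_trans[OF keys_sum], rule UN_mono[OF order_refl], rule keys_sum)
  also have "\<dots> \<subseteq> carrier G" using assms by (auto simp: subset_iff split: if_splits)
  finally show ?thesis .
qed

text \<open>By bilinearity only basis elements have to be considered, where it is associativity in
  the monoid.\<close>

lemma monoid_algebra_assoc:
  assumes "keys p \<subseteq> carrier G" "keys q \<subseteq> carrier G" "keys r \<subseteq> carrier G"
  shows "p \<otimes>\<^bsub>monoid_algebra G\<^esub> q \<otimes>\<^bsub>monoid_algebra G\<^esub> r =
     p \<otimes>\<^bsub>monoid_algebra G\<^esub> (q \<otimes>\<^bsub>monoid_algebra G\<^esub> (r :: 'a \<Rightarrow>\<^sub>0 'k::field))"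
  using assms(1)
proof (induction p rule: poly_mapping_span_induct)
  case (single g k)
  from assms(2) show ?case
  proof (induction q rule: poly_mapping_span_induct)
    case (single h l)
    from assms(3) show ?case
      by (induction r rule: poly_mapping_span_induct)
        (use \<open>g \<in> carrier G\<close> single in \<open>simp_all add: monoid_algebra_mult_add_right
          monoid_algebra_mult_single m_assoc mult.assoc\<close>)
  qed (simp_all add: monoid_algebra_mult_add_left monoid_algebra_mult_add_right)
qed (simp_all add: monoid_algebra_mult_add_left monoid_algebra_mult_add_right)

lemma monoid_algebra_one:
  assumes "keys p \<subseteq> carrier G"
  shows "Poly_Mapping.single \<one> 1 \<otimes>\<^bsub>monoid_algebra G\<^esub> p = (p :: 'a \<Rightarrow>\<^sub>0 'k::field)"
    "p \<otimes>\<^bsub>monoid_algebra G\<^esub> Poly_Mapping.single \<one> 1 = p"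
  using assms
  by (induction p rule: poly_mapping_span_induct)
    (simp_all add: monoid_algebra_mult_add_left monoid_algebra_mult_add_right monoid_algebra_mult_single)

lemma monoid_algebra_k_algebra: "k_algebra (monoid_algebra G :: ('k::field, 'a \<Rightarrow>\<^sub>0 'k) module)"
proof (rule k_algebraI)
  show "Ring.ring (monoid_algebra G :: ('k, 'a \<Rightarrow>\<^sub>0 'k) module)"
  proof (rule ringI)
    show "abelian_group (monoid_algebra G :: ('k, 'a \<Rightarrow>\<^sub>0 'k) module)"
    proof (rule abelian_groupI)
      fix x :: "'a \<Rightarrow>\<^sub>0 'k" assume "x \<in> carrier (monoid_algebra G)"
      then show "\<exists>y\<in>carrier (monoid_algebra G). y \<oplus>\<^bsub>monoid_algebra G\<^esub> x = \<zero>\<^bsub>monoid_algebra G\<^esub>"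
        by (intro bexI[of _ "- x"]) (auto simp: monoid_algebra_simps)
    qed (simp_all add: monoid_algebra_simps add.assoc add.commute keys_add_subset)
    show "Group.monoid (monoid_algebra G :: ('k, 'a \<Rightarrow>\<^sub>0 'k) module)"
      by (rule monoidI)
        (simp_all add: monoid_algebra_simps monoid_algebra_mult_closed monoid_algebra_assoc monoid_algebra_one)
  qed (simp_all add: monoid_algebra_simps monoid_algebra_mult_add_left monoid_algebra_mult_add_right)
qed (simp_all add: monoid_algebra_simps map_mult_poly_mapping monoid_algebra_mult_smult
    subset_trans[OF keys_map_mult])

end


section \<open>Tensor products of algebras\<close>

definition k_bilinear ::
  "('k::field, 'a, 'm) module_scheme \<Rightarrow> ('k, 'b, 'n) module_scheme \<Rightarrow> ('k, 'w, 'p) module_scheme \<Rightarrow>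
   ('a \<Rightarrow> 'b \<Rightarrow> 'w) \<Rightarrow> bool" where
  "k_bilinear A B W \<phi> \<longleftrightarrow> (\<forall>b\<in>carrier B. (\<lambda>a. \<phi> a b) \<in> k_linear_maps A W) \<and>
     (\<forall>a\<in>carrier A. \<phi> a \<in> k_linear_maps B W)"

lemma k_bilinearI:
  assumes "\<And>a b. a \<in> carrier A \<Longrightarrow> b \<in> carrier B \<Longrightarrow> \<phi> a b \<in> carrier W"
    and "\<And>a a' b. a \<in> carrier A \<Longrightarrow> a' \<in> carrier A \<Longrightarrow> b \<in> carrier B \<Longrightarrow>
       \<phi> (a \<oplus>\<^bsub>A\<^esub> a') b = \<phi> a b \<oplus>\<^bsub>W\<^esub> \<phi> a' b"
    and "\<And>a b b'. a \<in> carrier A \<Longrightarrow> b \<in> carrier B \<Longrightarrow> b' \<in> carrier B \<Longrightarrow>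
       \<phi> a (b \<oplus>\<^bsub>B\<^esub> b') = \<phi> a b \<oplus>\<^bsub>W\<^esub> \<phi> a b'"
    and "\<And>k a b. a \<in> carrier A \<Longrightarrow> b \<in> carrier B \<Longrightarrow> \<phi> (k \<odot>\<^bsub>A\<^esub> a) b = k \<odot>\<^bsub>W\<^esub> \<phi> a b"
    and "\<And>k a b. a \<in> carrier A \<Longrightarrow> b \<in> carrier B \<Longrightarrow> \<phi> a (k \<odot>\<^bsub>B\<^esub> b) = k \<odot>\<^bsub>W\<^esub> \<phi> a b"
  shows "k_bilinear A B W \<phi>"
  unfolding k_bilinear_def by (intro conjI ballI k_linear_mapsI) (simp_all add: assms)

lemma k_bilinearD:
  assumes "k_bilinear A B W \<phi>"
  shows "\<And>a b. a \<in> carrier A \<Longrightarrow> b \<in> carrier B \<Longrightarrow> \<phi> a b \<in> carrier W"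
    and "\<And>a a' b. a \<in> carrier A \<Longrightarrow> a' \<in> carrier A \<Longrightarrow> b \<in> carrier B \<Longrightarrow>
       \<phi> (a \<oplus>\<^bsub>A\<^esub> a') b = \<phi> a b \<oplus>\<^bsub>W\<^esub> \<phi> a' b"
    and "\<And>a b b'. a \<in> carrier A \<Longrightarrow> b \<in> carrier B \<Longrightarrow> b' \<in> carrier B \<Longrightarrow>
       \<phi> a (b \<oplus>\<^bsub>B\<^esub> b') = \<phi> a b \<oplus>\<^bsub>W\<^esub> \<phi> a b'"
    and "\<And>k a b. a \<in> carrier A \<Longrightarrow> b \<in> carrier B \<Longrightarrow> \<phi> (k \<odot>\<^bsub>A\<^esub> a) b = k \<odot>\<^bsub>W\<^esub> \<phi> a b"
    and "\<And>k a b. a \<in> carrier A \<Longrightarrow> b \<in> carrier B \<Longrightarrow> \<phi> a (k \<odot>\<^bsub>B\<^esub> b) = k \<odot>\<^bsub>W\<^esub> \<phi> a b"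
  using assms unfolding k_bilinear_def k_linear_maps_def by auto

locale tensor = A: k_alg A + B: k_alg B
  for A :: "('k::field, 'a, 'm) module_scheme" and B :: "('k, 'b, 'n) module_scheme"
begin

abbreviation "C \<equiv> tensor_cover A B"
abbreviation "J \<equiv> tensor_ideal A B"
abbreviation "T \<equiv> tensor_algebra A B"

lemma cover_k_algebra: "k_algebra C"
  unfolding tensor_cover_def
  by (intro monoid.monoid_algebra_k_algebra DirProd_monoid A.monoid_axioms B.monoid_axioms)

sublocale C: k_alg C
  by unfold_locales (rule cover_k_algebra)

lemma cover_carrier: "carrier C = {p. keys p \<subseteq> carrier A \<times> carrier B}"
  by (simp add: tensor_cover_def monoid_algebra_simps)

lemma cover_simps:
  "\<zero>\<^bsub>C\<^esub> = 0" "s \<oplus>\<^bsub>C\<^esub> t = s + t" "\<one>\<^bsub>C\<^esub> = Poly_Mapping.single (\<one>\<^bsub>A\<^esub>, \<one>\<^bsub>B\<^esub>) 1"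
  "k \<odot>\<^bsub>C\<^esub> s = Poly_Mapping.map ((*) k) s"
  "Poly_Mapping.single (a, b) k \<otimes>\<^bsub>C\<^esub> Poly_Mapping.single (a', b') l =
     Poly_Mapping.single (a \<otimes>\<^bsub>A\<^esub> a', b \<otimes>\<^bsub>B\<^esub> b') (k * l)"
  by (simp_all add: tensor_cover_def monoid_algebra_simps monoid_algebra_mult_single)

lemma cover_minus: "s \<in> carrier C \<Longrightarrow> t \<in> carrier C \<Longrightarrow> s \<ominus>\<^bsub>C\<^esub> t = s - t"
  by (simp add: a_minus_def C.minus_eq_smult cover_simps)
    (rule poly_mapping_eqI, simp add: lookup_add lookup_minus)

lemma cover_single: "a \<in> carrier A \<Longrightarrow> b \<in> carrier B \<Longrightarrow> Poly_Mapping.single (a, b) k \<in> carrier C"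
  by (simp add: cover_carrier)

lemma cover_diff: "s \<in> carrier C \<Longrightarrow> t \<in> carrier C \<Longrightarrow> s - t \<in> carrier C"
  using C.minus_closed[of s t] cover_minus[of s t] by simp

lemma relations_carrier: "bilinearity_relations A B \<subseteq> carrier C"
  unfolding bilinearity_relations_def
  by (auto intro!: cover_diff cover_single)

lemma tensor_ideal_ideal: "ideal J C"
  unfolding tensor_ideal_def by (rule C.genideal_ideal[OF relations_carrier])

sublocale J: ideal J C
  by (rule tensor_ideal_ideal)

abbreviation cls :: "('a \<times> 'b \<Rightarrow>\<^sub>0 'k) \<Rightarrow> ('a \<times> 'b \<Rightarrow>\<^sub>0 'k) set" where
  "cls t \<equiv> J +>\<^bsub>C\<^esub> t"

lemma cls_eq_iff: "s \<in> carrier C \<Longrightarrow> t \<in> carrier C \<Longrightarrow> cls s = cls t \<longleftrightarrow> s - t \<in> J"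
  using C.quotient_eq_iff_same_a_r_cos[OF tensor_ideal_ideal, of s t] cover_minus[of s t] by simp

text \<open>In a unital algebra every ideal is a subspace, as k j = (k 1) j.\<close>

lemma ideal_smult: "j \<in> J \<Longrightarrow> k \<odot>\<^bsub>C\<^esub> j \<in> J"
proof -
  assume j: "j \<in> J"
  then have "j \<in> carrier C" by (rule J.a_Hcarr)
  then have "k \<odot>\<^bsub>C\<^esub> j = (k \<odot>\<^bsub>C\<^esub> \<one>\<^bsub>C\<^esub>) \<otimes>\<^bsub>C\<^esub> j" by (simp add: C.mult_smult_left)
  then show ?thesis using J.I_l_closed[OF j, of "k \<odot>\<^bsub>C\<^esub> \<one>\<^bsub>C\<^esub>"] by simp
qed

text \<open>Scalar multiplication on the quotient is a union over all representatives of a class; it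
  collapses to one class because every representative contributes the same one.\<close>

lemma cls_smult_cong: 
  assumes "s \<in> carrier C" "t \<in> cls s"
  shows "cls (k \<odot>\<^bsub>C\<^esub> t) = cls (k \<odot>\<^bsub>C\<^esub> s)"
proof -
  obtain j where j: "j \<in> J" "t = j \<oplus>\<^bsub>C\<^esub> s" using assms(2) by (auto simp: a_r_coset_def')
  have jc: "j \<in> carrier C" using j(1) by (rule J.a_Hcarr)
  have "k \<odot>\<^bsub>C\<^esub> t = k \<odot>\<^bsub>C\<^esub> j \<oplus>\<^bsub>C\<^esub> k \<odot>\<^bsub>C\<^esub> s" using j jc assms by (simp add: C.smult_add_right)
  then have "k \<odot>\<^bsub>C\<^esub> t - k \<odot>\<^bsub>C\<^esub> s = k \<odot>\<^bsub>C\<^esub> j" by (simp add: cover_simps)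
  then show ?thesis using cls_eq_iff[of "k \<odot>\<^bsub>C\<^esub> t" "k \<odot>\<^bsub>C\<^esub> s"] ideal_smult[OF j(1)] jc assms j by simp
qed

lemma tensor_carrier: "carrier T = {cls t | t. t \<in> carrier C}"
  by (auto simp: tensor_algebra_def ring.defs FactRing_simps)

lemma cls_simps:
  assumes "s \<in> carrier C" "t \<in> carrier C"
  shows "cls s \<oplus>\<^bsub>T\<^esub> cls t = cls (s \<oplus>\<^bsub>C\<^esub> t)" "cls s \<otimes>\<^bsub>T\<^esub> cls t = cls (s \<otimes>\<^bsub>C\<^esub> t)"
  using assms by (simp_all add: tensor_algebra_def ring.defs FactRing_def J.a_rcos_sum J.rcoset_mult_add)

lemma cls_smult:
  assumes "s \<in> carrier C"
  shows "k \<odot>\<^bsub>T\<^esub> cls s = cls (k \<odot>\<^bsub>C\<^esub> s)"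
proof -
  have "(\<Union>t\<in>cls s. cls (k \<odot>\<^bsub>C\<^esub> t)) = (\<Union>t\<in>cls s. cls (k \<odot>\<^bsub>C\<^esub> s))"
    by (rule SUP_cong) (use cls_smult_cong assms in auto)
  moreover have "s \<in> cls s" using assms by (simp add: J.a_rcos_self)
  ultimately show ?thesis
    by (auto simp: tensor_algebra_def ring.defs module.defs)
qed

lemma tensor_one: "\<one>\<^bsub>T\<^esub> = cls \<one>\<^bsub>C\<^esub>" and tensor_zero: "\<zero>\<^bsub>T\<^esub> = cls \<zero>\<^bsub>C\<^esub>"
  by (simp_all add: tensor_algebra_def ring.defs FactRing_def C.a_rcos_zero[OF tensor_ideal_ideal])

text \<open>The quotient is a ring, but the tensor algebra is another record on top of it, so the
  axioms are transported along the equality of the operations.\<close>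

lemma tensor_ring: "Ring.ring T"
proof -
  interpret Q: Ring.ring "C Quot J" by (rule J.quotient_is_ring)
  have *: "carrier T = carrier (C Quot J)" "add T = add (C Quot J)" "monoid.mult T = monoid.mult (C Quot J)"
    "one T = one (C Quot J)" "ring.zero T = ring.zero (C Quot J)"
    by (simp_all add: tensor_algebra_def ring.defs)
  show ?thesis
  proof (rule ringI)
    show "abelian_group T"
      by (rule abelian_groupI) (use * Q.a_assoc Q.a_comm Q.add.l_inv_ex in auto)
    show "Group.monoid T"
      by (rule monoidI) (use * Q.m_assoc in auto)
  qed (use * Q.l_distr Q.r_distr in auto)
qed

lemma tensor_k_algebra: "k_algebra T"
  by (rule k_algebraI[OF tensor_ring])
    (auto simp: tensor_carrier cls_simps cls_smult C.smult_add_left C.smult_add_right C.smult_smult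
      C.mult_smult_left C.mult_smult_right)

lemma pure_tensor_cls: "pure_tensor A B a b = cls (Poly_Mapping.single (a, b) 1)"
  by (simp add: pure_tensor_def)

lemma pure_closed: "a \<in> carrier A \<Longrightarrow> b \<in> carrier B \<Longrightarrow> pure_tensor A B a b \<in> carrier T"
  using cover_single by (auto simp: pure_tensor_cls tensor_carrier)

lemma relations_in_ideal: "bilinearity_relations A B \<subseteq> J"
  unfolding tensor_ideal_def by (rule C.genideal_self[OF relations_carrier])

lemma pure_bilinear: "k_bilinear A B T (pure_tensor A B)"
proof (rule k_bilinearI)
  fix a a' b assume *: "a \<in> carrier A" "a' \<in> carrier A" "b \<in> carrier B"
  have "Poly_Mapping.single (a \<oplus>\<^bsub>A\<^esub> a', b) 1 - Poly_Mapping.single (a, b) 1 - Poly_Mapping.single (a', b) 1 \<in> J"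
    by (rule subsetD[OF relations_in_ideal]) (use * in \<open>auto simp: bilinearity_relations_def\<close>)
  then show "pure_tensor A B (a \<oplus>\<^bsub>A\<^esub> a') b = pure_tensor A B a b \<oplus>\<^bsub>T\<^esub> pure_tensor A B a' b"
    using * by (simp add: pure_tensor_cls cls_simps cls_smult cover_single cls_eq_iff del: cover_simps(2))
      (simp add: cover_simps diff_diff_eq)
next
  fix a b b' assume *: "a \<in> carrier A" "b \<in> carrier B" "b' \<in> carrier B"
  have "Poly_Mapping.single (a, b \<oplus>\<^bsub>B\<^esub> b') 1 - Poly_Mapping.single (a, b) 1 - Poly_Mapping.single (a, b') 1 \<in> J"
    by (rule subsetD[OF relations_in_ideal]) (use * in \<open>auto simp: bilinearity_relations_def\<close>)
  then show "pure_tensor A B a (b \<oplus>\<^bsub>B\<^esub> b') = pure_tensor A B a b \<oplus>\<^bsub>T\<^esub> pure_tensor A B a b'"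
    using * by (simp add: pure_tensor_cls cls_simps cls_smult cover_single cls_eq_iff del: cover_simps(2))
      (simp add: cover_simps diff_diff_eq)
next
  fix k a b assume *: "a \<in> carrier A" "b \<in> carrier B"
  have "Poly_Mapping.single (k \<odot>\<^bsub>A\<^esub> a, b) 1 - Poly_Mapping.single (a, b) k \<in> J"
    by (rule subsetD[OF relations_in_ideal]) (use * in \<open>auto simp: bilinearity_relations_def\<close>)
  then show "pure_tensor A B (k \<odot>\<^bsub>A\<^esub> a) b = k \<odot>\<^bsub>T\<^esub> pure_tensor A B a b"
    using * by (simp add: pure_tensor_cls cls_simps cls_smult cover_single cls_eq_iff)
      (simp add: cover_simps)
next
  fix k a b assume *: "a \<in> carrier A" "b \<in> carrier B"
  have "Poly_Mapping.single (a, k \<odot>\<^bsub>B\<^esub> b) 1 - Poly_Mapping.single (a, b) k \<in> J"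
    by (rule subsetD[OF relations_in_ideal]) (use * in \<open>auto simp: bilinearity_relations_def\<close>)
  then show "pure_tensor A B a (k \<odot>\<^bsub>B\<^esub> b) = k \<odot>\<^bsub>T\<^esub> pure_tensor A B a b"
    using * by (simp add: pure_tensor_cls cls_simps cls_smult cover_single cls_eq_iff)
      (simp add: cover_simps)
qed (rule pure_closed)

lemma pure_mult:
  assumes "a \<in> carrier A" "b \<in> carrier B" "a' \<in> carrier A" "b' \<in> carrier B"
  shows "pure_tensor A B a b \<otimes>\<^bsub>T\<^esub> pure_tensor A B a' b' = pure_tensor A B (a \<otimes>\<^bsub>A\<^esub> a') (b \<otimes>\<^bsub>B\<^esub> b')"
  using assms by (simp add: pure_tensor_cls cls_simps cls_smult cover_single) (simp add: cover_simps)

lemma pure_one: "pure_tensor A B \<one>\<^bsub>A\<^esub> \<one>\<^bsub>B\<^esub> = \<one>\<^bsub>T\<^esub>"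
  by (simp add: pure_tensor_cls tensor_one cover_simps)

text \<open>A coefficient can be absorbed into the left factor of a pure tensor, so every tensor is
  a plain sum of pure tensors and no scalar case is required.\<close>

lemma tensor_induct [consumes 1, case_names pure add]:
  assumes "z \<in> carrier T" and pure: "\<And>a b. a \<in> carrier A \<Longrightarrow> b \<in> carrier B \<Longrightarrow> P (pure_tensor A B a b)"
    and add: "\<And>s t. s \<in> carrier T \<Longrightarrow> t \<in> carrier T \<Longrightarrow> P s \<Longrightarrow> P t \<Longrightarrow> P (s \<oplus>\<^bsub>T\<^esub> t)"
  shows "P z"
proof -
  have scaled: "cls (Poly_Mapping.single (a, b) k) = pure_tensor A B (k \<odot>\<^bsub>A\<^esub> a) b"
    if "a \<in> carrier A" "b \<in> carrier B" for a b k
    using that k_bilinearD(4)[OF pure_bilinear that, of k]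
    by (simp add: pure_tensor_cls cls_simps cls_smult cover_single) (simp add: cover_simps)
  obtain t where t: "keys t \<subseteq> carrier A \<times> carrier B" "z = cls t"
    using assms(1) by (auto simp: tensor_carrier cover_carrier)
  from t(1) have "P (cls t)"
  proof (induction t rule: poly_mapping_span_induct)
    case zero
    have "cls (0 :: 'a \<times> 'b \<Rightarrow>\<^sub>0 'k) = cls (Poly_Mapping.single (\<zero>\<^bsub>A\<^esub>, \<zero>\<^bsub>B\<^esub>) 0)" by simp
    then show ?case using scaled[of "\<zero>\<^bsub>A\<^esub>" "\<zero>\<^bsub>B\<^esub>" 0] pure[of "0 \<odot>\<^bsub>A\<^esub> \<zero>\<^bsub>A\<^esub>" "\<zero>\<^bsub>B\<^esub>"] by simp
  next
    case (single i k)
    then show ?case using scaled pure by (cases i) auto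
  next
    case (add p q)
    then have pq: "p \<in> carrier C" "q \<in> carrier C" by (auto simp: cover_carrier)
    have "P (cls p \<oplus>\<^bsub>T\<^esub> cls q)"
      by (rule assms(3)) (use pq add in \<open>auto simp: tensor_carrier\<close>)
    then show ?case using pq by (simp add: cls_simps cls_smult) (simp add: cover_simps)
  qed
  with t(2) show ?thesis by simp
qed

text \<open>Multiplying by a basis element of the cover has the same effect as translating the
  arguments of the bilinear map. This is the step that makes the common kernel of all bilinear maps
  an ideal.\<close>

lemma lin_comb_mult_single:
  assumes W: "k_algebra W" and \<phi>: "k_bilinear A B W \<phi>" and uv: "u \<in> carrier A" "v \<in> carrier B"
    and t: "t \<in> carrier C"
  shows "lin_comb W (\<lambda>(a, b). \<phi> a b) (Poly_Mapping.single (u, v) k \<otimes>\<^bsub>C\<^esub> t) =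
      k \<odot>\<^bsub>W\<^esub> lin_comb W (\<lambda>(a, b). \<phi> (u \<otimes>\<^bsub>A\<^esub> a) (v \<otimes>\<^bsub>B\<^esub> b)) t" (is "?L t = ?R t")
    and "lin_comb W (\<lambda>(a, b). \<phi> a b) (t \<otimes>\<^bsub>C\<^esub> Poly_Mapping.single (u, v) k) =
      k \<odot>\<^bsub>W\<^esub> lin_comb W (\<lambda>(a, b). \<phi> (a \<otimes>\<^bsub>A\<^esub> u) (b \<otimes>\<^bsub>B\<^esub> v)) t" (is "?L' t = ?R' t")
proof -
  interpret W: k_alg W by unfold_locales (rule W)
  let ?I = "carrier A \<times> carrier B"
  have f: "(\<lambda>(a, b). \<phi> a b) \<in> ?I \<rightarrow> carrier W"
    "(\<lambda>(a, b). \<phi> (u \<otimes>\<^bsub>A\<^esub> a) (v \<otimes>\<^bsub>B\<^esub> b)) \<in> ?I \<rightarrow> carrier W"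
    "(\<lambda>(a, b). \<phi> (a \<otimes>\<^bsub>A\<^esub> u) (b \<otimes>\<^bsub>B\<^esub> v)) \<in> ?I \<rightarrow> carrier W"
    using k_bilinearD(1)[OF \<phi>] uv by auto
  note c = W.lin_comb_closed[OF f(1)] W.lin_comb_closed[OF f(2)] W.lin_comb_closed[OF f(3)]
  have k: "keys t \<subseteq> ?I" using t by (simp add: cover_carrier)
  have s: "Poly_Mapping.single (u, v) k \<in> carrier C" using uv by (rule cover_single)
  have L: "keys p \<subseteq> ?I \<Longrightarrow> keys (Poly_Mapping.single (u, v) k \<otimes>\<^bsub>C\<^esub> p) \<subseteq> ?I" for p
    using C.m_closed[OF s, of p] by (simp add: cover_carrier)
  have L': "keys p \<subseteq> ?I \<Longrightarrow> keys (p \<otimes>\<^bsub>C\<^esub> Poly_Mapping.single (u, v) k) \<subseteq> ?I" for p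
    using C.m_closed[OF _ s, of p] by (simp add: cover_carrier)
  have d: "keys p \<subseteq> ?I \<Longrightarrow> keys q \<subseteq> ?I \<Longrightarrow>
      Poly_Mapping.single (u, v) k \<otimes>\<^bsub>C\<^esub> (p + q) = Poly_Mapping.single (u, v) k \<otimes>\<^bsub>C\<^esub> p + Poly_Mapping.single (u, v) k \<otimes>\<^bsub>C\<^esub> q" for p q
    using C.r_distr[of p q "Poly_Mapping.single (u, v) k"] s by (simp add: cover_carrier cover_simps)
  have d': "keys p \<subseteq> ?I \<Longrightarrow> keys q \<subseteq> ?I \<Longrightarrow>
      (p + q) \<otimes>\<^bsub>C\<^esub> Poly_Mapping.single (u, v) k = p \<otimes>\<^bsub>C\<^esub> Poly_Mapping.single (u, v) k + q \<otimes>\<^bsub>C\<^esub> Poly_Mapping.single (u, v) k" for p q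
    using C.l_distr[of p q "Poly_Mapping.single (u, v) k"] s by (simp add: cover_carrier cover_simps)
  from k show "?L t = ?R t"
  proof (induction t rule: poly_mapping_span_induct)
    case zero
    then show ?case using C.r_null[OF s] by (simp add: cover_simps)
  next
    case (single i l)
    then show ?case using k_bilinearD(1)[OF \<phi>] uv
      by (cases i) (simp add: cover_simps W.smult_smult)
  next
    case (add p q)
    then show ?case
      by (simp add: d W.lin_comb_add[OF f(1) L L] W.lin_comb_add[OF f(2)] W.smult_add_right c)
  qed
  from k show "?L' t = ?R' t"
  proof (induction t rule: poly_mapping_span_induct)
    case zero
    then show ?case using C.l_null[OF s] by (simp add: cover_simps)
  next
    case (single i l)
    then show ?case using k_bilinearD(1)[OF \<phi>] uv
      by (cases i) (simp add: cover_simps W.smult_smult mult.commute)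
  next
    case (add p q)
    then show ?case
      by (simp add: d' W.lin_comb_add[OF f(1) L' L'] W.lin_comb_add[OF f(3)] W.smult_add_right c)
  qed
qed

text \<open>The tensors annihilated by all bilinear maps into a fixed space form an ideal, since
  bilinear maps are stable under multiplication of the arguments.\<close>

lemma lin_comb_tensor_ideal:
  assumes W: "k_algebra W" and \<phi>: "k_bilinear A B W \<phi>" and t: "t \<in> J"
  shows "lin_comb W (\<lambda>(a, b). \<phi> a b) t = \<zero>\<^bsub>W\<^esub>"
proof -
  interpret W: k_alg W by unfold_locales (rule W)
  let ?I = "carrier A \<times> carrier B"
  define L where "L = (\<lambda>\<phi>. lin_comb W (\<lambda>(a :: 'a, b :: 'b). \<phi> a b :: 'c))"
  define N where "N = {t \<in> carrier C. \<forall>\<phi>. k_bilinear A B W \<phi> \<longrightarrow> L \<phi> t = \<zero>\<^bsub>W\<^esub>}"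
  have f: "(\<lambda>(a, b). \<phi> a b) \<in> ?I \<rightarrow> carrier W" if "k_bilinear A B W \<phi>" for \<phi>
    using k_bilinearD(1)[OF that] by auto
  have lin: "L \<phi> \<in> k_linear_maps C W" if "k_bilinear A B W \<phi>" for \<phi>
    unfolding L_def
    by (rule k_linear_mapsI)
      (use W.lin_comb_closed[OF f[OF that]] W.lin_comb_add[OF f[OF that]] W.lin_comb_smult[OF f[OF that]]
        in \<open>auto simp: cover_carrier cover_simps\<close>)
  have N_sub: "submodule N scalar_ring C"
  proof (rule C.submoduleI)
    show "\<zero>\<^bsub>C\<^esub> \<in> N" by (simp add: N_def L_def) (simp add: cover_simps)
  qed (auto simp: N_def k_linear_mapsD[OF lin])
  have Nadd: "s + t \<in> N" if "s \<in> N" "t \<in> N" for s t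
    using C.submoduleD(3)[OF N_sub that] by (simp add: cover_simps)
  have shift: "k_bilinear A B W (\<lambda>a b. \<phi> (u \<otimes>\<^bsub>A\<^esub> a) (v \<otimes>\<^bsub>B\<^esub> b))"
    "k_bilinear A B W (\<lambda>a b. \<phi> (a \<otimes>\<^bsub>A\<^esub> u) (b \<otimes>\<^bsub>B\<^esub> v))"
    if "k_bilinear A B W \<phi>" "u \<in> carrier A" "v \<in> carrier B" for \<phi> u v
    using that k_bilinearD[OF that(1)]
    by (auto intro!: k_bilinearI simp: A.l_distr A.r_distr B.l_distr B.r_distr
        A.mult_smult_left A.mult_smult_right B.mult_smult_left B.mult_smult_right)
  have "ideal N C"
  proof (rule idealI)
    show "subgroup N (add_monoid C)" using N_sub by (rule submodule.axioms(1))
    fix t x assume t: "t \<in> N" and x: "x \<in> carrier C"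
    have tc: "t \<in> carrier C" using t by (simp add: N_def)
    have kx: "keys x \<subseteq> ?I" using x by (simp add: cover_carrier)
    from kx show "x \<otimes>\<^bsub>C\<^esub> t \<in> N"
    proof (induction x rule: poly_mapping_span_induct)
      case zero
      then show ?case using C.submoduleD(2)[OF N_sub] C.l_null[OF tc] by (simp add: cover_simps)
    next
      case (single i k)
      then obtain u v where i: "i = (u, v)" "u \<in> carrier A" "v \<in> carrier B" by (cases i) auto
      have "L \<phi> (Poly_Mapping.single i k \<otimes>\<^bsub>C\<^esub> t) = \<zero>\<^bsub>W\<^esub>" if "k_bilinear A B W \<phi>" for \<phi>
        using t lin_comb_mult_single(1)[OF W that i(2,3) tc, of k] shift(1)[OF that i(2,3)]
        by (simp add: i N_def L_def)
      moreover have "Poly_Mapping.single i k \<otimes>\<^bsub>C\<^esub> t \<in> carrier C" using i tc by (simp add: cover_single)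
      ultimately show ?case by (simp add: N_def)
    next
      case (add p q)
      then show ?case using C.l_distr[OF _ _ tc, of p q] Nadd by (simp add: cover_carrier cover_simps)
    qed
    from kx show "t \<otimes>\<^bsub>C\<^esub> x \<in> N"
    proof (induction x rule: poly_mapping_span_induct)
      case zero
      then show ?case using C.submoduleD(2)[OF N_sub] C.r_null[OF tc] by (simp add: cover_simps)
    next
      case (single i k)
      then obtain u v where i: "i = (u, v)" "u \<in> carrier A" "v \<in> carrier B" by (cases i) auto
      have "L \<phi> (t \<otimes>\<^bsub>C\<^esub> Poly_Mapping.single i k) = \<zero>\<^bsub>W\<^esub>" if "k_bilinear A B W \<phi>" for \<phi>
        using t lin_comb_mult_single(2)[OF W that i(2,3) tc, of k] shift(2)[OF that i(2,3)]
        by (simp add: i N_def L_def)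
      moreover have "t \<otimes>\<^bsub>C\<^esub> Poly_Mapping.single i k \<in> carrier C" using i tc by (simp add: cover_single)
      ultimately show ?case by (simp add: N_def)
    next
      case (add p q)
      then show ?case using C.r_distr[of p q t] tc Nadd by (simp add: cover_carrier cover_simps)
    qed
  qed (rule C.ring_axioms)
  moreover have "bilinearity_relations A B \<subseteq> N"
  proof
    fix r assume r: "r \<in> bilinearity_relations A B"
    have rc: "r \<in> carrier C" using r relations_carrier by auto
    have "L \<phi> r = \<zero>\<^bsub>W\<^esub>" if b: "k_bilinear A B W \<phi>" for \<phi>
    proof -
      interpret L: k_linear C W "L \<phi>" by (rule k_linearI[OF cover_k_algebra W lin[OF b]])
      have diff: "L \<phi> (s - t) = L \<phi> s \<ominus>\<^bsub>W\<^esub> L \<phi> t" if "s \<in> carrier C" "t \<in> carrier C" for s t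
        using cover_minus[OF that] that L.map_add[of s "\<ominus>\<^bsub>C\<^esub> t"] L.map_minus[of t] by (simp add: a_minus_def)
      have sg: "L \<phi> (Poly_Mapping.single (a, b) k) = k \<odot>\<^bsub>W\<^esub> \<phi> a b"
        if "a \<in> carrier A" "b \<in> carrier B" for a b k
        unfolding L_def using k_bilinearD(1)[OF b that] by (subst W.lin_comb_single) simp_all
      note D = k_bilinearD[OF b]
      have z: "p \<oplus>\<^bsub>W\<^esub> q \<ominus>\<^bsub>W\<^esub> p \<ominus>\<^bsub>W\<^esub> q = \<zero>\<^bsub>W\<^esub>" if "p \<in> carrier W" "q \<in> carrier W" for p q
      proof -
        have "p \<oplus>\<^bsub>W\<^esub> q \<ominus>\<^bsub>W\<^esub> p = q"
          using that by (simp add: a_minus_def W.a_comm[of p q] W.a_assoc W.r_neg)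
        then show ?thesis using that by (simp add: a_minus_def W.r_neg)
      qed
      have z': "p \<ominus>\<^bsub>W\<^esub> p = \<zero>\<^bsub>W\<^esub>" if "p \<in> carrier W" for p
        using that by (simp add: a_minus_def W.r_neg)
      \<comment> \<open>Each of the four families of relations is sent to an expression of the form
        p + q - p - q or p - p.\<close>
      show ?thesis using r unfolding bilinearity_relations_def
        by (elim UnE CollectE exE conjE; clarify)
          (simp_all add: diff sg cover_single cover_diff D z z')
    qed
    then show "r \<in> N" using rc by (simp add: N_def)
  qed
  ultimately have "J \<subseteq> N" unfolding tensor_ideal_def by (rule C.genideal_minimal)
  then show ?thesis using t \<phi> by (auto simp: N_def L_def)
qed

text \<open>Two representatives of a class differ by an element of the ideal, on which the linear
  extension of \<phi> vanishes; hence the image of a class is a singleton and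
  \<open>the_elem\<close> is meaningful.\<close>

lemma tensor_lift_cls:
  assumes W: "k_algebra W" and \<phi>: "k_bilinear A B W \<phi>" and t: "t \<in> carrier C"
  shows "tensor_lift W \<phi> (cls t) = lin_comb W (\<lambda>(a, b). \<phi> a b) t"
proof -
  interpret W: k_alg W by unfold_locales (rule W)
  have f: "(\<lambda>(a, b). \<phi> a b) \<in> carrier A \<times> carrier B \<rightarrow> carrier W"
    using k_bilinearD(1)[OF \<phi>] by auto
  have "lin_comb W (\<lambda>(a, b). \<phi> a b) s = lin_comb W (\<lambda>(a, b). \<phi> a b) t" if s: "s \<in> cls t" for s
  proof -
    obtain j where j: "j \<in> J" "s = j \<oplus>\<^bsub>C\<^esub> t" using s by (auto simp: a_r_coset_def')
    have jc: "j \<in> carrier C" using j(1) by (rule J.a_Hcarr)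
    show ?thesis
      using W.lin_comb_add[OF f, of j t] jc t j lin_comb_tensor_ideal[OF W \<phi> j(1)]
        W.lin_comb_closed[OF f, of t]
      by (simp add: cover_simps cover_carrier)
  qed
  moreover have "t \<in> cls t" using t by (simp add: J.a_rcos_self)
  ultimately have "lin_comb W (\<lambda>(a, b). \<phi> a b) ` cls t = {lin_comb W (\<lambda>(a, b). \<phi> a b) t}" by blast
  then show ?thesis by (simp add: tensor_lift_def)
qed

lemma tensor_lift_pure:
  assumes W: "k_algebra W" and \<phi>: "k_bilinear A B W \<phi>" and "a \<in> carrier A" "b \<in> carrier B"
  shows "tensor_lift W \<phi> (pure_tensor A B a b) = \<phi> a b"
proof -
  interpret W: k_alg W by unfold_locales (rule W)
  show ?thesis using k_bilinearD(1)[OF \<phi> assms(3,4)] assms(3,4)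
    by (simp add: pure_tensor_cls tensor_lift_cls[OF W \<phi>] cover_single)
qed

lemma tensor_lift_linear:
  assumes W: "k_algebra W" and \<phi>: "k_bilinear A B W \<phi>"
  shows "tensor_lift W \<phi> \<in> k_linear_maps T W"
proof -
  interpret W: k_alg W by unfold_locales (rule W)
  have f: "(\<lambda>(a, b). \<phi> a b) \<in> carrier A \<times> carrier B \<rightarrow> carrier W"
    using k_bilinearD(1)[OF \<phi>] by auto
  note L = tensor_lift_cls[OF W \<phi>]
  show ?thesis
  proof (rule k_linear_mapsI)
    fix s assume "s \<in> carrier T"
    then obtain s' where s: "s = cls s'" "s' \<in> carrier C" by (auto simp: tensor_carrier)
    then show "tensor_lift W \<phi> s \<in> carrier W"
      using W.lin_comb_closed[OF f] by (simp add: L) (simp add: cover_carrier)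
    show "tensor_lift W \<phi> (k \<odot>\<^bsub>T\<^esub> s) = k \<odot>\<^bsub>W\<^esub> tensor_lift W \<phi> s" for k
      using s W.lin_comb_smult[OF f, of s'] by (simp add: cls_simps cls_smult L) (simp add: cover_carrier cover_simps)
    fix t assume "t \<in> carrier T"
    then obtain t' where t: "t = cls t'" "t' \<in> carrier C" by (auto simp: tensor_carrier)
    show "tensor_lift W \<phi> (s \<oplus>\<^bsub>T\<^esub> t) = tensor_lift W \<phi> s \<oplus>\<^bsub>W\<^esub> tensor_lift W \<phi> t"
      using s t W.lin_comb_add[OF f, of s' t'] by (simp add: cls_simps cls_smult L) (simp add: cover_carrier cover_simps)
  qed
qed

sublocale T: k_alg T
  by unfold_locales (rule tensor_k_algebra)

text \<open>Turns identities between Sweedler sums into identities between algebra maps, which are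
  then decided by generators.\<close>

lemma tensor_lift_hom:
  assumes W: "k_algebra W" and \<phi>: "k_bilinear A B W \<phi>"
    and mult: "\<And>a a' b b'. a \<in> carrier A \<Longrightarrow> a' \<in> carrier A \<Longrightarrow> b \<in> carrier B \<Longrightarrow> b' \<in> carrier B \<Longrightarrow>
       \<phi> (a \<otimes>\<^bsub>A\<^esub> a') (b \<otimes>\<^bsub>B\<^esub> b') = \<phi> a b \<otimes>\<^bsub>W\<^esub> \<phi> a' b'"
    and one: "\<phi> \<one>\<^bsub>A\<^esub> \<one>\<^bsub>B\<^esub> = \<one>\<^bsub>W\<^esub>"
  shows "tensor_lift W \<phi> \<in> k_algebra_homs T W"
proof (rule k_algebra_homsI[OF tensor_lift_linear[OF W \<phi>]])
  interpret W: k_alg W by unfold_locales (rule W)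
  note P = tensor_lift_pure[OF W \<phi>] and L = k_linear_mapsD[OF tensor_lift_linear[OF W \<phi>]]
  show "tensor_lift W \<phi> \<one>\<^bsub>T\<^esub> = \<one>\<^bsub>W\<^esub>" using P[of "\<one>\<^bsub>A\<^esub>" "\<one>\<^bsub>B\<^esub>"] one by (simp add: pure_one)
  fix s t assume s: "s \<in> carrier T" and t: "t \<in> carrier T"
  from s show "tensor_lift W \<phi> (s \<otimes>\<^bsub>T\<^esub> t) = tensor_lift W \<phi> s \<otimes>\<^bsub>W\<^esub> tensor_lift W \<phi> t"
  proof (induction rule: tensor_induct)
    case (pure a b)
    from t show ?case
    proof (induction rule: tensor_induct)
      case (pure a' b')
      then show ?case using \<open>a \<in> carrier A\<close> \<open>b \<in> carrier B\<close> by (simp add: pure_mult P mult)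
    next
      case (add s t)
      then show ?case using \<open>a \<in> carrier A\<close> \<open>b \<in> carrier B\<close>
        by (simp add: T.r_distr W.r_distr L pure_closed)
    qed
  next
    case (add s s')
    then show ?case using t by (simp add: T.l_distr W.l_distr L)
  qed
qed

end

section \<open>Ore extensions\<close>

lemma up_iff: "p \<in> up R \<longleftrightarrow> (\<forall>n. p n \<in> carrier R) \<and> (\<exists>N. \<forall>n>N. p n = \<zero>\<^bsub>R\<^esub>)"
  unfolding up_def bound_def by auto

locale ore = R: k_alg R for R :: "('k::field, 'a, 'm) module_scheme" (structure) +
  fixes \<sigma> \<delta> :: "'a \<Rightarrow> 'a"
  assumes sigma: "\<sigma> \<in> k_algebra_homs R R"
    and delta: "\<delta> \<in> skew_derivations R \<sigma>"
begin

abbreviation "E \<equiv> ore_extension R \<sigma> \<delta>"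
abbreviation "Sh \<equiv> ore_shift R \<sigma> \<delta>"

definition mono :: "'a \<Rightarrow> nat \<Rightarrow> nat \<Rightarrow> 'a" where
  "mono r i n = (if n = i then r else \<zero>)"

text \<open>Left multiplication by a coefficient, acting on coefficient sequences. With
  \<open>Sh\<close>, the left multiplication by the variable, it expresses every product as a sum of
  terms \<open>lact (p i) ((Sh ^^ i) q)\<close>.\<close>

definition lact :: "'a \<Rightarrow> (nat \<Rightarrow> 'a) \<Rightarrow> nat \<Rightarrow> 'a" where
  "lact r q n = r \<otimes> q n"

lemma sigma_simps [simp]:
  "r \<in> carrier R \<Longrightarrow> \<sigma> r \<in> carrier R"
  "r \<in> carrier R \<Longrightarrow> s \<in> carrier R \<Longrightarrow> \<sigma> (r \<oplus> s) = \<sigma> r \<oplus> \<sigma> s"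
  "r \<in> carrier R \<Longrightarrow> s \<in> carrier R \<Longrightarrow> \<sigma> (r \<otimes> s) = \<sigma> r \<otimes> \<sigma> s"
  "r \<in> carrier R \<Longrightarrow> \<sigma> (k \<odot> r) = k \<odot> \<sigma> r" "\<sigma> \<one> = \<one>"
  using k_algebra_homsD[OF sigma] by auto

lemma delta_linear: "\<delta> \<in> k_linear_maps R R"
  using delta by (simp add: skew_derivations_def)

lemma delta_simps:
  "r \<in> carrier R \<Longrightarrow> \<delta> r \<in> carrier R"
  "r \<in> carrier R \<Longrightarrow> s \<in> carrier R \<Longrightarrow> \<delta> (r \<oplus> s) = \<delta> r \<oplus> \<delta> s"
  "r \<in> carrier R \<Longrightarrow> s \<in> carrier R \<Longrightarrow> \<delta> (r \<otimes> s) = (\<sigma> r \<otimes> \<delta> s) \<oplus> (\<delta> r \<otimes> s)"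
  "r \<in> carrier R \<Longrightarrow> \<delta> (k \<odot> r) = k \<odot> \<delta> r"
  using k_linear_mapsD[OF delta_linear] delta by (auto simp: skew_derivations_def)

lemma sigma_zero [simp]: "\<sigma> \<zero> = \<zero>"
  using sigma_simps(4)[of \<zero> 0] by simp

lemma delta_zero: "\<delta> \<zero> = \<zero>"
  using delta_simps(4)[of \<zero> 0] delta_simps(1)[of \<zero>] by simp

lemma delta_one: "\<delta> \<one> = \<zero>"
  using delta_simps(1)[of \<one>] delta_simps(3)[of \<one> \<one>] R.add.l_cancel_one[of "\<delta> \<one>" "\<delta> \<one>"] by simp

lemmas delta_rules = delta_simps delta_zero delta_one

lemma ore_simps:
  "carrier E = up R" "\<one>\<^bsub>E\<^esub> = mono \<one> 0" "\<zero>\<^bsub>E\<^esub> = (\<lambda>_. \<zero>)" "(p \<oplus>\<^bsub>E\<^esub> q) = (\<lambda>n. p n \<oplus> q n)"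
  "k \<odot>\<^bsub>E\<^esub> p = (\<lambda>n. k \<odot> p n)"
  by (auto simp: ore_extension_def mono_def)

lemma up_closed: "p \<in> up R \<Longrightarrow> p n \<in> carrier R"
  by (simp add: up_iff)

lemma up_zero: "(\<lambda>_. \<zero>) \<in> up R"
  by (simp add: up_iff)

lemma up_add:
  assumes "p \<in> up R" "q \<in> up R"
  shows "(\<lambda>n. p n \<oplus> q n) \<in> up R"
proof -
  obtain N M where "\<forall>n>N. p n = \<zero>" "\<forall>n>M. q n = \<zero>" using assms by (auto simp: up_iff)
  then have "\<forall>n>max N M. p n \<oplus> q n = \<zero>" by simp
  moreover have "\<forall>n. p n \<oplus> q n \<in> carrier R" using assms by (simp add: up_iff)
  ultimately show ?thesis unfolding up_iff by blast
qed

lemma up_smult: "p \<in> up R \<Longrightarrow> (\<lambda>n. k \<odot> p n) \<in> up R"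
  unfolding up_iff by (metis R.smult_closed R.smult_zero_right)

lemma up_lact: "r \<in> carrier R \<Longrightarrow> p \<in> up R \<Longrightarrow> lact r p \<in> up R"
  unfolding up_iff lact_def by (metis R.m_closed R.r_null)

lemma mono_up: "r \<in> carrier R \<Longrightarrow> mono r i \<in> up R"
  by (auto simp: up_iff mono_def)

lemma up_shift:
  assumes "p \<in> up R"
  shows "Sh p \<in> up R"
proof -
  obtain N where N: "\<forall>n>N. p n = \<zero>" using assms by (auto simp: up_iff)
  then have "\<forall>n>Suc N. Sh p n = \<zero>" by (auto simp: ore_shift_def delta_rules split: nat.split)
  moreover have "Sh p n \<in> carrier R" for n
    using up_closed[OF assms] by (simp add: ore_shift_def delta_rules split: nat.split)
  ultimately show ?thesis unfolding up_iff by blast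
qed

lemma up_shift_pow: "p \<in> up R \<Longrightarrow> (Sh ^^ i) p \<in> up R"
  by (induction i) (simp_all add: up_shift)

text \<open>Induction on a bound for the degree, peeling off the top coefficient.\<close>

lemma up_induct [consumes 1, case_names mono add]:
  assumes "p \<in> up R" "\<And>r i. r \<in> carrier R \<Longrightarrow> P (mono r i)"
    "\<And>p q. p \<in> up R \<Longrightarrow> q \<in> up R \<Longrightarrow> P p \<Longrightarrow> P q \<Longrightarrow> P (\<lambda>n. p n \<oplus> q n)"
  shows "P p"
proof -
  have *: "P p" if "p \<in> up R" "\<forall>n\<ge>N. p n = \<zero>" for N p
    using that
  proof (induction N arbitrary: p)
    case 0
    then have "p = mono \<zero> 0" by (auto simp: mono_def)
    then show ?case using assms(2) by simp
  next
    case (Suc N)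
    let ?q = "\<lambda>n. if n = N then \<zero> else p n"
    have c: "p n \<in> carrier R" for n using Suc(2) by (rule up_closed)
    have q: "?q \<in> up R" unfolding up_iff using Suc(3) c by (auto intro!: exI[of _ N])
    have "P ?q" using q Suc(1)[OF q] Suc(3) by (auto simp: Suc_le_eq)
    moreover have "p = (\<lambda>n. ?q n \<oplus> mono (p N) N n)"
      using c by (auto simp: mono_def)
    ultimately show ?case
      using assms(3)[OF q mono_up[OF c]] assms(2)[OF c] by metis
  qed
  obtain N where "\<forall>n>N. p n = \<zero>" using assms(1) by (auto simp: up_iff)
  then show ?thesis using *[OF assms(1), of "Suc N"] by simp
qed

lemma shift_add:
  assumes "p \<in> up R" "q \<in> up R"
  shows "Sh (\<lambda>n. p n \<oplus> q n) = (\<lambda>n. Sh p n \<oplus> Sh q n)"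
  using up_closed[OF assms(1)] up_closed[OF assms(2)]
  by (auto simp: ore_shift_def delta_rules fun_eq_iff R.a_ac split: nat.split)

lemma shift_smult:
  assumes "p \<in> up R"
  shows "Sh (\<lambda>n. k \<odot> p n) = (\<lambda>n. k \<odot> Sh p n)"
  using up_closed[OF assms]
  by (auto simp: ore_shift_def delta_rules fun_eq_iff R.smult_add_right split: nat.split)

lemma shift_pow_add: "p \<in> up R \<Longrightarrow> q \<in> up R \<Longrightarrow> (Sh ^^ i) (\<lambda>n. p n \<oplus> q n) = (\<lambda>n. (Sh ^^ i) p n \<oplus> (Sh ^^ i) q n)"
  by (induction i) (simp_all add: shift_add up_shift_pow)

lemma shift_pow_smult: "p \<in> up R \<Longrightarrow> (Sh ^^ i) (\<lambda>n. k \<odot> p n) = (\<lambda>n. k \<odot> (Sh ^^ i) p n)"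
  by (induction i) (simp_all add: shift_smult up_shift_pow)

text \<open>The commutation rule x r = \<sigma>(r) x + \<delta>(r) as an identity of operators; the
  twisted product rule of \<delta> enters the theory of the product here.\<close>

lemma shift_lact:
  assumes "r \<in> carrier R" "q \<in> up R"
  shows "Sh (lact r q) = (\<lambda>n. lact (\<sigma> r) (Sh q) n \<oplus> lact (\<delta> r) q n)"
  using assms(1) up_closed[OF assms(2)]
  by (auto simp: ore_shift_def delta_rules lact_def fun_eq_iff R.a_ac R.r_distr split: nat.split)

lemma shift_mono:
  assumes "r \<in> carrier R"
  shows "Sh (mono r i) = (\<lambda>n. mono (\<sigma> r) (Suc i) n \<oplus> mono (\<delta> r) i n)"
  using assms by (auto simp: ore_shift_def delta_rules mono_def fun_eq_iff split: nat.split)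

lemma shift_pow_one: "(Sh ^^ i) (mono \<one> 0) = mono \<one> i"
proof (induction i)
  case (Suc i)
  then show ?case by (simp add: shift_mono delta_one) (auto simp: mono_def)
qed simp

lemma mult_superset:
  assumes "p \<in> up R" "q \<in> up R" "finite I" "{i. p i \<noteq> \<zero>} \<subseteq> I"
  shows "(p \<otimes>\<^bsub>E\<^esub> q) n = (\<Oplus>i\<in>I. p i \<otimes> (Sh ^^ i) q n)"
  unfolding ore_extension_def
  using assms up_closed[OF assms(1)] up_closed[OF up_shift_pow[OF assms(2)]]
  by (auto intro!: R.add.finprod_mono_neutral_cong_left)

lemma finite_support: "p \<in> up R \<Longrightarrow> finite {i. p i \<noteq> \<zero>}"
proof -
  assume "p \<in> up R"
  then obtain N where "\<forall>n>N. p n = \<zero>" by (auto simp: up_iff)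
  then have "{i. p i \<noteq> \<zero>} \<subseteq> {..N}" using not_less by auto
  then show ?thesis by (rule finite_subset) simp
qed

lemma mult_add_left:
  assumes "p \<in> up R" "p' \<in> up R" "q \<in> up R"
  shows "(\<lambda>n. p n \<oplus> p' n) \<otimes>\<^bsub>E\<^esub> q = (\<lambda>n. (p \<otimes>\<^bsub>E\<^esub> q) n \<oplus> (p' \<otimes>\<^bsub>E\<^esub> q) n)"
proof
  fix n
  let ?I = "{i. p i \<noteq> \<zero>} \<union> {i. p' i \<noteq> \<zero>}"
  have fin: "finite ?I" using finite_support assms by auto
  have c: "(Sh ^^ i) q n \<in> carrier R" "p i \<in> carrier R" "p' i \<in> carrier R" for i
    using up_closed[OF up_shift_pow[OF assms(3)]] up_closed assms by auto
  have "((\<lambda>n. p n \<oplus> p' n) \<otimes>\<^bsub>E\<^esub> q) n = (\<Oplus>i\<in>?I. (p i \<oplus> p' i) \<otimes> (Sh ^^ i) q n)"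
    by (rule mult_superset) (use fin assms in \<open>auto simp: up_add\<close>)
  also have "\<dots> = (\<Oplus>i\<in>?I. p i \<otimes> (Sh ^^ i) q n \<oplus> p' i \<otimes> (Sh ^^ i) q n)"
    by (rule R.finsum_cong') (use c in \<open>auto simp: R.l_distr\<close>)
  also have "\<dots> = (\<Oplus>i\<in>?I. p i \<otimes> (Sh ^^ i) q n) \<oplus> (\<Oplus>i\<in>?I. p' i \<otimes> (Sh ^^ i) q n)"
    by (rule R.finsum_addf) (use c in auto)
  also have "\<dots> = (p \<otimes>\<^bsub>E\<^esub> q) n \<oplus> (p' \<otimes>\<^bsub>E\<^esub> q) n"
    using mult_superset[OF assms(1,3) fin, of n] mult_superset[OF assms(2,3) fin, of n] by simp
  finally show "((\<lambda>n. p n \<oplus> p' n) \<otimes>\<^bsub>E\<^esub> q) n = (p \<otimes>\<^bsub>E\<^esub> q) n \<oplus> (p' \<otimes>\<^bsub>E\<^esub> q) n" .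
qed

lemma mult_mono:
  assumes "r \<in> carrier R" "q \<in> up R"
  shows "mono r i \<otimes>\<^bsub>E\<^esub> q = lact r ((Sh ^^ i) q)"
proof
  fix n
  have "(mono r i \<otimes>\<^bsub>E\<^esub> q) n = (\<Oplus>j\<in>{i}. mono r i j \<otimes> (Sh ^^ j) q n)"
    by (rule mult_superset) (use assms mono_up in \<open>auto simp: mono_def\<close>)
  then show "(mono r i \<otimes>\<^bsub>E\<^esub> q) n = lact r ((Sh ^^ i) q) n"
    using assms up_closed[OF up_shift_pow[OF assms(2)]] by (simp add: mono_def lact_def)
qed

lemma mult_up:
  assumes "p \<in> up R" "q \<in> up R"
  shows "p \<otimes>\<^bsub>E\<^esub> q \<in> up R"
  using assms(1)
  by (induction rule: up_induct) (simp_all add: assms mult_mono up_lact up_shift_pow mult_add_left up_add)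

lemma lact_one: "p \<in> up R \<Longrightarrow> lact \<one> p = p"
  by (auto simp: lact_def up_closed)

lemma lact_add: 
  "r \<in> carrier R \<Longrightarrow> p \<in> up R \<Longrightarrow> q \<in> up R \<Longrightarrow> lact r (\<lambda>n. p n \<oplus> q n) = (\<lambda>n. lact r p n \<oplus> lact r q n)"
  by (auto simp: lact_def fun_eq_iff R.r_distr up_closed)

lemma lact_lact: "r \<in> carrier R \<Longrightarrow> s \<in> carrier R \<Longrightarrow> p \<in> up R \<Longrightarrow> lact r (lact s p) = lact (r \<otimes> s) p"
  by (auto simp: lact_def fun_eq_iff R.m_assoc up_closed)

lemma lact_mono: "r \<in> carrier R \<Longrightarrow> s \<in> carrier R \<Longrightarrow> lact r (mono s i) = mono (r \<otimes> s) i"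
  by (auto simp: lact_def mono_def fun_eq_iff)

lemma lact_mult:
  assumes "r \<in> carrier R" "p \<in> up R" "q \<in> up R"
  shows "lact r p \<otimes>\<^bsub>E\<^esub> q = lact r (p \<otimes>\<^bsub>E\<^esub> q)"
  using assms(2)
  by (induction rule: up_induct)
    (simp_all add: assms lact_mono mult_mono lact_lact up_shift_pow lact_add mult_add_left up_lact mult_up)

lemma up_ac:
  assumes "p \<in> up R" "q \<in> up R" "r \<in> up R" "s \<in> up R"
  shows "(\<lambda>n. p n \<oplus> q n \<oplus> (r n \<oplus> s n)) = (\<lambda>n. p n \<oplus> r n \<oplus> (q n \<oplus> s n))"
  using up_closed assms by (auto simp: R.a_ac)

text \<open>Associativity when the left factor is the variable: on a monomial the left-hand side is
  \<open>shift_mono\<close> and the right-hand side is \<open>shift_lact\<close>. The case of a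
  coefficient is \<open>lact_mult\<close>; the two together give general associativity.\<close>

lemma shift_mult:
  assumes "p \<in> up R" "q \<in> up R"
  shows "Sh p \<otimes>\<^bsub>E\<^esub> q = Sh (p \<otimes>\<^bsub>E\<^esub> q)"
  using assms(1)
proof (induction rule: up_induct)
  case (mono r i)
  then show ?case using assms(2)
    by (simp add: shift_mono mult_add_left mono_up mult_mono shift_lact up_shift_pow delta_simps)
next
  case (add p p')
  then show ?case using assms(2) by (simp add: shift_add mult_add_left up_shift mult_up)
qed

lemma shift_pow_mult:
  "p \<in> up R \<Longrightarrow> q \<in> up R \<Longrightarrow> (Sh ^^ i) p \<otimes>\<^bsub>E\<^esub> q = (Sh ^^ i) (p \<otimes>\<^bsub>E\<^esub> q)"
  by (induction i) (simp_all add: shift_mult up_shift_pow)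

lemma mult_add_right:
  assumes "p \<in> up R" "q \<in> up R" "q' \<in> up R"
  shows "p \<otimes>\<^bsub>E\<^esub> (\<lambda>n. q n \<oplus> q' n) = (\<lambda>n. (p \<otimes>\<^bsub>E\<^esub> q) n \<oplus> (p \<otimes>\<^bsub>E\<^esub> q') n)"
  using assms(1)
proof (induction rule: up_induct)
  case (mono r i)
  then show ?case using assms(2,3) by (simp add: mult_mono shift_pow_add up_add lact_add up_shift_pow)
next
  case (add p p')
  then show ?case using assms(2,3)
    by (simp add: mult_add_left up_add up_ac[of "p \<otimes>\<^bsub>E\<^esub> q" "p' \<otimes>\<^bsub>E\<^esub> q"] mult_up)
qed

lemma mult_assoc:
  assumes "p \<in> up R" "q \<in> up R" "r \<in> up R"
  shows "p \<otimes>\<^bsub>E\<^esub> q \<otimes>\<^bsub>E\<^esub> r = p \<otimes>\<^bsub>E\<^esub> (q \<otimes>\<^bsub>E\<^esub> r)"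
  using assms(1)
  by (induction rule: up_induct)
    (simp_all add: assms mult_mono lact_mult up_shift_pow shift_pow_mult mult_up mult_add_left)

lemma mult_smult:
  assumes "p \<in> up R" "q \<in> up R"
  shows "(\<lambda>n. k \<odot> p n) \<otimes>\<^bsub>E\<^esub> q = (\<lambda>n. k \<odot> (p \<otimes>\<^bsub>E\<^esub> q) n)"
    and "p \<otimes>\<^bsub>E\<^esub> (\<lambda>n. k \<odot> q n) = (\<lambda>n. k \<odot> (p \<otimes>\<^bsub>E\<^esub> q) n)"
  using assms(1)
proof (induction rule: up_induct)
  case (mono r i)
  have "(\<lambda>n. k \<odot> mono r i n) = mono (k \<odot> r) i" by (auto simp: mono_def)
  then show "(\<lambda>n. k \<odot> mono r i n) \<otimes>\<^bsub>E\<^esub> q = (\<lambda>n. k \<odot> (mono r i \<otimes>\<^bsub>E\<^esub> q) n)"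
    using mono assms(2) up_closed[OF up_shift_pow[OF assms(2)]]
    by (simp add: mult_mono) (simp add: lact_def fun_eq_iff R.mult_smult_left)
  show "mono r i \<otimes>\<^bsub>E\<^esub> (\<lambda>n. k \<odot> q n) = (\<lambda>n. k \<odot> (mono r i \<otimes>\<^bsub>E\<^esub> q) n)"
    using mono assms(2) up_closed[OF up_shift_pow[OF assms(2)]]
    by (simp add: mult_mono up_smult shift_pow_smult) (simp add: lact_def fun_eq_iff R.mult_smult_right)
next
  case (add p p')
  have pq: "(p \<otimes>\<^bsub>E\<^esub> q) n \<in> carrier R" "(p' \<otimes>\<^bsub>E\<^esub> q) n \<in> carrier R" "p n \<in> carrier R" "p' n \<in> carrier R" for n
    using up_closed mult_up add assms(2) by auto
  show "(\<lambda>n. k \<odot> (p n \<oplus> p' n)) \<otimes>\<^bsub>E\<^esub> q = (\<lambda>n. k \<odot> ((\<lambda>n. p n \<oplus> p' n) \<otimes>\<^bsub>E\<^esub> q) n)"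
    using add assms(2)
    by (simp add: R.smult_add_right pq mult_add_left up_smult)
  show "(\<lambda>n. p n \<oplus> p' n) \<otimes>\<^bsub>E\<^esub> (\<lambda>n. k \<odot> q n) = (\<lambda>n. k \<odot> ((\<lambda>n. p n \<oplus> p' n) \<otimes>\<^bsub>E\<^esub> q) n)"
    using add assms(2) by (simp add: R.smult_add_right pq mult_add_left up_smult)
qed

lemma mult_one:
  assumes "p \<in> up R"
  shows "mono \<one> 0 \<otimes>\<^bsub>E\<^esub> p = p" "p \<otimes>\<^bsub>E\<^esub> mono \<one> 0 = p"
proof -
  show "mono \<one> 0 \<otimes>\<^bsub>E\<^esub> p = p" using assms by (simp add: mult_mono lact_one)
  show "p \<otimes>\<^bsub>E\<^esub> mono \<one> 0 = p" using assms
    by (induction rule: up_induct) (simp_all add: mult_mono mono_up shift_pow_one lact_mono mult_add_left)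
qed

lemma ore_k_algebra: "k_algebra E"
proof (rule k_algebraI)
  show "Ring.ring E"
  proof (rule ringI)
    show "abelian_group E"
    proof (rule abelian_groupI)
      fix p assume "p \<in> carrier E"
      then have p: "p \<in> up R" by (simp add: ore_simps)
      have "(-1) \<odot> p n \<oplus> p n = \<zero>" for n
        using R.smult_add_left[of "p n" "-1" 1] up_closed[OF p] by simp
      then show "\<exists>q\<in>carrier E. q \<oplus>\<^bsub>E\<^esub> p = \<zero>\<^bsub>E\<^esub>"
        by (intro bexI[of _ "\<lambda>n. (-1) \<odot> p n"]) (simp_all add: ore_simps up_smult p)
    qed (auto simp: ore_simps up_add up_zero up_closed R.a_ac)
    show "Group.monoid E"
      by (rule monoidI) (simp_all add: ore_simps mult_up mono_up mult_assoc mult_one)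
  qed (simp_all add: ore_simps mult_add_left mult_add_right)
qed (simp_all add: ore_simps up_smult up_closed R.smult_add_left R.smult_add_right R.smult_smult mult_smult)

sublocale E: k_alg E
  by unfold_locales (rule ore_k_algebra)

lemma const_eq_mono: "ore_const R r = mono r 0" and var_eq_mono: "ore_var R = mono \<one> 1"
  by (auto simp: ore_const_def ore_var_def mono_def)

lemma const_hom: "ore_const R \<in> k_algebra_homs R E"
proof (rule k_algebra_homsI)
  show "ore_const R \<in> k_linear_maps R E"
    by (rule k_linear_mapsI) (auto simp: const_eq_mono ore_simps mono_up, auto simp: mono_def)
qed (simp_all add: const_eq_mono ore_simps mult_mono mono_up lact_mono)

lemma var_closed: "ore_var R \<in> carrier E" and const_closed: "r \<in> carrier R \<Longrightarrow> ore_const R r \<in> carrier E"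
  by (simp_all add: var_eq_mono const_eq_mono ore_simps mono_up)

lemma var_const:
  assumes "r \<in> carrier R"
  shows "ore_var R \<otimes>\<^bsub>E\<^esub> ore_const R r = ore_const R (\<sigma> r) \<otimes>\<^bsub>E\<^esub> ore_var R \<oplus>\<^bsub>E\<^esub> ore_const R (\<delta> r)"
  using assms
  by (simp add: var_eq_mono const_eq_mono mult_mono mono_up ore_simps lact_mono shift_mono)
    (auto simp: lact_def mono_def fun_eq_iff delta_simps)

lemma const_zero: "ore_const R \<zero> = \<zero>\<^bsub>E\<^esub>"
  by (auto simp: ore_const_def ore_simps)

lemma var_pow: "ore_var R [^]\<^bsub>E\<^esub> (i::nat) = mono \<one> i"
proof (induction i)
  case 0
  then show ?case by (simp add: ore_simps)
next
  case (Suc i)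
  then have "ore_var R [^]\<^bsub>E\<^esub> Suc i = mono \<one> i \<otimes>\<^bsub>E\<^esub> mono \<one> 1" by (simp add: var_eq_mono)
  also have "\<dots> = (Sh ^^ i) (Sh (mono \<one> 0))"
    using shift_pow_one[of 1] by (simp add: mult_mono mono_up up_shift_pow lact_one)
  also have "\<dots> = mono \<one> (Suc i)" using shift_pow_one[of "Suc i"] by (simp add: funpow_swap1)
  finally show ?case .
qed

lemma const_var_pow:
  assumes "r \<in> carrier R"
  shows "ore_const R r \<otimes>\<^bsub>E\<^esub> ore_var R [^]\<^bsub>E\<^esub> (i::nat) = mono r i"
  using assms by (simp add: var_pow const_eq_mono mult_mono mono_up lact_mono)

text \<open>The top coefficient of a product is p_m \<sigma>^m(q_n): injectivity of \<sigma> keeps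
  \<sigma>^m(q_n) nonzero, and the terms produced by \<delta> stay in lower degrees. Conversely the
  coefficient ring embeds as the constants.\<close>

lemma ore_domain_iff:
  assumes inj: "\<And>r. r \<in> carrier R \<Longrightarrow> \<sigma> r = \<zero> \<Longrightarrow> r = \<zero>"
  shows "nc_domain E \<longleftrightarrow> nc_domain R"
proof
  assume dom: "nc_domain E"
  show "nc_domain R" unfolding nc_domain_def
  proof (intro conjI ballI impI)
    show "Ring.ring R" by (rule R.ring_axioms)
    show "\<one> \<noteq> \<zero>"
    proof
      assume "\<one> = \<zero>"
      then have "\<one>\<^bsub>E\<^esub> = \<zero>\<^bsub>E\<^esub>" by (auto simp: ore_simps mono_def)
      then show False using dom by (simp add: nc_domain_def)
    qed
    fix u v assume uv: "u \<in> carrier R" "v \<in> carrier R" "u \<otimes> v = \<zero>"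
    have z: "mono w 0 = \<zero>\<^bsub>E\<^esub> \<longleftrightarrow> w = \<zero>" for w
      by (auto simp: ore_simps mono_def fun_eq_iff)
    have "mono u 0 \<otimes>\<^bsub>E\<^esub> mono v 0 = \<zero>\<^bsub>E\<^esub>" using uv by (simp add: mult_mono mono_up lact_mono z)
    then show "u = \<zero> \<or> v = \<zero>"
      using dom uv mono_up[of u 0] mono_up[of v 0] unfolding nc_domain_def ore_simps(1) by (metis z)
  qed
next
  assume dom: "nc_domain R"
  show "nc_domain E" unfolding nc_domain_def
  proof (intro conjI ballI impI)
    show "Ring.ring E" by (rule E.ring_axioms)
    show "\<one>\<^bsub>E\<^esub> \<noteq> \<zero>\<^bsub>E\<^esub>" using dom by (auto simp: nc_domain_def ore_simps mono_def fun_eq_iff)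
    fix p q assume "p \<in> carrier E" "q \<in> carrier E" and pq: "p \<otimes>\<^bsub>E\<^esub> q = \<zero>\<^bsub>E\<^esub>"
    then have p: "p \<in> up R" and q: "q \<in> up R" by (simp_all add: ore_simps)
    have top: "\<exists>m. p m \<noteq> \<zero> \<and> (\<forall>n>m. p n = \<zero>)" if p: "p \<in> up R" "p \<noteq> \<zero>\<^bsub>E\<^esub>" for p
    proof -
      have "finite {i. p i \<noteq> \<zero>}" "{i. p i \<noteq> \<zero>} \<noteq> {}" using finite_support[OF p(1)] p(2) by (auto simp: ore_simps)
      then show ?thesis using Max_in[of "{i. p i \<noteq> \<zero>}"] Max_ge[of "{i. p i \<noteq> \<zero>}"]
        by (metis (mono_tags, lifting) leD mem_Collect_eq)
    qed
    show "p = \<zero>\<^bsub>E\<^esub> \<or> q = \<zero>\<^bsub>E\<^esub>"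
    proof (rule ccontr)
      assume "\<not> (p = \<zero>\<^bsub>E\<^esub> \<or> q = \<zero>\<^bsub>E\<^esub>)"
      then obtain m n where m: "p m \<noteq> \<zero>" "\<forall>i>m. p i = \<zero>" and n: "q n \<noteq> \<zero>" "\<forall>i>n. q i = \<zero>"
        using top[OF p] top[OF q] by auto
      have qc: "q j \<in> carrier R" and Xc: "(Sh ^^ i) q j \<in> carrier R" and pc: "p j \<in> carrier R" for i j
        using up_closed q p up_shift_pow by auto
      \<comment> \<open>Each shift raises the top degree by exactly one and applies \<sigma> to the
        top coefficient.\<close>
      have lead: "(Sh ^^ i) q (n + i) \<noteq> \<zero> \<and> (\<forall>j>n + i. (Sh ^^ i) q j = \<zero>)" for i
      proof (induction i)
        case (Suc i)
        then have z: "(Sh ^^ i) q j = \<zero>" if "j > n + i" for j using that by blast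
        have "Sh ((Sh ^^ i) q) (Suc (n + i)) = \<sigma> ((Sh ^^ i) q (n + i))"
          using Xc[of i "n + i"] by (simp only: ore_shift_def nat.case z delta_zero) (simp add: z delta_zero)
        moreover have "Sh ((Sh ^^ i) q) j = \<zero>" if "j > n + Suc i" for j
        proof (cases j)
          case (Suc m)
          then show ?thesis using that by (simp only: ore_shift_def nat.case) (simp add: z delta_zero)
        qed (use that in simp)
        ultimately show ?case using Suc inj[OF Xc] by auto
      qed (use n in auto)
      have "(p \<otimes>\<^bsub>E\<^esub> q) (n + m) = (\<Oplus>i\<in>{..m}. p i \<otimes> (Sh ^^ i) q (n + m))"
        by (rule mult_superset[OF p q]) (use m not_less in auto)
      \<comment> \<open>For i < m the sequence \<open>(Sh ^^ i) q\<close> has top degree n + i < n +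
        m and contributes nothing.\<close>
      also have "\<dots> = (\<Oplus>i\<in>{m}. p i \<otimes> (Sh ^^ i) q (n + m))"
        by (rule R.add.finprod_mono_neutral_cong_right) (use lead pc Xc in auto)
      also have "\<dots> = p m \<otimes> (Sh ^^ m) q (n + m)" using pc Xc by simp
      finally have "p m \<otimes> (Sh ^^ m) q (n + m) = \<zero>" using pq by (simp add: ore_simps)
      then show False using dom m(1) lead[of m] pc Xc unfolding nc_domain_def by blast
    qed
  qed
qed

end

lemma oreI: "k_algebra R \<Longrightarrow> \<sigma> \<in> k_algebra_homs R R \<Longrightarrow> \<delta> \<in> skew_derivations R \<sigma> \<Longrightarrow> ore R \<sigma> \<delta>"
  by (simp add: ore_def k_alg_def ore_axioms_def)


lemma is_k_basis_cong:
  assumes "k_algebra A" and eq: "\<And>i. i \<in> I \<Longrightarrow> f i = f' i"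
  shows "is_k_basis A f I = is_k_basis A f' I"
proof -
  interpret k_alg A by unfold_locales fact
  have 1: "f \<in> I \<rightarrow> carrier A \<longleftrightarrow> f' \<in> I \<rightarrow> carrier A" using eq by (simp cong: Pi_cong)
  have 2: "lin_comb A f a = lin_comb A f' a" if "f \<in> I \<rightarrow> carrier A" "keys a \<subseteq> I" for a
    by (rule lin_comb_cong[OF that(2,1) eq])
  show ?thesis
  proof (cases "f \<in> I \<rightarrow> carrier A")
    case True
    show ?thesis unfolding is_k_basis_def using 1 2[OF True] True by (simp cong: conj_cong)
  qed (use 1 in \<open>simp add: is_k_basis_def\<close>)
qed


section \<open>The presentation of $H(G,\chi,\eta,b,c,\beta)$\<close>

text \<open>The relation \<open>y_x\<close> is written inside the algebra, so no derivation appears.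
  The constraints that the existence of a derivation imposes on the data come back as consequences
  of associativity and of the basis, as in \<open>chi_eta_inverse\<close>.\<close>

locale H_presentation = G: Group.group G + A: k_alg A
  for G :: "('g, 'm) monoid_scheme" and A :: "('k::field, 'a, 'n) module_scheme" +
  fixes \<chi> \<eta> :: "'g \<Rightarrow> 'k" and b c :: 'g and \<beta> :: 'k
    and \<iota> :: "'g \<Rightarrow> 'a" and x y :: 'a
  assumes chi_character: "\<chi> \<in> characters G" and eta_character: "\<eta> \<in> characters G"
    and b_central: "b \<in> group_center G" and c_central: "c \<in> group_center G"
    and eta_b: "\<eta> b = inverse (\<chi> c)"
    and iota_closed [simp]: "g \<in> carrier G \<Longrightarrow> \<iota> g \<in> carrier A"
    and x_closed [simp]: "x \<in> carrier A" and y_closed [simp]: "y \<in> carrier A"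
    and iota_one: "\<iota> \<one>\<^bsub>G\<^esub> = \<one>\<^bsub>A\<^esub>"
    and iota_mult: "g \<in> carrier G \<Longrightarrow> h \<in> carrier G \<Longrightarrow> \<iota> (g \<otimes>\<^bsub>G\<^esub> h) = \<iota> g \<otimes>\<^bsub>A\<^esub> \<iota> h"
    and x_iota: "g \<in> carrier G \<Longrightarrow> x \<otimes>\<^bsub>A\<^esub> \<iota> g = \<chi> g \<odot>\<^bsub>A\<^esub> (\<iota> g \<otimes>\<^bsub>A\<^esub> x)"
    and y_iota: "g \<in> carrier G \<Longrightarrow> y \<otimes>\<^bsub>A\<^esub> \<iota> g = \<eta> g \<odot>\<^bsub>A\<^esub> (\<iota> g \<otimes>\<^bsub>A\<^esub> y)"
    and y_x: "y \<otimes>\<^bsub>A\<^esub> x = \<eta> b \<odot>\<^bsub>A\<^esub> (x \<otimes>\<^bsub>A\<^esub> y) \<oplus>\<^bsub>A\<^esub> \<beta> \<odot>\<^bsub>A\<^esub> (\<one>\<^bsub>A\<^esub> \<ominus>\<^bsub>A\<^esub> \<iota> (c \<otimes>\<^bsub>G\<^esub> b))"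
    and monomial_basis: "is_k_basis A
      (\<lambda>(g, i :: nat, j :: nat). \<iota> g \<otimes>\<^bsub>A\<^esub> x [^]\<^bsub>A\<^esub> i \<otimes>\<^bsub>A\<^esub> y [^]\<^bsub>A\<^esub> j) (carrier G \<times> UNIV \<times> UNIV)"

lemma lookup_twist [simp]: "lookup (twist \<chi> p) g = \<chi> g * lookup p g"
  by (simp add: twist_def lookup_mapp "when_def" in_keys_iff)

lemma center_closed: "z \<in> group_center G \<Longrightarrow> z \<in> carrier G"
  by (simp add: group_center_def)

lemma center_commute: "z \<in> group_center G \<Longrightarrow> g \<in> carrier G \<Longrightarrow> z \<otimes>\<^bsub>G\<^esub> g = g \<otimes>\<^bsub>G\<^esub> z"
  by (simp add: group_center_def)

lemma keys_twist: "keys (twist \<chi> p) \<subseteq> keys p"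
  by (simp add: twist_def keys_mapp_subset)

lemma twist_simps [simp]:
  "twist \<chi> (p + q) = twist \<chi> p + twist \<chi> q" "twist \<chi> 0 = 0"
  "twist \<chi> (Poly_Mapping.map ((*) k) p) = Poly_Mapping.map ((*) k) (twist \<chi> p)"
  "twist \<chi> (Poly_Mapping.single g k) = Poly_Mapping.single g (\<chi> g * k)"
  "twist \<chi> (twist \<eta> p) = twist \<eta> (twist \<chi> p)"
  by (rule poly_mapping_eqI; simp add: lookup_add algebra_simps lookup_single "when_def")+

lemma character_simps:
  assumes "Group.group G" "\<chi> \<in> characters G"
  shows "g \<in> carrier G \<Longrightarrow> \<chi> g \<noteq> 0"
    "g \<in> carrier G \<Longrightarrow> h \<in> carrier G \<Longrightarrow> \<chi> (g \<otimes>\<^bsub>G\<^esub> h) = \<chi> g * \<chi> h"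
    "\<chi> \<one>\<^bsub>G\<^esub> = 1" "g \<in> carrier G \<Longrightarrow> \<chi> (inv\<^bsub>G\<^esub> g) = inverse (\<chi> g)"
proof -
  interpret Group.group G by fact
  show 1: "\<chi> g \<noteq> 0" if "g \<in> carrier G" for g
    using assms(2) that by (auto simp: hom_def mult_of_def)
  show 2: "\<chi> (g \<otimes>\<^bsub>G\<^esub> h) = \<chi> g * \<chi> h" if "g \<in> carrier G" "h \<in> carrier G" for g h
    using assms(2) that by (auto simp: hom_def mult_of_def)
  show 3: "\<chi> \<one>\<^bsub>G\<^esub> = 1" using 1[of "\<one>\<^bsub>G\<^esub>"] 2[of "\<one>\<^bsub>G\<^esub>" "\<one>\<^bsub>G\<^esub>"] by simp
  show "\<chi> (inv\<^bsub>G\<^esub> g) = inverse (\<chi> g)" if "g \<in> carrier G"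
    using 2[of g "inv\<^bsub>G\<^esub> g"] 3 1 that by (simp add: inverse_unique)
qed

section \<open>The inner extension K[G][x] and its automorphism\<close>

context Group.group
begin

abbreviation KG :: "('k::field, 'a \<Rightarrow>\<^sub>0 'k) module" where "KG \<equiv> monoid_algebra G"

lemma twist_hom:
  fixes \<chi> :: "'a \<Rightarrow> 'k::field"
  assumes "\<chi> \<in> characters G"
  shows "twist \<chi> \<in> k_algebra_homs KG KG"
proof (rule k_algebra_homsI)
  note ch = character_simps[OF is_group assms]
  show "twist \<chi> \<in> k_linear_maps KG KG"
    by (rule k_linear_mapsI)
      (simp_all add: monoid_algebra_simps subset_trans[OF keys_twist])
  show "twist \<chi> \<one>\<^bsub>KG\<^esub> = \<one>\<^bsub>KG\<^esub>" by (simp add: monoid_algebra_simps ch)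
  fix u v :: "'a \<Rightarrow>\<^sub>0 'k" assume "u \<in> carrier KG" "v \<in> carrier KG"
  then have u: "keys u \<subseteq> carrier G" and v: "keys v \<subseteq> carrier G" by (simp_all add: monoid_algebra_simps)
  from u show "twist \<chi> (u \<otimes>\<^bsub>KG\<^esub> v) = twist \<chi> u \<otimes>\<^bsub>KG\<^esub> twist \<chi> v"
  proof (induction u rule: poly_mapping_span_induct)
    case (single g k)
    from v show ?case
      by (induction v rule: poly_mapping_span_induct)
        (use single in \<open>simp_all add: monoid_algebra_mult_add_right monoid_algebra_mult_single ch mult_ac\<close>)
  qed (simp_all add: monoid_algebra_mult_add_left)
qed

lemma H_base_ore:
  assumes "\<chi> \<in> characters G"
  shows "ore KG (twist \<chi>) (\<lambda>_. 0)"
proof (rule oreI[OF monoid_algebra_k_algebra twist_hom[OF assms]])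
  show "(\<lambda>_. 0) \<in> skew_derivations KG (twist \<chi>)"
    by (auto simp: skew_derivations_def monoid_algebra_simps map_mult_poly_mapping intro!: k_linear_mapsI)
qed

end

locale H_base_data = Group.group G for G :: "('g, 'm) monoid_scheme" (structure) +
  fixes \<chi> :: "'g \<Rightarrow> 'k::field"
  assumes chi: "\<chi> \<in> characters G"
begin

sublocale B: ore "monoid_algebra G" "twist \<chi>" "\<lambda>_. 0"
  rewrites "ore_extension (monoid_algebra G) (twist \<chi>) (\<lambda>_. 0) = H_base G \<chi>"
  by (rule H_base_ore[OF chi]) (simp add: H_base_def)

text \<open>The inner derivation is zero, so powers of the shift carry monomials to monomials.
  Products of monomials thereby become explicit enough to check that the outer twist is
  multiplicative.\<close>

lemma shift_pow_mono:
  assumes "s \<in> carrier (monoid_algebra G)"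
  shows "(ore_shift (monoid_algebra G) (twist \<chi>) (\<lambda>_. 0) ^^ i) (B.mono s j) = B.mono ((twist \<chi> ^^ i) s) (i + j)"
    and "(twist \<chi> ^^ i) s \<in> carrier (monoid_algebra G)"
proof (induction i)
  case (Suc i)
  { case 2 show ?case using Suc by simp }
  { case 1 show ?case using Suc
      by (simp add: B.shift_mono) (auto simp: B.mono_def monoid_algebra_simps fun_eq_iff) }
qed (use assms in auto)

lemma mult_mono_mono:
  assumes "r \<in> carrier (monoid_algebra G)" "s \<in> carrier (monoid_algebra G)"
  shows "B.mono r i \<otimes>\<^bsub>H_base G \<chi>\<^esub> B.mono s j = B.mono (r \<otimes>\<^bsub>monoid_algebra G\<^esub> (twist \<chi> ^^ i) s) (i + j)"
  using assms by (simp add: B.mult_mono B.mono_up shift_pow_mono B.lact_mono)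

text \<open>On monomials two facts suffice: \<eta>(b)^(i+j) = \<eta>(b)^i \<eta>(b)^j, and the
  twists by \<chi> and \<eta> commute because both are diagonal on G.\<close>

lemma H_twist_hom:
  assumes eta: "\<eta> \<in> characters G"
  shows "H_twist \<eta> b \<in> k_algebra_homs (H_base G \<chi>) (H_base G \<chi>)"
proof -
  note ch = k_algebra_homsD[OF twist_hom[OF eta]]
  let ?K = "monoid_algebra G :: ('k, 'g \<Rightarrow>\<^sub>0 'k) module"
  have tc: "H_twist \<eta> b p \<in> up ?K" if p: "p \<in> up ?K" for p
  proof -
    have "H_twist \<eta> b p n = \<eta> b ^ n \<odot>\<^bsub>?K\<^esub> twist \<eta> (p n)" for n
      by (simp add: H_twist_def monoid_algebra_simps)
    moreover obtain N where "\<forall>n>N. p n = \<zero>\<^bsub>?K\<^esub>" using p by (auto simp: up_iff)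
    moreover have "twist \<eta> \<zero>\<^bsub>?K\<^esub> = \<zero>\<^bsub>?K\<^esub>" by (simp add: monoid_algebra_simps)
    ultimately have "\<forall>n>N. H_twist \<eta> b p n = \<zero>\<^bsub>?K\<^esub>" "\<forall>n. H_twist \<eta> b p n \<in> carrier ?K"
      using B.up_closed[OF p] ch(2) by simp_all
    then show ?thesis unfolding up_iff by blast
  qed
  have tw_add: "H_twist \<eta> b (\<lambda>n. p n \<oplus>\<^bsub>?K\<^esub> q n) = (\<lambda>n. H_twist \<eta> b p n \<oplus>\<^bsub>?K\<^esub> H_twist \<eta> b q n)" for p q
    by (simp add: H_twist_def monoid_algebra_simps map_mult_poly_mapping fun_eq_iff)
  have tw_mono: "H_twist \<eta> b (B.mono r i) = B.mono (\<eta> b ^ i \<odot>\<^bsub>?K\<^esub> twist \<eta> r) i" for r i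
    by (auto simp: H_twist_def B.mono_def monoid_algebra_simps map_mult_poly_mapping)
  have pow: "(twist \<chi> ^^ i) (k \<odot>\<^bsub>?K\<^esub> twist \<eta> s) = k \<odot>\<^bsub>?K\<^esub> twist \<eta> ((twist \<chi> ^^ i) s)" for i k s
    by (induction i) (simp_all add: monoid_algebra_simps)
  show ?thesis
  proof (rule k_algebra_homsI)
    show "H_twist \<eta> b \<in> k_linear_maps (H_base G \<chi>) (H_base G \<chi>)"
      by (rule k_linear_mapsI)
        (simp_all add: B.ore_simps tc tw_add,
          simp add: H_twist_def monoid_algebra_simps fun_eq_iff mult.commute flip: map_mult_poly_mapping(3))
    show "H_twist \<eta> b \<one>\<^bsub>H_base G \<chi>\<^esub> = \<one>\<^bsub>H_base G \<chi>\<^esub>"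
      using ch(6) by (simp add: B.ore_simps tw_mono)
    fix p q assume "p \<in> carrier (H_base G \<chi>)" "q \<in> carrier (H_base G \<chi>)"
    then have p: "p \<in> up ?K" and q: "q \<in> up ?K" by (simp_all add: B.ore_simps)
    from p show "H_twist \<eta> b (p \<otimes>\<^bsub>H_base G \<chi>\<^esub> q) = H_twist \<eta> b p \<otimes>\<^bsub>H_base G \<chi>\<^esub> H_twist \<eta> b q"
    proof (induction rule: B.up_induct)
      case (mono r i)
      from q show ?case
      proof (induction rule: B.up_induct)
        case (mono s j)
        note c = \<open>r \<in> carrier ?K\<close> \<open>s \<in> carrier ?K\<close>
        show ?case
          using c by (simp add: mult_mono_mono tw_mono ch shift_pow_mono pow B.R.mult_smult_left
              B.R.mult_smult_right B.R.smult_smult power_add mult.commute)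
      next
        case (add q q')
        then show ?case using \<open>r \<in> carrier ?K\<close> tc
          by (simp add: B.mult_add_right B.mono_up tw_add tw_mono ch)
      qed
    next
      case (add p p')
      then show ?case using tc q by (simp add: B.mult_add_left tw_add)
    qed
  qed
qed

end

section \<open>The iterated extension satisfies the presentation\<close>

context H_datum
begin

sublocale base: H_base_data G \<chi>
  by unfold_locales (rule chi_character)

abbreviation "del \<equiv> SOME \<delta>. \<delta> \<in> H_derivations G \<chi> \<eta> b c \<beta>"

lemma del: "del \<in> H_derivations G \<chi> \<eta> b c \<beta>"
  using derivation_exists by (simp add: some_in_eq)

sublocale H: ore "H_base G \<chi>" "H_twist \<eta> b" "SOME \<delta>. \<delta> \<in> H_derivations G \<chi> \<eta> b c \<beta>"
  rewrites "ore_extension (H_base G \<chi>) (H_twist \<eta> b) (SOME \<delta>. \<delta> \<in> H_derivations G \<chi> \<eta> b c \<beta>) =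
    H_algebra G \<chi> \<eta> b c \<beta>"
proof -
  show "ore (H_base G \<chi>) (H_twist \<eta> b) del"
    by (rule oreI[OF base.B.ore_k_algebra base.H_twist_hom[OF eta_character]])
      (use del in \<open>simp add: H_derivations_def\<close>)
qed (simp add: H_algebra_def)

abbreviation "HA \<equiv> H_algebra G \<chi> \<eta> b c \<beta>"

lemma group_elt_hom: "(\<lambda>u. ore_const (H_base G \<chi>) (ore_const KG u)) \<in> k_algebra_homs KG HA"
  by (rule k_algebra_homs_comp[OF base.B.const_hom H.const_hom])

lemma monomial_eq:
  assumes "g \<in> carrier G"
  shows "H_group_elt G \<chi> g \<otimes>\<^bsub>HA\<^esub> H_x G \<chi> [^]\<^bsub>HA\<^esub> (i::nat) \<otimes>\<^bsub>HA\<^esub> H_y G \<chi> [^]\<^bsub>HA\<^esub> (j::nat) =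
    H.mono (base.B.mono (Poly_Mapping.single g 1) i) j"
proof -
  have sg: "Poly_Mapping.single g 1 \<in> carrier (monoid_algebra G :: ('k, 'a \<Rightarrow>\<^sub>0 'k) module)"
    using assms by (simp add: monoid_algebra_simps)
  note hom = k_algebra_homsD[OF H.const_hom]
  have "H_x G \<chi> [^]\<^bsub>HA\<^esub> i = ore_const (H_base G \<chi>) (ore_var KG [^]\<^bsub>H_base G \<chi>\<^esub> i)"
    by (induction i) (simp_all add: hom H_x_def base.B.var_closed)
  then have "H_group_elt G \<chi> g \<otimes>\<^bsub>HA\<^esub> H_x G \<chi> [^]\<^bsub>HA\<^esub> i = ore_const (H_base G \<chi>) (base.B.mono (Poly_Mapping.single g 1) i)"
    using sg by (simp add: H_group_elt_def base.B.const_closed base.B.var_closed base.B.const_var_pow flip: hom(5))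
  moreover have "base.B.mono (Poly_Mapping.single g 1) i \<in> carrier (H_base G \<chi>)"
    using base.B.mono_up[OF sg] by (simp add: base.B.ore_simps)
  ultimately show ?thesis by (simp add: H_y_def H.const_var_pow)
qed

lemma monomial_apply:
  "H.mono (base.B.mono (Poly_Mapping.single g k) i) j n m = (if n = j \<and> m = i then Poly_Mapping.single g k else 0)"
  by (simp add: H.mono_def base.B.mono_def base.B.ore_simps monoid_algebra_simps)

lemma HA_simps:
  "h \<oplus>\<^bsub>HA\<^esub> h' = (\<lambda>n m. h n m + h' n m)" "\<zero>\<^bsub>HA\<^esub> = (\<lambda>n m. 0)"
  "k \<odot>\<^bsub>HA\<^esub> h = (\<lambda>n m. Poly_Mapping.map ((*) k) (h n m))"
  by (simp_all add: H.ore_simps base.B.ore_simps monoid_algebra_simps)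

text \<open>Elements are their own coefficient functions: the coordinate of \<open>h\<close> at
  \<open>(g, i, j)\<close> is \<open>lookup (h j i) g\<close>. The outer index is the exponent of
  y.\<close>

lemma monomials_basis: "is_k_basis HA
    (\<lambda>(g, i, j). H.mono (base.B.mono (Poly_Mapping.single g 1) i) j) (carrier G \<times> UNIV \<times> UNIV)"
proof -
  let ?I = "carrier G \<times> (UNIV :: nat set) \<times> (UNIV :: nat set)"
  let ?e = "\<lambda>(g, i, j). H.mono (base.B.mono (Poly_Mapping.single g (1 :: 'k)) i) j"
  have e: "?e \<in> ?I \<rightarrow> carrier HA"
    using base.B.mono_up H.mono_up by (auto simp: H.ore_simps base.B.ore_simps monoid_algebra_simps)
  have coeff: "lookup (lin_comb HA ?e a j i) g = lookup a (g, i, j)" if "keys a \<subseteq> ?I" for a :: "'a \<times> nat \<times> nat \<Rightarrow>\<^sub>0 'k" and g i j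
    using that
  proof (induction a rule: poly_mapping_span_induct)
    case zero
    then show ?case by (simp add: HA_simps)
  next
    case (single t k)
    then have eq: "lin_comb HA ?e (Poly_Mapping.single t k) = k \<odot>\<^bsub>HA\<^esub> ?e t"
      using funcset_mem[OF e, of t] by (intro H.E.lin_comb_single) auto
    show ?case unfolding eq by (cases t) (auto simp: HA_simps monomial_apply lookup_single "when_def")
  next
    case (add p q)
    then show ?case by (simp add: H.E.lin_comb_add[OF e] HA_simps lookup_add)
  qed
  show ?thesis unfolding is_k_basis_def
  proof (intro conjI allI impI ballI)
    fix a :: "'a \<times> nat \<times> nat \<Rightarrow>\<^sub>0 'k" assume a: "keys a \<subseteq> ?I \<and> lin_comb HA ?e a = \<zero>\<^bsub>HA\<^esub>"
    show "a = 0"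
    proof (rule poly_mapping_eqI)
      fix t show "lookup a t = lookup 0 t"
        using coeff[of a] a by (cases t) (metis HA_simps(2) lookup_zero)
    qed
  next
    fix h assume "h \<in> carrier HA"
    then have h: "h \<in> up (H_base G \<chi>)" by (simp add: H.ore_simps)
    then have hj: "h j \<in> up (monoid_algebra G)" for j
      using H.up_closed[OF h] by (simp add: base.B.ore_simps)
    have hji: "keys (h j i) \<subseteq> carrier G" for i j
      using base.B.up_closed[OF hj] by (simp add: monoid_algebra_simps)
    define f where "f = (\<lambda>(g, i, j). lookup (h j i) g)"
    \<comment> \<open>Finiteness in three layers: powers of y, powers of x for each of them, group
      elements for each pair.\<close>
    have "{t. f t \<noteq> 0} \<subseteq> (\<Union>j\<in>{j. h j \<noteq> \<zero>\<^bsub>H_base G \<chi>\<^esub>}. \<Union>i\<in>{i. h j i \<noteq> \<zero>\<^bsub>monoid_algebra G\<^esub>}. keys (h j i) \<times> {i} \<times> {j})"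
      by (auto simp: f_def in_keys_iff base.B.ore_simps monoid_algebra_simps)
    moreover have "finite \<dots>"
      by (intro finite_UN_I H.finite_support[OF h] base.B.finite_support[OF hj]) simp
    ultimately have fin: "finite {t. f t \<noteq> 0}" by (rule finite_subset)
    define a where "a = Abs_poly_mapping f"
    have la: "lookup a = f" unfolding a_def using fin by (simp add: lookup_Abs_poly_mapping)
    have "g \<in> carrier G" if "lookup (h j i) g \<noteq> 0" for g i j
      using subsetD[OF hji, of g j i] that by (simp add: in_keys_iff)
    then have ka: "keys a \<subseteq> ?I" by (auto simp: in_keys_iff la f_def)
    have "h = lin_comb HA ?e a"
      by (intro ext poly_mapping_eqI) (simp add: coeff[OF ka] la f_def)
    with ka show "\<exists>a :: 'a \<times> nat \<times> nat \<Rightarrow>\<^sub>0 'k. keys a \<subseteq> ?I \<and> h = lin_comb HA ?e a" by blast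
  qed (rule e)
qed

text \<open>The commutation relations are instances of \<open>var_const\<close> in one of the two
  layers. The chosen derivation has to be evaluated only at the elements of G and at x, where its
  values are prescribed.\<close>

lemma H_presentation:
  "H_presentation G HA \<chi> \<eta> b c \<beta> (H_group_elt G \<chi>) (H_x G \<chi>) (H_y G \<chi>)"
proof unfold_locales
  let ?K = "monoid_algebra G :: ('k, 'a \<Rightarrow>\<^sub>0 'k) module"
  let ?\<iota> = "H_group_elt G \<chi>" and ?x = "H_x G \<chi>" and ?y = "H_y G \<chi>"
  note hom = k_algebra_homsD[OF group_elt_hom]
  note chom = k_algebra_homsD[OF H.const_hom] and bhom = k_algebra_homsD[OF base.B.const_hom]
  have sg: "Poly_Mapping.single g k \<in> carrier ?K" if "g \<in> carrier G" for g k
    using that by (simp add: monoid_algebra_simps)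
  have \<iota>: "?\<iota> g = ore_const (H_base G \<chi>) (ore_const KG (Poly_Mapping.single g 1))" for g
    by (simp add: H_group_elt_def)
  have scaled: "Poly_Mapping.single g k = k \<odot>\<^bsub>?K\<^esub> Poly_Mapping.single g 1" for g k
    by (simp add: monoid_algebra_simps map_mult_poly_mapping)
  show ic: "?\<iota> g \<in> carrier HA" if "g \<in> carrier G" for g using hom(2)[OF sg[OF that]] by (simp add: \<iota>)
  show xc: "?x \<in> carrier HA" and yc: "?y \<in> carrier HA"
    by (simp_all add: H_x_def H_y_def chom(2) base.B.var_closed H.var_closed)
  show "?\<iota> \<one> = \<one>\<^bsub>HA\<^esub>" using hom(6) by (simp add: \<iota> monoid_algebra_simps)
  show "?\<iota> (g \<otimes> h) = ?\<iota> g \<otimes>\<^bsub>HA\<^esub> ?\<iota> h" if "g \<in> carrier G" "h \<in> carrier G" for g h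
    using hom(5)[OF sg[OF that(1)] sg[OF that(2)], of 1 1] by (simp add: \<iota> monoid_algebra_mult_single)
  show "?x \<otimes>\<^bsub>HA\<^esub> ?\<iota> g = \<chi> g \<odot>\<^bsub>HA\<^esub> (?\<iota> g \<otimes>\<^bsub>HA\<^esub> ?x)" if g: "g \<in> carrier G" for g
  proof -
    have "ore_var KG \<otimes>\<^bsub>H_base G \<chi>\<^esub> ore_const KG (Poly_Mapping.single g 1) =
        ore_const KG (\<chi> g \<odot>\<^bsub>?K\<^esub> Poly_Mapping.single g 1) \<otimes>\<^bsub>H_base G \<chi>\<^esub> ore_var KG"
      using base.B.var_const[OF sg[OF g], of 1] base.B.const_closed[OF sg[OF g], of "\<chi> g"] base.B.var_closed
        base.B.const_zero
      by (simp add: scaled[symmetric]) (simp add: monoid_algebra_simps)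
    then show ?thesis
      using g by (simp add: H_x_def \<iota> bhom chom sg base.B.var_closed base.B.E.mult_smult_left flip: chom(5))
  qed
  show "?y \<otimes>\<^bsub>HA\<^esub> ?\<iota> g = \<eta> g \<odot>\<^bsub>HA\<^esub> (?\<iota> g \<otimes>\<^bsub>HA\<^esub> ?y)" if g: "g \<in> carrier G" for g
  proof -
    have "H_twist \<eta> b (ore_const KG (Poly_Mapping.single g 1)) = \<eta> g \<odot>\<^bsub>H_base G \<chi>\<^esub> ore_const KG (Poly_Mapping.single g 1)"
      by (auto simp: H_twist_def ore_const_def fun_eq_iff base.B.ore_simps monoid_algebra_simps map_mult_poly_mapping)
    note tw = this
    have dl: "del (ore_const KG (Poly_Mapping.single g 1)) = \<zero>\<^bsub>H_base G \<chi>\<^esub>"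
      using del g by (simp add: H_derivations_def)
    have "?y \<otimes>\<^bsub>HA\<^esub> ?\<iota> g = ore_const (H_base G \<chi>) (\<eta> g \<odot>\<^bsub>H_base G \<chi>\<^esub> ore_const KG (Poly_Mapping.single g 1)) \<otimes>\<^bsub>HA\<^esub> ?y \<oplus>\<^bsub>HA\<^esub> \<zero>\<^bsub>HA\<^esub>"
      using H.var_const[OF base.B.const_closed[OF sg[OF g, of 1]]] unfolding H_y_def \<iota> tw dl H.const_zero .
    also have "ore_const (H_base G \<chi>) (\<eta> g \<odot>\<^bsub>H_base G \<chi>\<^esub> ore_const KG (Poly_Mapping.single g 1)) = \<eta> g \<odot>\<^bsub>HA\<^esub> ?\<iota> g"
      unfolding \<iota> by (rule chom(4)[OF base.B.const_closed[OF sg[OF g]]])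
    finally show ?thesis
      using ic[OF g] yc by (simp only: H.E.mult_smult_left H.E.r_zero H.E.smult_closed H.E.m_closed)
  qed
  show "?y \<otimes>\<^bsub>HA\<^esub> ?x = \<eta> b \<odot>\<^bsub>HA\<^esub> (?x \<otimes>\<^bsub>HA\<^esub> ?y) \<oplus>\<^bsub>HA\<^esub> \<beta> \<odot>\<^bsub>HA\<^esub> (\<one>\<^bsub>HA\<^esub> \<ominus>\<^bsub>HA\<^esub> ?\<iota> (c \<otimes> b))"
  proof -
    have bc: "c \<otimes> b \<in> carrier G" using center_closed[OF b_central] center_closed[OF c_central] by simp
    interpret f: k_linear ?K HA "\<lambda>u. ore_const (H_base G \<chi>) (ore_const KG u)"
      by (rule k_linearI[OF monoid_algebra_k_algebra H.ore_k_algebra hom(1)])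
    have tw: "H_twist \<eta> b (ore_var KG) = \<eta> b \<odot>\<^bsub>H_base G \<chi>\<^esub> ore_var KG"
      using character_simps(3)[OF is_group eta_character]
      by (auto simp: H_twist_def ore_var_def fun_eq_iff base.B.ore_simps monoid_algebra_simps map_mult_poly_mapping)
    have dl: "del (ore_var KG) = ore_const KG (beta_elt G b c \<beta>)"
      using del by (simp add: H_derivations_def)
    have one: "ore_const (H_base G \<chi>) (ore_const KG (Poly_Mapping.single \<one> 1)) = \<one>\<^bsub>HA\<^esub>"
      using hom(6) by (simp add: monoid_algebra_simps)
    have be: "ore_const (H_base G \<chi>) (ore_const KG (beta_elt G b c \<beta>)) = \<beta> \<odot>\<^bsub>HA\<^esub> (\<one>\<^bsub>HA\<^esub> \<ominus>\<^bsub>HA\<^esub> ?\<iota> (c \<otimes> b))"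
      unfolding beta_elt_def a_minus_def \<iota>
      by (simp only: f.map_smult f.map_add f.map_minus sg bc one_closed one base.B.R.a_closed base.B.R.a_inv_closed)
    have "?y \<otimes>\<^bsub>HA\<^esub> ?x = ore_const (H_base G \<chi>) (\<eta> b \<odot>\<^bsub>H_base G \<chi>\<^esub> ore_var KG) \<otimes>\<^bsub>HA\<^esub> ?y \<oplus>\<^bsub>HA\<^esub>
        ore_const (H_base G \<chi>) (ore_const KG (beta_elt G b c \<beta>))"
      using H.var_const[OF base.B.var_closed] unfolding H_y_def H_x_def tw dl .
    also have "ore_const (H_base G \<chi>) (\<eta> b \<odot>\<^bsub>H_base G \<chi>\<^esub> ore_var KG) = \<eta> b \<odot>\<^bsub>HA\<^esub> ?x"
      unfolding H_x_def by (rule chom(4)[OF base.B.var_closed])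
    finally show ?thesis unfolding be H.E.mult_smult_left[OF xc yc] .
  qed
  have "is_k_basis HA (\<lambda>(g, i :: nat, j :: nat). ?\<iota> g \<otimes>\<^bsub>HA\<^esub> ?x [^]\<^bsub>HA\<^esub> i \<otimes>\<^bsub>HA\<^esub> ?y [^]\<^bsub>HA\<^esub> j) (carrier G \<times> UNIV \<times> UNIV)
     = is_k_basis HA (\<lambda>(g, i, j). H.mono (base.B.mono (Poly_Mapping.single g 1) i) j) (carrier G \<times> UNIV \<times> UNIV)"
    by (rule is_k_basis_cong[OF H.ore_k_algebra]) (auto simp: monomial_eq)
  then show "is_k_basis HA (\<lambda>(g, i :: nat, j :: nat). ?\<iota> g \<otimes>\<^bsub>HA\<^esub> ?x [^]\<^bsub>HA\<^esub> i \<otimes>\<^bsub>HA\<^esub> ?y [^]\<^bsub>HA\<^esub> j) (carrier G \<times> UNIV \<times> UNIV)"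
    using monomials_basis by simp
qed (fact chi_character eta_character b_central c_central eta_b)+

text \<open>Characters do not vanish on G and \<eta>(b) is nonzero, so both twists are injective and
  \<open>ore_domain_iff\<close> applies to each layer.\<close>

lemma H_domain_iff: "nc_domain HA \<longleftrightarrow> nc_domain (KG :: ('k, 'a \<Rightarrow>\<^sub>0 'k) module)"
proof -
  have "p = 0" if "p \<in> carrier (monoid_algebra G)" "twist \<xi> p = 0" "\<xi> \<in> characters G" for p :: "'a \<Rightarrow>\<^sub>0 'k" and \<xi>
  proof (rule poly_mapping_eqI)
    fix g show "lookup p g = lookup 0 g"
    proof (cases "g \<in> keys p")
      case True
      then have "\<xi> g \<noteq> 0" using that character_simps(1)[OF is_group that(3)] by (auto simp: monoid_algebra_simps)
      moreover have "\<xi> g * lookup p g = 0" using that(2) lookup_twist[of \<xi> p g] by simp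
      ultimately show ?thesis by simp
    qed (simp add: in_keys_iff)
  qed
  note tw = this
  have 1: "nc_domain (H_base G \<chi>) \<longleftrightarrow> nc_domain (KG :: ('k, 'a \<Rightarrow>\<^sub>0 'k) module)"
    by (rule base.B.ore_domain_iff) (use tw[OF _ _ chi_character] in \<open>simp add: monoid_algebra_simps\<close>)
  have "p = \<zero>\<^bsub>H_base G \<chi>\<^esub>" if p: "p \<in> carrier (H_base G \<chi>)" "H_twist \<eta> b p = \<zero>\<^bsub>H_base G \<chi>\<^esub>" for p
  proof
    fix n
    have pn: "p n \<in> carrier (monoid_algebra G)" using p(1) base.B.up_closed by (simp add: base.B.ore_simps)
    have z: "Poly_Mapping.map ((*) (\<eta> b ^ n)) (twist \<eta> (p n)) = 0"
      using fun_cong[OF p(2), of n] by (simp add: H_twist_def base.B.ore_simps monoid_algebra_simps)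
    have "\<eta> b \<noteq> 0" using character_simps(1)[OF is_group eta_character center_closed[OF b_central]] .
    then have "twist \<eta> (p n) = 0"
      by (intro poly_mapping_eqI) (use lookup_map_mult[of "\<eta> b ^ n" "twist \<eta> (p n)"] z in simp)
    then show "p n = \<zero>\<^bsub>H_base G \<chi>\<^esub> n" using tw[OF pn _ eta_character] by (simp add: base.B.ore_simps monoid_algebra_simps)
  qed
  then have "nc_domain HA \<longleftrightarrow> nc_domain (H_base G \<chi>)" by (rule H.ore_domain_iff)
  with 1 show ?thesis by simp
qed

end

section \<open>Auxiliary algebras: extended records, opposite algebra, ground field\<close>

lemma (in k_alg) mult_linear:
  assumes "u \<in> carrier A"
  shows "(\<lambda>v. u \<otimes> v) \<in> k_linear_maps A A" "(\<lambda>v. v \<otimes> u) \<in> k_linear_maps A A"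
  using assms by (auto intro!: k_linear_mapsI simp: r_distr l_distr mult_smult_right mult_smult_left)

lemma (in k_alg) pow_commute: "u \<in> carrier A \<Longrightarrow> u \<otimes> u [^] (n::nat) = u [^] n \<otimes> u"
  using nat_pow_Suc2[of u n] by simp

text \<open>Adding coalgebra fields changes the type of a record but none of the operations that the
  axioms mention.\<close>

lemma k_algebra_same_ops:
  assumes A: "k_algebra A"
    and eq: "carrier B = carrier A" "monoid.mult B = monoid.mult A" "one B = one A" "ring.zero B = ring.zero A"
      "add B = add A" "module.smult B = module.smult A"
  shows "k_algebra B"
proof -
  interpret k_alg A by unfold_locales fact
  show ?thesis
  proof (rule k_algebraI)
    show "Ring.ring B"
    proof (rule ringI)
      show "abelian_group B" by (rule abelian_groupI) (use a_assoc a_comm add.l_inv_ex in \<open>auto simp: eq\<close>)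
      show "Group.monoid B" by (rule monoidI) (auto simp: eq m_assoc)
    qed (auto simp: eq l_distr r_distr)
  qed (simp_all add: eq smult_add_left smult_add_right smult_smult mult_smult_left mult_smult_right)
qed

text \<open>Serves two purposes: an anti-homomorphism is an algebra map into the opposite, so
  \<open>hom_extension\<close> also yields the antipode; and right ideals become left
  ideals.\<close>

definition opposite :: "('k, 'a, 'm) module_scheme \<Rightarrow> ('k, 'a, 'm) module_scheme" where
  "opposite A = A\<lparr>monoid.mult := \<lambda>u v. v \<otimes>\<^bsub>A\<^esub> u\<rparr>"

lemma opposite_simps [simp]:
  "carrier (opposite A) = carrier A" "u \<otimes>\<^bsub>opposite A\<^esub> v = v \<otimes>\<^bsub>A\<^esub> u" "\<one>\<^bsub>opposite A\<^esub> = \<one>\<^bsub>A\<^esub>"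
  "\<zero>\<^bsub>opposite A\<^esub> = \<zero>\<^bsub>A\<^esub>" "add (opposite A) = add A" "module.smult (opposite A) = module.smult A"
  by (simp_all add: opposite_def)

lemma (in k_alg) opposite_k_algebra: "k_algebra (opposite A)"
proof (rule k_algebraI)
  show "Ring.ring (opposite A)"
  proof (rule ringI)
    show "abelian_group (opposite A)" by (rule abelian_groupI) (use a_assoc a_comm add.l_inv_ex in auto)
    show "Group.monoid (opposite A)" by (rule monoidI) (auto simp: m_assoc)
  qed (auto simp: l_distr r_distr)
qed (simp_all add: smult_add_left smult_add_right smult_smult mult_smult_left mult_smult_right)

text \<open>The ground field as a record with scalar multiplication, so that the counit is an
  algebra map in the same sense as all others.\<close>

definition scalar_algebra :: "('k::field, 'k) module" where
  "scalar_algebra = ring.extend scalar_ring (module.fields (*))"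

lemma scalar_algebra_simps [simp]:
  "carrier scalar_algebra = UNIV" "monoid.mult scalar_algebra = (*)" "one scalar_algebra = 1"
  "ring.zero scalar_algebra = 0" "add scalar_algebra = (+)" "module.smult scalar_algebra = (*)"
  by (simp_all add: scalar_algebra_def ring.defs module.defs)

lemma scalar_algebra_k_algebra: "k_algebra scalar_algebra"
proof (rule k_algebraI)
  show "Ring.ring scalar_algebra"
  proof (rule ringI)
    show "abelian_group scalar_algebra"
      by (rule abelian_groupI) (auto intro: exI[of _ "- _"] simp: add_eq_0_iff)
    show "Group.monoid scalar_algebra" by (rule monoidI) auto
  qed (auto simp: algebra_simps)
qed (auto simp: algebra_simps)

section \<open>Left multiplication on monomials and the universal property\<close>

context H_presentation
begin

lemma b_closed [simp]: "b \<in> carrier G" and c_closed [simp]: "c \<in> carrier G"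
  by (rule center_closed[OF b_central], rule center_closed[OF c_central])

lemma b_commute: "g \<in> carrier G \<Longrightarrow> b \<otimes>\<^bsub>G\<^esub> g = g \<otimes>\<^bsub>G\<^esub> b"
  and c_commute: "g \<in> carrier G \<Longrightarrow> c \<otimes>\<^bsub>G\<^esub> g = g \<otimes>\<^bsub>G\<^esub> c"
  by (erule center_commute[OF b_central], erule center_commute[OF c_central])

lemmas chi_simps = character_simps[OF G.is_group chi_character]
lemmas eta_simps = character_simps[OF G.is_group eta_character]

lemma eta_b_chi_c: "\<eta> b * \<chi> c = 1"
  using eta_b chi_simps(1)[of c] by simp

definition mon :: "'g \<times> nat \<times> nat \<Rightarrow> 'a" where
  "mon = (\<lambda>(g, i, j). \<iota> g \<otimes>\<^bsub>A\<^esub> x [^]\<^bsub>A\<^esub> i \<otimes>\<^bsub>A\<^esub> y [^]\<^bsub>A\<^esub> j)"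

abbreviation "Ind \<equiv> carrier G \<times> (UNIV :: nat set) \<times> (UNIV :: nat set)"

sublocale M: k_basis A mon Ind
  by unfold_locales (use monomial_basis in \<open>simp add: mon_def\<close>)

lemma mon_eq: "g \<in> carrier G \<Longrightarrow> mon (g, i, j) = \<iota> g \<otimes>\<^bsub>A\<^esub> (x [^]\<^bsub>A\<^esub> i \<otimes>\<^bsub>A\<^esub> y [^]\<^bsub>A\<^esub> j)"
  by (simp add: mon_def A.m_assoc)

lemma mon_generators:
  "g \<in> carrier G \<Longrightarrow> mon (g, 0, 0) = \<iota> g" "mon (\<one>\<^bsub>G\<^esub>, 1, 0) = x" "mon (\<one>\<^bsub>G\<^esub>, 0, 1) = y"
  by (simp_all add: mon_def iota_one)

lemma pow_iota:
  assumes "g \<in> carrier G"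
  shows "x [^]\<^bsub>A\<^esub> (i::nat) \<otimes>\<^bsub>A\<^esub> \<iota> g = \<chi> g ^ i \<odot>\<^bsub>A\<^esub> (\<iota> g \<otimes>\<^bsub>A\<^esub> x [^]\<^bsub>A\<^esub> i)"
    and "y [^]\<^bsub>A\<^esub> (i::nat) \<otimes>\<^bsub>A\<^esub> \<iota> g = \<eta> g ^ i \<odot>\<^bsub>A\<^esub> (\<iota> g \<otimes>\<^bsub>A\<^esub> y [^]\<^bsub>A\<^esub> i)"
proof -
  show "x [^]\<^bsub>A\<^esub> i \<otimes>\<^bsub>A\<^esub> \<iota> g = \<chi> g ^ i \<odot>\<^bsub>A\<^esub> (\<iota> g \<otimes>\<^bsub>A\<^esub> x [^]\<^bsub>A\<^esub> i)"
  proof (induction i)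
    case (Suc i)
    have "x [^]\<^bsub>A\<^esub> Suc i \<otimes>\<^bsub>A\<^esub> \<iota> g = x [^]\<^bsub>A\<^esub> i \<otimes>\<^bsub>A\<^esub> (x \<otimes>\<^bsub>A\<^esub> \<iota> g)" using assms by (simp add: A.m_assoc)
    also have "\<dots> = \<chi> g \<odot>\<^bsub>A\<^esub> ((x [^]\<^bsub>A\<^esub> i \<otimes>\<^bsub>A\<^esub> \<iota> g) \<otimes>\<^bsub>A\<^esub> x)"
      using assms by (simp add: x_iota A.mult_smult_right A.m_assoc)
    also have "\<dots> = \<chi> g ^ Suc i \<odot>\<^bsub>A\<^esub> (\<iota> g \<otimes>\<^bsub>A\<^esub> x [^]\<^bsub>A\<^esub> Suc i)"
      using assms by (simp add: Suc A.mult_smult_left A.m_assoc A.smult_smult)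
    finally show ?case .
  qed (use assms in simp)
  show "y [^]\<^bsub>A\<^esub> i \<otimes>\<^bsub>A\<^esub> \<iota> g = \<eta> g ^ i \<odot>\<^bsub>A\<^esub> (\<iota> g \<otimes>\<^bsub>A\<^esub> y [^]\<^bsub>A\<^esub> i)"
  proof (induction i)
    case (Suc i)
    have "y [^]\<^bsub>A\<^esub> Suc i \<otimes>\<^bsub>A\<^esub> \<iota> g = y [^]\<^bsub>A\<^esub> i \<otimes>\<^bsub>A\<^esub> (y \<otimes>\<^bsub>A\<^esub> \<iota> g)" using assms by (simp add: A.m_assoc)
    also have "\<dots> = \<eta> g \<odot>\<^bsub>A\<^esub> ((y [^]\<^bsub>A\<^esub> i \<otimes>\<^bsub>A\<^esub> \<iota> g) \<otimes>\<^bsub>A\<^esub> y)"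
      using assms by (simp add: y_iota A.mult_smult_right A.m_assoc)
    also have "\<dots> = \<eta> g ^ Suc i \<odot>\<^bsub>A\<^esub> (\<iota> g \<otimes>\<^bsub>A\<^esub> y [^]\<^bsub>A\<^esub> Suc i)"
      using assms by (simp add: Suc A.mult_smult_left A.m_assoc A.smult_smult)
    finally show ?case .
  qed (use assms in simp)
qed

lemma iota_mon: "g \<in> carrier G \<Longrightarrow> h \<in> carrier G \<Longrightarrow> \<iota> g \<otimes>\<^bsub>A\<^esub> mon (h, i, j) = mon (g \<otimes>\<^bsub>G\<^esub> h, i, j)"
  by (simp add: mon_eq iota_mult A.m_assoc)

lemma x_mon: "h \<in> carrier G \<Longrightarrow> x \<otimes>\<^bsub>A\<^esub> mon (h, i, j) = \<chi> h \<odot>\<^bsub>A\<^esub> mon (h, Suc i, j)"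
proof -
  assume h: "h \<in> carrier G"
  have "x \<otimes>\<^bsub>A\<^esub> mon (h, i, j) = (x \<otimes>\<^bsub>A\<^esub> \<iota> h) \<otimes>\<^bsub>A\<^esub> (x [^]\<^bsub>A\<^esub> i \<otimes>\<^bsub>A\<^esub> y [^]\<^bsub>A\<^esub> j)"
    using h by (simp add: mon_eq A.m_assoc)
  also have "\<dots> = \<chi> h \<odot>\<^bsub>A\<^esub> (\<iota> h \<otimes>\<^bsub>A\<^esub> ((x \<otimes>\<^bsub>A\<^esub> x [^]\<^bsub>A\<^esub> i) \<otimes>\<^bsub>A\<^esub> y [^]\<^bsub>A\<^esub> j))"
    using h by (simp add: x_iota A.mult_smult_left A.m_assoc)
  also have "\<dots> = \<chi> h \<odot>\<^bsub>A\<^esub> mon (h, Suc i, j)"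
    using h by (simp add: mon_eq A.pow_commute)
  finally show ?thesis .
qed

text \<open>Reduces left multiplication by y to monomials with trivial group part, where the
  recursion \<open>y_mon_Suc\<close> applies.\<close>

lemma y_mon: "h \<in> carrier G \<Longrightarrow> y \<otimes>\<^bsub>A\<^esub> mon (h, i, j) = \<eta> h \<odot>\<^bsub>A\<^esub> (\<iota> h \<otimes>\<^bsub>A\<^esub> (y \<otimes>\<^bsub>A\<^esub> mon (\<one>\<^bsub>G\<^esub>, i, j)))"
proof -
  assume h: "h \<in> carrier G"
  have "y \<otimes>\<^bsub>A\<^esub> mon (h, i, j) = (y \<otimes>\<^bsub>A\<^esub> \<iota> h) \<otimes>\<^bsub>A\<^esub> (x [^]\<^bsub>A\<^esub> i \<otimes>\<^bsub>A\<^esub> y [^]\<^bsub>A\<^esub> j)"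
    using h by (simp add: mon_eq A.m_assoc)
  also have "\<dots> = \<eta> h \<odot>\<^bsub>A\<^esub> (\<iota> h \<otimes>\<^bsub>A\<^esub> (y \<otimes>\<^bsub>A\<^esub> (x [^]\<^bsub>A\<^esub> i \<otimes>\<^bsub>A\<^esub> y [^]\<^bsub>A\<^esub> j)))"
    using h by (simp add: y_iota A.mult_smult_left A.m_assoc)
  finally show ?thesis by (simp add: mon_eq iota_one)
qed

lemma y_mon_zero: "y \<otimes>\<^bsub>A\<^esub> mon (\<one>\<^bsub>G\<^esub>, 0, j) = mon (\<one>\<^bsub>G\<^esub>, 0, Suc j)"
  by (simp add: mon_eq iota_one A.pow_commute)

text \<open>Moves y past a single x. The product y x^i is never expanded in closed form;
  homomorphisms, Noetherianity and the filtration all use this recursion on the exponent of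
  x.\<close>

lemma y_mon_Suc: "y \<otimes>\<^bsub>A\<^esub> mon (\<one>\<^bsub>G\<^esub>, Suc i, j) =
   \<eta> b \<odot>\<^bsub>A\<^esub> (x \<otimes>\<^bsub>A\<^esub> (y \<otimes>\<^bsub>A\<^esub> mon (\<one>\<^bsub>G\<^esub>, i, j))) \<oplus>\<^bsub>A\<^esub>
   \<beta> \<odot>\<^bsub>A\<^esub> (mon (\<one>\<^bsub>G\<^esub>, i, j) \<ominus>\<^bsub>A\<^esub> mon (c \<otimes>\<^bsub>G\<^esub> b, i, j))"
proof -
  have mc: "mon (\<one>\<^bsub>G\<^esub>, i, j) \<in> carrier A" by simp
  have "mon (\<one>\<^bsub>G\<^esub>, Suc i, j) = x \<otimes>\<^bsub>A\<^esub> mon (\<one>\<^bsub>G\<^esub>, i, j)" using x_mon[of "\<one>\<^bsub>G\<^esub>" i j] by (simp add: chi_simps)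
  then have "y \<otimes>\<^bsub>A\<^esub> mon (\<one>\<^bsub>G\<^esub>, Suc i, j) = (y \<otimes>\<^bsub>A\<^esub> x) \<otimes>\<^bsub>A\<^esub> mon (\<one>\<^bsub>G\<^esub>, i, j)"
    using mc by (simp only: A.m_assoc y_closed x_closed)
  also have "\<dots> = \<eta> b \<odot>\<^bsub>A\<^esub> (x \<otimes>\<^bsub>A\<^esub> y) \<otimes>\<^bsub>A\<^esub> mon (\<one>\<^bsub>G\<^esub>, i, j) \<oplus>\<^bsub>A\<^esub>
      \<beta> \<odot>\<^bsub>A\<^esub> (\<one>\<^bsub>A\<^esub> \<ominus>\<^bsub>A\<^esub> \<iota> (c \<otimes>\<^bsub>G\<^esub> b)) \<otimes>\<^bsub>A\<^esub> mon (\<one>\<^bsub>G\<^esub>, i, j)"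
    unfolding y_x by (rule A.l_distr) (use mc in simp_all)
  also have "\<eta> b \<odot>\<^bsub>A\<^esub> (x \<otimes>\<^bsub>A\<^esub> y) \<otimes>\<^bsub>A\<^esub> mon (\<one>\<^bsub>G\<^esub>, i, j) = \<eta> b \<odot>\<^bsub>A\<^esub> (x \<otimes>\<^bsub>A\<^esub> (y \<otimes>\<^bsub>A\<^esub> mon (\<one>\<^bsub>G\<^esub>, i, j)))"
    using mc by (simp only: A.mult_smult_left A.m_assoc A.m_closed y_closed x_closed)
  also have "\<beta> \<odot>\<^bsub>A\<^esub> (\<one>\<^bsub>A\<^esub> \<ominus>\<^bsub>A\<^esub> \<iota> (c \<otimes>\<^bsub>G\<^esub> b)) \<otimes>\<^bsub>A\<^esub> mon (\<one>\<^bsub>G\<^esub>, i, j) =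
      \<beta> \<odot>\<^bsub>A\<^esub> (mon (\<one>\<^bsub>G\<^esub>, i, j) \<ominus>\<^bsub>A\<^esub> mon (c \<otimes>\<^bsub>G\<^esub> b, i, j))"
    using mc by (simp add: A.mult_smult_left a_minus_def A.l_distr A.l_minus iota_mon)
  finally show ?thesis .
qed

text \<open>Monomials span, and each of them is a product of generators.\<close>

lemma generators_induct [consumes 1, case_names iota x y add smult mult]:
  assumes "h \<in> carrier A" and "\<And>g. g \<in> carrier G \<Longrightarrow> P (\<iota> g)" "P x" "P y"
    and add: "\<And>u v. u \<in> carrier A \<Longrightarrow> v \<in> carrier A \<Longrightarrow> P u \<Longrightarrow> P v \<Longrightarrow> P (u \<oplus>\<^bsub>A\<^esub> v)"
    and smult: "\<And>k u. u \<in> carrier A \<Longrightarrow> P u \<Longrightarrow> P (k \<odot>\<^bsub>A\<^esub> u)"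
    and mult: "\<And>u v. u \<in> carrier A \<Longrightarrow> v \<in> carrier A \<Longrightarrow> P u \<Longrightarrow> P v \<Longrightarrow> P (u \<otimes>\<^bsub>A\<^esub> v)"
  shows "P h"
proof -
  have one: "P \<one>\<^bsub>A\<^esub>" using assms(2)[of "\<one>\<^bsub>G\<^esub>"] by (simp add: iota_one)
  have pow: "P (w [^]\<^bsub>A\<^esub> n)" if "w \<in> carrier A" "P w" for w and n :: nat
    by (induction n) (use that one mult in auto)
  have "h \<in> k_span A (mon ` Ind)" unfolding M.basis_span by (rule assms(1))
  moreover have "mon ` Ind \<subseteq> carrier A" by auto
  ultimately show ?thesis
  proof (induction rule: A.k_span_induct)
    case zero
    have "P (0 \<odot>\<^bsub>A\<^esub> \<one>\<^bsub>A\<^esub>)" by (rule smult) (use one in auto)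
    then show ?case by simp
  next
    case (base s)
    then obtain g i j where s: "s = mon (g, i, j)" "g \<in> carrier G" by auto
    show ?case unfolding s(1) mon_eq[OF s(2)]
      by (intro mult pow) (use s assms in auto)
  next
    case (add u v)
    then show ?case unfolding M.basis_span by (intro assms(5))
  next
    case (smult k u)
    then show ?case unfolding M.basis_span by (intro assms(6))
  qed
qed

text \<open>The device by which the Hopf axioms are verified: both sides are algebra maps, so the
  generators decide.\<close>

lemma hom_unique:
  assumes "F \<in> k_algebra_homs A B" "F' \<in> k_algebra_homs A B"
    and "\<And>g. g \<in> carrier G \<Longrightarrow> F (\<iota> g) = F' (\<iota> g)" "F x = F' x" "F y = F' y" "h \<in> carrier A"
  shows "F h = F' h"
  using assms(6)
  by (induction rule: generators_induct)
    (simp_all add: assms(3-5) k_algebra_homsD[OF assms(1)] k_algebra_homsD[OF assms(2)])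

text \<open>The linear extension of the evident map on
  monomials commutes with left multiplication by the generators.\<close>

lemma hom_extension:
  assumes B: "k_algebra B" and f: "\<And>g. g \<in> carrier G \<Longrightarrow> f g \<in> carrier B" and x': "x' \<in> carrier B" and y': "y' \<in> carrier B"
    and f_one: "f \<one>\<^bsub>G\<^esub> = \<one>\<^bsub>B\<^esub>"
    and f_mult: "\<And>g h. g \<in> carrier G \<Longrightarrow> h \<in> carrier G \<Longrightarrow> f (g \<otimes>\<^bsub>G\<^esub> h) = f g \<otimes>\<^bsub>B\<^esub> f h"
    and X_f: "\<And>g. g \<in> carrier G \<Longrightarrow> x' \<otimes>\<^bsub>B\<^esub> f g = \<chi> g \<odot>\<^bsub>B\<^esub> (f g \<otimes>\<^bsub>B\<^esub> x')"
    and Y_f: "\<And>g. g \<in> carrier G \<Longrightarrow> y' \<otimes>\<^bsub>B\<^esub> f g = \<eta> g \<odot>\<^bsub>B\<^esub> (f g \<otimes>\<^bsub>B\<^esub> y')"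
    and Y_X: "y' \<otimes>\<^bsub>B\<^esub> x' = \<eta> b \<odot>\<^bsub>B\<^esub> (x' \<otimes>\<^bsub>B\<^esub> y') \<oplus>\<^bsub>B\<^esub> \<beta> \<odot>\<^bsub>B\<^esub> (\<one>\<^bsub>B\<^esub> \<ominus>\<^bsub>B\<^esub> f (c \<otimes>\<^bsub>G\<^esub> b))"
  obtains F where "F \<in> k_algebra_homs A B" "\<And>g. g \<in> carrier G \<Longrightarrow> F (\<iota> g) = f g" "F x = x'" "F y = y'"
    "\<And>g i j. g \<in> carrier G \<Longrightarrow> F (mon (g, i, j)) = f g \<otimes>\<^bsub>B\<^esub> (x' [^]\<^bsub>B\<^esub> i \<otimes>\<^bsub>B\<^esub> y' [^]\<^bsub>B\<^esub> j)"
proof -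
  interpret B: k_alg B by unfold_locales (rule B)
  let ?w = "\<lambda>(g, i :: nat, j :: nat). f g \<otimes>\<^bsub>B\<^esub> (x' [^]\<^bsub>B\<^esub> i \<otimes>\<^bsub>B\<^esub> y' [^]\<^bsub>B\<^esub> j)"
  have "?w \<in> Ind \<rightarrow> carrier B" using f x' y' by auto
  from M.basis_extension[OF B this] obtain F where F: "F \<in> k_linear_maps A B"
    and F_mon': "\<forall>t\<in>Ind. F (mon t) = ?w t" by blast
  have F_mon: "F (mon (g, i, j)) = f g \<otimes>\<^bsub>B\<^esub> (x' [^]\<^bsub>B\<^esub> i \<otimes>\<^bsub>B\<^esub> y' [^]\<^bsub>B\<^esub> j)" if "g \<in> carrier G" for g i j
    using F_mon' that by auto
  interpret F: k_linear A B F by (rule k_linearI[OF A.k_algebra B F])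
  have F_g: "F (\<iota> g) = f g" if "g \<in> carrier G" for g
    using F_mon[OF that, of 0 0] that f by (simp add: mon_generators)
  have F_x: "F x = x'" and F_y: "F y = y'"
    using F_mon[of "\<one>\<^bsub>G\<^esub>" 1 0] F_mon[of "\<one>\<^bsub>G\<^esub>" 0 1] x' y' mon_generators by (simp_all add: f_one)
  \<comment> \<open>The linear maps v \<mapsto> F(u v) and v \<mapsto> U F(v) agree everywhere once
    they agree on the monomials.\<close>
  have extend: "F (u \<otimes>\<^bsub>A\<^esub> v) = U \<otimes>\<^bsub>B\<^esub> F v"
    if "u \<in> carrier A" "U \<in> carrier B" "v \<in> carrier A"
      "\<And>h i j. h \<in> carrier G \<Longrightarrow> F (u \<otimes>\<^bsub>A\<^esub> mon (h, i, j)) = U \<otimes>\<^bsub>B\<^esub> F (mon (h, i, j))" for u v U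
    by (rule M.basis_linear_eq[OF B k_linear_maps_comp[OF A.mult_linear(1)[OF that(1)] F]
          k_linear_maps_comp[OF F B.mult_linear(1)[OF that(2)]] _ that(3)])
      (use that(4) in auto)
  have L_g: "F (\<iota> g \<otimes>\<^bsub>A\<^esub> v) = f g \<otimes>\<^bsub>B\<^esub> F v" if "g \<in> carrier G" "v \<in> carrier A" for g v
    by (rule extend) (use that f x' y' in \<open>simp_all add: iota_mon F_mon f_mult B.m_assoc\<close>)
  have L_x: "F (x \<otimes>\<^bsub>A\<^esub> v) = x' \<otimes>\<^bsub>B\<^esub> F v" if "v \<in> carrier A" for v
  proof (rule extend)
    fix h i j assume h: "h \<in> carrier G"
    have "F (x \<otimes>\<^bsub>A\<^esub> mon (h, i, j)) = \<chi> h \<odot>\<^bsub>B\<^esub> (f h \<otimes>\<^bsub>B\<^esub> ((x' \<otimes>\<^bsub>B\<^esub> x' [^]\<^bsub>B\<^esub> i) \<otimes>\<^bsub>B\<^esub> y' [^]\<^bsub>B\<^esub> j))"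
      using h x' by (simp add: x_mon F.map_smult F_mon B.pow_commute)
    also have "\<dots> = (x' \<otimes>\<^bsub>B\<^esub> f h) \<otimes>\<^bsub>B\<^esub> (x' [^]\<^bsub>B\<^esub> i \<otimes>\<^bsub>B\<^esub> y' [^]\<^bsub>B\<^esub> j)"
      using h x' y' f by (simp add: X_f B.mult_smult_left B.m_assoc)
    finally show "F (x \<otimes>\<^bsub>A\<^esub> mon (h, i, j)) = x' \<otimes>\<^bsub>B\<^esub> F (mon (h, i, j))"
      using h x' y' f by (simp add: F_mon B.m_assoc)
  qed (use that x' in auto)
  \<comment> \<open>The only place where the relation \<open>Y_X\<close> is used; the induction
    follows \<open>y_mon_Suc\<close>, and the group term is handled by \<open>L_g\<close>.\<close>
  have y1: "F (y \<otimes>\<^bsub>A\<^esub> mon (\<one>\<^bsub>G\<^esub>, i, j)) = y' \<otimes>\<^bsub>B\<^esub> F (mon (\<one>\<^bsub>G\<^esub>, i, j))" for i j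
  proof (induction i)
    case 0
    show ?case using y' unfolding y_mon_zero by (simp add: F_mon f_one B.pow_commute)
  next
    case (Suc i)
    let ?m = "mon (\<one>\<^bsub>G\<^esub>, i, j)"
    have m: "?m \<in> carrier A" "F ?m \<in> carrier B" using F.map_closed by auto
    have cb: "f (c \<otimes>\<^bsub>G\<^esub> b) \<in> carrier B" using f by simp
    have "mon (c \<otimes>\<^bsub>G\<^esub> b, i, j) = \<iota> (c \<otimes>\<^bsub>G\<^esub> b) \<otimes>\<^bsub>A\<^esub> ?m" by (simp add: iota_mon)
    then have "F (y \<otimes>\<^bsub>A\<^esub> mon (\<one>\<^bsub>G\<^esub>, Suc i, j)) =
        \<eta> b \<odot>\<^bsub>B\<^esub> (x' \<otimes>\<^bsub>B\<^esub> (y' \<otimes>\<^bsub>B\<^esub> F ?m)) \<oplus>\<^bsub>B\<^esub> \<beta> \<odot>\<^bsub>B\<^esub> (F ?m \<ominus>\<^bsub>B\<^esub> f (c \<otimes>\<^bsub>G\<^esub> b) \<otimes>\<^bsub>B\<^esub> F ?m)"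
      using m unfolding y_mon_Suc a_minus_def
      by (simp add: F.map_add F.map_smult F.map_minus L_x L_g Suc)
    also have "\<dots> = (\<eta> b \<odot>\<^bsub>B\<^esub> (x' \<otimes>\<^bsub>B\<^esub> y') \<oplus>\<^bsub>B\<^esub> \<beta> \<odot>\<^bsub>B\<^esub> (\<one>\<^bsub>B\<^esub> \<ominus>\<^bsub>B\<^esub> f (c \<otimes>\<^bsub>G\<^esub> b))) \<otimes>\<^bsub>B\<^esub> F ?m"
      using m x' y' cb by (simp add: B.l_distr B.mult_smult_left B.m_assoc a_minus_def B.l_minus)
    also have "\<dots> = y' \<otimes>\<^bsub>B\<^esub> (x' \<otimes>\<^bsub>B\<^esub> F ?m)" unfolding Y_X[symmetric] using m x' y' by (simp add: B.m_assoc)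
    also have "x' \<otimes>\<^bsub>B\<^esub> F ?m = F (mon (\<one>\<^bsub>G\<^esub>, Suc i, j))"
      using L_x[of ?m] x_mon[of "\<one>\<^bsub>G\<^esub>" i j] by (simp add: chi_simps)
    finally show ?case .
  qed
  have L_y: "F (y \<otimes>\<^bsub>A\<^esub> v) = y' \<otimes>\<^bsub>B\<^esub> F v" if "v \<in> carrier A" for v
  proof (rule extend)
    fix h i j assume h: "h \<in> carrier G"
    let ?m = "mon (\<one>\<^bsub>G\<^esub>, i, j)"
    have m: "?m \<in> carrier A" "F ?m \<in> carrier B" using F.map_closed by auto
    have "F (y \<otimes>\<^bsub>A\<^esub> mon (h, i, j)) = \<eta> h \<odot>\<^bsub>B\<^esub> (f h \<otimes>\<^bsub>B\<^esub> (y' \<otimes>\<^bsub>B\<^esub> F ?m))"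
      using h m unfolding y_mon[OF h] by (simp add: F.map_smult L_g y1)
    also have "\<dots> = (y' \<otimes>\<^bsub>B\<^esub> f h) \<otimes>\<^bsub>B\<^esub> F ?m"
      using h m y' f by (simp add: Y_f B.mult_smult_left B.m_assoc)
    also have "\<dots> = y' \<otimes>\<^bsub>B\<^esub> F (mon (h, i, j))"
      using h m y' f L_g[OF h m(1)] by (simp add: iota_mon B.m_assoc)
    finally show "F (y \<otimes>\<^bsub>A\<^esub> mon (h, i, j)) = y' \<otimes>\<^bsub>B\<^esub> F (mon (h, i, j))" .
  qed (use that y' in auto)
  have "F \<in> k_algebra_homs A B"
  proof (rule k_algebra_homsI[OF F])
    show "F \<one>\<^bsub>A\<^esub> = \<one>\<^bsub>B\<^esub>" using F_g[of "\<one>\<^bsub>G\<^esub>"] by (simp add: iota_one f_one)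
    fix u v assume u: "u \<in> carrier A" and "v \<in> carrier A"
    \<comment> \<open>The left factors \<open>u\<close> that \<open>F\<close> respects against every
      \<open>v\<close> are closed under sums, multiples and products, so the generators
      suffice.\<close>
    from u have "\<forall>v\<in>carrier A. F (u \<otimes>\<^bsub>A\<^esub> v) = F u \<otimes>\<^bsub>B\<^esub> F v"
    proof (induction rule: generators_induct)
      case (add u u')
      then show ?case using F.map_closed by (simp add: A.l_distr B.l_distr F.map_add)
    next
      case (smult k u)
      then show ?case using F.map_closed by (simp add: A.mult_smult_left B.mult_smult_left F.map_smult)
    next
      case (mult u u')
      then show ?case using F.map_closed by (simp add: A.m_assoc B.m_assoc)
    qed (simp_all add: L_g L_x L_y F_g F_x F_y)
    then show "F (u \<otimes>\<^bsub>A\<^esub> v) = F u \<otimes>\<^bsub>B\<^esub> F v" using \<open>v \<in> carrier A\<close> by blast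
  qed
  then show thesis using that F_g F_x F_y F_mon by blast
qed

section \<open>Coproduct, counit and antipode on generators\<close>

sublocale T: tensor A A
  by unfold_locales

abbreviation "TA \<equiv> tensor_algebra A A"
abbreviation "p \<equiv> pure_tensor A A"

lemmas p_linear = k_bilinearD[OF T.pure_bilinear]

lemma p_minus:
  "u \<in> carrier A \<Longrightarrow> v \<in> carrier A \<Longrightarrow> p (\<ominus>\<^bsub>A\<^esub> u) v = \<ominus>\<^bsub>TA\<^esub> p u v"
  "u \<in> carrier A \<Longrightarrow> v \<in> carrier A \<Longrightarrow> p u (\<ominus>\<^bsub>A\<^esub> v) = \<ominus>\<^bsub>TA\<^esub> p u v"
  by (simp_all add: A.minus_eq_smult T.T.minus_eq_smult p_linear)

text \<open>The proposed images must satisfy the relations. Those with G hold because b and c are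
  central; the one for y x needs \<eta>(b) \<chi>(c) = 1 for the mixed terms and a telescoping of
  the \<beta>-terms.\<close>

lemma comult_exists:
  obtains \<Delta> where "\<Delta> \<in> k_algebra_homs A TA" "\<And>g. g \<in> carrier G \<Longrightarrow> \<Delta> (\<iota> g) = p (\<iota> g) (\<iota> g)"
    "\<Delta> x = p x \<one>\<^bsub>A\<^esub> \<oplus>\<^bsub>TA\<^esub> p (\<iota> b) x" "\<Delta> y = p y \<one>\<^bsub>A\<^esub> \<oplus>\<^bsub>TA\<^esub> p (\<iota> c) y"
proof -
  let ?X = "p x \<one>\<^bsub>A\<^esub> \<oplus>\<^bsub>TA\<^esub> p (\<iota> b) x" and ?Y = "p y \<one>\<^bsub>A\<^esub> \<oplus>\<^bsub>TA\<^esub> p (\<iota> c) y"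
  note cl = T.pure_closed iota_closed x_closed y_closed
  have gb: "\<iota> g \<otimes>\<^bsub>A\<^esub> \<iota> b = \<iota> b \<otimes>\<^bsub>A\<^esub> \<iota> g" "\<iota> g \<otimes>\<^bsub>A\<^esub> \<iota> c = \<iota> c \<otimes>\<^bsub>A\<^esub> \<iota> g" if "g \<in> carrier G" for g
    using that b_commute[OF that] c_commute[OF that] by (simp_all flip: iota_mult)
  show thesis
  proof (rule hom_extension[of TA "\<lambda>g. p (\<iota> g) (\<iota> g)" ?X ?Y])
    show "k_algebra TA" by (rule T.tensor_k_algebra)
    show "p (\<iota> \<one>\<^bsub>G\<^esub>) (\<iota> \<one>\<^bsub>G\<^esub>) = \<one>\<^bsub>TA\<^esub>" by (simp add: iota_one T.pure_one)
    show "?X \<otimes>\<^bsub>TA\<^esub> p (\<iota> g) (\<iota> g) = \<chi> g \<odot>\<^bsub>TA\<^esub> (p (\<iota> g) (\<iota> g) \<otimes>\<^bsub>TA\<^esub> ?X)" if "g \<in> carrier G" for g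
      using that by (simp add: T.T.l_distr T.T.r_distr T.pure_mult cl p_linear x_iota T.T.smult_add_right gb)
    show "?Y \<otimes>\<^bsub>TA\<^esub> p (\<iota> g) (\<iota> g) = \<eta> g \<odot>\<^bsub>TA\<^esub> (p (\<iota> g) (\<iota> g) \<otimes>\<^bsub>TA\<^esub> ?Y)" if "g \<in> carrier G" for g
      using that by (simp add: T.T.l_distr T.T.r_distr T.pure_mult cl p_linear y_iota T.T.smult_add_right gb)
    let ?cb = "\<iota> (c \<otimes>\<^bsub>G\<^esub> b)"
    have cb: "\<iota> c \<otimes>\<^bsub>A\<^esub> \<iota> b = ?cb" "\<iota> b \<otimes>\<^bsub>A\<^esub> \<iota> c = ?cb" "?cb \<in> carrier A"
      using gb(1)[of c] by (simp_all add: iota_mult)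
    define u1 where "u1 = \<eta> b \<odot>\<^bsub>TA\<^esub> p (x \<otimes>\<^bsub>A\<^esub> y) \<one>\<^bsub>A\<^esub>"
    define u2 where "u2 = p (\<iota> c \<otimes>\<^bsub>A\<^esub> x) y"
    define u3 where "u3 = \<eta> b \<odot>\<^bsub>TA\<^esub> p (\<iota> b \<otimes>\<^bsub>A\<^esub> y) x"
    define u4 where "u4 = \<eta> b \<odot>\<^bsub>TA\<^esub> p ?cb (x \<otimes>\<^bsub>A\<^esub> y)"
    define w1 where "w1 = \<beta> \<odot>\<^bsub>TA\<^esub> p \<one>\<^bsub>A\<^esub> \<one>\<^bsub>A\<^esub>"
    define w2 where "w2 = \<beta> \<odot>\<^bsub>TA\<^esub> p ?cb \<one>\<^bsub>A\<^esub>"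
    define w3 where "w3 = \<beta> \<odot>\<^bsub>TA\<^esub> p ?cb ?cb"
    note defs = u1_def u2_def u3_def u4_def w1_def w2_def w3_def
    have c: "u1 \<in> carrier TA" "u2 \<in> carrier TA" "u3 \<in> carrier TA" "u4 \<in> carrier TA"
      "w1 \<in> carrier TA" "w2 \<in> carrier TA" "w3 \<in> carrier TA"
      unfolding defs using cb(3) by (simp_all add: cl)
    have yx1: "p (y \<otimes>\<^bsub>A\<^esub> x) \<one>\<^bsub>A\<^esub> = u1 \<oplus>\<^bsub>TA\<^esub> (w1 \<ominus>\<^bsub>TA\<^esub> w2)"
      unfolding defs y_x using cb(3)
      by (simp add: a_minus_def p_linear p_minus cl T.T.smult_add_right T.T.smult_minus)
    have yx2: "p ?cb (y \<otimes>\<^bsub>A\<^esub> x) = u4 \<oplus>\<^bsub>TA\<^esub> (w2 \<ominus>\<^bsub>TA\<^esub> w3)"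
      unfolding defs y_x using cb(3)
      by (simp add: a_minus_def p_linear p_minus cl T.T.smult_add_right T.T.smult_minus)
    have "?Y \<otimes>\<^bsub>TA\<^esub> ?X = (p (y \<otimes>\<^bsub>A\<^esub> x) \<one>\<^bsub>A\<^esub> \<oplus>\<^bsub>TA\<^esub> u2) \<oplus>\<^bsub>TA\<^esub> (u3 \<oplus>\<^bsub>TA\<^esub> p ?cb (y \<otimes>\<^bsub>A\<^esub> x))"
      unfolding u2_def u3_def
      by (simp add: T.T.l_distr T.T.r_distr T.pure_mult cl p_linear y_iota cb)
    \<comment> \<open>The term \<beta> (c b \<otimes> 1) occurs with both signs: (1 - c b) \<otimes>
      1 + c b \<otimes> (1 - c b) telescopes to 1 \<otimes> 1 - c b \<otimes> c b.\<close>
    also have "\<dots> = (u1 \<oplus>\<^bsub>TA\<^esub> u3 \<oplus>\<^bsub>TA\<^esub> u2 \<oplus>\<^bsub>TA\<^esub> u4) \<oplus>\<^bsub>TA\<^esub> (w1 \<ominus>\<^bsub>TA\<^esub> w3)"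
    proof -
      have "w1 \<ominus>\<^bsub>TA\<^esub> w2 \<oplus>\<^bsub>TA\<^esub> (w2 \<ominus>\<^bsub>TA\<^esub> w3) = w1 \<ominus>\<^bsub>TA\<^esub> w3"
        using c by (simp add: a_minus_def T.T.a_assoc T.T.r_neg1)
      moreover have "(u1 \<oplus>\<^bsub>TA\<^esub> (w1 \<ominus>\<^bsub>TA\<^esub> w2) \<oplus>\<^bsub>TA\<^esub> u2) \<oplus>\<^bsub>TA\<^esub> (u3 \<oplus>\<^bsub>TA\<^esub> (u4 \<oplus>\<^bsub>TA\<^esub> (w2 \<ominus>\<^bsub>TA\<^esub> w3)))
          = (u1 \<oplus>\<^bsub>TA\<^esub> u3 \<oplus>\<^bsub>TA\<^esub> u2 \<oplus>\<^bsub>TA\<^esub> u4) \<oplus>\<^bsub>TA\<^esub> (w1 \<ominus>\<^bsub>TA\<^esub> w2 \<oplus>\<^bsub>TA\<^esub> (w2 \<ominus>\<^bsub>TA\<^esub> w3))"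
        using c by (simp add: T.T.a_ac)
      ultimately show ?thesis by (simp only: yx1 yx2)
    qed
    \<comment> \<open>Here \<eta>(b) \<chi>(c) = 1 turns \<eta>(b) x c \<otimes> y into c x
      \<otimes> y.\<close>
    also have "u1 \<oplus>\<^bsub>TA\<^esub> u3 \<oplus>\<^bsub>TA\<^esub> u2 \<oplus>\<^bsub>TA\<^esub> u4 = \<eta> b \<odot>\<^bsub>TA\<^esub> (?X \<otimes>\<^bsub>TA\<^esub> ?Y)"
      unfolding u1_def u2_def u3_def u4_def
      using eta_b_chi_c by (simp add: T.T.l_distr T.T.r_distr T.pure_mult cl p_linear x_iota cb T.T.smult_add_right
          T.T.smult_smult T.T.a_ac)
    also have "w1 \<ominus>\<^bsub>TA\<^esub> w3 = \<beta> \<odot>\<^bsub>TA\<^esub> (\<one>\<^bsub>TA\<^esub> \<ominus>\<^bsub>TA\<^esub> p ?cb ?cb)"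
      unfolding w1_def w3_def using cb(3)
      by (simp add: a_minus_def T.pure_one cl T.T.smult_add_right T.T.smult_minus)
    finally show "?Y \<otimes>\<^bsub>TA\<^esub> ?X = \<eta> b \<odot>\<^bsub>TA\<^esub> (?X \<otimes>\<^bsub>TA\<^esub> ?Y) \<oplus>\<^bsub>TA\<^esub>
        \<beta> \<odot>\<^bsub>TA\<^esub> (\<one>\<^bsub>TA\<^esub> \<ominus>\<^bsub>TA\<^esub> p ?cb ?cb)" .
  qed (use that in \<open>simp_all add: cl T.pure_mult iota_mult\<close>)
qed

lemma counit_exists:
  obtains \<epsilon> where "\<epsilon> \<in> k_algebra_homs A scalar_algebra" "\<And>g. g \<in> carrier G \<Longrightarrow> \<epsilon> (\<iota> g) = 1" "\<epsilon> x = 0" "\<epsilon> y = 0"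
proof (rule hom_extension[OF scalar_algebra_k_algebra, of "\<lambda>_. 1" 0 0])
  interpret K: k_alg "scalar_algebra :: ('k, 'k) module" by unfold_locales (rule scalar_algebra_k_algebra)
  \<comment> \<open>Both sides vanish because the group element c b is sent to 1.\<close>
  show "0 \<otimes>\<^bsub>scalar_algebra\<^esub> 0 = \<eta> b \<odot>\<^bsub>scalar_algebra\<^esub> (0 \<otimes>\<^bsub>scalar_algebra\<^esub> 0) \<oplus>\<^bsub>scalar_algebra\<^esub>
      \<beta> \<odot>\<^bsub>scalar_algebra\<^esub> (\<one>\<^bsub>scalar_algebra\<^esub> \<ominus>\<^bsub>scalar_algebra\<^esub> 1)"
    using K.minus_eq_smult[of 1] by (simp add: a_minus_def)
qed (use that in simp_all)

lemma iota_inv: "g \<in> carrier G \<Longrightarrow> \<iota> (inv\<^bsub>G\<^esub> g) \<otimes>\<^bsub>A\<^esub> \<iota> g = \<one>\<^bsub>A\<^esub>"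
  "g \<in> carrier G \<Longrightarrow> \<iota> g \<otimes>\<^bsub>A\<^esub> \<iota> (inv\<^bsub>G\<^esub> g) = \<one>\<^bsub>A\<^esub>"
  by (simp_all add: iota_one flip: iota_mult)

text \<open>The values are forced by the antipode axiom: S(x) 1 + S(b) x = 0 gives S(x) = - b^-1 x,
  and likewise for y. As S reverses products, it is built as an algebra map into the opposite
  algebra.\<close>

lemma antipode_hom_exists:
  obtains S where "S \<in> k_algebra_homs A (opposite A)" "\<And>g. g \<in> carrier G \<Longrightarrow> S (\<iota> g) = \<iota> (inv\<^bsub>G\<^esub> g)"
    "S x = \<ominus>\<^bsub>A\<^esub> (\<iota> (inv\<^bsub>G\<^esub> b) \<otimes>\<^bsub>A\<^esub> x)" "S y = \<ominus>\<^bsub>A\<^esub> (\<iota> (inv\<^bsub>G\<^esub> c) \<otimes>\<^bsub>A\<^esub> y)"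
proof -
  let ?b = "\<iota> (inv\<^bsub>G\<^esub> b)" and ?c = "\<iota> (inv\<^bsub>G\<^esub> c)"
  have comm: "?b \<otimes>\<^bsub>A\<^esub> \<iota> g = \<iota> g \<otimes>\<^bsub>A\<^esub> ?b" "?c \<otimes>\<^bsub>A\<^esub> \<iota> g = \<iota> g \<otimes>\<^bsub>A\<^esub> ?c" if g: "g \<in> carrier G" for g
  proof -
    have "inv\<^bsub>G\<^esub> b \<otimes>\<^bsub>G\<^esub> g = g \<otimes>\<^bsub>G\<^esub> inv\<^bsub>G\<^esub> b" "inv\<^bsub>G\<^esub> c \<otimes>\<^bsub>G\<^esub> g = g \<otimes>\<^bsub>G\<^esub> inv\<^bsub>G\<^esub> c"
      using g b_commute[OF g] c_commute[OF g]
      by (metis b_closed c_closed G.inv_solve_left G.inv_solve_right G.m_assoc G.inv_closed G.m_closed)+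
    then show "?b \<otimes>\<^bsub>A\<^esub> \<iota> g = \<iota> g \<otimes>\<^bsub>A\<^esub> ?b" "?c \<otimes>\<^bsub>A\<^esub> \<iota> g = \<iota> g \<otimes>\<^bsub>A\<^esub> ?c"
      using g by (simp_all flip: iota_mult)
  qed
  \<comment> \<open>Stated once for both variables: \<open>h\<close> is the inverse of b or of c,
    and \<xi> is \<chi> or \<eta>.\<close>
  have rel: "\<iota> (inv\<^bsub>G\<^esub> g) \<otimes>\<^bsub>A\<^esub> (\<ominus>\<^bsub>A\<^esub> (\<iota> h \<otimes>\<^bsub>A\<^esub> w)) = \<xi> g \<odot>\<^bsub>A\<^esub> ((\<ominus>\<^bsub>A\<^esub> (\<iota> h \<otimes>\<^bsub>A\<^esub> w)) \<otimes>\<^bsub>A\<^esub> \<iota> (inv\<^bsub>G\<^esub> g))"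
    if "g \<in> carrier G" "h \<in> carrier G" "w \<in> carrier A" "\<xi> \<in> characters G"
      "w \<otimes>\<^bsub>A\<^esub> \<iota> (inv\<^bsub>G\<^esub> g) = \<xi> (inv\<^bsub>G\<^esub> g) \<odot>\<^bsub>A\<^esub> (\<iota> (inv\<^bsub>G\<^esub> g) \<otimes>\<^bsub>A\<^esub> w)"
      "\<iota> h \<otimes>\<^bsub>A\<^esub> \<iota> (inv\<^bsub>G\<^esub> g) = \<iota> (inv\<^bsub>G\<^esub> g) \<otimes>\<^bsub>A\<^esub> \<iota> h" for g h w \<xi>
  proof -
    note xi = character_simps[OF G.is_group that(4)]
    have "(\<iota> h \<otimes>\<^bsub>A\<^esub> w) \<otimes>\<^bsub>A\<^esub> \<iota> (inv\<^bsub>G\<^esub> g) = \<iota> h \<otimes>\<^bsub>A\<^esub> (\<xi> (inv\<^bsub>G\<^esub> g) \<odot>\<^bsub>A\<^esub> (\<iota> (inv\<^bsub>G\<^esub> g) \<otimes>\<^bsub>A\<^esub> w))"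
      unfolding that(5)[symmetric] using that(1-3) by (simp add: A.m_assoc)
    also have "\<dots> = \<xi> (inv\<^bsub>G\<^esub> g) \<odot>\<^bsub>A\<^esub> ((\<iota> h \<otimes>\<^bsub>A\<^esub> \<iota> (inv\<^bsub>G\<^esub> g)) \<otimes>\<^bsub>A\<^esub> w)"
      using that(1-3) by (simp add: A.mult_smult_right A.m_assoc)
    also have "\<dots> = \<xi> (inv\<^bsub>G\<^esub> g) \<odot>\<^bsub>A\<^esub> (\<iota> (inv\<^bsub>G\<^esub> g) \<otimes>\<^bsub>A\<^esub> (\<iota> h \<otimes>\<^bsub>A\<^esub> w))"
      unfolding that(6) using that(1-3) by (simp add: A.m_assoc)
    finally show ?thesis using that(1-3) xi(1)[of g]
      by (simp add: A.l_minus A.r_minus A.smult_minus A.smult_smult xi(4))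
  qed
  show thesis
  proof (rule hom_extension[OF A.opposite_k_algebra, of "\<lambda>g. \<iota> (inv\<^bsub>G\<^esub> g)" "\<ominus>\<^bsub>A\<^esub> (?b \<otimes>\<^bsub>A\<^esub> x)" "\<ominus>\<^bsub>A\<^esub> (?c \<otimes>\<^bsub>A\<^esub> y)"])
    show "\<iota> (inv\<^bsub>G\<^esub> (g \<otimes>\<^bsub>G\<^esub> h)) = \<iota> (inv\<^bsub>G\<^esub> g) \<otimes>\<^bsub>opposite A\<^esub> \<iota> (inv\<^bsub>G\<^esub> h)" if "g \<in> carrier G" "h \<in> carrier G" for g h
      using that by (simp add: G.inv_mult_group iota_mult)
    show "(\<ominus>\<^bsub>A\<^esub> (?b \<otimes>\<^bsub>A\<^esub> x)) \<otimes>\<^bsub>opposite A\<^esub> \<iota> (inv\<^bsub>G\<^esub> g) = \<chi> g \<odot>\<^bsub>opposite A\<^esub> (\<iota> (inv\<^bsub>G\<^esub> g) \<otimes>\<^bsub>opposite A\<^esub> (\<ominus>\<^bsub>A\<^esub> (?b \<otimes>\<^bsub>A\<^esub> x)))"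
      if "g \<in> carrier G" for g
      using rel[OF that _ x_closed chi_character x_iota comm(1)] that by simp
    show "(\<ominus>\<^bsub>A\<^esub> (?c \<otimes>\<^bsub>A\<^esub> y)) \<otimes>\<^bsub>opposite A\<^esub> \<iota> (inv\<^bsub>G\<^esub> g) = \<eta> g \<odot>\<^bsub>opposite A\<^esub> (\<iota> (inv\<^bsub>G\<^esub> g) \<otimes>\<^bsub>opposite A\<^esub> (\<ominus>\<^bsub>A\<^esub> (?c \<otimes>\<^bsub>A\<^esub> y)))"
      if "g \<in> carrier G" for g
      using rel[OF that _ y_closed eta_character y_iota comm(2)] that by simp
    let ?cb = "\<iota> (c \<otimes>\<^bsub>G\<^esub> b)" and ?d = "\<iota> (inv\<^bsub>G\<^esub> (c \<otimes>\<^bsub>G\<^esub> b))"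
    have "?b \<otimes>\<^bsub>A\<^esub> ?c = ?d" by (simp add: G.inv_mult_group flip: iota_mult)
    moreover have "?c \<otimes>\<^bsub>A\<^esub> ?b = ?b \<otimes>\<^bsub>A\<^esub> ?c" using comm(2)[of "inv\<^bsub>G\<^esub> b"] by simp
    ultimately have d: "?b \<otimes>\<^bsub>A\<^esub> ?c = ?d" "?c \<otimes>\<^bsub>A\<^esub> ?b = ?d" "?d \<in> carrier A" by simp_all
    have q: "\<chi> (inv\<^bsub>G\<^esub> c) = \<eta> b" "\<eta> b * \<eta> (inv\<^bsub>G\<^esub> b) = 1"
      using eta_simps(1,4)[of b] chi_simps(4)[of c] eta_b by simp_all
    have 1: "(?b \<otimes>\<^bsub>A\<^esub> x) \<otimes>\<^bsub>A\<^esub> (?c \<otimes>\<^bsub>A\<^esub> y) = \<eta> b \<odot>\<^bsub>A\<^esub> (?d \<otimes>\<^bsub>A\<^esub> (x \<otimes>\<^bsub>A\<^esub> y))"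
    proof -
      have "(?b \<otimes>\<^bsub>A\<^esub> x) \<otimes>\<^bsub>A\<^esub> (?c \<otimes>\<^bsub>A\<^esub> y) = ?b \<otimes>\<^bsub>A\<^esub> ((x \<otimes>\<^bsub>A\<^esub> ?c) \<otimes>\<^bsub>A\<^esub> y)" by (simp add: A.m_assoc)
      also have "\<dots> = \<eta> b \<odot>\<^bsub>A\<^esub> ((?b \<otimes>\<^bsub>A\<^esub> ?c) \<otimes>\<^bsub>A\<^esub> (x \<otimes>\<^bsub>A\<^esub> y))"
        by (simp add: x_iota q A.mult_smult_left A.mult_smult_right A.m_assoc)
      finally show ?thesis by (simp only: d)
    qed
    \<comment> \<open>With d = (c b)^-1, multiplying \<beta>(1 - c b) by d gives \<beta>(d - 1), the
      negative of the term \<beta>(1 - d) that the relation in the opposite algebra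
      contains.\<close>
    have 2: "\<eta> b \<odot>\<^bsub>A\<^esub> ((?c \<otimes>\<^bsub>A\<^esub> y) \<otimes>\<^bsub>A\<^esub> (?b \<otimes>\<^bsub>A\<^esub> x)) = \<eta> b \<odot>\<^bsub>A\<^esub> (?d \<otimes>\<^bsub>A\<^esub> (x \<otimes>\<^bsub>A\<^esub> y)) \<oplus>\<^bsub>A\<^esub> \<beta> \<odot>\<^bsub>A\<^esub> (?d \<ominus>\<^bsub>A\<^esub> \<one>\<^bsub>A\<^esub>)"
    proof -
      have "(?c \<otimes>\<^bsub>A\<^esub> y) \<otimes>\<^bsub>A\<^esub> (?b \<otimes>\<^bsub>A\<^esub> x) = ?c \<otimes>\<^bsub>A\<^esub> ((y \<otimes>\<^bsub>A\<^esub> ?b) \<otimes>\<^bsub>A\<^esub> x)" by (simp add: A.m_assoc)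
      also have "\<dots> = \<eta> (inv\<^bsub>G\<^esub> b) \<odot>\<^bsub>A\<^esub> ((?c \<otimes>\<^bsub>A\<^esub> ?b) \<otimes>\<^bsub>A\<^esub> (y \<otimes>\<^bsub>A\<^esub> x))"
        by (simp add: y_iota A.mult_smult_left A.mult_smult_right A.m_assoc)
      finally have "\<eta> b \<odot>\<^bsub>A\<^esub> ((?c \<otimes>\<^bsub>A\<^esub> y) \<otimes>\<^bsub>A\<^esub> (?b \<otimes>\<^bsub>A\<^esub> x)) = ?d \<otimes>\<^bsub>A\<^esub> (y \<otimes>\<^bsub>A\<^esub> x)"
        using q(2) d(3) by (simp add: d(2) A.smult_smult)
      also have "\<dots> = \<eta> b \<odot>\<^bsub>A\<^esub> (?d \<otimes>\<^bsub>A\<^esub> (x \<otimes>\<^bsub>A\<^esub> y)) \<oplus>\<^bsub>A\<^esub> \<beta> \<odot>\<^bsub>A\<^esub> (?d \<ominus>\<^bsub>A\<^esub> ?d \<otimes>\<^bsub>A\<^esub> ?cb)"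
        using d(3) unfolding y_x by (simp add: A.r_distr A.mult_smult_right a_minus_def A.r_minus)
      finally show ?thesis by (simp add: iota_inv)
    qed
    have 3: "\<beta> \<odot>\<^bsub>A\<^esub> (?d \<ominus>\<^bsub>A\<^esub> \<one>\<^bsub>A\<^esub>) \<oplus>\<^bsub>A\<^esub> \<beta> \<odot>\<^bsub>A\<^esub> (\<one>\<^bsub>A\<^esub> \<ominus>\<^bsub>A\<^esub> ?d) = \<zero>\<^bsub>A\<^esub>"
    proof -
      have "(?d \<ominus>\<^bsub>A\<^esub> \<one>\<^bsub>A\<^esub>) \<oplus>\<^bsub>A\<^esub> (\<one>\<^bsub>A\<^esub> \<ominus>\<^bsub>A\<^esub> ?d) = \<zero>\<^bsub>A\<^esub>"
        using d(3) by (simp add: a_minus_def A.a_assoc A.r_neg1 A.r_neg)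
      then show ?thesis using d(3) A.smult_add_right[of "?d \<ominus>\<^bsub>A\<^esub> \<one>\<^bsub>A\<^esub>" "\<one>\<^bsub>A\<^esub> \<ominus>\<^bsub>A\<^esub> ?d" \<beta>] by simp
    qed
    have am: "u \<ominus>\<^bsub>opposite A\<^esub> v = u \<ominus>\<^bsub>A\<^esub> v" if "u \<in> carrier A" "v \<in> carrier A" for u v
    proof -
      interpret O: k_alg "opposite A" by unfold_locales (rule A.opposite_k_algebra)
      show ?thesis using that by (simp add: a_minus_def A.minus_eq_smult O.minus_eq_smult)
    qed
    show "(\<ominus>\<^bsub>A\<^esub> (?c \<otimes>\<^bsub>A\<^esub> y)) \<otimes>\<^bsub>opposite A\<^esub> (\<ominus>\<^bsub>A\<^esub> (?b \<otimes>\<^bsub>A\<^esub> x)) =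
        \<eta> b \<odot>\<^bsub>opposite A\<^esub> ((\<ominus>\<^bsub>A\<^esub> (?b \<otimes>\<^bsub>A\<^esub> x)) \<otimes>\<^bsub>opposite A\<^esub> (\<ominus>\<^bsub>A\<^esub> (?c \<otimes>\<^bsub>A\<^esub> y))) \<oplus>\<^bsub>opposite A\<^esub>
        \<beta> \<odot>\<^bsub>opposite A\<^esub> (\<one>\<^bsub>opposite A\<^esub> \<ominus>\<^bsub>opposite A\<^esub> ?d)"
      using 1 2 3 d(3) by (simp add: am A.l_minus A.r_minus A.a_assoc)
  qed (use that in \<open>simp_all add: iota_one\<close>)
qed

end

section \<open>The Hopf algebra structure\<close>

locale H_hopf_presentation = H_presentation G A \<chi> \<eta> b c \<beta> \<iota> x y
  for G :: "('g, 'm) monoid_scheme" and A :: "('k::field, 'a, 'n) bialgebra_scheme"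
    and \<chi> \<eta> b c \<beta> \<iota> x y +
  assumes comult_hom: "comult A \<in> k_algebra_homs A (tensor_algebra A A)"
    and comult_iota: "g \<in> carrier G \<Longrightarrow> comult A (\<iota> g) = pure_tensor A A (\<iota> g) (\<iota> g)"
    and comult_x: "comult A x = pure_tensor A A x \<one>\<^bsub>A\<^esub> \<oplus>\<^bsub>tensor_algebra A A\<^esub> pure_tensor A A (\<iota> b) x"
    and comult_y: "comult A y = pure_tensor A A y \<one>\<^bsub>A\<^esub> \<oplus>\<^bsub>tensor_algebra A A\<^esub> pure_tensor A A (\<iota> c) y"
    and counit_hom: "counit A \<in> k_algebra_homs A scalar_algebra"
    and counit_iota: "g \<in> carrier G \<Longrightarrow> counit A (\<iota> g) = 1"
    and counit_x: "counit A x = 0" and counit_y: "counit A y = 0"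
begin

abbreviation "\<Delta> \<equiv> comult A"
abbreviation "\<epsilon> \<equiv> counit A"

lemmas Delta = k_algebra_homsD[OF comult_hom]

lemma counit_simps:
  "u \<in> carrier A \<Longrightarrow> v \<in> carrier A \<Longrightarrow> \<epsilon> (u \<oplus>\<^bsub>A\<^esub> v) = \<epsilon> u + \<epsilon> v"
  "u \<in> carrier A \<Longrightarrow> v \<in> carrier A \<Longrightarrow> \<epsilon> (u \<otimes>\<^bsub>A\<^esub> v) = \<epsilon> u * \<epsilon> v"
  "u \<in> carrier A \<Longrightarrow> \<epsilon> (k \<odot>\<^bsub>A\<^esub> u) = k * \<epsilon> u" "\<epsilon> \<one>\<^bsub>A\<^esub> = 1"
  using k_algebra_homsD[OF counit_hom] by simp_all

lemma comult_one: "\<Delta> \<one>\<^bsub>A\<^esub> = p \<one>\<^bsub>A\<^esub> \<one>\<^bsub>A\<^esub>"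
  using Delta(6) by (simp add: T.pure_one)

abbreviation "W \<equiv> tensor_algebra A TA"
abbreviation "p3 \<equiv> pure_tensor A TA"

sublocale T3: tensor A TA
  by unfold_locales

lemmas p3_linear = k_bilinearD[OF T3.pure_bilinear]

text \<open>The regrouping of (u \<otimes> w) \<otimes> v as u \<otimes> (w \<otimes> v).
  Coassociativity nests one \<open>tensor_lift\<close> inside another; this is the inner one, and
  its bilinearity in \<open>t\<close> and \<open>v\<close> makes the outer one well defined.\<close>

definition assoc_map :: "('a \<times> 'a \<Rightarrow>\<^sub>0 'k) set \<Rightarrow> 'a \<Rightarrow> ('a \<times> ('a \<times> 'a \<Rightarrow>\<^sub>0 'k) set \<Rightarrow>\<^sub>0 'k) set" where
  "assoc_map t v = tensor_lift W (\<lambda>u\<^sub>1 u\<^sub>2. p3 u\<^sub>1 (p u\<^sub>2 v)) t"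

lemma assoc_bilinear:
  assumes "v \<in> carrier A"
  shows "k_bilinear A A W (\<lambda>u\<^sub>1 u\<^sub>2. p3 u\<^sub>1 (p u\<^sub>2 v))"
  by (rule k_bilinearI) (use assms in \<open>simp_all add: T3.pure_closed T.pure_closed p_linear p3_linear\<close>)

lemma assoc_map_pure:
  "u \<in> carrier A \<Longrightarrow> w \<in> carrier A \<Longrightarrow> v \<in> carrier A \<Longrightarrow> assoc_map (p u w) v = p3 u (p w v)"
  unfolding assoc_map_def by (rule T.tensor_lift_pure[OF T3.tensor_k_algebra assoc_bilinear])

lemma assoc_map_linear_left: "v \<in> carrier A \<Longrightarrow> (\<lambda>t. assoc_map t v) \<in> k_linear_maps TA W"
  unfolding assoc_map_def by (rule T.tensor_lift_linear[OF T3.tensor_k_algebra assoc_bilinear])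

text \<open>Here \<open>v\<close> is a parameter of the lifted map and not an argument of the lift,
  so linearity does not come from \<open>tensor_lift_linear\<close>; it is obtained by induction on
  the tensor.\<close>

lemma assoc_map_linear_right:
  assumes "t \<in> carrier TA"
  shows "assoc_map t \<in> k_linear_maps A W"
  using assms
proof (induction rule: T.tensor_induct)
  case (pure u w)
  then show ?case
    by (intro k_linear_mapsI)
      (simp_all add: assoc_map_pure T3.pure_closed T.pure_closed p_linear p3_linear)
next
  case (add s t)
  note s = k_linear_mapsD[OF add(3)] and t = k_linear_mapsD[OF add(4)]
  have st: "assoc_map (s \<oplus>\<^bsub>TA\<^esub> t) v = assoc_map s v \<oplus>\<^bsub>W\<^esub> assoc_map t v" if "v \<in> carrier A" for v
    using k_linear_mapsD(2)[OF assoc_map_linear_left[OF that] add(1,2)] .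
  show ?case
    by (intro k_linear_mapsI)
      (simp_all add: st s t T3.T.smult_add_right T3.T.a_ac)
qed

lemma assoc_map_mult:
  assumes "s \<in> carrier TA" "t \<in> carrier TA" "v \<in> carrier A" "w \<in> carrier A"
  shows "assoc_map (s \<otimes>\<^bsub>TA\<^esub> t) (v \<otimes>\<^bsub>A\<^esub> w) = assoc_map s v \<otimes>\<^bsub>W\<^esub> assoc_map t w"
  using assms(1)
proof (induction rule: T.tensor_induct)
  case (pure a a')
  note a = pure
  from assms(2) show ?case
  proof (induction rule: T.tensor_induct)
    case (pure d d')
    then show ?case using a assms(3,4)
      by (simp add: T.pure_mult assoc_map_pure T3.pure_mult T.pure_closed)
  next
    case (add t t')
    note L = k_linear_mapsD[OF assoc_map_linear_left]
    show ?case using a add assms(3,4)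
      by (simp add: T.T.r_distr T.pure_closed L T3.T.r_distr)
  qed
next
  case (add s s')
  note L = k_linear_mapsD[OF assoc_map_linear_left]
  show ?case using add assms(2-4) by (simp add: T.T.l_distr L T3.T.l_distr)
qed

text \<open>Both sides are composites of algebra maps, so they need comparing only on G, x and
  y.\<close>

lemma coassociative:
  assumes "h \<in> carrier A"
  shows "tensor_lift W (\<lambda>u v. assoc_map (\<Delta> u) v) (\<Delta> h) = tensor_lift W (\<lambda>u v. p3 u (\<Delta> v)) (\<Delta> h)"
proof -
  note L = k_linear_mapsD[OF assoc_map_linear_left] and R = k_linear_mapsD[OF assoc_map_linear_right]
  have b1: "k_bilinear A A W (\<lambda>u v. assoc_map (\<Delta> u) v)"
    by (rule k_bilinearI) (simp_all add: L R Delta)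
  have b2: "k_bilinear A A W (\<lambda>u v. p3 u (\<Delta> v))"
    by (rule k_bilinearI) (simp_all add: p3_linear Delta T3.pure_closed)
  have unit: "p3 \<one>\<^bsub>A\<^esub> (p \<one>\<^bsub>A\<^esub> \<one>\<^bsub>A\<^esub>) = \<one>\<^bsub>W\<^esub>"
    by (simp add: T.pure_one T3.pure_one)
  have h1: "tensor_lift W (\<lambda>u v. assoc_map (\<Delta> u) v) \<in> k_algebra_homs TA W"
    by (rule T.tensor_lift_hom[OF T3.tensor_k_algebra b1])
      (simp_all add: Delta(2,5) assoc_map_mult comult_one assoc_map_pure unit)
  have h2: "tensor_lift W (\<lambda>u v. p3 u (\<Delta> v)) \<in> k_algebra_homs TA W"
    by (rule T.tensor_lift_hom[OF T3.tensor_k_algebra b2])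
      (simp_all add: Delta(2,5) T3.pure_mult comult_one T.pure_one T3.pure_one)
  note l1 = T.tensor_lift_pure[OF T3.tensor_k_algebra b1] and l2 = T.tensor_lift_pure[OF T3.tensor_k_algebra b2]
  note H1 = k_algebra_homsD[OF h1] and H2 = k_algebra_homsD[OF h2]
  \<comment> \<open>Common to x and y: both sides equal w \<otimes> 1 \<otimes> 1 + g \<otimes> w
    \<otimes> 1 + g \<otimes> g \<otimes> w.\<close>
  have prim: "tensor_lift W (\<lambda>u v. assoc_map (\<Delta> u) v) (\<Delta> w) = tensor_lift W (\<lambda>u v. p3 u (\<Delta> v)) (\<Delta> w)"
    if "\<Delta> w = p w \<one>\<^bsub>A\<^esub> \<oplus>\<^bsub>TA\<^esub> p (\<iota> g) w" "w \<in> carrier A" "g \<in> carrier G" for w g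
    using that
    by (simp add: H1 H2 l1 l2 T.pure_closed T3.pure_closed comult_iota comult_one L assoc_map_pure p3_linear T3.T.a_assoc)
  show ?thesis
    by (rule hom_unique[OF k_algebra_homs_comp[OF comult_hom h1] k_algebra_homs_comp[OF comult_hom h2] _ _ _ assms])
      (simp_all add: prim[OF comult_x] prim[OF comult_y] comult_iota l1 l2 assoc_map_pure)
qed

text \<open>The two contractions with \<epsilon> are algebra maps because scalars commute with
  everything; hence generators decide again.\<close>

lemma counit_left:
  assumes "h \<in> carrier A"
  shows "tensor_lift A (\<lambda>u v. \<epsilon> u \<odot>\<^bsub>A\<^esub> v) (\<Delta> h) = h" "tensor_lift A (\<lambda>u v. \<epsilon> v \<odot>\<^bsub>A\<^esub> u) (\<Delta> h) = h"
proof -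
  have b1: "k_bilinear A A A (\<lambda>u v. \<epsilon> u \<odot>\<^bsub>A\<^esub> v)" and b2: "k_bilinear A A A (\<lambda>u v. \<epsilon> v \<odot>\<^bsub>A\<^esub> u)"
    by (rule k_bilinearI; simp add: counit_simps A.smult_add_left A.smult_add_right A.smult_smult mult.commute)+
  have h1: "tensor_lift A (\<lambda>u v. \<epsilon> u \<odot>\<^bsub>A\<^esub> v) \<in> k_algebra_homs TA A"
    by (rule T.tensor_lift_hom[OF A.k_algebra b1])
      (simp_all add: counit_simps A.mult_smult_left A.mult_smult_right A.smult_smult mult.commute)
  have h2: "tensor_lift A (\<lambda>u v. \<epsilon> v \<odot>\<^bsub>A\<^esub> u) \<in> k_algebra_homs TA A"
    by (rule T.tensor_lift_hom[OF A.k_algebra b2])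
      (simp_all add: counit_simps A.mult_smult_left A.mult_smult_right A.smult_smult mult.commute)
  have id: "(\<lambda>u. u) \<in> k_algebra_homs A A" by (auto intro!: k_algebra_homsI k_linear_mapsI)
  note l1 = T.tensor_lift_pure[OF A.k_algebra b1] and l2 = T.tensor_lift_pure[OF A.k_algebra b2]
  note H1 = k_algebra_homsD[OF h1] and H2 = k_algebra_homsD[OF h2]
  show "tensor_lift A (\<lambda>u v. \<epsilon> u \<odot>\<^bsub>A\<^esub> v) (\<Delta> h) = h"
    by (rule hom_unique[OF k_algebra_homs_comp[OF comult_hom h1] id _ _ _ assms])
      (simp_all add: comult_x comult_y comult_iota l1 H1 T.pure_closed counit_simps counit_iota counit_x counit_y)
  show "tensor_lift A (\<lambda>u v. \<epsilon> v \<odot>\<^bsub>A\<^esub> u) (\<Delta> h) = h"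
    by (rule hom_unique[OF k_algebra_homs_comp[OF comult_hom h2] id _ _ _ assms])
      (simp_all add: comult_x comult_y comult_iota l2 H2 T.pure_closed counit_simps counit_iota counit_x counit_y)
qed

lemma bialgebra: "is_bialgebra A"
proof -
  have "\<epsilon> \<in> ring_hom A scalar_ring"
    by (rule ring_hom_memI) (simp_all add: counit_simps)
  then show ?thesis
    unfolding is_bialgebra_def
    using A.k_algebra comult_hom counit_simps(3) coassociative[unfolded assoc_map_def] counit_left by blast
qed

text \<open>A map pinned down on the generators, with which calculations can be made. The arbitrary
  choice \<open>antipode\<close> is identified with it in \<open>antipode_unique\<close>.\<close>

definition S0 :: "'a \<Rightarrow> 'a" where
  "S0 = (SOME S. S \<in> k_algebra_homs A (opposite A) \<and> (\<forall>g\<in>carrier G. S (\<iota> g) = \<iota> (inv\<^bsub>G\<^esub> g)) \<and>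
     S x = \<ominus>\<^bsub>A\<^esub> (\<iota> (inv\<^bsub>G\<^esub> b) \<otimes>\<^bsub>A\<^esub> x) \<and> S y = \<ominus>\<^bsub>A\<^esub> (\<iota> (inv\<^bsub>G\<^esub> c) \<otimes>\<^bsub>A\<^esub> y))"

lemma S0: "S0 \<in> k_algebra_homs A (opposite A)" "g \<in> carrier G \<Longrightarrow> S0 (\<iota> g) = \<iota> (inv\<^bsub>G\<^esub> g)"
  "S0 x = \<ominus>\<^bsub>A\<^esub> (\<iota> (inv\<^bsub>G\<^esub> b) \<otimes>\<^bsub>A\<^esub> x)" "S0 y = \<ominus>\<^bsub>A\<^esub> (\<iota> (inv\<^bsub>G\<^esub> c) \<otimes>\<^bsub>A\<^esub> y)"
proof -
  have "\<exists>S. S \<in> k_algebra_homs A (opposite A) \<and> (\<forall>g\<in>carrier G. S (\<iota> g) = \<iota> (inv\<^bsub>G\<^esub> g)) \<and>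
     S x = \<ominus>\<^bsub>A\<^esub> (\<iota> (inv\<^bsub>G\<^esub> b) \<otimes>\<^bsub>A\<^esub> x) \<and> S y = \<ominus>\<^bsub>A\<^esub> (\<iota> (inv\<^bsub>G\<^esub> c) \<otimes>\<^bsub>A\<^esub> y)"
    by (rule antipode_hom_exists) blast
  from someI_ex[OF this, folded S0_def]
  show "S0 \<in> k_algebra_homs A (opposite A)" "g \<in> carrier G \<Longrightarrow> S0 (\<iota> g) = \<iota> (inv\<^bsub>G\<^esub> g)"
    "S0 x = \<ominus>\<^bsub>A\<^esub> (\<iota> (inv\<^bsub>G\<^esub> b) \<otimes>\<^bsub>A\<^esub> x)" "S0 y = \<ominus>\<^bsub>A\<^esub> (\<iota> (inv\<^bsub>G\<^esub> c) \<otimes>\<^bsub>A\<^esub> y)" by blast+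
qed

lemmas S0_simps = k_algebra_homsD[OF S0(1), simplified]

lemma S0_linear: "S0 \<in> k_linear_maps A A"
  by (rule k_linear_mapsI) (simp_all add: S0_simps)

lemma convolution_bilinear:
  assumes "S \<in> k_linear_maps A A"
  shows "k_bilinear A A A (\<lambda>u v. S u \<otimes>\<^bsub>A\<^esub> v)" "k_bilinear A A A (\<lambda>u v. u \<otimes>\<^bsub>A\<^esub> S v)"
  by (rule k_bilinearI;
      simp add: k_linear_mapsD[OF assms] A.l_distr A.r_distr A.mult_smult_left A.mult_smult_right)+

abbreviation "conv_left S \<equiv> tensor_lift A (\<lambda>u v. S u \<otimes>\<^bsub>A\<^esub> v)"
abbreviation "conv_right S \<equiv> tensor_lift A (\<lambda>u v. u \<otimes>\<^bsub>A\<^esub> S v)"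

text \<open>In Sweedler notation, $S(h_1 k_1) h_2 k_2 = S(k_1) (S(h_1) h_2) k_2$ for an anti-homomorphism $S$.\<close>

lemma S0_antipode: "is_antipode A S0"
proof -
  note bl = convolution_bilinear(1)[OF S0_linear] and br = convolution_bilinear(2)[OF S0_linear]
  note L = k_linear_mapsD[OF T.tensor_lift_linear[OF A.k_algebra bl]]
    and R = k_linear_mapsD[OF T.tensor_lift_linear[OF A.k_algebra br]]
  note Lp = T.tensor_lift_pure[OF A.k_algebra bl] and Rp = T.tensor_lift_pure[OF A.k_algebra br]
  have bl2: "k_bilinear A A A (\<lambda>u v. S0 u \<otimes>\<^bsub>A\<^esub> (w \<otimes>\<^bsub>A\<^esub> v))" if "w \<in> carrier A" for w
    by (rule k_bilinearI; use that in \<open>simp add: S0_simps A.l_distr A.r_distr A.mult_smult_left A.mult_smult_right\<close>)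
  have br2: "k_bilinear A A A (\<lambda>u v. u \<otimes>\<^bsub>A\<^esub> (w \<otimes>\<^bsub>A\<^esub> S0 v))" if "w \<in> carrier A" for w
    by (rule k_bilinearI; use that in \<open>simp add: S0_simps A.l_distr A.r_distr A.mult_smult_left A.mult_smult_right\<close>)
  note L2 = k_linear_mapsD[OF T.tensor_lift_linear[OF A.k_algebra bl2]]
    and R2 = k_linear_mapsD[OF T.tensor_lift_linear[OF A.k_algebra br2]]
  note L2p = T.tensor_lift_pure[OF A.k_algebra bl2] and R2p = T.tensor_lift_pure[OF A.k_algebra br2]
  have ml: "conv_left S0 (s \<otimes>\<^bsub>TA\<^esub> t) = tensor_lift A (\<lambda>u v. S0 u \<otimes>\<^bsub>A\<^esub> (conv_left S0 s \<otimes>\<^bsub>A\<^esub> v)) t"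
    if s: "s \<in> carrier TA" and t: "t \<in> carrier TA" for s t
    using t
  proof (induction rule: T.tensor_induct)
    case (pure d d')
    note d = pure
    from s show ?case
    proof (induction rule: T.tensor_induct)
      case (pure a a')
      then show ?case using d by (simp add: T.pure_mult Lp L2p S0_simps A.m_assoc)
    next
      case (add s s')
      then show ?case using d
        by (simp add: T.T.l_distr T.pure_closed L L2p S0_simps A.l_distr A.r_distr)
    qed
  next
    case (add t t')
    then show ?case using s by (simp add: T.T.r_distr L L2)
  qed
  have mr: "conv_right S0 (t \<otimes>\<^bsub>TA\<^esub> s) = tensor_lift A (\<lambda>u v. u \<otimes>\<^bsub>A\<^esub> (conv_right S0 s \<otimes>\<^bsub>A\<^esub> S0 v)) t"
    if s: "s \<in> carrier TA" and t: "t \<in> carrier TA" for s t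
    using t
  proof (induction rule: T.tensor_induct)
    case (pure d d')
    note d = pure
    from s show ?case
    proof (induction rule: T.tensor_induct)
      case (pure a a')
      then show ?case using d by (simp add: T.pure_mult Rp R2p S0_simps A.m_assoc)
    next
      case (add s s')
      then show ?case using d
        by (simp add: T.T.r_distr T.pure_closed R R2p S0_simps A.l_distr A.r_distr)
    qed
  next
    case (add t t')
    then show ?case using s by (simp add: T.T.l_distr R R2)
  qed
  \<comment> \<open>In the product case the factor inserted in the middle is \<epsilon>(h) times 1
    by induction, and can be pulled out.\<close>
  have ml_scalar: "tensor_lift A (\<lambda>u v. S0 u \<otimes>\<^bsub>A\<^esub> ((k \<odot>\<^bsub>A\<^esub> \<one>\<^bsub>A\<^esub>) \<otimes>\<^bsub>A\<^esub> v)) t = k \<odot>\<^bsub>A\<^esub> conv_left S0 t"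
    and mr_scalar: "tensor_lift A (\<lambda>u v. u \<otimes>\<^bsub>A\<^esub> ((k \<odot>\<^bsub>A\<^esub> \<one>\<^bsub>A\<^esub>) \<otimes>\<^bsub>A\<^esub> S0 v)) t = k \<odot>\<^bsub>A\<^esub> conv_right S0 t"
    if "t \<in> carrier TA" for k t
    using that
    by (induction rule: T.tensor_induct)
      (simp_all add: Lp L2p L L2 Rp R2p R R2 S0_simps A.mult_smult_left A.mult_smult_right A.smult_add_right)
  have "conv_left S0 (\<Delta> h) = \<epsilon> h \<odot>\<^bsub>A\<^esub> \<one>\<^bsub>A\<^esub> \<and> conv_right S0 (\<Delta> h) = \<epsilon> h \<odot>\<^bsub>A\<^esub> \<one>\<^bsub>A\<^esub>" if "h \<in> carrier A" for h
    using that
  proof (induction rule: generators_induct)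
    case (iota g)
    then show ?case by (simp add: comult_iota Lp Rp S0 iota_inv counit_iota)
  next
    case x
    have "\<iota> b \<otimes>\<^bsub>A\<^esub> (\<iota> (inv\<^bsub>G\<^esub> b) \<otimes>\<^bsub>A\<^esub> x) = x" by (simp add: iota_inv flip: A.m_assoc)
    then show ?case using S0_simps(6)
      by (simp add: comult_x L R Lp Rp S0 T.pure_closed counit_x A.l_neg A.r_neg A.r_minus)
  next
    case y
    have "\<iota> c \<otimes>\<^bsub>A\<^esub> (\<iota> (inv\<^bsub>G\<^esub> c) \<otimes>\<^bsub>A\<^esub> y) = y" by (simp add: iota_inv flip: A.m_assoc)
    then show ?case using S0_simps(6)
      by (simp add: comult_y L R Lp Rp S0 T.pure_closed counit_y A.l_neg A.r_neg A.r_minus)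
  next
    case (add u v)
    then show ?case by (simp add: Delta L R counit_simps A.smult_add_left)
  next
    case (smult k u)
    then show ?case by (simp add: Delta L R counit_simps A.smult_smult)
  next
    case (mult u v)
    then show ?case
      by (simp add: Delta(2,5) ml mr ml_scalar mr_scalar counit_simps A.smult_smult mult.commute)
  qed
  then show ?thesis using S0_linear by (simp add: is_antipode_def)
qed

lemma hopf_algebra: "is_hopf_algebra A"
  using bialgebra S0_antipode by (auto simp: is_hopf_algebra_def)

section \<open>Leading terms of the coproduct\<close>

text \<open>Remainders of \<Delta> are controlled through their left factors alone; right factors
  stay arbitrary, since both applications evaluate a map on the left factor.\<close>

definition left_span :: "('g \<times> nat \<times> nat \<Rightarrow> bool) \<Rightarrow> ('a \<times> 'a \<Rightarrow>\<^sub>0 'k) set set" where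
  "left_span P = k_span TA {p (mon t) v | t v. t \<in> Ind \<and> P t \<and> v \<in> carrier A}"

lemma left_span_generators: "{p (mon t) v | t v. t \<in> Ind \<and> P t \<and> v \<in> carrier A} \<subseteq> carrier TA"
  by (auto intro!: T.pure_closed M.basis_closed)

lemma left_span_submodule: "submodule (left_span P) scalar_ring TA"
  unfolding left_span_def by (rule T.T.k_span_submodule[OF left_span_generators])

lemmas left_spanD = T.T.submoduleD[OF left_span_submodule]

lemma left_span_carrier: "r \<in> left_span P \<Longrightarrow> r \<in> carrier TA"
  using left_spanD(1) by auto

lemma left_span_pure:
  assumes "\<exists>k t. u = k \<odot>\<^bsub>A\<^esub> mon t \<and> t \<in> Ind \<and> P t" "v \<in> carrier A"
  shows "p u v \<in> left_span P"
proof -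
  obtain k t where t: "u = k \<odot>\<^bsub>A\<^esub> mon t" "t \<in> Ind" "P t" using assms(1) by blast
  have "p (mon t) v \<in> left_span P" unfolding left_span_def
    by (rule T.T.k_span_base) (use t assms in auto)
  then have "k \<odot>\<^bsub>TA\<^esub> p (mon t) v \<in> left_span P" by (rule left_spanD(4))
  then show ?thesis using t assms(2) M.basis_closed[OF t(2)] by (simp add: p_linear)
qed

text \<open>Right multiplication by w \<otimes> 1 + h \<otimes> w replaces a left factor m by m w or
  m h. The two conditions say that these remain multiples of monomials of the new kind.\<close>

lemma left_span_mult:
  assumes r: "r \<in> left_span P" and w: "w \<in> carrier A" "h \<in> carrier G"
    and step: "\<And>t. t \<in> Ind \<Longrightarrow> P t \<Longrightarrow> \<exists>k t'. mon t \<otimes>\<^bsub>A\<^esub> w = k \<odot>\<^bsub>A\<^esub> mon t' \<and> t' \<in> Ind \<and> P' t'"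
      "\<And>t. t \<in> Ind \<Longrightarrow> P t \<Longrightarrow> \<exists>k t'. mon t \<otimes>\<^bsub>A\<^esub> \<iota> h = k \<odot>\<^bsub>A\<^esub> mon t' \<and> t' \<in> Ind \<and> P' t'"
  shows "r \<otimes>\<^bsub>TA\<^esub> (p w \<one>\<^bsub>A\<^esub> \<oplus>\<^bsub>TA\<^esub> p (\<iota> h) w) \<in> left_span P'"
proof -
  have Wc: "p w \<one>\<^bsub>A\<^esub> \<oplus>\<^bsub>TA\<^esub> p (\<iota> h) w \<in> carrier TA" using w by (simp add: T.pure_closed)
  interpret F: k_linear TA TA "\<lambda>r. r \<otimes>\<^bsub>TA\<^esub> (p w \<one>\<^bsub>A\<^esub> \<oplus>\<^bsub>TA\<^esub> p (\<iota> h) w)"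
    by (rule k_linearI[OF T.tensor_k_algebra T.tensor_k_algebra T.T.mult_linear(2)[OF Wc]])
  show ?thesis
  proof (rule F.span_into[OF left_span_generators left_span_submodule _ r[unfolded left_span_def]])
    fix s assume "s \<in> {p (mon t) v | t v. t \<in> Ind \<and> P t \<and> v \<in> carrier A}"
    then obtain t v where t: "s = p (mon t) v" "t \<in> Ind" "P t" "v \<in> carrier A" by blast
    have m: "mon t \<in> carrier A" using M.basis_closed[OF t(2)] .
    have "s \<otimes>\<^bsub>TA\<^esub> (p w \<one>\<^bsub>A\<^esub> \<oplus>\<^bsub>TA\<^esub> p (\<iota> h) w) = p (mon t \<otimes>\<^bsub>A\<^esub> w) v \<oplus>\<^bsub>TA\<^esub> p (mon t \<otimes>\<^bsub>A\<^esub> \<iota> h) (v \<otimes>\<^bsub>A\<^esub> w)"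
      using t(1,4) m w by (simp add: T.T.r_distr T.pure_mult T.pure_closed)
    also have "\<dots> \<in> left_span P'"
      by (intro left_spanD(3) left_span_pure step t A.m_closed w)
    finally show "s \<otimes>\<^bsub>TA\<^esub> (p w \<one>\<^bsub>A\<^esub> \<oplus>\<^bsub>TA\<^esub> p (\<iota> h) w) \<in> left_span P'" .
  qed
qed

lemma mon_iota:
  assumes "g \<in> carrier G" "h \<in> carrier G"
  shows "\<exists>k. mon (g, i, j) \<otimes>\<^bsub>A\<^esub> \<iota> h = k \<odot>\<^bsub>A\<^esub> mon (g \<otimes>\<^bsub>G\<^esub> h, i, j)"
proof
  let ?xi = "x [^]\<^bsub>A\<^esub> i" and ?yj = "y [^]\<^bsub>A\<^esub> j"
  have "mon (g, i, j) \<otimes>\<^bsub>A\<^esub> \<iota> h = \<iota> g \<otimes>\<^bsub>A\<^esub> (?xi \<otimes>\<^bsub>A\<^esub> (?yj \<otimes>\<^bsub>A\<^esub> \<iota> h))"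
    using assms by (simp add: mon_eq A.m_assoc)
  also have "\<dots> = \<eta> h ^ j \<odot>\<^bsub>A\<^esub> (\<iota> g \<otimes>\<^bsub>A\<^esub> ((?xi \<otimes>\<^bsub>A\<^esub> \<iota> h) \<otimes>\<^bsub>A\<^esub> ?yj))"
    unfolding pow_iota(2)[OF assms(2)] using assms by (simp add: A.mult_smult_right A.m_assoc)
  also have "\<dots> = (\<eta> h ^ j * \<chi> h ^ i) \<odot>\<^bsub>A\<^esub> mon (g \<otimes>\<^bsub>G\<^esub> h, i, j)"
    unfolding pow_iota(1)[OF assms(2)] using assms
    by (simp add: A.mult_smult_left A.mult_smult_right A.m_assoc A.smult_smult mon_eq iota_mult)
  finally show "mon (g, i, j) \<otimes>\<^bsub>A\<^esub> \<iota> h = (\<eta> h ^ j * \<chi> h ^ i) \<odot>\<^bsub>A\<^esub> mon (g \<otimes>\<^bsub>G\<^esub> h, i, j)" .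
qed

text \<open>Right multiplication by x gives a monomial as long as no y has been attached, hence the
  restriction to exponent 0. This dictates the order in \<open>comult_mon\<close>: all factors x,
  then all factors y.\<close>

lemma mon_x: "g \<in> carrier G \<Longrightarrow> mon (g, i, 0) \<otimes>\<^bsub>A\<^esub> x = mon (g, Suc i, 0)"
  and mon_y: "g \<in> carrier G \<Longrightarrow> mon (g, i, j) \<otimes>\<^bsub>A\<^esub> y = mon (g, i, Suc j)"
  by (simp_all add: mon_def A.m_assoc)

text \<open>The only summand of \<open>\<Delta>(g x^i y^j)\<close> whose left factor has full degree is \<open>g x^i y^j \<otimes> g\<close>.\<close>

lemma comult_mon:
  assumes g: "g \<in> carrier G"
  shows "\<exists>r\<in>left_span (\<lambda>(g', i', j'). i' + j' < i + j). \<Delta> (mon (g, i, j)) = p (mon (g, i, j)) (\<iota> g) \<oplus>\<^bsub>TA\<^esub> r"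
proof -
  \<comment> \<open>Attaching one more factor w turns u \<otimes> g into u w \<otimes> g plus u h
    \<otimes> g w, and the left factor of the latter still has the old degree.\<close>
  have step: "\<exists>r'\<in>left_span P'. \<Delta> (u \<otimes>\<^bsub>A\<^esub> w) = p (u \<otimes>\<^bsub>A\<^esub> w) (\<iota> g) \<oplus>\<^bsub>TA\<^esub> r'"
    if ih: "\<exists>r\<in>left_span P. \<Delta> u = p u (\<iota> g) \<oplus>\<^bsub>TA\<^esub> r" and u: "u \<in> carrier A" and w: "w \<in> carrier A" "h \<in> carrier G"
      and Dw: "\<Delta> w = p w \<one>\<^bsub>A\<^esub> \<oplus>\<^bsub>TA\<^esub> p (\<iota> h) w"
      and st: "\<And>t. t \<in> Ind \<Longrightarrow> P t \<Longrightarrow> \<exists>k t'. mon t \<otimes>\<^bsub>A\<^esub> w = k \<odot>\<^bsub>A\<^esub> mon t' \<and> t' \<in> Ind \<and> P' t'"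
        "\<And>t. t \<in> Ind \<Longrightarrow> P t \<Longrightarrow> \<exists>k t'. mon t \<otimes>\<^bsub>A\<^esub> \<iota> h = k \<odot>\<^bsub>A\<^esub> mon t' \<and> t' \<in> Ind \<and> P' t'"
        "\<exists>k t'. u \<otimes>\<^bsub>A\<^esub> \<iota> h = k \<odot>\<^bsub>A\<^esub> mon t' \<and> t' \<in> Ind \<and> P' t'"
    for u w h P P'
  proof -
    obtain r where r: "r \<in> left_span P" "\<Delta> u = p u (\<iota> g) \<oplus>\<^bsub>TA\<^esub> r" using ih by blast
    have rc: "r \<in> carrier TA" using r(1) by (rule left_span_carrier)
    let ?r = "p (u \<otimes>\<^bsub>A\<^esub> \<iota> h) (\<iota> g \<otimes>\<^bsub>A\<^esub> w) \<oplus>\<^bsub>TA\<^esub> r \<otimes>\<^bsub>TA\<^esub> (p w \<one>\<^bsub>A\<^esub> \<oplus>\<^bsub>TA\<^esub> p (\<iota> h) w)"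
    have "?r \<in> left_span P'"
      by (intro left_spanD(3) left_span_mult[OF r(1) w st(1,2)] left_span_pure[OF st(3)]) (use g w in auto)
    moreover have "\<Delta> (u \<otimes>\<^bsub>A\<^esub> w) = p (u \<otimes>\<^bsub>A\<^esub> w) (\<iota> g) \<oplus>\<^bsub>TA\<^esub> ?r"
    proof -
      have "\<Delta> (u \<otimes>\<^bsub>A\<^esub> w) = (p u (\<iota> g) \<oplus>\<^bsub>TA\<^esub> r) \<otimes>\<^bsub>TA\<^esub> (p w \<one>\<^bsub>A\<^esub> \<oplus>\<^bsub>TA\<^esub> p (\<iota> h) w)"
        using u w Delta(5)[of u w] r(2) Dw by simp
      also have "\<dots> = p u (\<iota> g) \<otimes>\<^bsub>TA\<^esub> (p w \<one>\<^bsub>A\<^esub> \<oplus>\<^bsub>TA\<^esub> p (\<iota> h) w) \<oplus>\<^bsub>TA\<^esub> r \<otimes>\<^bsub>TA\<^esub> (p w \<one>\<^bsub>A\<^esub> \<oplus>\<^bsub>TA\<^esub> p (\<iota> h) w)"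
        by (rule T.T.l_distr) (use u w g rc in \<open>simp_all add: T.pure_closed\<close>)
      also have "p u (\<iota> g) \<otimes>\<^bsub>TA\<^esub> (p w \<one>\<^bsub>A\<^esub> \<oplus>\<^bsub>TA\<^esub> p (\<iota> h) w) = p (u \<otimes>\<^bsub>A\<^esub> w) (\<iota> g) \<oplus>\<^bsub>TA\<^esub> p (u \<otimes>\<^bsub>A\<^esub> \<iota> h) (\<iota> g \<otimes>\<^bsub>A\<^esub> w)"
        using u w g by (simp add: T.T.r_distr T.pure_closed T.pure_mult)
      finally show ?thesis using u w g rc by (simp add: T.pure_closed T.T.a_assoc)
    qed
    ultimately show ?thesis by blast
  qed
  have mc: "mon (g, i, j) \<in> carrier A" for i j using g by simp
  have ex: "\<exists>k t'. u = k \<odot>\<^bsub>A\<^esub> mon t' \<and> t' \<in> Ind \<and> P t'" if "\<exists>k. u = k \<odot>\<^bsub>A\<^esub> mon t'" "t' \<in> Ind" "P t'" for u t' P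
    using that by blast
  have one: "\<exists>k. mon (g', i, j) = k \<odot>\<^bsub>A\<^esub> mon (g', i, j)" if "g' \<in> carrier G" for g' i j
    by (rule exI[of _ 1]) (use that in simp)
  \<comment> \<open>The condition j' = 0 is kept during this phase so that \<open>mon_x\<close>
    applies to the remainder as well.\<close>
  have base: "\<exists>r\<in>left_span (\<lambda>(g', i', j'). i' < i \<and> j' = 0). \<Delta> (mon (g, i, 0)) = p (mon (g, i, 0)) (\<iota> g) \<oplus>\<^bsub>TA\<^esub> r"
  proof (induction i)
    case 0
    show ?case
      by (rule bexI[of _ "\<zero>\<^bsub>TA\<^esub>"]) (use g left_spanD(2) in \<open>simp_all add: mon_generators comult_iota T.pure_closed\<close>)
  next
    case (Suc i)
    have "\<exists>r\<in>left_span (\<lambda>(g', i', j'). i' < Suc i \<and> j' = 0). \<Delta> (mon (g, i, 0) \<otimes>\<^bsub>A\<^esub> x) = p (mon (g, i, 0) \<otimes>\<^bsub>A\<^esub> x) (\<iota> g) \<oplus>\<^bsub>TA\<^esub> r"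
    proof (rule step[OF Suc mc x_closed b_closed comult_x])
      fix t assume t: "t \<in> Ind" "case t of (g', i', j') \<Rightarrow> i' < i \<and> j' = 0"
      obtain g' i' where t': "t = (g', i', 0)" "g' \<in> carrier G" "i' < i" using t by (cases t) auto
      show "\<exists>k t'. mon t \<otimes>\<^bsub>A\<^esub> x = k \<odot>\<^bsub>A\<^esub> mon t' \<and> t' \<in> Ind \<and> (case t' of (g', i', j') \<Rightarrow> i' < Suc i \<and> j' = 0)"
        unfolding t'(1) mon_x[OF t'(2)] by (rule ex[OF one[OF t'(2)]]) (use t' in auto)
      show "\<exists>k t'. mon t \<otimes>\<^bsub>A\<^esub> \<iota> b = k \<odot>\<^bsub>A\<^esub> mon t' \<and> t' \<in> Ind \<and> (case t' of (g', i', j') \<Rightarrow> i' < Suc i \<and> j' = 0)"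
        unfolding t'(1) by (rule ex[OF mon_iota[OF t'(2) b_closed]]) (use t' in auto)
    next
      show "\<exists>k t'. mon (g, i, 0) \<otimes>\<^bsub>A\<^esub> \<iota> b = k \<odot>\<^bsub>A\<^esub> mon t' \<and> t' \<in> Ind \<and> (case t' of (g', i', j') \<Rightarrow> i' < Suc i \<and> j' = 0)"
        by (rule ex[OF mon_iota[OF g b_closed]]) (use g in auto)
    qed
    then show ?case by (simp only: mon_x[OF g])
  qed
  show ?thesis
  proof (induction j)
    case 0
    have "left_span (\<lambda>(g', i', j'). i' < i \<and> j' = 0) \<subseteq> left_span (\<lambda>(g', i', j'). i' + j' < i + 0)"
      unfolding left_span_def by (rule T.T.k_span_mono) fastforce
    then show ?case using base by blast
  next
    case (Suc j)
    have "\<exists>r\<in>left_span (\<lambda>(g', i', j'). i' + j' < i + Suc j). \<Delta> (mon (g, i, j) \<otimes>\<^bsub>A\<^esub> y) = p (mon (g, i, j) \<otimes>\<^bsub>A\<^esub> y) (\<iota> g) \<oplus>\<^bsub>TA\<^esub> r"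
    proof (rule step[OF Suc mc y_closed c_closed comult_y])
      fix t assume t: "t \<in> Ind" "case t of (g', i', j') \<Rightarrow> i' + j' < i + j"
      obtain g' i' j' where t': "t = (g', i', j')" "g' \<in> carrier G" "i' + j' < i + j" using t by (cases t) auto
      show "\<exists>k t'. mon t \<otimes>\<^bsub>A\<^esub> y = k \<odot>\<^bsub>A\<^esub> mon t' \<and> t' \<in> Ind \<and> (case t' of (g', i', j') \<Rightarrow> i' + j' < i + Suc j)"
        unfolding t'(1) mon_y[OF t'(2)] by (rule ex[OF one[OF t'(2)]]) (use t' in auto)
      show "\<exists>k t'. mon t \<otimes>\<^bsub>A\<^esub> \<iota> c = k \<odot>\<^bsub>A\<^esub> mon t' \<and> t' \<in> Ind \<and> (case t' of (g', i', j') \<Rightarrow> i' + j' < i + Suc j)"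
        unfolding t'(1) by (rule ex[OF mon_iota[OF t'(2) c_closed]]) (use t' in auto)
    next
      show "\<exists>k t'. mon (g, i, j) \<otimes>\<^bsub>A\<^esub> \<iota> c = k \<odot>\<^bsub>A\<^esub> mon t' \<and> t' \<in> Ind \<and> (case t' of (g', i', j') \<Rightarrow> i' + j' < i + Suc j)"
        by (rule ex[OF mon_iota[OF g c_closed]]) (use g in auto)
    qed
    then show ?case by (simp only: mon_y[OF g])
  qed
qed

section \<open>Uniqueness, square and order of the antipode; pointedness\<close>

text \<open>Induction on the degree of a monomial m. Left factors of the remainder have smaller
  degree, so both antipodes agree there, and the axiom fixes S(m) g. As g is invertible, S(m) is
  determined.\<close>

lemma antipode_unique:
  assumes S: "is_antipode A S" and "h \<in> carrier A"
  shows "S h = S0 h"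
proof -
  have Sl: "S \<in> k_linear_maps A A" using S by (simp add: is_antipode_def)
  have "S (mon (g, i, j)) = S0 (mon (g, i, j))" if "g \<in> carrier G" "i + j = n" for g i j n
    using that
  proof (induction n arbitrary: g i j rule: less_induct)
    case (less n)
    note g = \<open>g \<in> carrier G\<close>
    let ?m = "mon (g, i, j)"
    have m: "?m \<in> carrier A" using g by simp
    obtain r where r: "r \<in> left_span (\<lambda>(g', i', j'). i' + j' < i + j)" "\<Delta> ?m = p ?m (\<iota> g) \<oplus>\<^bsub>TA\<^esub> r"
      using comult_mon[OF g] by blast
    have rc: "r \<in> carrier TA" using r(1) by (rule left_span_carrier)
    have split: "conv_left S' (\<Delta> ?m) = S' ?m \<otimes>\<^bsub>A\<^esub> \<iota> g \<oplus>\<^bsub>A\<^esub> conv_left S' r" if "S' \<in> k_linear_maps A A" for S'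
      unfolding r(2) using k_linear_mapsD(2)[OF T.tensor_lift_linear[OF A.k_algebra convolution_bilinear(1)[OF that]] _ rc]
        T.tensor_lift_pure[OF A.k_algebra convolution_bilinear(1)[OF that] m] m g by (simp add: T.pure_closed)
    interpret L: k_linear TA A "conv_left S"
      by (rule k_linearI[OF T.tensor_k_algebra A.k_algebra T.tensor_lift_linear[OF A.k_algebra convolution_bilinear(1)[OF Sl]]])
    have eq_r: "conv_left S r = conv_left S0 r"
    proof (rule L.eq_on_span[OF T.tensor_lift_linear[OF A.k_algebra convolution_bilinear(1)[OF S0_linear]]
          left_span_generators _ r(1)[unfolded left_span_def]])
      fix s assume "s \<in> {p (mon t) v | t v. t \<in> Ind \<and> (case t of (g', i', j') \<Rightarrow> i' + j' < i + j) \<and> v \<in> carrier A}"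
      then obtain g' i' j' v where t: "s = p (mon (g', i', j')) v" "g' \<in> carrier G" "i' + j' < i + j" "v \<in> carrier A" by auto
      have "S (mon (g', i', j')) = S0 (mon (g', i', j'))" using less t by auto
      then show "conv_left S s = conv_left S0 s" using t
        by (simp add: T.tensor_lift_pure[OF A.k_algebra convolution_bilinear(1)[OF Sl]]
            T.tensor_lift_pure[OF A.k_algebra convolution_bilinear(1)[OF S0_linear]])
    qed
    have "conv_left S (\<Delta> ?m) = conv_left S0 (\<Delta> ?m)"
      using S S0_antipode m by (simp add: is_antipode_def)
    then have "S ?m \<otimes>\<^bsub>A\<^esub> \<iota> g = S0 ?m \<otimes>\<^bsub>A\<^esub> \<iota> g"
      unfolding split[OF Sl] split[OF S0_linear] eq_r
      using k_linear_mapsD(1)[OF Sl m] k_linear_mapsD(1)[OF S0_linear m] g L.map_closed[OF rc] eq_r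
        A.add.right_cancel[of "conv_left S0 r" "S ?m \<otimes>\<^bsub>A\<^esub> \<iota> g" "S0 ?m \<otimes>\<^bsub>A\<^esub> \<iota> g"]
      by simp
    then have "S ?m \<otimes>\<^bsub>A\<^esub> \<iota> g \<otimes>\<^bsub>A\<^esub> \<iota> (inv\<^bsub>G\<^esub> g) = S0 ?m \<otimes>\<^bsub>A\<^esub> \<iota> g \<otimes>\<^bsub>A\<^esub> \<iota> (inv\<^bsub>G\<^esub> g)" by simp
    then show ?case using k_linear_mapsD(1)[OF Sl m] k_linear_mapsD(1)[OF S0_linear m] g
      by (simp add: A.m_assoc iota_inv)
  qed
  then have "S (mon t) = S0 (mon t)" if "t \<in> Ind" for t using that by (cases t) auto
  then show ?thesis using M.basis_linear_eq[OF A.k_algebra Sl S0_linear _ assms(2)] by blast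
qed

lemma antipode_eq: "h \<in> carrier A \<Longrightarrow> antipode A h = S0 h"
  unfolding antipode_def
  by (rule antipode_unique) (rule someI[of "is_antipode A", OF S0_antipode])

text \<open>Since S reverses products, S^2(x) = - S(x) S(b^-1) = b^-1 x b = \<chi>(b) x; the same
  with c and \<eta> for y.\<close>

lemma S0_S0: "g \<in> carrier G \<Longrightarrow> S0 (S0 (\<iota> g)) = \<iota> g" "S0 (S0 x) = \<chi> b \<odot>\<^bsub>A\<^esub> x" "S0 (S0 y) = \<eta> c \<odot>\<^bsub>A\<^esub> y"
proof -
  show "g \<in> carrier G \<Longrightarrow> S0 (S0 (\<iota> g)) = \<iota> g" by (simp add: S0)
  have min: "S0 (\<ominus>\<^bsub>A\<^esub> u) = \<ominus>\<^bsub>A\<^esub> S0 u" if "u \<in> carrier A" for u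
    using that by (simp add: A.minus_eq_smult S0_simps)
  have *: "\<ominus>\<^bsub>A\<^esub> ((\<ominus>\<^bsub>A\<^esub> (\<iota> (inv\<^bsub>G\<^esub> h) \<otimes>\<^bsub>A\<^esub> w)) \<otimes>\<^bsub>A\<^esub> \<iota> h) = \<xi> h \<odot>\<^bsub>A\<^esub> w"
    if "h \<in> carrier G" "w \<in> carrier A" "w \<otimes>\<^bsub>A\<^esub> \<iota> h = \<xi> h \<odot>\<^bsub>A\<^esub> (\<iota> h \<otimes>\<^bsub>A\<^esub> w)" for h w \<xi>
  proof -
    have "\<ominus>\<^bsub>A\<^esub> ((\<ominus>\<^bsub>A\<^esub> (\<iota> (inv\<^bsub>G\<^esub> h) \<otimes>\<^bsub>A\<^esub> w)) \<otimes>\<^bsub>A\<^esub> \<iota> h) = \<iota> (inv\<^bsub>G\<^esub> h) \<otimes>\<^bsub>A\<^esub> (w \<otimes>\<^bsub>A\<^esub> \<iota> h)"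
      using that(1,2) by (simp add: A.l_minus A.m_assoc)
    also have "\<dots> = \<xi> h \<odot>\<^bsub>A\<^esub> ((\<iota> (inv\<^bsub>G\<^esub> h) \<otimes>\<^bsub>A\<^esub> \<iota> h) \<otimes>\<^bsub>A\<^esub> w)"
      unfolding that(3) using that(1,2) by (simp add: A.mult_smult_right A.m_assoc)
    finally show ?thesis using that by (simp add: iota_inv)
  qed
  show "S0 (S0 x) = \<chi> b \<odot>\<^bsub>A\<^esub> x" "S0 (S0 y) = \<eta> c \<odot>\<^bsub>A\<^esub> y"
    using *[of b x \<chi>, OF b_closed x_closed x_iota[OF b_closed]] *[of c y \<eta>, OF c_closed y_closed y_iota[OF c_closed]]
    by (simp_all add: S0 min S0_simps)
qed

lemma S0_S0_hom: "(\<lambda>u. S0 (S0 u)) \<in> k_algebra_homs A A"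
  by (rule k_algebra_homsI) (auto intro!: k_linear_mapsI simp: S0_simps)

text \<open>The square of S is an algebra map that fixes G and scales x and y, so monomials are
  eigenvectors.\<close>

lemma S0_S0_mon:
  assumes "g \<in> carrier G"
  shows "((\<lambda>u. S0 (S0 u)) ^^ n) (mon (g, i, j)) = (\<chi> b ^ (n * i) * \<eta> c ^ (n * j)) \<odot>\<^bsub>A\<^esub> mon (g, i, j)"
proof -
  note H = k_algebra_homsD[OF S0_S0_hom]
  have pow: "S0 (S0 (w [^]\<^bsub>A\<^esub> m)) = k ^ m \<odot>\<^bsub>A\<^esub> w [^]\<^bsub>A\<^esub> m" if "w \<in> carrier A" "S0 (S0 w) = k \<odot>\<^bsub>A\<^esub> w" for w k and m :: nat
  proof (induction m)
    case 0
    then show ?case using H(6) by simp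
  next
    case (Suc m)
    then show ?case using that
      by (simp add: H(5) A.mult_smult_left A.mult_smult_right A.smult_smult mult.commute)
  qed
  have one: "S0 (S0 (mon (g, i, j))) = (\<chi> b ^ i * \<eta> c ^ j) \<odot>\<^bsub>A\<^esub> mon (g, i, j)"
    using assms unfolding mon_eq[OF assms]
    by (simp add: H(5) S0_S0(1) pow[OF x_closed S0_S0(2)] pow[OF y_closed S0_S0(3)]
        A.mult_smult_left A.mult_smult_right A.smult_smult mult.commute)
  show ?thesis
  proof (induction n)
    case (Suc n)
    then show ?case using assms by (simp add: H(4) one A.smult_smult power_add mult_ac)
  qed (use assms in simp)
qed

text \<open>The square of S is diagonal on monomials with eigenvalues \<chi>(b)^i \<eta>(c)^j. The
  monomials x and y give necessity; if n and m are exponents for the two roots of unity, 2 n m is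
  one for S.\<close>

lemma antipode_finite_order_iff:
  "finite_order_on (carrier A) (antipode A) \<longleftrightarrow> root_of_unity (\<chi> b) \<and> root_of_unity (\<eta> c)"
proof -
  let ?Q = "\<lambda>u. S0 (S0 u)"
  have it: "(antipode A ^^ n) h = (S0 ^^ n) h \<and> (S0 ^^ n) h \<in> carrier A" if "h \<in> carrier A" for n h
    by (induction n) (use that in \<open>simp_all add: antipode_eq S0_simps\<close>)
  have even: "(S0 ^^ (2 * n)) h = (?Q ^^ n) h" for n h
    by (induction n) simp_all
  have Qn_linear: "?Q ^^ n \<in> k_linear_maps A A" for n
  proof (induction n)
    case 0
    show ?case by (rule k_linear_mapsI) auto
  next
    case (Suc n)
    from k_linear_maps_comp[OF Suc k_algebra_homsD(1)[OF S0_S0_hom]] show ?case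
      by (simp add: comp_def)
  qed
  have coeff: "k = 1" if "k \<odot>\<^bsub>A\<^esub> mon t = mon t" "t \<in> Ind" for k t
  proof -
    have "lookup (M.coord (k \<odot>\<^bsub>A\<^esub> mon t)) t = lookup (M.coord (mon t)) t" using that(1) by simp
    then show ?thesis
      unfolding M.coord_smult[OF M.basis_closed[OF that(2)]] M.coord_basis[OF that(2)] by simp
  qed
  show ?thesis
  proof
    assume "finite_order_on (carrier A) (antipode A)"
    then obtain n where n: "n > 0" "\<forall>h\<in>carrier A. (antipode A ^^ n) h = h" by (auto simp: finite_order_on_def)
    have Q: "(?Q ^^ n) h = h" if "h \<in> carrier A" for h
    proof -
      have "(S0 ^^ n) h = h" using n(2) it that by simp
      \<comment> \<open>Doubling an arbitrary period makes it an iterate of the square of S.\<close>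
      then have "(S0 ^^ (n + n)) h = h" unfolding funpow_add comp_def by simp
      then show ?thesis using even[of n h] by (simp add: mult_2)
    qed
    have "\<chi> b ^ n = 1" using coeff[of "\<chi> b ^ n" "(\<one>\<^bsub>G\<^esub>, 1, 0)"] Q[of "mon (\<one>\<^bsub>G\<^esub>, 1, 0)"] S0_S0_mon[of "\<one>\<^bsub>G\<^esub>" n 1 0] by simp
    moreover have "\<eta> c ^ n = 1" using coeff[of "\<eta> c ^ n" "(\<one>\<^bsub>G\<^esub>, 0, 1)"] Q[of "mon (\<one>\<^bsub>G\<^esub>, 0, 1)"] S0_S0_mon[of "\<one>\<^bsub>G\<^esub>" n 0 1] by simp
    ultimately show "root_of_unity (\<chi> b) \<and> root_of_unity (\<eta> c)" using n(1) by (auto simp: root_of_unity_def)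
  next
    assume "root_of_unity (\<chi> b) \<and> root_of_unity (\<eta> c)"
    then obtain n m where nm: "n > 0" "m > 0" "\<chi> b ^ n = 1" "\<eta> c ^ m = 1" by (auto simp: root_of_unity_def)
    have "\<chi> b ^ (n * m) = 1" "\<eta> c ^ (n * m) = 1"
      using nm power_mult[of "\<chi> b" n m] power_mult[of "\<eta> c" m n] by (simp_all add: mult.commute)
    then have "(?Q ^^ (n * m)) (mon t) = mon t" if "t \<in> Ind" for t
      using that S0_S0_mon[of _ "n * m"] by (cases t) (auto simp: power_mult)
    moreover have "(\<lambda>u. u) \<in> k_linear_maps A A" by (rule k_linear_mapsI) auto
    ultimately have "(?Q ^^ (n * m)) h = h" if "h \<in> carrier A" for h
      using M.basis_linear_eq[OF A.k_algebra Qn_linear[of "n * m"], of "\<lambda>u. u" h] that by blast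
    then have "\<forall>h\<in>carrier A. (antipode A ^^ (2 * (n * m))) h = h" using it even by simp
    then show "finite_order_on (carrier A) (antipode A)"
      unfolding finite_order_on_def using nm by (intro exI[of _ "2 * (n * m)"]) simp
  qed
qed

text \<open>Evaluating the left tensor factor at the coordinate of a monomial \<open>g x^i y^j\<close> of maximal degree
  in \<open>h\<close> maps \<open>\<Delta>(h)\<close> to a nonzero multiple of \<open>g\<close>.\<close>

lemma subcoalgebra_contains_group_element:
  assumes C: "subcoalgebra C A" and "C \<noteq> {\<zero>\<^bsub>A\<^esub>}"
  shows "\<exists>g\<in>carrier G. \<iota> g \<in> C"
proof -
  note [simp del] = UNIV_Times_UNIV
  have Cs: "submodule C scalar_ring A" and Cd: "comult A ` C \<subseteq> k_span TA {p u v | u v. u \<in> C \<and> v \<in> C}"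
    using C by (auto simp: subcoalgebra_def)
  note CD = A.submoduleD[OF Cs]
  obtain h where h: "h \<in> C" "h \<noteq> \<zero>\<^bsub>A\<^esub>" using assms(2) CD(2) by blast
  have hc: "h \<in> carrier A" using h(1) CD(1) by blast
  let ?K = "keys (M.coord h)" and ?deg = "\<lambda>(g :: 'g, i :: nat, j :: nat). i + j"
  have "?K \<noteq> {}" using h(2) M.coord[OF hc] by (metis A.lin_comb_zero keys_eq_empty)
  then have "Max (?deg ` ?K) \<in> ?deg ` ?K" by (intro Max_in) auto
  then obtain t0 where "t0 \<in> ?K" "?deg t0 = Max (?deg ` ?K)" by (metis (no_types, lifting) imageE)
  then have t0: "t0 \<in> ?K" "\<And>t. t \<in> ?K \<Longrightarrow> ?deg t \<le> ?deg t0" by simp_all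
  have t0I: "t0 \<in> Ind" using t0(1) M.coord(1)[OF hc] by blast
  obtain g0 i0 j0 where t0e: "t0 = (g0, i0, j0)" by (cases t0)
  define \<phi> where "\<phi> u = lookup (M.coord u) t0" for u
  have phi: "\<phi> (u \<oplus>\<^bsub>A\<^esub> v) = \<phi> u + \<phi> v" "\<phi> (k \<odot>\<^bsub>A\<^esub> u) = k * \<phi> u" if "u \<in> carrier A" "v \<in> carrier A" for u v k
    using that by (simp_all add: \<phi>_def M.coord_add M.coord_smult lookup_add)
  have phi_mon: "\<phi> (mon t) = (if t = t0 then 1 else 0)" if "t \<in> Ind" for t
    using that by (simp add: \<phi>_def M.coord_basis lookup_single "when_def")
  have bil: "k_bilinear A A A (\<lambda>u v. \<phi> u \<odot>\<^bsub>A\<^esub> v)"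
    by (rule k_bilinearI) (simp_all add: phi A.smult_add_left A.smult_add_right A.smult_smult mult.commute)
  let ?F = "tensor_lift A (\<lambda>u v. \<phi> u \<odot>\<^bsub>A\<^esub> v)"
  note Fp = T.tensor_lift_pure[OF A.k_algebra bil]
  interpret F: k_linear TA A ?F
    by (rule k_linearI[OF T.tensor_k_algebra A.k_algebra T.tensor_lift_linear[OF A.k_algebra bil]])
  interpret D: k_linear A TA \<Delta>
    by (rule k_linearI[OF A.k_algebra T.tensor_k_algebra Delta(1)])
  \<comment> \<open>Contracting the left factor leaves a combination of right factors, and these lie
    in \<open>C\<close>.\<close>
  have "?F (\<Delta> h) \<in> C"
  proof (rule F.span_into[OF _ Cs])
    show "{p u v | u v. u \<in> C \<and> v \<in> C} \<subseteq> carrier TA" using CD(1) by (auto intro!: T.pure_closed)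
    show "?F s \<in> C" if "s \<in> {p u v | u v. u \<in> C \<and> v \<in> C}" for s
      using that CD(1,4) by (auto simp: Fp subset_iff)
    show "\<Delta> h \<in> k_span TA {p u v | u v. u \<in> C \<and> v \<in> C}" using Cd h(1) by blast
  qed
  moreover have "?F (\<Delta> h) = \<phi> h \<odot>\<^bsub>A\<^esub> \<iota> g0"
  proof -
    \<comment> \<open>Left factors in the remainder have degree strictly below that of
      \<open>t0\<close>, so \<phi> kills them; the leading term survives only for the monomial
      \<open>t0\<close> itself.\<close>
    have F_mon: "?F (\<Delta> (mon t)) = \<phi> (mon t) \<odot>\<^bsub>A\<^esub> \<iota> g0" if t: "t \<in> Ind" "?deg t \<le> ?deg t0" for t
    proof -
      obtain g i j where te: "t = (g, i, j)" "g \<in> carrier G" using t by (cases t) auto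
      obtain r where r: "r \<in> left_span (\<lambda>(g', i', j'). i' + j' < i + j)"
        "\<Delta> (mon t) = p (mon t) (\<iota> g) \<oplus>\<^bsub>TA\<^esub> r" using comult_mon[OF te(2)] te(1) by blast
      have "?F r \<in> {\<zero>\<^bsub>A\<^esub>}"
      proof (rule F.span_into[OF left_span_generators _ _ r(1)[unfolded left_span_def]])
        show "submodule {\<zero>\<^bsub>A\<^esub>} scalar_ring A" by (rule A.submoduleI) auto
        fix s assume "s \<in> {p (mon t) v | t v. t \<in> Ind \<and> (case t of (g', i', j') \<Rightarrow> i' + j' < i + j) \<and> v \<in> carrier A}"
        then obtain g' i' j' v where t': "s = p (mon (g', i', j')) v" "(g', i', j') \<in> Ind" "i' + j' < i + j" "v \<in> carrier A"
          by auto
        have "i + j \<le> i0 + j0" using t(2) te(1) t0e by simp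
        then have "(g', i', j') \<noteq> t0" using t'(3) t0e by auto
        then show "?F s \<in> {\<zero>\<^bsub>A\<^esub>}" using t' M.basis_closed[OF t'(2)] by (simp add: Fp phi_mon)
      qed
      then have "?F (\<Delta> (mon t)) = \<phi> (mon t) \<odot>\<^bsub>A\<^esub> \<iota> g"
        unfolding r(2) using te left_span_carrier[OF r(1)] t(1) M.basis_closed[OF t(1)]
        by (simp add: F.map_add Fp T.pure_closed)
      then show ?thesis using phi_mon[OF t(1)] te t0e t0I by (cases "t = t0") auto
    qed
    have fin: "mon \<in> Ind \<rightarrow> carrier A" by (rule M.basis_funcset)
    have gc: "\<iota> g0 \<in> carrier A" using t0e t0I by simp
    have P: "(\<lambda>u. \<phi> u \<odot>\<^bsub>A\<^esub> \<iota> g0) \<in> k_linear_maps A A"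
      by (rule k_linear_mapsI) (use gc in \<open>simp_all add: phi A.smult_add_left A.smult_smult\<close>)
    have FD: "(\<lambda>u. ?F (\<Delta> u)) \<in> k_linear_maps A A" by (rule k_linear_maps_comp[OF D.lin F.lin])
    interpret FD: k_linear A A "\<lambda>u. ?F (\<Delta> u)" by (rule k_linearI[OF A.k_algebra A.k_algebra FD])
    have KI: "t \<in> Ind" if "t \<in> ?K" for t using M.coord(1)[OF hc] that by (rule subsetD)
    have K: "mon \<in> ?K \<rightarrow> carrier A" by (rule Pi_I) (rule M.basis_closed[OF KI])
    \<comment> \<open>The identity is known only for monomials of degree at most that of
      \<open>t0\<close>, so \<open>h\<close> is expanded over its own support rather than over the
      whole basis.\<close>
    have hs: "h \<in> k_span A (mon ` ?K)"
      using A.lin_comb_in_span[OF order_refl K] M.coord(2)[OF hc] by simp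
    show ?thesis
    proof (rule FD.eq_on_span[OF P _ _ hs])
      show "mon ` ?K \<subseteq> carrier A" using K by (rule funcset_image)
      show "?F (\<Delta> s) = \<phi> s \<odot>\<^bsub>A\<^esub> \<iota> g0" if s: "s \<in> mon ` ?K" for s
      proof -
        obtain t where t: "t \<in> ?K" "s = mon t" using s by blast
        show ?thesis unfolding t(2) by (rule F_mon[OF KI[OF t(1)] t0(2)[OF t(1)]])
      qed
    qed
  qed
  moreover have "\<phi> h \<noteq> 0" using t0(1) by (simp add: \<phi>_def in_keys_iff)
  ultimately have "inverse (\<phi> h) \<odot>\<^bsub>A\<^esub> (\<phi> h \<odot>\<^bsub>A\<^esub> \<iota> g0) \<in> C" "g0 \<in> carrier G" using CD(4) t0e t0I by auto
  then show ?thesis using \<open>\<phi> h \<noteq> 0\<close> by (intro bexI[of _ g0]) (simp_all add: A.smult_smult)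
qed

lemma line_submodule: "u \<in> carrier A \<Longrightarrow> submodule {k \<odot>\<^bsub>A\<^esub> u | k. True} scalar_ring A"
proof (rule A.submoduleI)
  assume u: "u \<in> carrier A"
  show "{k \<odot>\<^bsub>A\<^esub> u | k. True} \<subseteq> carrier A" using u by auto
  show "\<zero>\<^bsub>A\<^esub> \<in> {k \<odot>\<^bsub>A\<^esub> u | k. True}" using A.smult_zero_left[OF u] by (auto intro: exI[of _ 0] simp: eq_commute)
  show "v \<oplus>\<^bsub>A\<^esub> w \<in> {k \<odot>\<^bsub>A\<^esub> u | k. True}" if "v \<in> {k \<odot>\<^bsub>A\<^esub> u | k. True}" "w \<in> {k \<odot>\<^bsub>A\<^esub> u | k. True}" for v w
    using that A.smult_add_left[OF u] by (auto simp flip: A.smult_add_left[OF u])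
  show "l \<odot>\<^bsub>A\<^esub> v \<in> {k \<odot>\<^bsub>A\<^esub> u | k. True}" if "v \<in> {k \<odot>\<^bsub>A\<^esub> u | k. True}" for l v
    using that u by (auto simp: A.smult_smult)
qed

lemma line_subcoalgebra:
  assumes u: "u \<in> carrier A" and "\<Delta> u = p u u"
  shows "subcoalgebra {k \<odot>\<^bsub>A\<^esub> u | k. True} A"
proof -
  let ?C = "{k \<odot>\<^bsub>A\<^esub> u | k. True}"
  have uC: "u \<in> ?C" using A.smult_one[OF u] by (auto intro!: exI[of _ 1] simp: eq_commute)
  have sub: "{p v w | v w. v \<in> ?C \<and> w \<in> ?C} \<subseteq> carrier TA" using u by (auto intro!: T.pure_closed)
  note V = T.T.submoduleD[OF T.T.k_span_submodule[OF sub]]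
  have "p u u \<in> k_span TA {p v w | v w. v \<in> ?C \<and> w \<in> ?C}" by (rule T.T.k_span_base) (use uC in blast)
  then have "\<Delta> (k \<odot>\<^bsub>A\<^esub> u) \<in> k_span TA {p v w | v w. v \<in> ?C \<and> w \<in> ?C}" for k
    using u assms(2) V(4) by (simp add: Delta(4))
  then show ?thesis using line_submodule[OF u] by (auto simp: subcoalgebra_def)
qed

lemma iota_nonzero: "g \<in> carrier G \<Longrightarrow> \<iota> g \<noteq> \<zero>\<^bsub>A\<^esub>"
proof
  assume g: "g \<in> carrier G" and z: "\<iota> g = \<zero>\<^bsub>A\<^esub>"
  have "mon (g, 0, 0) = 0 \<odot>\<^bsub>A\<^esub> mon (g, 0, 0)" using g z by (simp add: mon_generators)
  then have "M.coord (mon (g, 0, 0)) = Poly_Mapping.map ((*) 0) (M.coord (mon (g, 0, 0)))"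
    using M.coord_smult[of "mon (g, 0, 0)" 0] g by simp
  then have "lookup (M.coord (mon (g, 0, 0))) (g, 0, 0) = 0" by (metis lookup_map_mult mult_zero_left)
  then show False using M.coord_basis[of "(g, 0, 0)"] g by simp
qed

text \<open>The line through a group-like u is a subcoalgebra and so contains some g; thus u is a
  multiple of g. The counit axiom gives u = \<epsilon>(u) u, hence \<epsilon>(u) = 1, which makes
  the factor 1.\<close>

lemma group_likes_eq: "group_likes A = \<iota> ` carrier G"
proof
  show "\<iota> ` carrier G \<subseteq> group_likes A" using iota_nonzero by (auto simp: group_likes_def comult_iota)
  show "group_likes A \<subseteq> \<iota> ` carrier G"
  proof
    fix u assume "u \<in> group_likes A"
    then have u: "u \<in> carrier A" "u \<noteq> \<zero>\<^bsub>A\<^esub>" "\<Delta> u = p u u" by (auto simp: group_likes_def)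
    have "u \<in> {k \<odot>\<^bsub>A\<^esub> u | k. True}" using A.smult_one[OF u(1)] by (auto intro!: exI[of _ 1] simp: eq_commute)
    then have "{k \<odot>\<^bsub>A\<^esub> u | k. True} \<noteq> {\<zero>\<^bsub>A\<^esub>}" using u(2) by auto
    then obtain g k where g: "g \<in> carrier G" "\<iota> g = k \<odot>\<^bsub>A\<^esub> u"
      using subcoalgebra_contains_group_element[OF line_subcoalgebra[OF u(1,3)]] by auto
    have k: "k \<noteq> 0" using g iota_nonzero[OF g(1)] u(1) by auto
    have ue: "u = inverse k \<odot>\<^bsub>A\<^esub> \<iota> g" unfolding g(2) using k u(1) by (simp add: A.smult_smult)
    let ?e = "\<lambda>u v. \<epsilon> u \<odot>\<^bsub>A\<^esub> v"
    have "k_bilinear A A A ?e"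
      by (rule k_bilinearI; simp add: counit_simps A.smult_add_left A.smult_add_right A.smult_smult mult.commute)
    then have "tensor_lift A ?e (p u u) = \<epsilon> u \<odot>\<^bsub>A\<^esub> u"
      using T.tensor_lift_pure[OF A.k_algebra _ u(1) u(1)] by blast
    then have "u = \<epsilon> u \<odot>\<^bsub>A\<^esub> u" using counit_left(1)[OF u(1)] u(3) by simp
    then have "(\<epsilon> u - 1) \<odot>\<^bsub>A\<^esub> u = \<zero>\<^bsub>A\<^esub>"
      using A.smult_add_left[OF u(1), of "\<epsilon> u" "- 1"] u(1) by (simp add: A.smult_minus_left A.r_neg)
    then have "\<epsilon> u = 1" using A.smult_eq_zero_iff[OF u(1)] u(2) by simp
    moreover have "\<epsilon> u = inverse k" unfolding ue using g(1) by (simp add: counit_simps counit_iota)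
    ultimately have "u = \<iota> g" using ue g(1) by simp
    then show "u \<in> \<iota> ` carrier G" using g(1) by blast
  qed
qed

lemma scalars_mult: "u \<in> carrier A \<Longrightarrow> (k \<odot>\<^bsub>A\<^esub> \<one>\<^bsub>A\<^esub>) \<otimes>\<^bsub>A\<^esub> u = k \<odot>\<^bsub>A\<^esub> u"
  by (simp add: A.mult_smult_left)

text \<open>A simple subcoalgebra contains some g, hence the line through g, which is itself a
  nonzero subcoalgebra.\<close>

lemma pointed: "pointed A"
  unfolding pointed_def
proof (intro allI impI)
  fix C assume C: "simple_subcoalgebra C A"
  then have sub: "subcoalgebra C A" and nz: "C \<noteq> {\<zero>\<^bsub>A\<^esub>}"
    and min: "\<And>D. D \<subseteq> C \<Longrightarrow> subcoalgebra D A \<Longrightarrow> D = {\<zero>\<^bsub>A\<^esub>} \<or> D = C"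
    by (auto simp: simple_subcoalgebra_def)
  obtain g where g: "g \<in> carrier G" "\<iota> g \<in> C" using subcoalgebra_contains_group_element[OF sub nz] by blast
  let ?L = "{k \<odot>\<^bsub>A\<^esub> \<iota> g | k. True}"
  have "submodule C scalar_ring A" using sub by (simp add: subcoalgebra_def)
  then have "?L \<subseteq> C" using A.submoduleD(4) g(2) by blast
  moreover have "\<iota> g \<in> ?L" using A.smult_one[of "\<iota> g"] g(1) by (auto intro!: exI[of _ 1] simp: eq_commute)
  ultimately have "C = ?L"
    using min[OF _ line_subcoalgebra[OF iota_closed[OF g(1)] comult_iota[OF g(1)]]] iota_nonzero[OF g(1)] by blast
  moreover have "A.line_extension (scalars A) (\<iota> g) {\<zero>\<^bsub>A\<^esub>} = ?L"
    using g(1) by (auto simp: A.line_extension_mem_iff scalars_def scalars_mult)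
  moreover have "A.dimension (Suc 0) (scalars A) (A.line_extension (scalars A) (\<iota> g) {\<zero>\<^bsub>A\<^esub>})"
    by (rule A.Suc_dim) (use g(1) iota_nonzero[OF g(1)] in auto)
  ultimately show "A.dimension 1 (scalars A) C" by simp
qed

end

section \<open>Noetherian algebras\<close>

lemma submodule_opposite [simp]: "submodule V scalar_ring (opposite A) = submodule V scalar_ring A"
  by (simp add: submodule_def subgroup_def submodule_axioms_def a_inv_def m_inv_def)

definition subalg :: "('k::field, 'a, 'm) module_scheme \<Rightarrow> 'a set \<Rightarrow> bool" where
  "subalg A B \<longleftrightarrow> submodule B scalar_ring A \<and> \<one>\<^bsub>A\<^esub> \<in> B \<and> (\<forall>u\<in>B. \<forall>v\<in>B. u \<otimes>\<^bsub>A\<^esub> v \<in> B)"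

text \<open>The chain condition for left \<open>B\<close>-submodules of \<open>M\<close>, with
  \<open>B\<close> and \<open>M\<close> inside one ambient algebra. Asking for subspaces loses
  nothing in the end, as left ideals of a unital algebra are subspaces.\<close>

definition left_acc :: "('k::field, 'a, 'm) module_scheme \<Rightarrow> 'a set \<Rightarrow> 'a set \<Rightarrow> bool" where
  "left_acc A B M \<longleftrightarrow> ascending_chain_condition
     (\<lambda>I. submodule I scalar_ring A \<and> I \<subseteq> M \<and> (\<forall>r\<in>B. \<forall>a\<in>I. r \<otimes>\<^bsub>A\<^esub> a \<in> I))"

lemma subalg_opposite [simp]: "subalg (opposite A) B = subalg A B"
  by (auto simp: subalg_def)

lemma chain_mono: "(\<And>n. C n \<subseteq> C (Suc n)) \<Longrightarrow> m \<le> n \<Longrightarrow> C m \<subseteq> (C n :: 'a set)"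
  by (rule lift_Suc_mono_le[of C])

lemma left_acc_chain:
  assumes "left_acc A B M" "\<And>n. submodule (C n) scalar_ring A" "\<And>n. C n \<subseteq> M"
    "\<And>n r a. r \<in> B \<Longrightarrow> a \<in> C n \<Longrightarrow> r \<otimes>\<^bsub>A\<^esub> a \<in> C n" "\<And>n. C n \<subseteq> C (Suc n)"
  obtains N where "\<And>n. n \<ge> N \<Longrightarrow> C n = C N"
  using assms unfolding left_acc_def ascending_chain_condition_def by blast

lemma left_accI:
  assumes "\<And>C :: nat \<Rightarrow> 'a set. (\<And>n. submodule (C n) scalar_ring A) \<Longrightarrow> (\<And>n. C n \<subseteq> M) \<Longrightarrow>
    (\<And>n r a. r \<in> B \<Longrightarrow> a \<in> C n \<Longrightarrow> r \<otimes>\<^bsub>A\<^esub> a \<in> C n) \<Longrightarrow> (\<And>m n. m \<le> n \<Longrightarrow> C m \<subseteq> C n) \<Longrightarrow>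
    \<exists>N. \<forall>n\<ge>N. C n = C N"
  shows "left_acc A B M"
  unfolding left_acc_def ascending_chain_condition_def
proof (intro allI impI)
  fix C :: "nat \<Rightarrow> 'a set"
  assume *: "(\<forall>n. submodule (C n) scalar_ring A \<and> C n \<subseteq> M \<and> (\<forall>r\<in>B. \<forall>a\<in>C n. r \<otimes>\<^bsub>A\<^esub> a \<in> C n)) \<and>
    (\<forall>n. C n \<subseteq> C (Suc n))"
  show "\<exists>N. \<forall>n\<ge>N. C n = C N"
    by (rule assms) (use * chain_mono[of C] in blast)+
qed

context k_alg
begin

lemma submodule_inter: "submodule V scalar_ring A \<Longrightarrow> submodule V' scalar_ring A \<Longrightarrow> submodule (V \<inter> V') scalar_ring A"
  by (rule submoduleI) (auto dest: submoduleD)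

lemma submodule_diff: "submodule V scalar_ring A \<Longrightarrow> u \<in> V \<Longrightarrow> v \<in> V \<Longrightarrow> u \<ominus> v \<in> V"
  unfolding a_minus_def by (auto dest: submoduleD)

text \<open>Among comparable submodules \<open>C\<close> of \<open>M = M' + B g\<close>, one is determined by \<open>C \<inter> M'\<close> and the
  left ideal of the \<open>r \<in> B\<close> with \<open>r g \<in> C + M'\<close>.\<close>

lemma left_acc_extend:
  assumes B: "subalg A B" and BB: "left_acc A B B" and M': "left_acc A B M'" "submodule M' scalar_ring A"
    and M'B: "\<And>r m. r \<in> B \<Longrightarrow> m \<in> M' \<Longrightarrow> r \<otimes> m \<in> M'" and g: "g \<in> carrier A"
    and M: "\<And>m. m \<in> M \<Longrightarrow> \<exists>m'\<in>M'. \<exists>r\<in>B. m = m' \<oplus> r \<otimes> g"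
  shows "left_acc A B M"
proof (rule left_accI)
  fix C :: "nat \<Rightarrow> 'a set"
  assume C: "\<And>n. submodule (C n) scalar_ring A" "\<And>n. C n \<subseteq> M" "\<And>n r a. r \<in> B \<Longrightarrow> a \<in> C n \<Longrightarrow> r \<otimes> a \<in> C n"
    "\<And>m n. m \<le> n \<Longrightarrow> C m \<subseteq> C n"
  have Bs: "submodule B scalar_ring A" and Bm: "\<And>u v. u \<in> B \<Longrightarrow> v \<in> B \<Longrightarrow> u \<otimes> v \<in> B" using B by (auto simp: subalg_def)
  note BD = submoduleD[OF Bs] and MD = submoduleD[OF M'(2)] and CD = submoduleD[OF C(1)]
  have Bc: "r \<in> carrier A" if "r \<in> B" for r using that BD(1) by blast
  have M'c: "m \<in> carrier A" if "m \<in> M'" for m using that MD(1) by blast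
  define L where "L n = {r \<in> B. \<exists>m\<in>M'. m \<oplus> r \<otimes> g \<in> C n}" for n
  have CS: "a \<in> C (Suc n)" if "a \<in> C n" for a n using C(4)[of n "Suc n"] that by auto
  obtain N1 where N1: "\<And>n. n \<ge> N1 \<Longrightarrow> C n \<inter> M' = C N1 \<inter> M'"
    by (rule left_acc_chain[OF M'(1), of "\<lambda>n. C n \<inter> M'"])
      (use C(1-3) CS M'B submodule_inter[OF C(1) M'(2)] in auto)
  obtain N2 where N2: "\<And>n. n \<ge> N2 \<Longrightarrow> L n = L N2"
  proof (rule left_acc_chain[OF BB, of L])
    show "submodule (L n) scalar_ring A" for n
    proof (rule submoduleI)
      show "L n \<subseteq> carrier A" using BD(1) by (auto simp: L_def)
      show "\<zero> \<in> L n" using BD(2) MD(2) CD(2) g by (auto simp: L_def intro!: bexI[of _ \<zero>])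
      show "r \<oplus> s \<in> L n" if rs: "r \<in> L n" "s \<in> L n" for r s
      proof -
        obtain m m' where m: "m \<in> M'" "m \<oplus> r \<otimes> g \<in> C n" "m' \<in> M'" "m' \<oplus> s \<otimes> g \<in> C n" "r \<in> B" "s \<in> B"
          using rs by (auto simp: L_def)
        have "(m \<oplus> r \<otimes> g) \<oplus> (m' \<oplus> s \<otimes> g) \<in> C n" using m CD(3) by blast
        also have "(m \<oplus> r \<otimes> g) \<oplus> (m' \<oplus> s \<otimes> g) = (m \<oplus> m') \<oplus> (r \<oplus> s) \<otimes> g"
          using m M'c Bc g by (simp add: l_distr a_ac)
        finally show ?thesis using m MD(3) BD(3) by (auto simp: L_def)
      qed
      show "k \<odot> r \<in> L n" if r: "r \<in> L n" for k r
      proof -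
        obtain m where m: "m \<in> M'" "m \<oplus> r \<otimes> g \<in> C n" "r \<in> B" using r by (auto simp: L_def)
        have "k \<odot> (m \<oplus> r \<otimes> g) \<in> C n" using m CD(4) by blast
        also have "k \<odot> (m \<oplus> r \<otimes> g) = k \<odot> m \<oplus> (k \<odot> r) \<otimes> g"
          using m M'c Bc g by (simp add: smult_add_right mult_smult_left)
        finally show ?thesis using m MD(4) BD(4) by (auto simp: L_def)
      qed
    qed
    show "r \<otimes> s \<in> L n" if rs: "r \<in> B" "s \<in> L n" for n r s
    proof -
      obtain m where m: "m \<in> M'" "m \<oplus> s \<otimes> g \<in> C n" "s \<in> B" using rs by (auto simp: L_def)
      have "r \<otimes> (m \<oplus> s \<otimes> g) \<in> C n" using m rs C(3) by blast
      also have "r \<otimes> (m \<oplus> s \<otimes> g) = r \<otimes> m \<oplus> (r \<otimes> s) \<otimes> g"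
        using m rs M'c Bc g by (simp add: r_distr m_assoc)
      finally show ?thesis using m rs M'B Bm by (auto simp: L_def)
    qed
    show "L n \<subseteq> L (Suc n)" for n using C(4)[of n "Suc n"] by (auto simp: L_def)
  qed (auto simp: L_def)
  show "\<exists>N. \<forall>n\<ge>N. C n = C N"
  proof (intro exI allI impI)
    fix n assume n: "max N1 N2 \<le> n"
    let ?N = "max N1 N2"
    show "C n = C ?N"
    proof
      show "C n \<subseteq> C ?N"
      proof
        fix a assume a: "a \<in> C n"
        obtain m r where m: "m \<in> M'" "r \<in> B" "a = m \<oplus> r \<otimes> g" using M[of a] C(2) a by blast
        then have "r \<in> L n" using a by (auto simp: L_def)
        also have "L n = L ?N" using N2[of n] N2[of ?N] n by simp
        finally obtain m' where m': "m' \<in> M'" "m' \<oplus> r \<otimes> g \<in> C ?N" by (auto simp: L_def)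
        have cs: "m \<in> carrier A" "m' \<in> carrier A" "r \<otimes> g \<in> carrier A" using m m' M'c Bc g by auto
        \<comment> \<open>Subtracting an element of \<open>C ?N\<close> with the same coefficient of
          \<open>g\<close> leaves an element of \<open>M'\<close>, where the chain is already
          stationary.\<close>
        have "a \<ominus> (m' \<oplus> r \<otimes> g) = (m \<ominus> m') \<oplus> (r \<otimes> g \<ominus> r \<otimes> g)"
          unfolding m(3) using cs by (simp add: a_minus_def minus_add a_ac)
        then have "m \<ominus> m' = a \<ominus> (m' \<oplus> r \<otimes> g)" using cs by (simp add: a_minus_def r_neg)
        also have "\<dots> \<in> C n" using submodule_diff[OF C(1) a] m'(2) C(4)[OF n] by blast
        finally have "m \<ominus> m' \<in> C n \<inter> M'" using submodule_diff[OF M'(2) m(1) m'(1)] by simp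
        also have "C n \<inter> M' = C ?N \<inter> M'" using N1[of n] N1[of ?N] n by simp
        finally have "(m \<ominus> m') \<oplus> (m' \<oplus> r \<otimes> g) \<in> C ?N" using m'(2) CD(3) by blast
        also have "(m \<ominus> m') \<oplus> (m' \<oplus> r \<otimes> g) = a"
          unfolding m(3) a_minus_def using cs by (simp add: a_assoc r_neg1)
        finally show "a \<in> C ?N" .
      qed
    qed (use C(4) n in auto)
  qed
qed

text \<open>The generators are added one at a time by \<open>left_acc_extend\<close>.\<close>

lemma left_acc_finite_extension:
  assumes B: "subalg A B" and BB: "left_acc A B B" and "finite F" "F \<subseteq> carrier A"
  shows "left_acc A B (k_span A {r \<otimes> g | r g. r \<in> B \<and> g \<in> F})"
  using assms(3,4)
proof (induction F)
  case empty
  have "submodule {\<zero>} scalar_ring A" by (rule submoduleI) auto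
  then have "k_span A {} \<subseteq> {\<zero>}" by (rule k_span_least) simp
  show ?case
  proof (rule left_accI)
    fix C :: "nat \<Rightarrow> 'a set" assume C: "\<And>n. submodule (C n) scalar_ring A" "\<And>n. C n \<subseteq> k_span A {r \<otimes> g |r g. r \<in> B \<and> g \<in> {}}"
    have "C n = {\<zero>}" for n using C(2)[of n] submoduleD(2)[OF C(1), of n] \<open>k_span A {} \<subseteq> {\<zero>}\<close> by auto
    then show "\<exists>N. \<forall>n\<ge>N. C n = C N" by simp
  qed
next
  case (insert g F)
  have Bs: "submodule B scalar_ring A" and Bm: "\<And>u v. u \<in> B \<Longrightarrow> v \<in> B \<Longrightarrow> u \<otimes> v \<in> B" using B by (auto simp: subalg_def)
  note BD = submoduleD[OF Bs]
  let ?E = "\<lambda>F. {r \<otimes> g | r g. r \<in> B \<and> g \<in> F}"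
  let ?M = "k_span A (?E F)"
  have gF: "g \<in> carrier A" "F \<subseteq> carrier A" using insert by auto
  have E: "?E F \<subseteq> carrier A" "?E (insert g F) \<subseteq> carrier A" using gF BD(1) by auto
  note VD = submoduleD[OF k_span_submodule[OF E(1)]]
  have Mc: "m \<in> carrier A" if "m \<in> ?M" for m using that VD(1) by blast
  have stab: "r \<otimes> m \<in> ?M" if r: "r \<in> B" and m: "m \<in> ?M" for r m
  proof -
    have rc: "r \<in> carrier A" using r BD(1) by blast
    interpret F: k_linear A A "\<lambda>v. r \<otimes> v" by (rule k_linearI[OF k_algebra k_algebra mult_linear(1)[OF rc]])
    show ?thesis
    proof (rule F.span_into[OF E(1) k_span_submodule[OF E(1)] _ m])
      fix s assume "s \<in> ?E F"
      then obtain r' h where s: "s = r' \<otimes> h" "r' \<in> B" "h \<in> F" by blast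
      then have "r \<otimes> s = (r \<otimes> r') \<otimes> h" using rc BD(1) gF by (simp add: m_assoc subset_iff)
      then have "r \<otimes> s \<in> ?E F" using s Bm[OF r s(2)] by blast
      then show "r \<otimes> s \<in> ?M" by (rule k_span_base)
    qed
  qed
  show ?case
  proof (rule left_acc_extend[OF B BB insert.IH[OF gF(2)] k_span_submodule[OF E(1)] stab gF(1)])
    fix m assume "m \<in> k_span A (?E (insert g F))"
    then show "\<exists>m'\<in>?M. \<exists>r\<in>B. m = m' \<oplus> r \<otimes> g" using E(2)
    proof (induction rule: k_span_induct)
      case zero
      show ?case using VD(2) BD(2) gF by (intro bexI[of _ \<zero>]) auto
    next
      case (base s)
      then obtain r h where s: "s = r \<otimes> h" "r \<in> B" "h \<in> insert g F" by blast
      have rc: "r \<in> carrier A" using s BD(1) by blast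
      show ?case
      proof (cases "h = g")
        case True
        then show ?thesis using s rc gF VD(2) by (intro bexI[of _ \<zero>] bexI[of _ r]) auto
      next
        case False
        then have "s \<in> ?M" using s by (intro k_span_base) blast
        then show ?thesis using BD(2) gF Mc by (intro bexI[of _ s] bexI[of _ \<zero>]) auto
      qed
    next
      case (add u v)
      then obtain m r m' r' where *: "m \<in> ?M" "r \<in> B" "u = m \<oplus> r \<otimes> g" "m' \<in> ?M" "r' \<in> B" "v = m' \<oplus> r' \<otimes> g" by blast
      then have "r \<in> carrier A" "r' \<in> carrier A" using BD(1) by auto
      then have "u \<oplus> v = (m \<oplus> m') \<oplus> (r \<oplus> r') \<otimes> g" using * gF Mc by (simp add: l_distr a_ac)
      then show ?case using * VD(3) BD(3) by blast
    next
      case (smult k u)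
      then obtain m r where *: "m \<in> ?M" "r \<in> B" "u = m \<oplus> r \<otimes> g" by blast
      then have "r \<in> carrier A" using BD(1) by auto
      then have "k \<odot> u = k \<odot> m \<oplus> (k \<odot> r) \<otimes> g" using * gF Mc by (simp add: smult_add_right mult_smult_left)
      then show ?case using * VD(4) BD(4) by blast
    qed
  qed
qed

text \<open>Left ideals of \<open>S\<close> are in particular left \<open>B\<close>-submodules of
  \<open>M\<close>.\<close>

lemma left_acc_restrict:
  assumes "left_acc A B M" "B \<subseteq> S" "S \<subseteq> M"
  shows "left_acc A S S"
proof (rule left_accI)
  fix C :: "nat \<Rightarrow> 'a set"
  assume C: "\<And>n. submodule (C n) scalar_ring A" "\<And>n. C n \<subseteq> S" "\<And>n r a. r \<in> S \<Longrightarrow> a \<in> C n \<Longrightarrow> r \<otimes> a \<in> C n"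
    "\<And>m n. m \<le> n \<Longrightarrow> C m \<subseteq> C n"
  obtain N where "\<And>n. n \<ge> N \<Longrightarrow> C n = C N"
  proof (rule left_acc_chain[OF assms(1), of C])
    show "submodule (C n) scalar_ring A" for n by (rule C(1))
    show "C n \<subseteq> M" for n using C(2)[of n] assms(3) by (rule subset_trans)
    show "r \<otimes> a \<in> C n" if "r \<in> B" "a \<in> C n" for n r a using that assms(2) by (intro C(3)) auto
    show "C n \<subseteq> C (Suc n)" for n by (rule C(4)) simp
  qed (blast intro: that)
  then show "\<exists>N. \<forall>n\<ge>N. C n = C N" by auto
qed

end

section \<open>Hilbert's basis theorem inside an ambient algebra\<close>

text \<open>Coefficients must pass \<open>x\<close> in both directions modulo \<open>B\<close>; the
  condition is symmetric under passing to the opposite algebra. It covers conjugation by a group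
  element as well as Ore variables. Powers of \<open>x\<close> may be dependent over
  \<open>B\<close>, which happens for finite cyclic factors.\<close>

locale hilbert_step = k_alg A for A :: "('k::field, 'a, 'm) module_scheme" (structure) +
  fixes B :: "'a set" and x :: 'a
  assumes B_subalg: "subalg A B" and x_closed: "x \<in> carrier A"
    and x_B: "\<And>r. r \<in> B \<Longrightarrow> \<exists>r'\<in>B. \<exists>r''\<in>B. x \<otimes> r = r' \<otimes> x \<oplus> r''"
    and B_x: "\<And>r. r \<in> B \<Longrightarrow> \<exists>r'\<in>B. \<exists>r''\<in>B. r \<otimes> x = x \<otimes> r' \<oplus> r''"
begin

text \<open>Polynomials of degree strictly below the index, with coefficients on the left; a
  monomial of degree \<open>n\<close> lies in the space of index \<open>Suc n\<close>.\<close>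

primrec poly_space :: "nat \<Rightarrow> 'a set" where
  "poly_space 0 = {\<zero>}"
| "poly_space (Suc n) = {m \<oplus> r \<otimes> x [^] n | m r. m \<in> poly_space n \<and> r \<in> B}"

declare poly_space.simps(2) [simp del]

lemma poly_SucI: "m \<in> poly_space n \<Longrightarrow> r \<in> B \<Longrightarrow> m \<oplus> r \<otimes> x [^] n \<in> poly_space (Suc n)"
  unfolding poly_space.simps by blast

lemma poly_SucE:
  assumes "u \<in> poly_space (Suc n)"
  obtains m r where "u = m \<oplus> r \<otimes> x [^] n" "m \<in> poly_space n" "r \<in> B"
  using assms unfolding poly_space.simps by blast

lemma B_submodule: "submodule B scalar_ring A" and B_one: "\<one> \<in> B"
  and B_mult: "\<And>u v. u \<in> B \<Longrightarrow> v \<in> B \<Longrightarrow> u \<otimes> v \<in> B"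
  using B_subalg by (auto simp: subalg_def)

lemmas BD = submoduleD[OF B_submodule]

lemma B_closed: "r \<in> B \<Longrightarrow> r \<in> carrier A"
  using BD(1) by blast

lemma xp: "x [^] (n::nat) \<in> carrier A"
  using x_closed by simp

lemma poly_submodule: "submodule (poly_space n) scalar_ring A"
proof (induction n)
  case 0
  show ?case by (simp, rule submoduleI) auto
next
  case (Suc n)
  note P = submoduleD[OF Suc]
  have Pc: "m \<in> carrier A" if "m \<in> poly_space n" for m using that P(1) by blast
  show ?case
  proof (rule submoduleI)
    show "poly_space (Suc n) \<subseteq> carrier A" using Pc B_closed xp by (auto elim!: poly_SucE)
    show "\<zero> \<in> poly_space (Suc n)" using poly_SucI[OF P(2) BD(2)] xp by simp
    show "u \<oplus> v \<in> poly_space (Suc n)" if uv: "u \<in> poly_space (Suc n)" "v \<in> poly_space (Suc n)" for u v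
    proof -
      obtain m r where 1: "u = m \<oplus> r \<otimes> x [^] n" "m \<in> poly_space n" "r \<in> B" using uv(1) by (rule poly_SucE)
      obtain m' r' where 2: "v = m' \<oplus> r' \<otimes> x [^] n" "m' \<in> poly_space n" "r' \<in> B" using uv(2) by (rule poly_SucE)
      have "u \<oplus> v = (m \<oplus> m') \<oplus> (r \<oplus> r') \<otimes> x [^] n" using 1 2 Pc B_closed xp by (simp add: l_distr a_ac)
      then show ?thesis using poly_SucI[OF P(3)[OF 1(2) 2(2)] BD(3)[OF 1(3) 2(3)]] by simp
    qed
    show "k \<odot> u \<in> poly_space (Suc n)" if u: "u \<in> poly_space (Suc n)" for k u
    proof -
      obtain m r where *: "u = m \<oplus> r \<otimes> x [^] n" "m \<in> poly_space n" "r \<in> B" using u by (rule poly_SucE)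
      then have "k \<odot> u = k \<odot> m \<oplus> (k \<odot> r) \<otimes> x [^] n" using Pc B_closed xp
        by (simp add: smult_add_right mult_smult_left)
      then show ?thesis using poly_SucI[OF P(4)[OF *(2)] BD(4)[OF *(3)]] by simp
    qed
  qed
qed

lemmas PD = submoduleD[OF poly_submodule]

lemma poly_closed: "m \<in> poly_space n \<Longrightarrow> m \<in> carrier A"
  using PD(1) by blast

lemma poly_Suc: "m \<in> poly_space n \<Longrightarrow> m \<in> poly_space (Suc n)"
  using poly_SucI[OF _ BD(2), of m n] poly_closed[of m n] xp by simp

lemma poly_mono: "n \<le> n' \<Longrightarrow> m \<in> poly_space n \<Longrightarrow> m \<in> poly_space n'"
  by (induction rule: dec_induct) (auto intro: poly_Suc)

lemma poly_base: "r \<in> B \<Longrightarrow> r \<otimes> x [^] n \<in> poly_space (Suc n)"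
  using poly_SucI[OF PD(2), of r n] B_closed[of r] xp by simp

lemma B_poly: "r \<in> B \<Longrightarrow> m \<in> poly_space n \<Longrightarrow> r \<otimes> m \<in> poly_space n"
proof (induction n arbitrary: m)
  case 0
  then show ?case using B_closed by simp
next
  case (Suc n)
  from \<open>m \<in> poly_space (Suc n)\<close>
  obtain m' s where m: "m = m' \<oplus> s \<otimes> x [^] n" "m' \<in> poly_space n" "s \<in> B" by (rule poly_SucE)
  have "r \<otimes> m = r \<otimes> m' \<oplus> (r \<otimes> s) \<otimes> x [^] n"
    using m Suc(2) B_closed poly_closed xp by (simp add: r_distr m_assoc)
  then show ?case using poly_SucI[OF Suc(1)[OF Suc(2) m(2)] B_mult[OF Suc(2) m(3)]] by simp
qed

lemma poly_x: "m \<in> poly_space n \<Longrightarrow> m \<otimes> x \<in> poly_space (Suc n)"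
proof (induction n arbitrary: m)
  case 0
  then show ?case using PD(2)[of "Suc 0"] x_closed by simp
next
  case (Suc n)
  from \<open>m \<in> poly_space (Suc n)\<close>
  obtain m' s where m: "m = m' \<oplus> s \<otimes> x [^] n" "m' \<in> poly_space n" "s \<in> B" by (rule poly_SucE)
  have "m \<otimes> x = m' \<otimes> x \<oplus> s \<otimes> x [^] Suc n"
    using m B_closed poly_closed xp x_closed by (simp add: l_distr m_assoc)
  then show ?case using PD(3)[OF poly_Suc[OF Suc(1)[OF m(2)]] poly_base[OF m(3)]] by metis
qed

lemma x_poly: "m \<in> poly_space n \<Longrightarrow> x \<otimes> m \<in> poly_space (Suc n)"
proof (induction n arbitrary: m)
  case 0
  then show ?case using PD(2)[of "Suc 0"] x_closed by simp
next
  case (Suc n)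
  from \<open>m \<in> poly_space (Suc n)\<close>
  obtain m' s where m: "m = m' \<oplus> s \<otimes> x [^] n" "m' \<in> poly_space n" "s \<in> B" by (rule poly_SucE)
  obtain s' s'' where s: "s' \<in> B" "s'' \<in> B" "x \<otimes> s = s' \<otimes> x \<oplus> s''" using x_B[OF m(3)] by blast
  have "x \<otimes> m = x \<otimes> m' \<oplus> (x \<otimes> s) \<otimes> x [^] n"
    using m B_closed poly_closed xp x_closed by (simp add: r_distr m_assoc)
  also have "(x \<otimes> s) \<otimes> x [^] n = s' \<otimes> x [^] Suc n \<oplus> s'' \<otimes> x [^] n"
    unfolding s(3) using s B_closed xp x_closed pow_commute[OF x_closed, of n] by (simp add: l_distr m_assoc)
  finally show ?case
    using PD(3)[OF poly_Suc[OF Suc(1)[OF m(2)]] PD(3)[OF poly_base[OF s(1)] poly_Suc[OF poly_base[OF s(2)]]]]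
    by (simp del: nat_pow_Suc)
qed

lemma xpow_poly: "m \<in> poly_space n \<Longrightarrow> x [^] (i::nat) \<otimes> m \<in> poly_space (i + n)"
proof (induction i)
  case 0
  then show ?case using poly_closed by simp
next
  case (Suc i)
  have "x [^] Suc i \<otimes> m = x \<otimes> (x [^] i \<otimes> m)"
    using poly_closed[OF Suc(2)] x_closed pow_commute[OF x_closed, of i] by (simp flip: m_assoc)
  then show ?case using x_poly[OF Suc(1)[OF Suc(2)]] by simp
qed

lemma B_poly_one: "r \<in> B \<Longrightarrow> r \<in> poly_space (Suc 0)"
  using poly_base[of r 0] B_closed[of r] by simp

lemma xpow_B:
  assumes "r \<in> B"
  shows "\<exists>m\<in>poly_space n. \<exists>r'\<in>B. x [^] n \<otimes> r = m \<oplus> r' \<otimes> x [^] n"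
  using xpow_poly[OF B_poly_one[OF assms], of n] by (auto elim!: poly_SucE)

lemma poly_B: "m \<in> poly_space n \<Longrightarrow> r \<in> B \<Longrightarrow> m \<otimes> r \<in> poly_space n"
proof (induction n arbitrary: m)
  case 0
  then show ?case using B_closed by simp
next
  case (Suc n)
  from \<open>m \<in> poly_space (Suc n)\<close>
  obtain m' s where m: "m = m' \<oplus> s \<otimes> x [^] n" "m' \<in> poly_space n" "s \<in> B" by (rule poly_SucE)
  have "m \<otimes> r = m' \<otimes> r \<oplus> s \<otimes> (x [^] n \<otimes> r)"
    using m Suc(3) B_closed poly_closed xp by (simp add: l_distr m_assoc)
  moreover have "x [^] n \<otimes> r \<in> poly_space (Suc n)" using xpow_poly[OF B_poly_one[OF Suc(3)], of n] by simp
  ultimately show ?case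
    using PD(3)[OF poly_Suc[OF Suc(1)[OF m(2) Suc(3)]] B_poly[OF m(3)]] by simp
qed

text \<open>Counterpart of \<open>xpow_B\<close>. Both exchanges are needed, because
  \<open>poly_space\<close> has its coefficients on the left of x^n and \<open>lead\<close> has them
  on the right.\<close>

lemma B_xpow:
  assumes "r \<in> B"
  shows "\<exists>m\<in>poly_space n. \<exists>r'\<in>B. r \<otimes> x [^] n = x [^] n \<otimes> r' \<oplus> m"
proof (induction n)
  case 0
  then show ?case using assms B_closed by (auto intro!: bexI[of _ r])
next
  case (Suc n)
  then obtain m r' where 1: "m \<in> poly_space n" "r' \<in> B" "r \<otimes> x [^] n = x [^] n \<otimes> r' \<oplus> m" by blast
  obtain s s' where 2: "s \<in> B" "s' \<in> B" "r' \<otimes> x = x \<otimes> s \<oplus> s'" using B_x[OF 1(2)] by blast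
  note cl = B_closed[OF 1(2)] B_closed[OF 2(1)] B_closed[OF 2(2)] poly_closed[OF 1(1)] B_closed[OF assms] xp x_closed
  have "r \<otimes> x [^] Suc n = (r \<otimes> x [^] n) \<otimes> x" using cl by (simp add: m_assoc)
  also have "\<dots> = x [^] n \<otimes> (r' \<otimes> x) \<oplus> m \<otimes> x" unfolding 1(3) using cl by (simp add: l_distr m_assoc)
  also have "\<dots> = x [^] Suc n \<otimes> s \<oplus> (x [^] n \<otimes> s' \<oplus> m \<otimes> x)"
    unfolding 2(3) using cl by (simp add: r_distr m_assoc a_assoc)
  finally have "r \<otimes> x [^] Suc n = x [^] Suc n \<otimes> s \<oplus> (x [^] n \<otimes> s' \<oplus> m \<otimes> x)" .
  moreover have "x [^] n \<otimes> s' \<oplus> m \<otimes> x \<in> poly_space (Suc n)"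
    using PD(3)[OF _ poly_x[OF 1(1)]] xpow_poly[OF B_poly_one[OF 2(2)], of n] by simp
  ultimately show ?case using 2(1) by blast
qed

definition polys :: "'a set" where "polys = (\<Union>n. poly_space n)"

lemma poly_mult: "m \<in> poly_space n \<Longrightarrow> m' \<in> poly_space n' \<Longrightarrow> m \<otimes> m' \<in> poly_space (n + n')"
proof (induction n arbitrary: m)
  case 0
  then show ?case using PD(2)[of n'] poly_closed by simp
next
  case (Suc n)
  from \<open>m \<in> poly_space (Suc n)\<close>
  obtain l s where m: "m = l \<oplus> s \<otimes> x [^] n" "l \<in> poly_space n" "s \<in> B" by (rule poly_SucE)
  have "m \<otimes> m' = l \<otimes> m' \<oplus> s \<otimes> (x [^] n \<otimes> m')"
    using m B_closed poly_closed[OF m(2)] poly_closed[OF Suc(3)] xp by (simp add: l_distr m_assoc)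
  moreover have "l \<otimes> m' \<oplus> s \<otimes> (x [^] n \<otimes> m') \<in> poly_space (n + n')"
    by (intro PD(3) Suc(1) m Suc(3) B_poly xpow_poly)
  ultimately show ?case using poly_Suc by simp
qed

lemma polys_subalg: "subalg A polys"
  unfolding subalg_def
proof (intro conjI ballI)
  show "submodule polys scalar_ring A"
  proof (rule submoduleI)
    show "polys \<subseteq> carrier A" using poly_closed by (auto simp: polys_def)
    show "\<zero> \<in> polys" using PD(2) by (auto simp: polys_def)
    show "k \<odot> u \<in> polys" if "u \<in> polys" for k u using that PD(4) by (auto simp: polys_def)
    fix u v assume "u \<in> polys" "v \<in> polys"
    then obtain n n' where "u \<in> poly_space n" "v \<in> poly_space n'" by (auto simp: polys_def)
    then have "u \<oplus> v \<in> poly_space (max n n')"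
      by (intro PD(3)) (erule poly_mono[rotated], simp)+
    then show "u \<oplus> v \<in> polys" by (auto simp: polys_def)
  qed
  show "\<one> \<in> polys" using B_poly_one[OF B_one] by (auto simp: polys_def)
  fix u v assume "u \<in> polys" "v \<in> polys"
  then show "u \<otimes> v \<in> polys" using poly_mult by (auto simp: polys_def) blast
qed

text \<open>Leading coefficients of degree \<open>n\<close>, with \<open>x^n\<close> on the left of the coefficient.\<close>

definition lead :: "nat \<Rightarrow> 'a set \<Rightarrow> 'a set" where
  "lead n I = {r \<in> B. \<exists>m\<in>poly_space n. x [^] n \<otimes> r \<oplus> m \<in> I}"

text \<open>The sets \<open>lead n (C k)\<close> grow in both indices. Once they are stationary in k
  for every n, the chain itself is: leading terms can be removed inside the smaller ideal. With x^n
  on the left of the coefficient, left multiplication by x raises the degree without touching the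
  leading coefficient.\<close>

theorem hilbert_basis:
  assumes BB: "left_acc A B B"
  shows "left_acc A polys polys"
proof (rule left_accI)
  fix C :: "nat \<Rightarrow> 'a set"
  assume C: "\<And>n. submodule (C n) scalar_ring A" "\<And>n. C n \<subseteq> polys" "\<And>n r a. r \<in> polys \<Longrightarrow> a \<in> C n \<Longrightarrow> r \<otimes> a \<in> C n"
    "\<And>m n. m \<le> n \<Longrightarrow> C m \<subseteq> C n"
  note CD = submoduleD[OF C(1)]
  have x_polys: "x \<in> polys" using poly_base[OF B_one, of 1] x_closed by (auto simp: polys_def)
  have B_polys: "r \<in> polys" if "r \<in> B" for r using B_poly_one[OF that] by (auto simp: polys_def)
  have lead_sub: "submodule (lead n (C k)) scalar_ring A" for n k
  proof (rule submoduleI)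
    show "lead n (C k) \<subseteq> carrier A" using B_closed by (auto simp: lead_def)
    show "\<zero> \<in> lead n (C k)" using BD(2) PD(2)[of n] CD(2) xp by (auto simp: lead_def intro!: bexI[of _ \<zero>])
    show "r \<oplus> s \<in> lead n (C k)" if rs: "r \<in> lead n (C k)" "s \<in> lead n (C k)" for r s
    proof -
      obtain m m' where m: "r \<in> B" "s \<in> B" "m \<in> poly_space n" "m' \<in> poly_space n"
        "x [^] n \<otimes> r \<oplus> m \<in> C k" "x [^] n \<otimes> s \<oplus> m' \<in> C k" using rs by (auto simp: lead_def)
      have "(x [^] n \<otimes> r \<oplus> m) \<oplus> (x [^] n \<otimes> s \<oplus> m') = x [^] n \<otimes> (r \<oplus> s) \<oplus> (m \<oplus> m')"
        using m B_closed poly_closed xp by (simp add: r_distr a_ac)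
      then have "x [^] n \<otimes> (r \<oplus> s) \<oplus> (m \<oplus> m') \<in> C k" using CD(3)[OF m(5,6)] by simp
      then show ?thesis using m BD(3) PD(3) by (auto simp: lead_def)
    qed
    show "l \<odot> r \<in> lead n (C k)" if r: "r \<in> lead n (C k)" for l r
    proof -
      obtain m where m: "r \<in> B" "m \<in> poly_space n" "x [^] n \<otimes> r \<oplus> m \<in> C k" using r by (auto simp: lead_def)
      have "l \<odot> (x [^] n \<otimes> r \<oplus> m) = x [^] n \<otimes> (l \<odot> r) \<oplus> l \<odot> m"
        using m B_closed poly_closed xp by (simp add: smult_add_right mult_smult_right)
      then have "x [^] n \<otimes> (l \<odot> r) \<oplus> l \<odot> m \<in> C k" using CD(4)[OF m(3)] by metis
      then show ?thesis using m BD(4) PD(4) by (auto simp: lead_def)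
    qed
  qed
  \<comment> \<open>Since x^n s = s' x^n modulo lower degree, multiplying by s' instead of s
    produces the leading coefficient s r.\<close>
  have lead_B: "s \<otimes> r \<in> lead n (C k)" if s: "s \<in> B" and r: "r \<in> lead n (C k)" for n k s r
  proof -
    obtain m where m: "r \<in> B" "m \<in> poly_space n" "x [^] n \<otimes> r \<oplus> m \<in> C k" using r by (auto simp: lead_def)
    obtain m1 s' where s': "m1 \<in> poly_space n" "s' \<in> B" "x [^] n \<otimes> s = m1 \<oplus> s' \<otimes> x [^] n" using xpow_B[OF s] by blast
    note cl = B_closed[OF m(1)] B_closed[OF s] B_closed[OF s'(2)] poly_closed[OF m(2)] poly_closed[OF s'(1)] xp
    have "s' \<otimes> (x [^] n \<otimes> r \<oplus> m) \<in> C k" using C(3)[OF B_polys[OF s'(2)] m(3)] .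
    moreover have "s' \<otimes> (x [^] n \<otimes> r \<oplus> m) = x [^] n \<otimes> (s \<otimes> r) \<oplus> (s' \<otimes> m \<ominus> m1 \<otimes> r)"
    proof -
      have lhs: "x [^] n \<otimes> (s \<otimes> r) = m1 \<otimes> r \<oplus> s' \<otimes> (x [^] n \<otimes> r)"
        using cl by (simp add: s'(3) l_distr flip: m_assoc)
      have cancel: "q \<oplus> t = (p \<oplus> q) \<oplus> (t \<ominus> p)" if "p \<in> carrier A" "q \<in> carrier A" "t \<in> carrier A" for p q t
      proof -
        have "(p \<oplus> q) \<oplus> (t \<ominus> p) = (q \<oplus> t) \<oplus> (p \<ominus> p)" using that by (simp add: a_minus_def a_ac)
        then show ?thesis using that by (simp add: a_minus_def r_neg)
      qed
      have "s' \<otimes> (x [^] n \<otimes> r \<oplus> m) = s' \<otimes> (x [^] n \<otimes> r) \<oplus> s' \<otimes> m" using cl by (simp add: r_distr)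
      also have "\<dots> = (m1 \<otimes> r \<oplus> s' \<otimes> (x [^] n \<otimes> r)) \<oplus> (s' \<otimes> m \<ominus> m1 \<otimes> r)"
        by (rule cancel) (use cl in simp_all)
      finally show ?thesis unfolding lhs .
    qed
    moreover have "s' \<otimes> m \<ominus> m1 \<otimes> r \<in> poly_space n"
      by (rule submodule_diff[OF poly_submodule B_poly[OF s'(2) m(2)] poly_B[OF s'(1) m(1)]])
    ultimately show ?thesis using B_mult[OF s m(1)] by (auto simp: lead_def)
  qed
  have lead_Suc: "lead n (C k) \<subseteq> lead (Suc n) (C k)" for n k
  proof
    fix r assume "r \<in> lead n (C k)"
    then obtain m where m: "r \<in> B" "m \<in> poly_space n" "x [^] n \<otimes> r \<oplus> m \<in> C k" by (auto simp: lead_def)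
    have "x \<otimes> (x [^] n \<otimes> r \<oplus> m) = x [^] Suc n \<otimes> r \<oplus> x \<otimes> m"
      using B_closed[OF m(1)] poly_closed[OF m(2)] x_closed pow_commute[OF x_closed, of n]
      by (simp add: r_distr flip: m_assoc)
    then have "x [^] Suc n \<otimes> r \<oplus> x \<otimes> m \<in> C k" using C(3)[OF x_polys m(3)] by metis
    then show "r \<in> lead (Suc n) (C k)" unfolding lead_def using m(1) x_poly[OF m(2)] by blast
  qed
  have lead_chain: "lead n (C k) \<subseteq> lead n (C k')" if "k \<le> k'" for n k k'
    using C(4)[OF that] by (auto simp: lead_def)
  have lead_mono: "lead n (C k) \<subseteq> lead n' (C k')" if "n \<le> n'" "k \<le> k'" for n n' k k'
    using chain_mono[of "\<lambda>n. lead n (C k)", OF lead_Suc that(1)] lead_chain[OF that(2)] by blast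
  have lead_subset: "lead n (C k) \<subseteq> B" for n k by (auto simp: lead_def)
  \<comment> \<open>The diagonal chain stabilises; this settles all degrees n \<ge> N at once and
    leaves finitely many rows, which are treated separately.\<close>
  obtain N where N: "\<And>n. n \<ge> N \<Longrightarrow> lead n (C n) = lead N (C N)"
  proof (rule left_acc_chain[OF BB, of "\<lambda>n. lead n (C n)"])
    show "lead n (C n) \<subseteq> lead (Suc n) (C (Suc n))" for n by (rule lead_mono) simp_all
  qed (blast intro: that lead_sub lead_B subsetD[OF lead_subset])+
  have "\<exists>K. \<forall>k\<ge>K. lead n (C k) = lead n (C K)" for n
  proof -
    obtain K where "\<And>k. k \<ge> K \<Longrightarrow> lead n (C k) = lead n (C K)"
    proof (rule left_acc_chain[OF BB, of "\<lambda>k. lead n (C k)"])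
      show "lead n (C k) \<subseteq> lead n (C (Suc k))" for k by (rule lead_mono) simp_all
    qed (blast intro: that lead_sub lead_B subsetD[OF lead_subset])+
    then show ?thesis by auto
  qed
  then obtain K where K: "\<And>n k. k \<ge> K n \<Longrightarrow> lead n (C k) = lead n (C (K n))" by metis
  \<comment> \<open>From this index on, every row of the array is stationary.\<close>
  define M where "M = Max (insert N (K ` {..<N}))"
  have M: "N \<le> M" "n < N \<Longrightarrow> K n \<le> M" for n by (auto simp: M_def)
  have stable: "lead n (C k) = lead n (C M)" if "k \<ge> M" for n k
  proof (cases "n < N")
    case True
    then have "K n \<le> M" "K n \<le> k" using M(2)[of n] that by simp_all
    then show ?thesis using K[of n k] K[of n M] by simp
  next
    case False
    \<comment> \<open>Each such entry is squeezed between the entry (N, N) and a later diagonal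
      entry.\<close>
    have big: "lead n (C j) = lead N (C N)" if j: "j \<ge> N" for j
    proof
      show "lead N (C N) \<subseteq> lead n (C j)" using False j by (intro lead_mono) auto
      have "lead n (C j) \<subseteq> lead (max n j) (C (max n j))" by (intro lead_mono) auto
      also have "\<dots> = lead N (C N)" using j by (intro N) auto
      finally show "lead n (C j) \<subseteq> lead N (C N)" .
    qed
    show ?thesis using big[of k] big[of M] M that by simp
  qed
  \<comment> \<open>Induction on the degree bound: an element of \<open>C M\<close> with the same
    leading coefficient is subtracted.\<close>
  have "a \<in> C M" if "a \<in> C k" "a \<in> poly_space n" "k \<ge> M" for a k n
    using that
  proof (induction n arbitrary: a)
    case 0
    then show ?case using CD(2) by simp
  next
    case (Suc n)
    from \<open>a \<in> poly_space (Suc n)\<close>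
    obtain m s where a: "a = m \<oplus> s \<otimes> x [^] n" "m \<in> poly_space n" "s \<in> B" by (rule poly_SucE)
    obtain m' r where r: "m' \<in> poly_space n" "r \<in> B" "s \<otimes> x [^] n = x [^] n \<otimes> r \<oplus> m'" using B_xpow[OF a(3)] by blast
    note cl = poly_closed[OF a(2)] poly_closed[OF r(1)] B_closed[OF r(2)] xp
    have a': "a = x [^] n \<otimes> r \<oplus> (m' \<oplus> m)" unfolding a(1) r(3) using cl by (simp add: a_ac)
    then have "r \<in> lead n (C k)" using Suc(2) r(2) PD(3)[OF r(1) a(2)] by (auto simp: lead_def)
    then have "r \<in> lead n (C M)" using stable[OF Suc(4)] by simp
    then obtain l where l: "l \<in> poly_space n" "x [^] n \<otimes> r \<oplus> l \<in> C M" by (auto simp: lead_def)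
    note lc = poly_closed[OF l(1)]
    have "a \<ominus> (x [^] n \<otimes> r \<oplus> l) \<in> C k" using submodule_diff[OF C(1) Suc(2)] l(2) C(4)[OF Suc(4)] by blast
    moreover have d: "a \<ominus> (x [^] n \<otimes> r \<oplus> l) = (m' \<oplus> m) \<ominus> l"
    proof -
      have "p \<oplus> q \<ominus> (p \<oplus> l) = q \<ominus> l" if "p \<in> carrier A" "q \<in> carrier A" for p q
        using that lc by (simp add: a_minus_def minus_add a_comm[of p q] a_assoc r_neg2)
      then show ?thesis unfolding a' using cl by simp
    qed
    moreover have "(m' \<oplus> m) \<ominus> l \<in> poly_space n" by (rule submodule_diff[OF poly_submodule PD(3)[OF r(1) a(2)] l(1)])
    ultimately have "a \<ominus> (x [^] n \<otimes> r \<oplus> l) \<in> C M" using Suc(1) Suc(4) by simp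
    then have "(a \<ominus> (x [^] n \<otimes> r \<oplus> l)) \<oplus> (x [^] n \<otimes> r \<oplus> l) \<in> C M" using l(2) CD(3) by blast
    moreover have "(a \<ominus> (x [^] n \<otimes> r \<oplus> l)) \<oplus> (x [^] n \<otimes> r \<oplus> l) = a"
      using cl lc a' by (simp add: a_minus_def a_assoc l_neg)
    ultimately show ?case by simp
  qed
  then have "C k \<subseteq> C M" if "k \<ge> M" for k using C(2)[of k] that by (auto simp: polys_def)
  then show "\<exists>N. \<forall>n\<ge>N. C n = C N" using C(4) by blast
qed

text \<open>Monomials with the coefficient on the right span the same polynomials. This identifies
  them with those of the opposite algebra, where the sides are exchanged.\<close>

lemma polys_in:
  assumes V: "submodule V scalar_ring A" and "\<And>r n. r \<in> B \<Longrightarrow> x [^] (n::nat) \<otimes> r \<in> V"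
  shows "polys \<subseteq> V"
proof -
  have "poly_space n \<subseteq> V" for n
  proof (induction n)
    case 0
    then show ?case using submoduleD(2)[OF V] by simp
  next
    case (Suc n)
    have "m \<oplus> r \<otimes> x [^] n \<in> V" if m: "m \<in> poly_space n" and r: "r \<in> B" for m r
    proof -
      obtain m' r' where "m' \<in> poly_space n" "r' \<in> B" "r \<otimes> x [^] n = x [^] n \<otimes> r' \<oplus> m'" using B_xpow[OF r] by blast
      then show ?thesis using Suc m assms(2) submoduleD(3)[OF V] by (metis subsetD)
    qed
    then show ?case by (auto elim!: poly_SucE)
  qed
  then show ?thesis by (auto simp: polys_def)
qed

lemma opposite_hilbert_step: "hilbert_step (opposite A) B x"
proof -
  interpret O: k_alg "opposite A" by unfold_locales (rule opposite_k_algebra)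
  show ?thesis
    by unfold_locales (use B_subalg x_closed x_B B_x in auto)
qed

lemma opposite_pow: "u \<in> carrier A \<Longrightarrow> u [^]\<^bsub>opposite A\<^esub> (n::nat) = u [^] n"
proof (induction n)
  case (Suc n)
  interpret O: k_alg "opposite A" by unfold_locales (rule opposite_k_algebra)
  have "u [^]\<^bsub>opposite A\<^esub> Suc n = u \<otimes> (u [^]\<^bsub>opposite A\<^esub> n)" using O.nat_pow_Suc[of u n] by simp
  then show ?case using Suc pow_commute by simp
next
  case 0
  interpret O: k_alg "opposite A" by unfold_locales (rule opposite_k_algebra)
  show ?case using O.nat_pow_0[of u] by simp
qed

lemma opposite_polys: "hilbert_step.polys (opposite A) B x = polys"
proof -
  interpret O: hilbert_step "opposite A" B x by (rule opposite_hilbert_step)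
  have "polys \<subseteq> O.polys"
  proof (rule polys_in)
    show "submodule O.polys scalar_ring A" using O.polys_subalg by (simp add: subalg_def)
    show "x [^] n \<otimes> r \<in> O.polys" if "r \<in> B" for r and n :: nat
      using O.poly_base[OF that, of n] x_closed by (auto simp: O.polys_def opposite_pow simp del: O.poly_space.simps)
  qed
  moreover have "O.polys \<subseteq> polys"
  proof (rule O.polys_in)
    show "submodule polys scalar_ring (opposite A)" using polys_subalg by (simp add: subalg_def)
    show "x [^]\<^bsub>opposite A\<^esub> n \<otimes>\<^bsub>opposite A\<^esub> r \<in> polys" if "r \<in> B" for r and n :: nat
      using poly_base[OF that, of n] x_closed by (auto simp: polys_def opposite_pow)
  qed
  ultimately show ?thesis by blast
qed

text \<open>A left ideal C of \<open>S\<close> is determined by its polynomials: if x^i a is one,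
  then a = v^i (x^i a) is recovered from it.\<close>

lemma left_acc_localization:
  assumes BB: "left_acc A B B" and v: "v \<in> S" "v \<otimes> x = \<one>" and S: "subalg A S" "polys \<subseteq> S"
    and shift: "\<And>s. s \<in> S \<Longrightarrow> \<exists>n. x [^] (n::nat) \<otimes> s \<in> polys"
  shows "left_acc A S S"
proof (rule left_accI)
  fix C :: "nat \<Rightarrow> 'a set"
  assume C: "\<And>n. submodule (C n) scalar_ring A" "\<And>n. C n \<subseteq> S" "\<And>n r a. r \<in> S \<Longrightarrow> a \<in> C n \<Longrightarrow> r \<otimes> a \<in> C n"
    "\<And>m n. m \<le> n \<Longrightarrow> C m \<subseteq> C n"
  have Ss: "submodule S scalar_ring A" and Sm: "\<And>u v. u \<in> S \<Longrightarrow> v \<in> S \<Longrightarrow> u \<otimes> v \<in> S" and S1: "\<one> \<in> S" using S(1) by (auto simp: subalg_def)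
  have Sc: "s \<in> carrier A" if "s \<in> S" for s using that submoduleD(1)[OF Ss] by blast
  have P: "submodule polys scalar_ring A" "\<And>u v. u \<in> polys \<Longrightarrow> v \<in> polys \<Longrightarrow> u \<otimes> v \<in> polys" using polys_subalg by (auto simp: subalg_def)
  have x_polys: "x \<in> polys" using poly_base[OF B_one, of 1] x_closed by (auto simp: polys_def)
  have pw: "w [^] (n::nat) \<in> S" if "w \<in> S" for w n by (induction n) (use S1 Sm that in auto)
  have vx: "v [^] n \<otimes> x [^] n = \<one>" for n :: nat
  proof (induction n)
    case (Suc n)
    have "v [^] Suc n \<otimes> x [^] Suc n = v [^] n \<otimes> ((v \<otimes> x) \<otimes> x [^] n)"
      using Sc[OF v(1)] x_closed pow_commute[OF x_closed, of n] by (simp add: m_assoc del: v(2))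
    then show ?case using Suc v(2) Sc[OF v(1)] x_closed by simp
  qed simp
  have CS: "a \<in> C (Suc n)" if "a \<in> C n" for a n using C(4)[of n "Suc n"] that by auto
  obtain N where N: "\<And>n. n \<ge> N \<Longrightarrow> C n \<inter> polys = C N \<inter> polys"
    by (rule left_acc_chain[OF hilbert_basis[OF BB], of "\<lambda>n. C n \<inter> polys"])
      (use C(1-3) CS P S submodule_inter[OF C(1) P(1)] in auto)
  have "C n \<subseteq> C N" if n: "n \<ge> N" for n
  proof
    fix a assume a: "a \<in> C n"
    then have aS: "a \<in> S" using C(2) by blast
    obtain i where i: "x [^] (i::nat) \<otimes> a \<in> polys" using shift[OF aS] by blast
    have "x [^] i \<otimes> a \<in> C n" using C(3) a pw x_polys S(2) by blast
    then have "x [^] i \<otimes> a \<in> C N" using i N[OF n] by blast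
    then have "v [^] i \<otimes> (x [^] i \<otimes> a) \<in> C N" using C(3) pw v(1) by blast
    moreover have "v [^] i \<otimes> (x [^] i \<otimes> a) = a"
      using vx[of i] Sc[OF v(1)] Sc[OF aS] x_closed by (simp flip: m_assoc)
    ultimately show "a \<in> C N" by simp
  qed
  then show "\<exists>N. \<forall>n\<ge>N. C n = C N" using C(4) by blast
qed

end

section \<open>Two-sided chain conditions\<close>

definition noetherian_subalg :: "('k::field, 'a, 'm) module_scheme \<Rightarrow> 'a set \<Rightarrow> bool" where
  "noetherian_subalg A B \<longleftrightarrow> left_acc A B B \<and> left_acc (opposite A) B B"

context k_alg
begin

lemma span_subalg:
  assumes E: "E \<subseteq> carrier A" and "\<one> \<in> k_span A E" and "\<And>e e'. e \<in> E \<Longrightarrow> e' \<in> E \<Longrightarrow> e \<otimes> e' \<in> k_span A E"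
  shows "subalg A (k_span A E)"
  unfolding subalg_def using k_span_submodule[OF E] assms(2)
    k_span_mult[OF E E k_span_submodule[OF E] assms(3)] by auto

lemma opposite_span: "k_span (opposite A) E = k_span A E"
  by (simp add: k_span_def)

lemma noetherian_finite_extension:
  assumes B: "subalg A B" "noetherian_subalg A B" and F: "finite F" "F \<subseteq> carrier A" and S: "subalg A S" "B \<subseteq> S" "F \<subseteq> S"
    and gen: "S \<subseteq> k_span A {r \<otimes> g | r g. r \<in> B \<and> g \<in> F}" "S \<subseteq> k_span A {g \<otimes> r | r g. r \<in> B \<and> g \<in> F}"
  shows "noetherian_subalg A S"
proof -
  interpret O: k_alg "opposite A" by unfold_locales (rule opposite_k_algebra)
  have "left_acc A S S"
    by (rule left_acc_restrict[OF left_acc_finite_extension[OF B(1) _ F] S(2) gen(1)])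
      (use B(2) in \<open>simp add: noetherian_subalg_def\<close>)
  moreover have "left_acc (opposite A) S S"
  proof (rule O.left_acc_restrict[OF _ S(2)])
    show "left_acc (opposite A) B (k_span (opposite A) {r \<otimes>\<^bsub>opposite A\<^esub> g | r g. r \<in> B \<and> g \<in> F})"
      by (rule O.left_acc_finite_extension) (use B F in \<open>simp_all add: noetherian_subalg_def\<close>)
    show "S \<subseteq> k_span (opposite A) {r \<otimes>\<^bsub>opposite A\<^esub> g | r g. r \<in> B \<and> g \<in> F}"
      using gen(2) by (simp add: opposite_span)
  qed
  ultimately show ?thesis by (simp add: noetherian_subalg_def)
qed

text \<open>On a spanning set the relation x e = k e x + r can be solved for e x because k is
  invertible; this gives the exchange in the other direction.\<close>

lemma hilbert_stepI:
  assumes E: "E \<subseteq> carrier A" and B: "subalg A (k_span A E)" and x: "x \<in> carrier A"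
    and comm: "\<And>e. e \<in> E \<Longrightarrow> \<exists>k r. k \<noteq> 0 \<and> r \<in> k_span A E \<and> x \<otimes> e = k \<odot> (e \<otimes> x) \<oplus> r"
  shows "hilbert_step A (k_span A E) x"
proof -
  let ?B = "k_span A E"
  note D = submoduleD[OF k_span_submodule[OF E]]
  have Bc: "r \<in> carrier A" if "r \<in> ?B" for r using that D(1) by blast
  have 1: "\<exists>r'\<in>?B. \<exists>r''\<in>?B. x \<otimes> r = r' \<otimes> x \<oplus> r''" if "r \<in> ?B" for r
    using that E
  proof (induction rule: k_span_induct)
    case zero
    then show ?case using D(2) x by (intro bexI[of _ \<zero>]) auto
  next
    case (base e)
    then obtain k r where kr: "r \<in> ?B" "x \<otimes> e = k \<odot> (e \<otimes> x) \<oplus> r" using comm by blast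
    have "e \<in> carrier A" using base E by blast
    then have "k \<odot> (e \<otimes> x) = (k \<odot> e) \<otimes> x" using x by (simp add: mult_smult_left)
    then show ?case using kr D(4)[OF k_span_base[OF base]] by metis
  next
    case (add u v)
    then obtain r r' s s' where *: "r \<in> ?B" "r' \<in> ?B" "x \<otimes> u = r \<otimes> x \<oplus> r'" "s \<in> ?B" "s' \<in> ?B" "x \<otimes> v = s \<otimes> x \<oplus> s'" by blast
    have "x \<otimes> (u \<oplus> v) = (r \<oplus> s) \<otimes> x \<oplus> (r' \<oplus> s')"
      using * Bc add(1,2) x by (simp add: r_distr l_distr a_ac)
    then show ?case using * D(3) by blast
  next
    case (smult k u)
    then obtain r r' where *: "r \<in> ?B" "r' \<in> ?B" "x \<otimes> u = r \<otimes> x \<oplus> r'" by blast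
    have "x \<otimes> (k \<odot> u) = (k \<odot> r) \<otimes> x \<oplus> k \<odot> r'"
      using * Bc smult(1) x by (simp add: mult_smult_left mult_smult_right smult_add_right)
    then show ?case using * D(4) by blast
  qed
  have 2: "\<exists>r'\<in>?B. \<exists>r''\<in>?B. r \<otimes> x = x \<otimes> r' \<oplus> r''" if "r \<in> ?B" for r
    using that E
  proof (induction rule: k_span_induct)
    case zero
    then show ?case using D(2) x by (intro bexI[of _ \<zero>]) auto
  next
    case (base e)
    then obtain k r where kr: "k \<noteq> 0" "r \<in> ?B" "x \<otimes> e = k \<odot> (e \<otimes> x) \<oplus> r" using comm by blast
    have e: "e \<in> carrier A" using base E by blast
    have "x \<otimes> (inverse k \<odot> e) \<oplus> \<ominus> (inverse k \<odot> r) = inverse k \<odot> (x \<otimes> e) \<oplus> \<ominus> (inverse k \<odot> r)"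
      using e x by (simp add: mult_smult_right)
    also have "\<dots> = e \<otimes> x"
      unfolding kr(3) using kr(1) e x Bc[OF kr(2)] by (simp add: smult_add_right smult_smult a_assoc r_neg)
    finally show ?case using D(4)[OF k_span_base[OF base]] D(5)[OF D(4)[OF kr(2)]] by metis
  next
    case (add u v)
    then obtain r r' s s' where *: "r \<in> ?B" "r' \<in> ?B" "u \<otimes> x = x \<otimes> r \<oplus> r'" "s \<in> ?B" "s' \<in> ?B" "v \<otimes> x = x \<otimes> s \<oplus> s'" by blast
    have "(u \<oplus> v) \<otimes> x = x \<otimes> (r \<oplus> s) \<oplus> (r' \<oplus> s')"
      using * Bc add(1,2) x by (simp add: r_distr l_distr a_ac)
    then show ?case using * D(3) by blast
  next
    case (smult k u)
    then obtain r r' where *: "r \<in> ?B" "r' \<in> ?B" "u \<otimes> x = x \<otimes> r \<oplus> r'" by blast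
    have "(k \<odot> u) \<otimes> x = x \<otimes> (k \<odot> r) \<oplus> k \<odot> r'"
      using * Bc smult(1) x by (simp add: mult_smult_left mult_smult_right smult_add_right)
    then show ?case using * D(4) by blast
  qed
  show ?thesis by unfold_locales (use B x 1 2 in auto)
qed

text \<open>One-sided ideals are subspaces because k u = (k 1) u, and right ideals are left ideals
  of the opposite algebra.\<close>

lemma noetherian_subalg_carrier:
  assumes "noetherian_subalg A (carrier A)"
  shows "nc_noetherian A"
proof -
  have left: "\<exists>N. \<forall>n\<ge>N. C n = C N"
    if B: "k_algebra B" "left_acc B (carrier B) (carrier B)"
      and C: "\<And>n. additive_subgroup (C n) B" "\<And>n r a. r \<in> carrier B \<Longrightarrow> a \<in> C n \<Longrightarrow> r \<otimes>\<^bsub>B\<^esub> a \<in> C n" "\<And>n. C n \<subseteq> C (Suc n)"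
    for B :: "('k, 'a, 'm) module_scheme" and C :: "nat \<Rightarrow> 'a set"
  proof -
    interpret B: k_alg B by unfold_locales (rule B(1))
    have sub: "submodule (C n) scalar_ring B" for n
    proof (rule B.submoduleI)
      interpret a: additive_subgroup "C n" B by (rule C(1))
      show cs: "C n \<subseteq> carrier B" by (rule a.a_subset)
      show "\<zero>\<^bsub>B\<^esub> \<in> C n" by (rule a.zero_closed)
      show "u \<oplus>\<^bsub>B\<^esub> v \<in> C n" if "u \<in> C n" "v \<in> C n" for u v using that by (rule a.a_closed)
      show "k \<odot>\<^bsub>B\<^esub> u \<in> C n" if u: "u \<in> C n" for k u
      proof -
        have uc: "u \<in> carrier B" using u cs by blast
        have "(k \<odot>\<^bsub>B\<^esub> \<one>\<^bsub>B\<^esub>) \<otimes>\<^bsub>B\<^esub> u \<in> C n" by (rule C(2)) (use u in auto)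
        then show ?thesis using uc by (simp add: B.mult_smult_left)
      qed
    qed
    show ?thesis
    proof -
      obtain N where "\<And>n. n \<ge> N \<Longrightarrow> C n = C N"
      proof (rule left_acc_chain[OF B(2), of C])
        show "submodule (C n) scalar_ring B" for n by (rule sub)
        show "C n \<subseteq> carrier B" for n by (rule B.submoduleD(1)[OF sub])
        show "r \<otimes>\<^bsub>B\<^esub> a \<in> C n" if "r \<in> carrier B" "a \<in> C n" for n r a using that by (rule C(2))
        show "C n \<subseteq> C (Suc n)" for n by (rule C(3))
      qed (blast intro: that)
      then show ?thesis by auto
    qed
  qed
  have opp: "additive_subgroup I (opposite A) = additive_subgroup I A" for I
    by (simp add: additive_subgroup_def subgroup_def m_inv_def)
  show ?thesis unfolding nc_noetherian_def ascending_chain_condition_def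
  proof (intro conjI allI impI)
    show "Ring.ring A" by (rule ring_axioms)
    fix C :: "nat \<Rightarrow> 'a set"
    assume "(\<forall>n. left_ideal (C n) A) \<and> (\<forall>n. C n \<subseteq> C (Suc n))"
    then show "\<exists>N. \<forall>n\<ge>N. C n = C N"
      by (intro left[OF k_algebra]) (use assms in \<open>auto simp: noetherian_subalg_def left_ideal_def\<close>)
  next
    fix C :: "nat \<Rightarrow> 'a set"
    assume "(\<forall>n. right_ideal (C n) A) \<and> (\<forall>n. C n \<subseteq> C (Suc n))"
    then show "\<exists>N. \<forall>n\<ge>N. C n = C N"
      by (intro left[OF opposite_k_algebra]) (use assms in \<open>auto simp: noetherian_subalg_def right_ideal_def opp\<close>)
  qed
qed

text \<open>Starting point of the polycyclic tower: any nonzero subspace of the scalars contains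
  1.\<close>

lemma scalars_noetherian: "noetherian_subalg A (k_span A {\<one>})"
proof -
  have "left_acc B (k_span B {\<one>\<^bsub>B\<^esub>}) (k_span B {\<one>\<^bsub>B\<^esub>})" if "k_algebra B" for B :: "('k, 'a, 'm) module_scheme"
  proof (rule left_accI)
    interpret B: k_alg B by unfold_locales fact
    let ?K = "k_span B {\<one>\<^bsub>B\<^esub>}"
    fix C :: "nat \<Rightarrow> 'a set"
    assume C: "\<And>n. submodule (C n) scalar_ring B" "\<And>n. C n \<subseteq> ?K" "\<And>m n. m \<le> n \<Longrightarrow> C m \<subseteq> C n"
    have K: "\<exists>k. u = k \<odot>\<^bsub>B\<^esub> \<one>\<^bsub>B\<^esub>" if "u \<in> ?K" for u
    proof -
      have "{\<one>\<^bsub>B\<^esub>} \<subseteq> carrier B" by simp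
      with that show ?thesis
      proof (induction rule: B.k_span_induct)
        case zero
        show ?case by (rule exI[of _ 0]) simp
      next
        case (base s)
        then show ?case by (intro exI[of _ 1]) simp
      next
        case (add u v)
        then obtain k l where "u = k \<odot>\<^bsub>B\<^esub> \<one>\<^bsub>B\<^esub>" "v = l \<odot>\<^bsub>B\<^esub> \<one>\<^bsub>B\<^esub>" by blast
        then show ?case by (intro exI[of _ "k + l"]) (simp add: B.smult_add_left)
      next
        case (smult k u)
        then obtain l where "u = l \<odot>\<^bsub>B\<^esub> \<one>\<^bsub>B\<^esub>" by blast
        then show ?case by (intro exI[of _ "k * l"]) (simp add: B.smult_smult)
      qed
    qed
    have full: "C n = ?K" if u: "u \<in> C n" "u \<noteq> \<zero>\<^bsub>B\<^esub>" for n u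
    proof
      obtain k where k: "u = k \<odot>\<^bsub>B\<^esub> \<one>\<^bsub>B\<^esub>" using K u C(2) by blast
      then have "k \<noteq> 0" using u(2) by auto
      then have "\<one>\<^bsub>B\<^esub> = inverse k \<odot>\<^bsub>B\<^esub> u" unfolding k by (simp add: B.smult_smult)
      then have "\<one>\<^bsub>B\<^esub> \<in> C n" using B.submoduleD(4)[OF C(1) u(1)] by simp
      then show "?K \<subseteq> C n" by (intro B.k_span_least[OF C(1)]) simp
    qed (rule C(2))
    show "\<exists>N. \<forall>n\<ge>N. C n = C N"
    proof (cases "\<exists>N u. u \<in> C N \<and> u \<noteq> \<zero>\<^bsub>B\<^esub>")
      case True
      then obtain N u where "u \<in> C N" "u \<noteq> \<zero>\<^bsub>B\<^esub>" by blast
      then have "C n = C N" if "n \<ge> N" for n using full[of u n] full[of u N] C(3)[OF that] by blast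
      then show ?thesis by blast
    next
      case False
      then have "C n = {\<zero>\<^bsub>B\<^esub>}" for n using B.submoduleD(2)[OF C(1), of n] by blast
      then show ?thesis by simp
    qed
  qed
  from this[OF k_algebra] this[OF opposite_k_algebra] show ?thesis
    by (simp add: noetherian_subalg_def opposite_span)
qed

end

context hilbert_step
begin

lemma monomial_in_polys: "r \<in> B \<Longrightarrow> r \<otimes> x [^] (n::nat) \<in> polys"
  unfolding polys_def using poly_base by blast

lemma noetherian_polys:
  assumes "noetherian_subalg A B"
  shows "noetherian_subalg A polys"
proof -
  interpret O: hilbert_step "opposite A" B x by (rule opposite_hilbert_step)
  show ?thesis
    using hilbert_basis O.hilbert_basis assms by (simp add: noetherian_subalg_def opposite_polys)
qed

lemma noetherian_localization:
  assumes B: "noetherian_subalg A B" and v: "v \<in> S" "v \<otimes> x = \<one>" "x \<otimes> v = \<one>" and S: "subalg A S" "polys \<subseteq> S"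
    and shift: "\<And>s. s \<in> S \<Longrightarrow> \<exists>n. x [^] (n::nat) \<otimes> s \<in> polys" "\<And>s. s \<in> S \<Longrightarrow> \<exists>n. s \<otimes> x [^] (n::nat) \<in> polys"
  shows "noetherian_subalg A S"
proof -
  interpret O: hilbert_step "opposite A" B x by (rule opposite_hilbert_step)
  have "left_acc A S S"
    by (rule left_acc_localization[OF _ v(1,2) S shift(1)]) (use B in \<open>simp_all add: noetherian_subalg_def\<close>)
  moreover have "left_acc (opposite A) S S"
    by (rule O.left_acc_localization[OF _ v(1)])
      (use B v S shift x_closed in \<open>simp_all add: noetherian_subalg_def opposite_polys opposite_pow\<close>)
  ultimately show ?thesis by (simp add: noetherian_subalg_def)
qed

end

section \<open>Polycyclic towers and the algebra above them\<close>

text \<open>Lifting a generator of the quotient gives the concrete description by powers of one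
  element that the Laurent argument uses.\<close>

lemma (in group) cyclic_quotient_generator:
  assumes H: "subgroup H G" and K: "K \<lhd> (G\<lparr>carrier := H\<rparr>)" and cyc: "cyclic_group ((G\<lparr>carrier := H\<rparr>) Mod K)"
  obtains t where "t \<in> H" "\<And>h. h \<in> H \<Longrightarrow> \<exists>k\<in>K. \<exists>j::int. h = k \<otimes> t [^] j"
proof -
  let ?H = "G\<lparr>carrier := H\<rparr>"
  interpret H: group ?H using H is_group by (rule subgroup.subgroup_is_group)
  interpret K: normal K ?H by (rule K)
  interpret Q: group "?H Mod K" by (rule K.factorgroup_is_group)
  interpret f: group_hom ?H "?H Mod K" "\<lambda>a. K #>\<^bsub>?H\<^esub> a"
    by (rule group_hom.intro[OF H.is_group Q.is_group group_hom_axioms.intro[OF K.r_coset_hom_Mod]])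
  obtain Z where Z: "Z \<in> carrier (?H Mod K)" "carrier (?H Mod K) = range (\<lambda>n::int. Z [^]\<^bsub>?H Mod K\<^esub> n)"
    using cyc Q.cyclic_group by blast
  obtain t where t: "t \<in> H" "Z = K #>\<^bsub>?H\<^esub> t" using Z(1) by (auto simp: FactGroup_def RCOSETS_def)
  have ipow: "K #>\<^bsub>?H\<^esub> (t [^]\<^bsub>?H\<^esub> (n::int)) = Z [^]\<^bsub>?H Mod K\<^esub> n" for n
    using f.hom_int_pow[of t n] t by simp
  show thesis
  proof (rule that[OF t(1)])
    fix h assume h: "h \<in> H"
    then have "K #>\<^bsub>?H\<^esub> h \<in> carrier (?H Mod K)" using f.hom_closed[of h] by simp
    then obtain n :: int where "K #>\<^bsub>?H\<^esub> h = Z [^]\<^bsub>?H Mod K\<^esub> n" using Z(2) by auto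
    then have "K #>\<^bsub>?H\<^esub> h = K #>\<^bsub>?H\<^esub> (t [^]\<^bsub>?H\<^esub> n)" by (simp only: ipow)
    moreover have "h \<in> K #>\<^bsub>?H\<^esub> h" using H.rcos_self[OF _ K.is_subgroup, of h] h by simp
    ultimately have "h \<in> K #>\<^bsub>?H\<^esub> (t [^] n)" using int_pow_consistent[OF H t(1), of n] by simp
    then show "\<exists>k\<in>K. \<exists>j::int. h = k \<otimes> t [^] j" by (auto simp: r_coset_def)
  qed
qed

context H_presentation
begin

abbreviation "group_span N \<equiv> k_span A (\<iota> ` N)"

lemma group_span_subalg:
  assumes "subgroup N G"
  shows "subalg A (group_span N)"
proof -
  interpret N: subgroup N G by (rule assms)
  show ?thesis
  proof (rule A.span_subalg)
    show "\<iota> ` N \<subseteq> carrier A" using N.subset by auto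
    show "\<one>\<^bsub>A\<^esub> \<in> group_span N" using A.k_span_base[OF imageI[OF N.one_closed, of \<iota>]] by (simp add: iota_one)
    fix e e' assume "e \<in> \<iota> ` N" "e' \<in> \<iota> ` N"
    then obtain g h where gh: "g \<in> N" "h \<in> N" "e = \<iota> g" "e' = \<iota> h" by auto
    then have "e \<otimes>\<^bsub>A\<^esub> e' = \<iota> (g \<otimes>\<^bsub>G\<^esub> h)" using N.subset by (auto simp: iota_mult)
    then show "e \<otimes>\<^bsub>A\<^esub> e' \<in> group_span N" using gh by (auto intro: A.k_span_base)
  qed
qed

lemma iota_pow: "t \<in> carrier G \<Longrightarrow> \<iota> t [^]\<^bsub>A\<^esub> (n::nat) = \<iota> (t [^]\<^bsub>G\<^esub> n)"
  by (induction n) (simp_all add: iota_one iota_mult)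

text \<open>Adjoining t to the span of \<open>K\<close> gives all k t^j with j \<ge> 0, and a high
  power of t clears negative exponents, so localisation applies. Finite and infinite factors need no
  distinction, as \<open>hilbert_step\<close> allows dependent powers.\<close>

lemma noetherian_cyclic_extension:
  assumes H: "subgroup H G" and K: "K \<lhd> (G\<lparr>carrier := H\<rparr>)" and cyc: "cyclic_group ((G\<lparr>carrier := H\<rparr>) Mod K)"
    and noeth: "noetherian_subalg A (group_span K)"
  shows "noetherian_subalg A (group_span H)"
proof -
  interpret Hs: subgroup H G by (rule H)
  interpret H: Group.group "G\<lparr>carrier := H\<rparr>" using H G.is_group by (rule subgroup.subgroup_is_group)
  interpret K: normal K "G\<lparr>carrier := H\<rparr>" by (rule K)
  have KH: "K \<subseteq> H" using K.subset by simp
  have Ksub: "subgroup K G" using G.incl_subgroup[OF H K.is_subgroup] .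
  interpret Ks: subgroup K G by (rule Ksub)
  obtain t where t: "t \<in> H" and gen: "\<And>h. h \<in> H \<Longrightarrow> \<exists>k\<in>K. \<exists>j::int. h = k \<otimes>\<^bsub>G\<^esub> t [^]\<^bsub>G\<^esub> j"
    using G.cyclic_quotient_generator[OF H K cyc] by blast
  have tG: "t \<in> carrier G" using t Hs.subset by blast
  have conj: "s \<otimes>\<^bsub>G\<^esub> k \<otimes>\<^bsub>G\<^esub> inv\<^bsub>G\<^esub> s \<in> K" if "s \<in> H" "k \<in> K" for s k
    using K.inv_op_closed2[of s k] that G.m_inv_consistent[OF H] by simp
  have Kc: "k \<in> carrier G" if "k \<in> K" for k using that Ks.subset by blast
  have Hc: "h \<in> carrier G" if "h \<in> H" for h using that Hs.subset by blast
  have EK: "\<iota> ` K \<subseteq> carrier A" and EH: "\<iota> ` H \<subseteq> carrier A" using Kc Hc by auto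
  note DK = A.submoduleD[OF A.k_span_submodule[OF EK]]
  \<comment> \<open>\<open>K\<close> is normal in \<open>H\<close>, so conjugation preserves its
    span; both exchange conditions follow with remainder zero.\<close>
  have conj_span: "\<iota> s \<otimes>\<^bsub>A\<^esub> r \<otimes>\<^bsub>A\<^esub> \<iota> (inv\<^bsub>G\<^esub> s) \<in> group_span K" if s: "s \<in> H" and r: "r \<in> group_span K" for s r
  proof -
    have sG: "s \<in> carrier G" using s Hs.subset by blast
    have "(\<lambda>r. \<iota> s \<otimes>\<^bsub>A\<^esub> r \<otimes>\<^bsub>A\<^esub> \<iota> (inv\<^bsub>G\<^esub> s)) \<in> k_linear_maps A A"
      by (rule k_linear_maps_comp[OF A.mult_linear(1) A.mult_linear(2)]) (use sG in auto)
    then interpret F: k_linear A A "\<lambda>r. \<iota> s \<otimes>\<^bsub>A\<^esub> r \<otimes>\<^bsub>A\<^esub> \<iota> (inv\<^bsub>G\<^esub> s)"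
      by (rule k_linearI[OF A.k_algebra A.k_algebra])
    show ?thesis
    proof (rule F.span_into[OF EK A.k_span_submodule[OF EK] _ r])
      fix e assume "e \<in> \<iota> ` K"
      then obtain k where k: "k \<in> K" "e = \<iota> k" by auto
      then have "\<iota> s \<otimes>\<^bsub>A\<^esub> e \<otimes>\<^bsub>A\<^esub> \<iota> (inv\<^bsub>G\<^esub> s) = \<iota> (s \<otimes>\<^bsub>G\<^esub> k \<otimes>\<^bsub>G\<^esub> inv\<^bsub>G\<^esub> s)" using sG Kc by (simp add: iota_mult)
      then show "\<iota> s \<otimes>\<^bsub>A\<^esub> e \<otimes>\<^bsub>A\<^esub> \<iota> (inv\<^bsub>G\<^esub> s) \<in> group_span K" using conj[OF s k(1)] by (auto intro: A.k_span_base)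
    qed
  qed
  have KA: "r \<in> carrier A" if "r \<in> group_span K" for r using that DK(1) by blast
  have zK: "\<zero>\<^bsub>A\<^esub> \<in> group_span K" by (rule DK(2))
  interpret S: hilbert_step A "group_span K" "\<iota> t"
  proof unfold_locales
    show "subalg A (group_span K)" by (rule group_span_subalg[OF Ksub])
    show "\<iota> t \<in> carrier A" using tG by simp
    fix r assume r: "r \<in> group_span K"
    have "\<iota> t \<otimes>\<^bsub>A\<^esub> r = (\<iota> t \<otimes>\<^bsub>A\<^esub> r \<otimes>\<^bsub>A\<^esub> \<iota> (inv\<^bsub>G\<^esub> t)) \<otimes>\<^bsub>A\<^esub> \<iota> t \<oplus>\<^bsub>A\<^esub> \<zero>\<^bsub>A\<^esub>"
      using tG KA[OF r] by (simp add: A.m_assoc iota_inv)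
    then show "\<exists>r'\<in>group_span K. \<exists>r''\<in>group_span K. \<iota> t \<otimes>\<^bsub>A\<^esub> r = r' \<otimes>\<^bsub>A\<^esub> \<iota> t \<oplus>\<^bsub>A\<^esub> r''"
      using conj_span[OF t r] zK by blast
    have "r \<otimes>\<^bsub>A\<^esub> \<iota> t = \<iota> t \<otimes>\<^bsub>A\<^esub> (\<iota> (inv\<^bsub>G\<^esub> t) \<otimes>\<^bsub>A\<^esub> r \<otimes>\<^bsub>A\<^esub> \<iota> t) \<oplus>\<^bsub>A\<^esub> \<zero>\<^bsub>A\<^esub>"
      using tG KA[OF r] by (simp add: iota_inv flip: A.m_assoc)
    moreover have "\<iota> (inv\<^bsub>G\<^esub> t) \<otimes>\<^bsub>A\<^esub> r \<otimes>\<^bsub>A\<^esub> \<iota> t \<in> group_span K"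
      using conj_span[of "inv\<^bsub>G\<^esub> t" r] r t tG by simp
    ultimately show "\<exists>r'\<in>group_span K. \<exists>r''\<in>group_span K. r \<otimes>\<^bsub>A\<^esub> \<iota> t = \<iota> t \<otimes>\<^bsub>A\<^esub> r' \<oplus>\<^bsub>A\<^esub> r''"
      using zK by blast
  qed
  have P: "submodule S.polys scalar_ring A" using S.polys_subalg by (simp add: subalg_def)
  note PD = A.submoduleD[OF P]
  have monomial: "\<iota> (k \<otimes>\<^bsub>G\<^esub> t [^]\<^bsub>G\<^esub> (j::int)) \<in> S.polys" if k: "k \<in> K" and j0: "j \<ge> 0" for k j
  proof -
    obtain n where j: "j = int n" using j0 zero_le_imp_eq_int by blast
    have "\<iota> (k \<otimes>\<^bsub>G\<^esub> t [^]\<^bsub>G\<^esub> j) = \<iota> k \<otimes>\<^bsub>A\<^esub> \<iota> t [^]\<^bsub>A\<^esub> n"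
      unfolding j int_pow_int iota_pow[OF tG] by (rule iota_mult[OF Kc[OF k] G.nat_pow_closed[OF tG]])
    also have "\<dots> \<in> S.polys" by (rule S.monomial_in_polys[OF A.k_span_base[OF imageI[OF k]]])
    finally show ?thesis .
  qed
  \<comment> \<open>Stated for all large exponents and not just for one, so that a single power of t
    serves both summands of a sum.\<close>
  have shift1: "\<exists>n0. \<forall>n\<ge>n0. \<iota> t [^]\<^bsub>A\<^esub> (n::nat) \<otimes>\<^bsub>A\<^esub> s \<in> S.polys \<and> s \<otimes>\<^bsub>A\<^esub> \<iota> t [^]\<^bsub>A\<^esub> n \<in> S.polys"
    if "s \<in> group_span H" for s
    using that EH
  proof (induction rule: A.k_span_induct)
    case zero
    then show ?case using PD(2) S.xp by simp
  next
    case (base s)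
    then obtain h where h: "h \<in> H" "s = \<iota> h" by auto
    obtain k j where kj: "k \<in> K" "h = k \<otimes>\<^bsub>G\<^esub> t [^]\<^bsub>G\<^esub> (j::int)" using gen[OF h(1)] by blast
    show ?case
    proof (intro exI allI impI)
      fix n assume n: "nat \<bar>j\<bar> \<le> n"
      have tn: "t [^]\<^bsub>G\<^esub> n \<in> H" by (induction n) (use t in auto)
      have tnj: "t [^]\<^bsub>G\<^esub> n \<otimes>\<^bsub>G\<^esub> t [^]\<^bsub>G\<^esub> j = t [^]\<^bsub>G\<^esub> (int n + j)" "t [^]\<^bsub>G\<^esub> j \<otimes>\<^bsub>G\<^esub> t [^]\<^bsub>G\<^esub> n = t [^]\<^bsub>G\<^esub> (int n + j)"
        using G.int_pow_mult[OF tG, of "int n" j] G.int_pow_mult[OF tG, of j "int n"] by (simp_all add: int_pow_int add.commute)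
      have "t [^]\<^bsub>G\<^esub> n \<otimes>\<^bsub>G\<^esub> h = (t [^]\<^bsub>G\<^esub> n \<otimes>\<^bsub>G\<^esub> k \<otimes>\<^bsub>G\<^esub> inv\<^bsub>G\<^esub> (t [^]\<^bsub>G\<^esub> n)) \<otimes>\<^bsub>G\<^esub> t [^]\<^bsub>G\<^esub> (int n + j)"
        unfolding kj(2) tnj(1)[symmetric] using tG Kc[OF kj(1)]
        by (simp add: G.m_assoc) (simp add: G.l_inv flip: G.m_assoc)
      then have "\<iota> t [^]\<^bsub>A\<^esub> n \<otimes>\<^bsub>A\<^esub> s = \<iota> ((t [^]\<^bsub>G\<^esub> n \<otimes>\<^bsub>G\<^esub> k \<otimes>\<^bsub>G\<^esub> inv\<^bsub>G\<^esub> (t [^]\<^bsub>G\<^esub> n)) \<otimes>\<^bsub>G\<^esub> t [^]\<^bsub>G\<^esub> (int n + j))"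
        using h tG Hc by (simp add: iota_pow flip: iota_mult)
      moreover have "h \<otimes>\<^bsub>G\<^esub> t [^]\<^bsub>G\<^esub> n = k \<otimes>\<^bsub>G\<^esub> t [^]\<^bsub>G\<^esub> (int n + j)"
        unfolding kj(2) tnj(2)[symmetric] using tG Kc[OF kj(1)] by (simp add: G.m_assoc)
      then have "s \<otimes>\<^bsub>A\<^esub> \<iota> t [^]\<^bsub>A\<^esub> n = \<iota> (k \<otimes>\<^bsub>G\<^esub> t [^]\<^bsub>G\<^esub> (int n + j))"
        using h tG Hc by (simp add: iota_pow flip: iota_mult)
      moreover have "int n + j \<ge> 0" using n by linarith
      ultimately show "\<iota> t [^]\<^bsub>A\<^esub> n \<otimes>\<^bsub>A\<^esub> s \<in> S.polys \<and> s \<otimes>\<^bsub>A\<^esub> \<iota> t [^]\<^bsub>A\<^esub> n \<in> S.polys"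
        using monomial[OF conj[OF tn kj(1)]] monomial[OF kj(1)] by simp
    qed
  next
    case (add u v)
    then obtain n1 n2 :: nat where n12:
      "\<forall>n\<ge>n1. \<iota> t [^]\<^bsub>A\<^esub> n \<otimes>\<^bsub>A\<^esub> u \<in> S.polys \<and> u \<otimes>\<^bsub>A\<^esub> \<iota> t [^]\<^bsub>A\<^esub> n \<in> S.polys"
      "\<forall>n\<ge>n2. \<iota> t [^]\<^bsub>A\<^esub> n \<otimes>\<^bsub>A\<^esub> v \<in> S.polys \<and> v \<otimes>\<^bsub>A\<^esub> \<iota> t [^]\<^bsub>A\<^esub> n \<in> S.polys" by blast
    have uv: "u \<in> carrier A" "v \<in> carrier A" using add(1,2) A.k_span_carrier[OF EH] by auto
    show ?case
      by (rule exI[of _ "max n1 n2"]) (use n12 uv S.xp in \<open>auto simp: A.r_distr A.l_distr intro!: PD(3)\<close>)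
  next
    case (smult k u)
    then have uv: "u \<in> carrier A" using A.k_span_carrier[OF EH] by auto
    obtain n1 :: nat where n1: "\<forall>n\<ge>n1. \<iota> t [^]\<^bsub>A\<^esub> n \<otimes>\<^bsub>A\<^esub> u \<in> S.polys \<and> u \<otimes>\<^bsub>A\<^esub> \<iota> t [^]\<^bsub>A\<^esub> n \<in> S.polys"
      using smult(2) by blast
    show ?case
      by (rule exI[of _ n1]) (use n1 uv S.xp in \<open>auto simp: A.mult_smult_left A.mult_smult_right intro!: PD(4)\<close>)
  qed
  have SH: "submodule (group_span H) scalar_ring A" "\<And>u v. u \<in> group_span H \<Longrightarrow> v \<in> group_span H \<Longrightarrow> u \<otimes>\<^bsub>A\<^esub> v \<in> group_span H"
    using group_span_subalg[OF H] by (auto simp: subalg_def)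
  show ?thesis
  proof (rule S.noetherian_localization[OF noeth _ _ _ group_span_subalg[OF H]])
    show "\<iota> (inv\<^bsub>G\<^esub> t) \<in> group_span H" using t by (intro A.k_span_base) auto
    show "\<iota> (inv\<^bsub>G\<^esub> t) \<otimes>\<^bsub>A\<^esub> \<iota> t = \<one>\<^bsub>A\<^esub>" "\<iota> t \<otimes>\<^bsub>A\<^esub> \<iota> (inv\<^bsub>G\<^esub> t) = \<one>\<^bsub>A\<^esub>" using tG by (simp_all add: iota_inv)
    show "S.polys \<subseteq> group_span H"
    proof (rule S.polys_in[OF SH(1)])
      fix r and n :: nat assume r: "r \<in> group_span K"
      have "t [^]\<^bsub>G\<^esub> n \<in> H" by (induction n) (use t in auto)
      then have "\<iota> t [^]\<^bsub>A\<^esub> n \<in> group_span H" using tG by (auto simp: iota_pow intro: A.k_span_base)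
      moreover have "r \<in> group_span H" using r A.k_span_mono[of "\<iota> ` K" "\<iota> ` H"] KH by blast
      ultimately show "\<iota> t [^]\<^bsub>A\<^esub> n \<otimes>\<^bsub>A\<^esub> r \<in> group_span H" by (rule SH(2))
    qed
  qed (use shift1 in blast)+
qed

lemma noetherian_polycyclic:
  assumes "polycyclic_seq G N"
  shows "subgroup N G \<and> noetherian_subalg A (group_span N)"
  using assms
proof (induction rule: polycyclic_seq.induct)
  case unity
  show ?case using G.triv_subgroup A.scalars_noetherian by (simp add: iota_one)
next
  case (extension K H)
  then show ?case using noetherian_cyclic_extension by blast
qed

lemma noetherian_group_algebra:
  assumes "polycyclic_by_finite G"
  shows "noetherian_subalg A (group_span (carrier G))"
proof -
  obtain N where N: "N \<lhd> G" "polycyclic_seq G N" "finite (carrier (G Mod N))"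
    using assms by (auto simp: polycyclic_by_finite_def)
  interpret N: normal N G by (rule N(1))
  \<comment> \<open>One representative for each of the finitely many cosets of
    \<open>N\<close>.\<close>
  define F where "F = (\<lambda>Z. SOME g. g \<in> Z) ` carrier (G Mod N)"
  have rep: "\<exists>f\<in>F. \<exists>n\<in>N. g = n \<otimes>\<^bsub>G\<^esub> f" "f \<in> F \<Longrightarrow> f \<in> carrier G" if g: "g \<in> carrier G" for g f
  proof -
    let ?X = "N #>\<^bsub>G\<^esub> g"
    have Z: "?X \<in> carrier (G Mod N)" using g by (auto simp: FactGroup_def RCOSETS_def)
    have "g \<in> ?X" by (rule G.rcos_self[OF g N.is_subgroup])
    then have "(SOME g. g \<in> ?X) \<in> ?X" by (rule someI)
    then obtain n where n: "n \<in> N" "(SOME g. g \<in> ?X) = n \<otimes>\<^bsub>G\<^esub> g" by (auto simp: r_coset_def)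
    have "g = inv\<^bsub>G\<^esub> n \<otimes>\<^bsub>G\<^esub> (n \<otimes>\<^bsub>G\<^esub> g)" using n(1) g N.subset by (simp add: subset_iff flip: G.m_assoc)
    moreover have "n \<otimes>\<^bsub>G\<^esub> g \<in> F" unfolding F_def n(2)[symmetric] using Z by (rule imageI)
    ultimately show "\<exists>f\<in>F. \<exists>n\<in>N. g = n \<otimes>\<^bsub>G\<^esub> f" using n(1) by (intro bexI[of _ "n \<otimes>\<^bsub>G\<^esub> g"] bexI[of _ "inv\<^bsub>G\<^esub> n"]) auto
    show "f \<in> carrier G" if f: "f \<in> F"
    proof -
      obtain Z where "Z \<in> carrier (G Mod N)" "f = (SOME g. g \<in> Z)" using f by (auto simp: F_def)
      then obtain a where a: "a \<in> carrier G" "f = (SOME g. g \<in> N #>\<^bsub>G\<^esub> a)" by (auto simp: FactGroup_def RCOSETS_def)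
      have "(SOME g. g \<in> N #>\<^bsub>G\<^esub> a) \<in> N #>\<^bsub>G\<^esub> a" by (rule someI, rule G.rcos_self[OF a(1) N.is_subgroup])
      then show ?thesis unfolding a(2) using a(1) G.r_coset_subset_G[OF N.subset a(1)] by blast
    qed
  qed
  have Fc: "f \<in> carrier G" if "f \<in> F" for f using rep(2)[OF G.one_closed that] .
  have EG: "\<iota> ` carrier G \<subseteq> carrier A" by auto
  note Nc = subsetD[OF N.subset]
  show ?thesis
  proof (rule A.noetherian_finite_extension[of "group_span N" "\<iota> ` F"])
    show "subalg A (group_span N)" by (rule group_span_subalg[OF N.is_subgroup])
    show "noetherian_subalg A (group_span N)" using noetherian_polycyclic[OF N(2)] by simp
    show "finite (\<iota> ` F)" using N(3) by (simp add: F_def)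
    show "\<iota> ` F \<subseteq> carrier A" using Fc by auto
    show "subalg A (group_span (carrier G))" by (rule group_span_subalg[OF G.subgroup_self])
    show "group_span N \<subseteq> group_span (carrier G)" using N.subset by (intro A.k_span_mono) auto
    show "\<iota> ` F \<subseteq> group_span (carrier G)" using Fc by (auto intro: A.k_span_base)
    have NA: "group_span N \<subseteq> carrier A" by (rule A.k_span_carrier) (use Nc in auto)
    let ?E = "{r \<otimes>\<^bsub>A\<^esub> g | r g. r \<in> group_span N \<and> g \<in> \<iota> ` F}" and ?E' = "{g \<otimes>\<^bsub>A\<^esub> r | r g. r \<in> group_span N \<and> g \<in> \<iota> ` F}"
    have E: "?E \<subseteq> carrier A" "?E' \<subseteq> carrier A" using NA Fc by auto
    have iN: "\<iota> n \<in> group_span N" if "n \<in> N" for n using that by (intro A.k_span_base) auto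
    show "group_span (carrier G) \<subseteq> k_span A ?E"
    proof (rule A.k_span_least[OF A.k_span_submodule[OF E(1)]], rule image_subsetI)
      fix g assume "g \<in> carrier G"
      then obtain f n where fn: "f \<in> F" "n \<in> N" "g = n \<otimes>\<^bsub>G\<^esub> f" using rep(1) by blast
      then have "\<iota> g = \<iota> n \<otimes>\<^bsub>A\<^esub> \<iota> f" using Fc Nc by (simp add: iota_mult)
      then show "\<iota> g \<in> k_span A ?E" using fn iN by (intro A.k_span_base) blast
    qed
    show "group_span (carrier G) \<subseteq> k_span A ?E'"
    proof (rule A.k_span_least[OF A.k_span_submodule[OF E(2)]], rule image_subsetI)
      fix g assume "g \<in> carrier G"
      then obtain f n where fn: "f \<in> F" "n \<in> N" "g = n \<otimes>\<^bsub>G\<^esub> f" using rep(1) by blast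
      \<comment> \<open>Normality carries the factor from \<open>N\<close> to the other side of the
        representative, as the right-hand chain condition needs.\<close>
      have "g = f \<otimes>\<^bsub>G\<^esub> (inv\<^bsub>G\<^esub> f \<otimes>\<^bsub>G\<^esub> n \<otimes>\<^bsub>G\<^esub> f)" using fn Fc Nc by (simp flip: G.m_assoc)
      moreover have n': "inv\<^bsub>G\<^esub> f \<otimes>\<^bsub>G\<^esub> n \<otimes>\<^bsub>G\<^esub> f \<in> N" using N.inv_op_closed1[OF Fc[OF fn(1)] fn(2)] .
      ultimately have "\<iota> g = \<iota> f \<otimes>\<^bsub>A\<^esub> \<iota> (inv\<^bsub>G\<^esub> f \<otimes>\<^bsub>G\<^esub> n \<otimes>\<^bsub>G\<^esub> f)" using Fc[OF fn(1)] Nc[OF n'] by (metis iota_mult)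
      then show "\<iota> g \<in> k_span A ?E'" using fn(1) iN[OF n'] by (intro A.k_span_base) blast
    qed
  qed
qed

text \<open>Two Hilbert steps, adjoining x to K[G] and then y to K[G][x]. The scalars in the
  exchange relations are products of character values, hence nonzero.\<close>

lemma noetherian:
  assumes "polycyclic_by_finite G"
  shows "nc_noetherian A"
proof -
  let ?E = "\<iota> ` carrier G"
  have E: "?E \<subseteq> carrier A" by auto
  have DG: "submodule (group_span (carrier G)) scalar_ring A" by (rule A.k_span_submodule[OF E])
  interpret X: hilbert_step A "group_span (carrier G)" x
  proof (rule A.hilbert_stepI[OF E group_span_subalg[OF G.subgroup_self] x_closed])
    fix e assume "e \<in> ?E"
    then obtain g where g: "g \<in> carrier G" "e = \<iota> g" by auto
    then have "x \<otimes>\<^bsub>A\<^esub> e = \<chi> g \<odot>\<^bsub>A\<^esub> (e \<otimes>\<^bsub>A\<^esub> x) \<oplus>\<^bsub>A\<^esub> \<zero>\<^bsub>A\<^esub>" by (simp add: x_iota)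
    then show "\<exists>k r. k \<noteq> 0 \<and> r \<in> group_span (carrier G) \<and> x \<otimes>\<^bsub>A\<^esub> e = k \<odot>\<^bsub>A\<^esub> (e \<otimes>\<^bsub>A\<^esub> x) \<oplus>\<^bsub>A\<^esub> r"
      using chi_simps(1)[OF g(1)] A.submoduleD(2)[OF DG] by blast
  qed
  have iB: "\<iota> g \<in> group_span (carrier G)" if "g \<in> carrier G" for g using that by (intro A.k_span_base) auto
  \<comment> \<open>The monomials without y: K[G][x] must be known as the span of an explicit set
    before \<open>hilbert_stepI\<close> can be applied with y.\<close>
  define M where "M = (\<lambda>(g, i). mon (g, i, 0)) ` (carrier G \<times> UNIV)"
  have M: "M \<subseteq> carrier A" by (auto simp: M_def)
  have monM: "mon (g, i, 0) \<in> k_span A M" if "g \<in> carrier G" for g i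
    using that by (intro A.k_span_base) (auto simp: M_def)
  have X_eq: "X.polys = k_span A M"
  proof
    show "k_span A M \<subseteq> X.polys"
    proof (rule A.k_span_least)
      show "submodule X.polys scalar_ring A" using X.polys_subalg by (simp add: subalg_def)
      show "M \<subseteq> X.polys" using X.monomial_in_polys[OF iB] by (auto simp: M_def mon_def)
    qed
    show "X.polys \<subseteq> k_span A M"
    proof (rule X.polys_in[OF A.k_span_submodule[OF M]])
      fix r and n :: nat assume r: "r \<in> group_span (carrier G)"
      have xn: "x [^]\<^bsub>A\<^esub> n \<in> carrier A" by simp
      interpret F: k_linear A A "\<lambda>v. x [^]\<^bsub>A\<^esub> n \<otimes>\<^bsub>A\<^esub> v" by (rule k_linearI[OF A.k_algebra A.k_algebra A.mult_linear(1)[OF xn]])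
      show "x [^]\<^bsub>A\<^esub> n \<otimes>\<^bsub>A\<^esub> r \<in> k_span A M"
      proof (rule F.span_into[OF E A.k_span_submodule[OF M] _ r])
        fix e assume "e \<in> ?E"
        then obtain g where g: "g \<in> carrier G" "e = \<iota> g" by auto
        have "x [^]\<^bsub>A\<^esub> n \<otimes>\<^bsub>A\<^esub> e = \<chi> g ^ n \<odot>\<^bsub>A\<^esub> mon (g, n, 0)" using g by (simp add: pow_iota mon_def)
        then show "x [^]\<^bsub>A\<^esub> n \<otimes>\<^bsub>A\<^esub> e \<in> k_span A M" using A.submoduleD(4)[OF A.k_span_submodule[OF M] monM[OF g(1)]] by simp
      qed
    qed
  qed
  have MS: "subalg A (k_span A M)" using X.polys_subalg X_eq by simp
  then have Mm: "\<And>u v. u \<in> k_span A M \<Longrightarrow> v \<in> k_span A M \<Longrightarrow> u \<otimes>\<^bsub>A\<^esub> v \<in> k_span A M" by (simp add: subalg_def)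
  note MD = A.submoduleD[OF A.k_span_submodule[OF M]]
  have Mc: "u \<in> carrier A" if "u \<in> k_span A M" for u using that MD(1) by blast
  have xM: "x \<in> k_span A M" using monM[OF G.one_closed, of 1] mon_generators by simp
  \<comment> \<open>Only the term with y on the right matters; by the recursion
    \<open>y_mon_Suc\<close> everything else stays in K[G][x].\<close>
  have yx: "\<exists>r\<in>k_span A M. y \<otimes>\<^bsub>A\<^esub> mon (\<one>\<^bsub>G\<^esub>, i, 0) = \<eta> b ^ i \<odot>\<^bsub>A\<^esub> (mon (\<one>\<^bsub>G\<^esub>, i, 0) \<otimes>\<^bsub>A\<^esub> y) \<oplus>\<^bsub>A\<^esub> r" for i
  proof (induction i)
    case 0
    show ?case by (rule bexI[OF _ MD(2)]) (simp add: mon_generators iota_one)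
  next
    case (Suc i)
    then obtain r where r: "r \<in> k_span A M" "y \<otimes>\<^bsub>A\<^esub> mon (\<one>\<^bsub>G\<^esub>, i, 0) = \<eta> b ^ i \<odot>\<^bsub>A\<^esub> (mon (\<one>\<^bsub>G\<^esub>, i, 0) \<otimes>\<^bsub>A\<^esub> y) \<oplus>\<^bsub>A\<^esub> r" by blast
    have xm: "x \<otimes>\<^bsub>A\<^esub> mon (\<one>\<^bsub>G\<^esub>, i, 0) = mon (\<one>\<^bsub>G\<^esub>, Suc i, 0)" using x_mon[of "\<one>\<^bsub>G\<^esub>" i 0] by (simp add: chi_simps)
    let ?r = "\<eta> b \<odot>\<^bsub>A\<^esub> (x \<otimes>\<^bsub>A\<^esub> r) \<oplus>\<^bsub>A\<^esub> \<beta> \<odot>\<^bsub>A\<^esub> (mon (\<one>\<^bsub>G\<^esub>, i, 0) \<ominus>\<^bsub>A\<^esub> mon (c \<otimes>\<^bsub>G\<^esub> b, i, 0))"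
    have "x \<otimes>\<^bsub>A\<^esub> (y \<otimes>\<^bsub>A\<^esub> mon (\<one>\<^bsub>G\<^esub>, i, 0)) = \<eta> b ^ i \<odot>\<^bsub>A\<^esub> (mon (\<one>\<^bsub>G\<^esub>, Suc i, 0) \<otimes>\<^bsub>A\<^esub> y) \<oplus>\<^bsub>A\<^esub> x \<otimes>\<^bsub>A\<^esub> r"
      unfolding r(2) xm[symmetric] using Mc[OF r(1)] by (simp add: A.r_distr A.mult_smult_right A.m_assoc)
    then have "y \<otimes>\<^bsub>A\<^esub> mon (\<one>\<^bsub>G\<^esub>, Suc i, 0) = \<eta> b ^ Suc i \<odot>\<^bsub>A\<^esub> (mon (\<one>\<^bsub>G\<^esub>, Suc i, 0) \<otimes>\<^bsub>A\<^esub> y) \<oplus>\<^bsub>A\<^esub> ?r"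
      unfolding y_mon_Suc using Mc[OF r(1)] by (simp add: A.smult_add_right A.smult_smult A.a_assoc)
    moreover have "?r \<in> k_span A M"
      by (intro MD(3,4) Mm xM r(1) A.submodule_diff[OF A.k_span_submodule[OF M]] monM) auto
    ultimately show ?case by blast
  qed
  interpret Y: hilbert_step A "k_span A M" y
  proof (rule A.hilbert_stepI[OF M MS y_closed])
    fix e assume "e \<in> M"
    then obtain g i where g: "g \<in> carrier G" "e = mon (g, i, 0)" by (auto simp: M_def)
    obtain r where r: "r \<in> k_span A M" "y \<otimes>\<^bsub>A\<^esub> mon (\<one>\<^bsub>G\<^esub>, i, 0) = \<eta> b ^ i \<odot>\<^bsub>A\<^esub> (mon (\<one>\<^bsub>G\<^esub>, i, 0) \<otimes>\<^bsub>A\<^esub> y) \<oplus>\<^bsub>A\<^esub> r" using yx by blast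
    have gi: "\<iota> g \<otimes>\<^bsub>A\<^esub> mon (\<one>\<^bsub>G\<^esub>, i, 0) = e" using g by (simp add: iota_mon)
    have "y \<otimes>\<^bsub>A\<^esub> e = (\<eta> g * \<eta> b ^ i) \<odot>\<^bsub>A\<^esub> (e \<otimes>\<^bsub>A\<^esub> y) \<oplus>\<^bsub>A\<^esub> \<eta> g \<odot>\<^bsub>A\<^esub> (\<iota> g \<otimes>\<^bsub>A\<^esub> r)"
      unfolding g(2) y_mon[OF g(1)] r(2) unfolding g(2)[symmetric] gi[symmetric]
      using Mc[OF r(1)] g(1) by (simp add: A.r_distr A.mult_smult_right A.smult_add_right A.smult_smult A.m_assoc)
    moreover have "\<eta> g \<odot>\<^bsub>A\<^esub> (\<iota> g \<otimes>\<^bsub>A\<^esub> r) \<in> k_span A M"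
      using monM[OF g(1), of 0] g(1) by (intro MD(4) Mm r(1)) (simp add: mon_generators)
    moreover have "\<eta> g * \<eta> b ^ i \<noteq> 0" using eta_simps(1) g(1) by simp
    ultimately show "\<exists>k r. k \<noteq> 0 \<and> r \<in> k_span A M \<and> y \<otimes>\<^bsub>A\<^esub> e = k \<odot>\<^bsub>A\<^esub> (e \<otimes>\<^bsub>A\<^esub> y) \<oplus>\<^bsub>A\<^esub> r" by blast
  qed
  have Ysub: "submodule Y.polys scalar_ring A" using Y.polys_subalg by (simp add: subalg_def)
  have "mon t \<in> Y.polys" if tI: "t \<in> Ind" for t
  proof -
    obtain g i j where t: "t = (g, i, j)" "g \<in> carrier G" using tI by (cases t) auto
    have "mon t = mon (g, i, 0) \<otimes>\<^bsub>A\<^esub> y [^]\<^bsub>A\<^esub> j" using t by (simp add: mon_def)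
    then show ?thesis using Y.monomial_in_polys[OF monM[OF t(2)], of i j] by simp
  qed
  then have "k_span A (mon ` Ind) \<subseteq> Y.polys" by (intro A.k_span_least[OF Ysub]) auto
  then have "Y.polys = carrier A" unfolding M.basis_span using A.submoduleD(1)[OF Ysub] by blast
  then show ?thesis
    using Y.noetherian_polys X.noetherian_polys[OF noetherian_group_algebra[OF assms]] X_eq
    by (intro A.noetherian_subalg_carrier) simp
qed

end

section \<open>Gelfand-Kirillov dimension\<close>

text \<open>The scalars form a subfield, as the dimension theory requires, only if 1 differs from
  0.\<close>

locale nontrivial_k_alg = k_alg A for A :: "('k::field, 'a, 'm) module_scheme" (structure) +
  assumes one_neq_zero: "\<one> \<noteq> \<zero>"
begin

abbreviation "K \<equiv> scalars A"

lemma scalars_iff: "u \<in> K \<longleftrightarrow> (\<exists>k. u = k \<odot> \<one>)"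
  by (auto simp: scalars_def)

lemma scalar_mult: "u \<in> carrier A \<Longrightarrow> (k \<odot> \<one>) \<otimes> u = k \<odot> u"
  by (simp add: mult_smult_left)

lemma scalars_subfield: "subfield K A"
proof (rule subfieldI)
  have "subring K A"
  proof (rule subringI)
    show "K \<subseteq> carrier A" by (auto simp: scalars_def)
    show "\<one> \<in> K" unfolding scalars_iff by (rule exI[of _ 1]) simp
    show "\<ominus> h \<in> K" if h: "h \<in> K" for h
    proof -
      obtain k where "h = k \<odot> \<one>" using h scalars_iff by blast
      then have "\<ominus> h = (- k) \<odot> \<one>" by (simp add: smult_minus_left)
      then show ?thesis using scalars_iff by blast
    qed
    show "h1 \<otimes> h2 \<in> K" "h1 \<oplus> h2 \<in> K" if h: "h1 \<in> K" "h2 \<in> K" for h1 h2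
    proof -
      obtain k l where kl: "h1 = k \<odot> \<one>" "h2 = l \<odot> \<one>" using h scalars_iff by blast
      then have "h1 \<otimes> h2 = (k * l) \<odot> \<one>" "h1 \<oplus> h2 = (k + l) \<odot> \<one>"
        by (simp_all add: scalar_mult smult_smult smult_add_left)
      then show "h1 \<otimes> h2 \<in> K" "h1 \<oplus> h2 \<in> K" using scalars_iff by blast+
    qed
  qed
  then show "subcring K A"
  proof (rule subcringI)
    show "h1 \<otimes> h2 = h2 \<otimes> h1" if h: "h1 \<in> K" "h2 \<in> K" for h1 h2
    proof -
      obtain k l where kl: "h1 = k \<odot> \<one>" "h2 = l \<odot> \<one>" using h scalars_iff by blast
      then show ?thesis by (simp add: scalar_mult smult_smult mult.commute)
    qed
  qed
  show "Units (A\<lparr>carrier := K\<rparr>) = K - {\<zero>}"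
  proof
    show "K - {\<zero>} \<subseteq> Units (A\<lparr>carrier := K\<rparr>)"
    proof
      fix u assume u: "u \<in> K - {\<zero>}"
      then obtain k where k: "u = k \<odot> \<one>" "k \<noteq> 0" using scalars_iff by fastforce
      have i: "(inverse k \<odot> \<one>) \<otimes> u = \<one>" "u \<otimes> (inverse k \<odot> \<one>) = \<one>" using k by (simp_all add: scalar_mult smult_smult)
      have "inverse k \<odot> \<one> \<in> K" using scalars_iff by blast
      then show "u \<in> Units (A\<lparr>carrier := K\<rparr>)" using u i by (auto simp: Units_def)
    qed
    show "Units (A\<lparr>carrier := K\<rparr>) \<subseteq> K - {\<zero>}"
    proof
      fix u assume u: "u \<in> Units (A\<lparr>carrier := K\<rparr>)"
      then obtain v where v: "u \<in> K" "v \<in> K" "v \<otimes> u = \<one>" by (auto simp: Units_def)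
      have "v \<in> carrier A" using v(2) by (auto simp: scalars_def)
      then have "u \<noteq> \<zero>" using v(3) one_neq_zero by auto
      then show "u \<in> K - {\<zero>}" using v(1) by simp
    qed
  qed
qed

lemma span_insert_iff:
  assumes "u \<in> carrier A" "S \<subseteq> carrier A"
  shows "w \<in> k_span A (insert u S) \<longleftrightarrow> (\<exists>k. \<exists>v\<in>k_span A S. w = k \<odot> u \<oplus> v)"
proof
  have US: "insert u S \<subseteq> carrier A" using assms by simp
  note D = submoduleD[OF k_span_submodule[OF US]] and DS = submoduleD[OF k_span_submodule[OF assms(2)]]
  have Sc: "v \<in> carrier A" if "v \<in> k_span A S" for v using that DS(1) by blast
  show "\<exists>k. \<exists>v\<in>k_span A S. w = k \<odot> u \<oplus> v \<Longrightarrow> w \<in> k_span A (insert u S)"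
    using D(3,4) k_span_base[of u "insert u S"] k_span_mono[OF subset_insertI, of S u] by blast
  assume "w \<in> k_span A (insert u S)"
  then show "\<exists>k. \<exists>v\<in>k_span A S. w = k \<odot> u \<oplus> v" using US
  proof (induction rule: k_span_induct)
    case zero
    show ?case by (rule exI[of _ 0], rule bexI[OF _ DS(2)]) (use assms in simp)
  next
    case (base s)
    show ?case
    proof (cases "s = u")
      case True
      show ?thesis by (rule exI[of _ 1], rule bexI[OF _ DS(2)]) (use assms True in simp)
    next
      case False
      then have s: "s \<in> k_span A S" using base by (intro k_span_base) simp
      show ?thesis by (rule exI[of _ 0], rule bexI[OF _ s]) (use assms Sc[OF s] in simp)
    qed
  next
    case (add w w')
    then obtain k v k' v' where *: "v \<in> k_span A S" "w = k \<odot> u \<oplus> v" "v' \<in> k_span A S" "w' = k' \<odot> u \<oplus> v'" by blast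
    have "w \<oplus> w' = (k + k') \<odot> u \<oplus> (v \<oplus> v')" using * Sc assms(1) by (simp add: smult_add_left a_ac)
    then show ?case using DS(3)[OF *(1,3)] by blast
  next
    case (smult l w)
    then obtain k v where *: "v \<in> k_span A S" "w = k \<odot> u \<oplus> v" by blast
    have "l \<odot> w = (l * k) \<odot> u \<oplus> l \<odot> v" using * Sc assms(1) by (simp add: smult_add_right smult_smult)
    then show ?case using DS(4)[OF *(1)] by blast
  qed
qed

text \<open>Bridge to the dimension theory, in which spans are built from lists by adjoining one
  line at a time.\<close>

lemma Span_eq_k_span: "set Us \<subseteq> carrier A \<Longrightarrow> Span K Us = k_span A (set Us)"
proof (induction Us)
  case Nil
  have "submodule {\<zero>} scalar_ring A" by (rule submoduleI) auto
  then have "k_span A {} \<subseteq> {\<zero>}" by (rule k_span_least) simp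
  moreover have "\<zero> \<in> k_span A {}" using submoduleD(2)[OF k_span_submodule[of "{}"]] by simp
  ultimately show ?case by auto
next
  case (Cons u Us)
  have eq: "Span K (u # Us) = line_extension K u (k_span A (set Us))" using Cons by simp
  have u: "u \<in> carrier A" "set Us \<subseteq> carrier A" using Cons by auto
  have "w \<in> line_extension K u (k_span A (set Us)) \<longleftrightarrow> w \<in> k_span A (set (u # Us))" for w
  proof -
    have "w \<in> line_extension K u (k_span A (set Us)) \<longleftrightarrow> (\<exists>k. \<exists>v\<in>k_span A (set Us). w = k \<odot> u \<oplus> v)"
      unfolding line_extension_mem_iff using u by (auto simp: scalars_def scalar_mult)
    then show ?thesis using span_insert_iff[OF u] by simp
  qed
  then show ?case unfolding eq by blast
qed

lemma submodule_subalgebra: "submodule V scalar_ring A \<Longrightarrow> subalgebra K V A"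
  using submoduleD[of V]
  by (auto simp: subalgebra_def subalgebra_axioms_def scalars_def submodule_def scalar_mult subset_iff)

lemma finite_dimension_span:
  assumes "finite S" "S \<subseteq> carrier A"
  shows "finite_dimension K (k_span A S)"
proof -
  obtain Us where "set Us = S" using assms(1) finite_list by blast
  then show ?thesis using Span_finite_dimension[OF scalars_subfield, of Us] Span_eq_k_span[of Us] assms(2) by simp
qed

lemma finite_dimension_subspace:
  assumes "submodule V scalar_ring A" "V \<subseteq> k_span A S" "finite S" "S \<subseteq> carrier A"
  shows "finite_dimension K V"
  by (rule subalbegra_incl_imp_finite_dimension[OF scalars_subfield finite_dimension_span submodule_subalgebra])
    (use assms in auto)

lemma finite_dimension_generators:
  assumes "finite_dimension K V"
  obtains S where "finite S" "S \<subseteq> carrier A" "V = k_span A S"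
proof -
  obtain n where "dimension n K V" using assms by (auto simp: finite_dimension_def)
  from exists_base[OF scalars_subfield this] obtain Us where "set Us \<subseteq> carrier A" "Span K Us = V" by blast
  then show thesis using that[of "set Us"] Span_eq_k_span[of Us] by simp
qed

lemma dim_dimension: "finite_dimension K V \<Longrightarrow> dimension (dim K V) K V"
  using finite_dimensionE[OF scalars_subfield, of V] by (simp add: over_def)

lemma independent_spanning_sublist:
  "set Us \<subseteq> carrier A \<Longrightarrow> \<exists>Vs. independent K Vs \<and> Span K Vs = Span K Us \<and> length Vs \<le> length Us"
proof (induction Us)
  case Nil
  show ?case by (intro exI[of _ "[]"]) auto
next
  case (Cons u Us)
  then obtain Vs where Vs: "independent K Vs" "Span K Vs = Span K Us" "length Vs \<le> length Us" by auto
  show ?case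
  proof (cases "u \<in> Span K Us")
    case True
    then have "Span K (u # Us) = Span K Us"
      using Span_base_incl[OF scalars_subfield, of Us] mono_Span_subset[OF scalars_subfield, of "u # Us" Us]
        mono_Span[OF scalars_subfield, of Us u] Cons.prems by auto
    then show ?thesis using Vs by (intro exI[of _ Vs]) simp
  next
    case False
    then have "independent K (u # Vs)" using li_Cons[of u K Vs] Vs Cons.prems by simp
    moreover have "Span K (u # Vs) = Span K (u # Us)" using Vs(2) by simp
    ultimately show ?thesis using Vs(3) by (intro exI[of _ "u # Vs"]) simp
  qed
qed

text \<open>A basis of \<open>V\<close> is an independent list in the span of \<open>S\<close>,
  hence not longer than an independent list that is extracted from \<open>S\<close> and spans the
  same space.\<close>

lemma dim_le_card:
  assumes "submodule V scalar_ring A" "V \<subseteq> k_span A S" "finite S" "S \<subseteq> carrier A"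
  shows "dim K V \<le> card S"
proof -
  obtain Us where Us: "set Us = S" "length Us = card S" using assms(3) finite_distinct_list distinct_card by metis
  have "dimension (dim K V) K V" by (rule dim_dimension[OF finite_dimension_subspace[OF assms]])
  from exists_base[OF scalars_subfield this]
  obtain Vs where Vs: "independent K Vs" "length Vs = dim K V" "Span K Vs = V" "set Vs \<subseteq> carrier A" by blast
  have "set Vs \<subseteq> V" using Vs(3) Span_eq_k_span[OF Vs(4)] k_span_base[of _ "set Vs"] by blast
  then have *: "set Vs \<subseteq> Span K Us" using assms(2,4) Us Span_eq_k_span[of Us] by blast
  obtain Ws where "independent K Ws" "Span K Ws = Span K Us" "length Ws \<le> length Us"
    using independent_spanning_sublist[of Us] assms(4) Us by blast
  then have "length Vs \<le> length Us"
    using independent_length_le[OF scalars_subfield Vs(1), of Ws] * by simp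
  then show ?thesis using Vs(2) Us(2) by simp
qed

end

section \<open>Dimension bounds by counting basis elements\<close>

context k_basis
begin

lemma coord_span:
  assumes "h \<in> k_span A (e ` J)" "J \<subseteq> I"
  shows "keys (coord h) \<subseteq> J"
proof -
  have J: "e ` J \<subseteq> carrier A" using assms(2) by auto
  show ?thesis using assms(1) J
  proof (induction rule: k_span_induct)
    case zero
    have "coord \<zero> = 0" using coord_smult[of \<zero> 0] by (simp add: poly_mapping_eq_iff fun_eq_iff)
    then show ?case by simp
  next
    case (base s)
    then show ?case using assms(2) coord_basis by (auto split: if_splits)
  next
    case (add u v)
    then show ?case using k_span_carrier[OF J] keys_add[of "coord u" "coord v"] by (auto simp: coord_add subset_iff)
  next
    case (smult k u)
    then show ?case using k_span_carrier[OF J] keys_map_mult[of k "coord u"] by (auto simp: coord_smult subset_iff)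
  qed
qed

lemma basis_not_in_span: "J \<subseteq> I \<Longrightarrow> i \<in> I \<Longrightarrow> i \<notin> J \<Longrightarrow> e i \<notin> k_span A (e ` J)"
  using coord_span[of "e i" J] coord_basis[of i] by auto

lemma mem_span_keys: "h \<in> carrier A \<Longrightarrow> h \<in> k_span A (e ` keys (coord h))"
  using lin_comb_in_span[OF order_refl, of e "coord h"] coord[of h] basis_funcset
  by (metis Pi_anti_mono subsetD)

end

locale nontrivial_k_basis = k_basis A e I + nontrivial_k_alg A
  for A :: "('k::field, 'a, 'm) module_scheme" and e :: "'i \<Rightarrow> 'a" and I
begin

lemma basis_list_independent: "distinct ts \<Longrightarrow> set ts \<subseteq> I \<Longrightarrow> independent K (map e ts)"
proof (induction ts)
  case (Cons t ts)
  have "set (map e ts) \<subseteq> carrier A" using Cons(3) by auto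
  then have "Span K (map e ts) = k_span A (e ` set ts)" using Span_eq_k_span[of "map e ts"] by simp
  then have "e t \<notin> Span K (map e ts)" using basis_not_in_span[of "set ts" t] Cons by simp
  then show ?case using li_Cons[of "e t" K "map e ts"] Cons by simp
qed simp

text \<open>Together with \<open>dim_le_card\<close> this turns the growth of dimensions into a
  counting problem for basis elements.\<close>

lemma card_le_dim:
  assumes "finite_dimension K V" "finite J" "J \<subseteq> I" "e ` J \<subseteq> V"
  shows "card J \<le> dim K V"
proof -
  obtain ts where ts: "set ts = J" "distinct ts" using assms(2) finite_distinct_list by blast
  have "length (map e ts) \<le> dim K V"
    by (rule independent_length_le_dimension[OF scalars_subfield dim_dimension[OF assms(1)] basis_list_independent])
      (use ts assms in auto)
  then show ?thesis using ts distinct_card by fastforce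
qed

text \<open>Finitely many spanning vectors involve finitely many basis elements.\<close>

lemma finite_dimension_in_basis_span:
  assumes "finite_dimension K V"
  obtains J where "finite J" "J \<subseteq> I" "V \<subseteq> k_span A (e ` J)"
proof -
  obtain S where S: "finite S" "S \<subseteq> carrier A" "V = k_span A S" using assms by (rule finite_dimension_generators)
  let ?J = "\<Union>s\<in>S. keys (coord s)"
  have J: "?J \<subseteq> I" using coord(1) S(2) by blast
  have "k_span A S \<subseteq> k_span A (e ` ?J)"
  proof (rule k_span_least[OF k_span_submodule])
    show "e ` ?J \<subseteq> carrier A" using J basis_closed by blast
    show "S \<subseteq> k_span A (e ` ?J)"
    proof
      fix s assume s: "s \<in> S"
      then have "s \<in> k_span A (e ` keys (coord s))" using S(2) mem_span_keys by blast
      moreover have "e ` keys (coord s) \<subseteq> e ` ?J" using s by blast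
      ultimately show "s \<in> k_span A (e ` ?J)" using k_span_mono by blast
    qed
  qed
  then show thesis using that[of ?J] S(1,3) J by simp
qed

end

context k_alg
begin

lemma word_closed: "set vs \<subseteq> carrier A \<Longrightarrow> foldr (\<otimes>) vs \<one> \<in> carrier A"
  by (induction vs) auto

lemma power_space_submodule: "V \<subseteq> carrier A \<Longrightarrow> submodule (power_space A V n) scalar_ring A"
  unfolding power_space_def by (rule k_span_submodule) (use word_closed in blast)

lemma power_space_base: "set vs \<subseteq> V \<Longrightarrow> length vs \<le> n \<Longrightarrow> foldr (\<otimes>) vs \<one> \<in> power_space A V n"
  unfolding power_space_def by (rule k_span_base) blast

text \<open>One multiplicative filtration bounds the powers of every \<open>V\<close>; the level
  \<open>k\<close> containing \<open>V\<close> causes the rescaling of \<open>n\<close>.\<close>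

lemma power_space_filtration:
  assumes U: "\<And>m. submodule (U m) scalar_ring A" "\<one> \<in> U 0" "\<And>m m'. m \<le> m' \<Longrightarrow> U m \<subseteq> U m'"
      "\<And>m m' u v. u \<in> U m \<Longrightarrow> v \<in> U m' \<Longrightarrow> u \<otimes> v \<in> U (m + m')"
    and V: "V \<subseteq> U k"
  shows "power_space A V n \<subseteq> U (k * n)"
proof -
  have word: "foldr (\<otimes>) vs \<one> \<in> U (k * length vs)" if "set vs \<subseteq> V" for vs
    using that
  proof (induction vs)
    case (Cons v vs)
    then have "v \<otimes> foldr (\<otimes>) vs \<one> \<in> U (k + k * length vs)" using V by (intro U(4)) auto
    then show ?case by simp
  qed (use U(2) in simp)
  show ?thesis unfolding power_space_def
  proof (rule k_span_least[OF U(1)], clarify)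
    fix vs assume "set vs \<subseteq> V" "length vs \<le> n"
    then show "foldr (\<otimes>) vs \<one> \<in> U (k * n)" using word[of vs] U(3)[of "k * length vs" "k * n"] by auto
  qed
qed

end

section \<open>Word balls in a monoid\<close>

definition word_ball :: "('g, 'm) monoid_scheme \<Rightarrow> 'g set \<Rightarrow> nat \<Rightarrow> 'g set" where
  "word_ball G F n = {foldr (monoid.mult G) vs \<one>\<^bsub>G\<^esub> | vs. set vs \<subseteq> F \<and> length vs \<le> n}"

context Group.monoid
begin

lemma ball_word_closed: "set vs \<subseteq> carrier G \<Longrightarrow> foldr (\<otimes>) vs \<one> \<in> carrier G"
  by (induction vs) auto

lemma ball_carrier: "F \<subseteq> carrier G \<Longrightarrow> word_ball G F n \<subseteq> carrier G"
  using ball_word_closed by (auto simp: word_ball_def)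

lemma ball_one: "\<one> \<in> word_ball G F n"
  by (auto simp: word_ball_def intro!: exI[of _ "[]"])

lemma ball_base: "g \<in> F \<Longrightarrow> F \<subseteq> carrier G \<Longrightarrow> g \<in> word_ball G F 1"
  by (auto simp: word_ball_def intro!: exI[of _ "[g]"])

lemma ball_mono: "m \<le> n \<Longrightarrow> word_ball G F m \<subseteq> word_ball G F n"
  by (auto simp: word_ball_def intro: order_trans)

lemma finite_ball:
  assumes "finite F"
  shows "finite (word_ball G F n)"
proof -
  have "word_ball G F n = (\<lambda>vs. foldr (\<otimes>) vs \<one>) ` {vs. set vs \<subseteq> F \<and> length vs \<le> n}" by (auto simp: word_ball_def)
  then show ?thesis using finite_lists_length_le[OF assms, of n] by simp
qed

lemma foldr_mult_append:
  "set vs \<subseteq> carrier G \<Longrightarrow> w \<in> carrier G \<Longrightarrow> foldr (\<otimes>) vs w = foldr (\<otimes>) vs \<one> \<otimes> w"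
proof (induction vs)
  case (Cons v vs)
  have "foldr (\<otimes>) vs \<one> \<in> carrier G" using Cons(2) by (intro ball_word_closed) auto
  then show ?case using Cons by (simp add: m_assoc)
qed simp

lemma ball_mult:
  assumes F: "F \<subseteq> carrier G" and "g \<in> word_ball G F m" "h \<in> word_ball G F n"
  shows "g \<otimes> h \<in> word_ball G F (m + n)"
proof -
  obtain vs ws where vw: "g = foldr (\<otimes>) vs \<one>" "set vs \<subseteq> F" "length vs \<le> m"
    "h = foldr (\<otimes>) ws \<one>" "set ws \<subseteq> F" "length ws \<le> n" using assms(2,3) by (auto simp: word_ball_def)
  have "g \<otimes> h = foldr (\<otimes>) (vs @ ws) \<one>"
    using foldr_mult_append[of vs h] ball_carrier[OF F, of n] assms(3) F vw by auto
  then show ?thesis unfolding word_ball_def using vw by (intro CollectI exI[of _ "vs @ ws"]) auto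
qed

lemma card_ball_pos: "finite F \<Longrightarrow> 1 \<le> card (word_ball G F n)"
  using ball_one[of F n] finite_ball[of F n] by (metis One_nat_def Suc_leI card_gt_0_iff empty_iff)

end

subsection \<open>Growth rates\<close>

definition growth :: "(nat \<Rightarrow> nat) \<Rightarrow> ereal" where
  "growth f = limsup (\<lambda>n. ereal (ln (real (f n)) / ln (real n)))"

lemma growth_mono:
  assumes "\<And>n. f n \<le> g n"
  shows "growth f \<le> growth g"
  unfolding growth_def
proof (rule Limsup_mono, rule eventually_sequentiallyI[of 1])
  fix n :: nat assume "1 \<le> n"
  \<comment> \<open>The convention ln 0 = 0 does no harm, because ln is nonnegative at every
    positive integer.\<close>
  have "ln (real (f n)) \<le> ln (real (g n))"
    using assms[of n] by (cases "f n = 0"; cases "g n = 0") auto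
  then show "ereal (ln (real (f n)) / ln (real n)) \<le> ereal (ln (real (g n)) / ln (real n))"
    using \<open>1 \<le> n\<close> by (simp add: divide_right_mono)
qed

lemma eventually_ln_gt: "eventually (\<lambda>n. C < ln (real n)) sequentially"
  using filterlim_compose[OF ln_at_top filterlim_real_sequentially] by (simp add: filterlim_at_top_dense)

text \<open>Since ln (k n) / ln n tends to 1, rescaling leaves the exponent unchanged, and the
  quadratic factor contributes 2. All constants disappear against ln n.\<close>

lemma growth_le:
  assumes a: "growth a \<le> ereal d" and pos: "\<And>n. 1 \<le> a n" and k: "k \<ge> 1"
    and f: "\<And>n. f n \<le> a (k * n) * (k * n + 1)\<^sup>2"
  shows "growth f \<le> ereal (d + 2)"
  unfolding growth_def
proof (rule ereal_le_epsilon2)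
  fix \<epsilon> :: real assume e: "\<epsilon> > 0"
  \<comment> \<open>Half of \<epsilon> is spent on the limit superior of \<open>a\<close>, the other
    half on C / ln n.\<close>
  define r where "r = d + \<epsilon> / 2"
  have "limsup (\<lambda>n. ereal (ln (real (a n)) / ln (real n))) < ereal r"
    using a e unfolding growth_def r_def by (rule_tac order_le_less_trans) auto
  then have "eventually (\<lambda>n. ln (real (a n)) / ln (real n) < r) sequentially"
    using Limsup_lessD by fastforce
  then obtain N where N: "\<And>n. n \<ge> N \<Longrightarrow> ln (real (a n)) / ln (real n) < r" by (auto simp: eventually_sequentially)
  \<comment> \<open>Collects what is not proportional to ln n: r ln k from the bound on a(k n), and
    2 ln (k + 1) from the square.\<close>
  define C where "C = r * ln (real k) + 2 * ln (real k + 1)"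
  have "eventually (\<lambda>n. ln (real (f n)) / ln (real n) \<le> d + 2 + \<epsilon>) sequentially"
    using eventually_ge_at_top[of "max N 2"] eventually_ln_gt[of "2 * C / \<epsilon>"]
  proof eventually_elim
    case (elim n)
    have n: "n \<ge> 2" "n \<ge> N" using elim by auto
    then have L: "ln (real n) > 0" by simp
    have kn: "k * n \<ge> N" "k * n \<ge> 2" using n k by (metis le_trans mult_le_mono nat_mult_1)+
    then have "real (k * n) \<ge> 2" by (metis of_nat_le_iff of_nat_numeral)
    then have "ln (real (k * n)) > 0" by simp
    then have "ln (real (a (k * n))) \<le> r * ln (real (k * n))"
      using N[OF kn(1)] by (simp add: divide_less_eq del: of_nat_mult)
    moreover have "ln (real (k * n)) = ln (real k) + ln (real n)" using n k by (simp add: ln_mult)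
    moreover have "ln (real (k * n + 1)) \<le> ln (real k + 1) + ln (real n)"
    proof -
      have "real (k * n + 1) \<le> (real k + 1) * real n" using n by (simp add: algebra_simps)
      then have "ln (real (k * n + 1)) \<le> ln ((real k + 1) * real n)" by (subst ln_le_cancel_iff) (use n k in \<open>auto intro!: add_nonneg_pos mult_pos_pos\<close>)
      then show ?thesis using n by (simp add: ln_mult)
    qed
    moreover have "ln (real (f n)) \<le> ln (real (a (k * n))) + 2 * ln (real (k * n + 1))"
    proof (cases "f n = 0")
      case True
      then show ?thesis using pos[of "k * n"] by simp
    next
      case False
      have "real (f n) \<le> real (a (k * n)) * (real (k * n + 1))\<^sup>2"
        using f[of n] by (metis of_nat_le_iff of_nat_mult of_nat_power)
      then have "ln (real (f n)) \<le> ln (real (a (k * n)) * (real (k * n + 1))\<^sup>2)"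
        using False by (subst ln_le_cancel_iff) auto
      also have "\<dots> = ln (real (a (k * n))) + 2 * ln (real (k * n + 1))"
        using pos[of "k * n"] by (simp add: ln_mult ln_realpow del: of_nat_add of_nat_mult)
      finally show ?thesis .
    qed
    ultimately have "ln (real (f n)) \<le> C + (r + 2) * ln (real n)" by (simp add: C_def algebra_simps)
    also have "C \<le> \<epsilon> / 2 * ln (real n)" using elim(2) e by (simp add: field_simps)
    finally have "ln (real (f n)) \<le> (d + 2 + \<epsilon>) * ln (real n)" by (simp add: r_def algebra_simps)
    then show ?case using L by (simp add: divide_le_eq)
  qed
  then show "limsup (\<lambda>n. ereal (ln (real (f n)) / ln (real n))) \<le> ereal (d + 2) + ereal \<epsilon>"
    by (intro Limsup_bounded) simp
qed

text \<open>If \<open>f\<close> grew more slowly than r + 2, then \<open>a\<close> would grow at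
  most like r. The factor 3 comes from words made of a group part, a power of x and a power of y,
  each of length at most n.\<close>

lemma growth_ge:
  assumes a: "ereal r < growth a" and pos: "\<And>n. 1 \<le> a n" and f: "\<And>n. a n * (n + 1)\<^sup>2 \<le> f (3 * n)"
  shows "ereal (r + 2) \<le> growth f"
proof (rule ccontr)
  assume "\<not> ?thesis"
  then have "growth f < ereal (r + 2)" by simp
  \<comment> \<open>The gap r + 2 - s will absorb the constant s ln 3 that stems from the
    rescaling.\<close>
  then obtain s where s: "growth f < ereal s" "s < r + 2"
    using ereal_dense2 by (metis ereal_less(2) less_ereal.simps(1) ereal_dense3 order_less_trans)
  then have "eventually (\<lambda>n. ereal (ln (real (f n)) / ln (real n)) < ereal s) sequentially"
    unfolding growth_def using Limsup_lessD by blast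
  then obtain N where N: "\<And>n. n \<ge> N \<Longrightarrow> ln (real (f n)) / ln (real n) < s" by (auto simp: eventually_sequentially)
  \<comment> \<open>The threshold makes (r + 2 - s) ln n exceed s ln 3; the absolute value is there
    because s may be negative.\<close>
  have "eventually (\<lambda>n. ln (real (a n)) / ln (real n) \<le> r) sequentially"
    using eventually_ge_at_top[of "max N 2"] eventually_ln_gt[of "\<bar>s\<bar> * ln 3 / (r + 2 - s)"]
  proof eventually_elim
    case (elim n)
    have n: "n \<ge> 2" "3 * n \<ge> N" using elim by auto
    then have L: "ln (real n) > 0" by simp
    have L3: "ln (real (3 * n)) = ln 3 + ln (real n)" using n by (simp add: ln_mult)
    then have "ln (real (3 * n)) > 0" using L by (simp add: add_pos_pos)
    then have "ln (real (f (3 * n))) \<le> s * (ln 3 + ln (real n))"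
      using N[OF n(2)] L3 by (simp add: divide_less_eq del: of_nat_mult)
    moreover have "ln (real (a n)) + 2 * ln (real n) \<le> ln (real (f (3 * n)))"
    proof -
      have "a n * n\<^sup>2 \<le> a n * (n + 1)\<^sup>2" by (intro mult_le_mono2 power_mono) auto
      then have "a n * n\<^sup>2 \<le> f (3 * n)" using f[of n] by (rule order_trans)
      then have "real (a n) * (real n)\<^sup>2 \<le> real (f (3 * n))" by (metis of_nat_le_iff of_nat_mult of_nat_power)
      moreover have "0 < real (a n) * (real n)\<^sup>2" using pos[of n] n by simp
      ultimately have "ln (real (a n) * (real n)\<^sup>2) \<le> ln (real (f (3 * n)))" by (subst ln_le_cancel_iff) auto
      then show ?thesis using pos[of n] n by (simp add: ln_mult ln_realpow)
    qed
    moreover have "s * ln 3 \<le> (r + 2 - s) * ln (real n)"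
    proof -
      have "s * ln 3 \<le> \<bar>s\<bar> * ln 3" by (intro mult_right_mono) auto
      also have "\<dots> \<le> (r + 2 - s) * ln (real n)" using elim(2) s(2) by (simp add: field_simps)
      finally show ?thesis .
    qed
    ultimately have "ln (real (a n)) \<le> r * ln (real n)" by (simp add: algebra_simps)
    then show ?case using L by (simp add: divide_le_eq)
  qed
  then have "growth a \<le> ereal r" unfolding growth_def by (intro Limsup_bounded) simp
  then show False using a by simp
qed

lemma GKdim_eq: "GKdim A = (SUP V \<in> {V. submodule V scalar_ring A \<and> ring.finite_dimension A (scalars A) V}.
    growth (\<lambda>n. ring.dim A (scalars A) (power_space A V n)))"
  by (simp add: GKdim_def growth_def)

section \<open>The dimension of K[G] and the growth of balls\<close>

lemma (in Group.monoid) monoid_algebra_basis: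
  "is_k_basis (monoid_algebra G :: ('k::field, 'a \<Rightarrow>\<^sub>0 'k) module) (\<lambda>g. Poly_Mapping.single g 1) (carrier G)"
proof -
  let ?A = "monoid_algebra G :: ('k, 'a \<Rightarrow>\<^sub>0 'k) module"
  interpret k_alg ?A by unfold_locales (rule monoid_algebra_k_algebra)
  have f: "(\<lambda>g. Poly_Mapping.single g 1) \<in> carrier G \<rightarrow> carrier ?A" by (simp add: monoid_algebra_simps)
  have id: "lin_comb ?A (\<lambda>g. Poly_Mapping.single g 1) a = a" if "keys a \<subseteq> carrier G" for a
    using that
  proof (induction a rule: poly_mapping_span_induct)
    case (single i k)
    then show ?case using lin_comb_single[of "\<lambda>g. Poly_Mapping.single g 1" i k]
      by (simp add: monoid_algebra_simps map_mult_poly_mapping)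
  next
    case (add p q)
    then show ?case using lin_comb_add[OF f, of p q] by (simp add: monoid_algebra_simps)
  qed (simp add: monoid_algebra_simps)
  show ?thesis unfolding is_k_basis_def
    using f id by (auto simp: monoid_algebra_simps)
qed

context Group.group
begin

text \<open>Expresses d as the supremum of ball growth rates, one inequality each. A
  finite-dimensional V lies in the span of a finite F, so its powers lie in spans of balls;
  conversely the powers of the span of F contain the balls.\<close>

lemma GKdim_group_algebra:
  assumes d: "GKdim (monoid_algebra G :: ('k::field, 'a \<Rightarrow>\<^sub>0 'k) module) = ereal d"
  shows "finite F \<Longrightarrow> F \<subseteq> carrier G \<Longrightarrow> growth (\<lambda>n. card (word_ball G F n)) \<le> ereal d"
    and "r < d \<Longrightarrow> \<exists>F. finite F \<and> F \<subseteq> carrier G \<and> ereal r < growth (\<lambda>n. card (word_ball G F n))"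
proof -
  let ?A = "monoid_algebra G :: ('k, 'a \<Rightarrow>\<^sub>0 'k) module" and ?s = "\<lambda>g. Poly_Mapping.single g (1 :: 'k)"
  interpret B: nontrivial_k_basis ?A ?s "carrier G"
    by (intro nontrivial_k_basis.intro k_basis.intro k_alg.intro k_basis_axioms.intro nontrivial_k_alg.intro
        nontrivial_k_alg_axioms.intro monoid_algebra_k_algebra monoid_algebra_basis)
      (simp add: monoid_algebra_simps poly_mapping_eq_iff fun_eq_iff lookup_single when_def)
  have sp: "?s ` word_ball G F n \<subseteq> carrier ?A" if "F \<subseteq> carrier G" for F n using ball_carrier[OF that, of n] by (auto simp: monoid_algebra_simps)
  have upper: "power_space ?A V n \<subseteq> k_span ?A (?s ` word_ball G F n)"
    if F: "F \<subseteq> carrier G" and V: "V \<subseteq> k_span ?A (?s ` F)" for F V n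
  proof -
    have "power_space ?A V n \<subseteq> k_span ?A (?s ` word_ball G F (1 * n))"
    proof (rule B.power_space_filtration)
      show "submodule (k_span ?A (?s ` word_ball G F m)) scalar_ring ?A" for m by (rule B.k_span_submodule[OF sp[OF F]])
      show "\<one>\<^bsub>?A\<^esub> \<in> k_span ?A (?s ` word_ball G F 0)"
        using B.k_span_base[OF imageI[OF ball_one, of ?s]] by (simp add: monoid_algebra_simps)
      show "k_span ?A (?s ` word_ball G F m) \<subseteq> k_span ?A (?s ` word_ball G F m')" if "m \<le> m'" for m m'
        by (rule B.k_span_mono[OF image_mono[OF ball_mono[OF that]]])
      show "u \<otimes>\<^bsub>?A\<^esub> v \<in> k_span ?A (?s ` word_ball G F (m + m'))"
        if "u \<in> k_span ?A (?s ` word_ball G F m)" "v \<in> k_span ?A (?s ` word_ball G F m')" for m m' u v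
      proof (rule B.k_span_mult[OF sp[OF F] sp[OF F] B.k_span_submodule[OF sp[OF F]] _ that])
        fix s t assume "s \<in> ?s ` word_ball G F m" "t \<in> ?s ` word_ball G F m'"
        then obtain g h where gh: "g \<in> word_ball G F m" "h \<in> word_ball G F m'" "s = ?s g" "t = ?s h" by blast
        then have "s \<otimes>\<^bsub>?A\<^esub> t = ?s (g \<otimes> h)" by (simp add: monoid_algebra_mult_single)
        then show "s \<otimes>\<^bsub>?A\<^esub> t \<in> k_span ?A (?s ` word_ball G F (m + m'))"
          using B.k_span_base[OF imageI[OF ball_mult[OF F gh(1,2)], of ?s]] by simp
      qed
      have "?s ` F \<subseteq> ?s ` word_ball G F 1" using ball_base[OF _ F] by blast
      then show "V \<subseteq> k_span ?A (?s ` word_ball G F 1)" using V B.k_span_mono by blast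
    qed
    then show ?thesis by simp
  qed
  show "growth (\<lambda>n. card (word_ball G F n)) \<le> ereal d" if F: "finite F" "F \<subseteq> carrier G" for F
  proof -
    let ?V = "k_span ?A (?s ` F)"
    have sF: "?s ` F \<subseteq> carrier ?A" using F by (auto simp: monoid_algebra_simps)
    have V: "submodule ?V scalar_ring ?A" by (rule B.k_span_submodule[OF sF])
    have Vc: "?V \<subseteq> carrier ?A" by (rule B.k_span_carrier[OF sF])
    have fd: "B.finite_dimension B.K ?V" using F sF by (intro B.finite_dimension_span) auto
    have "card (word_ball G F n) \<le> B.dim B.K (power_space ?A ?V n)" for n
    proof (rule B.card_le_dim)
      show "B.finite_dimension B.K (power_space ?A ?V n)"
        by (rule B.finite_dimension_subspace[OF B.power_space_submodule[OF Vc] upper[OF F(2) order_refl]])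
          (use finite_ball[OF F(1)] sp[OF F(2)] in auto)
      show "?s ` word_ball G F n \<subseteq> power_space ?A ?V n"
      proof
        fix u assume "u \<in> ?s ` word_ball G F n"
        then obtain vs where vs: "u = ?s (foldr (\<otimes>) vs \<one>)" "set vs \<subseteq> F" "length vs \<le> n" by (auto simp: word_ball_def)
        have "?s (foldr (\<otimes>) vs \<one>) = foldr (\<otimes>\<^bsub>?A\<^esub>) (map ?s vs) \<one>\<^bsub>?A\<^esub>"
        proof (induction vs)
          case (Cons g vs)
          have "?s (foldr (\<otimes>) (g # vs) \<one>) = ?s g \<otimes>\<^bsub>?A\<^esub> ?s (foldr (\<otimes>) vs \<one>)"
            by (simp add: monoid_algebra_mult_single)
          then show ?case using Cons by simp
        qed (simp add: monoid_algebra_simps)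
        moreover have "set (map ?s vs) \<subseteq> ?V" using vs(2) B.k_span_base by auto
        ultimately show "u \<in> power_space ?A ?V n" using B.power_space_base[of "map ?s vs" ?V n] vs by simp
      qed
    qed (use finite_ball[OF F(1)] ball_carrier[OF F(2)] in auto)
    then have "growth (\<lambda>n. card (word_ball G F n)) \<le> growth (\<lambda>n. B.dim B.K (power_space ?A ?V n))" by (rule growth_mono)
    also have "\<dots> \<le> GKdim ?A" unfolding GKdim_eq using V fd by (intro SUP_upper) simp
    finally show ?thesis using d by simp
  qed
  show "\<exists>F. finite F \<and> F \<subseteq> carrier G \<and> ereal r < growth (\<lambda>n. card (word_ball G F n))" if r: "r < d" for r
  proof -
    have "ereal r < GKdim ?A" using r d by simp
    then obtain V where V: "submodule V scalar_ring ?A" "B.finite_dimension B.K V"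
      "ereal r < growth (\<lambda>n. B.dim B.K (power_space ?A V n))"
      unfolding GKdim_eq less_SUP_iff by blast
    obtain F where F: "finite F" "F \<subseteq> carrier G" "V \<subseteq> k_span ?A (?s ` F)"
      using B.finite_dimension_in_basis_span[OF V(2)] .
    have dim: "B.dim B.K (power_space ?A V n) \<le> card (?s ` word_ball G F n)" for n
      by (rule B.dim_le_card[OF B.power_space_submodule[OF B.submoduleD(1)[OF V(1)]] upper[OF F(2,3)]])
        (use finite_ball[OF F(1)] sp[OF F(2)] in auto)
    have "growth (\<lambda>n. B.dim B.K (power_space ?A V n)) \<le> growth (\<lambda>n. card (word_ball G F n))"
      by (rule growth_mono) (rule order_trans[OF dim card_image_le[OF finite_ball[OF F(1)]]])
    then show ?thesis using V(3) F(1,2) by (intro exI[of _ F]) simp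
  qed
qed

end

section \<open>The weight filtration and the growth of the algebra\<close>

context H_presentation
begin

lemma one_neq_zero: "\<one>\<^bsub>A\<^esub> \<noteq> \<zero>\<^bsub>A\<^esub>"
proof
  assume "\<one>\<^bsub>A\<^esub> = \<zero>\<^bsub>A\<^esub>"
  then have "mon (\<one>\<^bsub>G\<^esub>, 0, 0) \<in> k_span A (mon ` {})"
    using A.submoduleD(2)[OF A.k_span_submodule[of "{}"]] by (simp add: mon_def iota_one)
  then show False using M.basis_not_in_span[of "{}" "(\<one>\<^bsub>G\<^esub>, 0, 0)"] by simp
qed

sublocale M: nontrivial_k_basis A mon Ind
  by unfold_locales (rule one_neq_zero)

text \<open>Word length counts along with the degree, because reordering y x trades x y for 1 and c
  b. If c b lies in \<open>F\<close>, this lowers the weight from 2 to at most 1, so reordering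
  never leaves a filtration level.\<close>

definition weights :: "'g set \<Rightarrow> nat \<Rightarrow> ('g \<times> nat \<times> nat) set" where
  "weights F m = {(g, i, j) | g i j r. g \<in> word_ball G F r \<and> r + i + j \<le> m}"

abbreviation "filt F m \<equiv> k_span A (mon ` weights F m)"

lemma weights_Ind: "F \<subseteq> carrier G \<Longrightarrow> weights F m \<subseteq> Ind"
  using G.ball_carrier[of F] by (fastforce simp: weights_def)

lemma weights_subset: "weights F m \<subseteq> word_ball G F m \<times> {..m} \<times> {..m}"
proof
  fix p assume "p \<in> weights F m"
  then obtain g i j r where "p = (g, i, j)" "g \<in> word_ball G F r" "r + i + j \<le> m"
    by (auto simp: weights_def)
  then show "p \<in> word_ball G F m \<times> {..m} \<times> {..m}" using G.ball_mono[of r m F] by auto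
qed

lemma finite_weights: "finite F \<Longrightarrow> finite (weights F m)"
  using weights_subset G.finite_ball by (metis finite_SigmaI finite_atMost finite_subset)

lemma card_weights: "finite F \<Longrightarrow> card (weights F m) \<le> card (word_ball G F m) * (m + 1)\<^sup>2"
  using card_mono[OF _ weights_subset, of F m] G.finite_ball[of F m]
  by (simp add: card_cartesian_product power2_eq_square)

context
  fixes F assumes F: "F \<subseteq> carrier G" and cb: "c \<otimes>\<^bsub>G\<^esub> b \<in> F"
begin

lemma mon_weights_carrier: "mon ` weights F m \<subseteq> carrier A"
  using weights_Ind[OF F] M.basis_closed by blast

lemmas filt_submodule = A.k_span_submodule[OF mon_weights_carrier]
lemmas filtD = A.submoduleD[OF filt_submodule]

lemma filt_carrier: "u \<in> filt F m \<Longrightarrow> u \<in> carrier A"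
  using filtD(1) by blast

lemma filt_mono: "m \<le> m' \<Longrightarrow> filt F m \<subseteq> filt F m'"
  by (rule A.k_span_mono) (fastforce simp: weights_def)

lemma filt_base: "g \<in> word_ball G F r \<Longrightarrow> r + i + j \<le> m \<Longrightarrow> mon (g, i, j) \<in> filt F m"
  by (rule A.k_span_base, rule imageI) (auto simp: weights_def)

lemma filt_left_mult:
  assumes u: "u \<in> carrier A"
    and step: "\<And>g i j r. g \<in> word_ball G F r \<Longrightarrow> r + i + j \<le> m \<Longrightarrow> u \<otimes>\<^bsub>A\<^esub> mon (g, i, j) \<in> filt F (s + m)"
    and v: "v \<in> filt F m"
  shows "u \<otimes>\<^bsub>A\<^esub> v \<in> filt F (s + m)"
proof -
  interpret L: k_linear A A "\<lambda>v. u \<otimes>\<^bsub>A\<^esub> v" by (rule k_linearI[OF A.k_algebra A.k_algebra A.mult_linear(1)[OF u]])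
  show ?thesis
    by (rule L.span_into[OF mon_weights_carrier filt_submodule _ v]) (use step in \<open>auto simp: weights_def\<close>)
qed

lemma ballc: "g \<in> word_ball G F r \<Longrightarrow> g \<in> carrier G"
  using G.ball_carrier[OF F] by blast

lemma filt_iota: "g \<in> word_ball G F s \<Longrightarrow> v \<in> filt F m \<Longrightarrow> \<iota> g \<otimes>\<^bsub>A\<^esub> v \<in> filt F (s + m)"
proof (rule filt_left_mult)
  assume g: "g \<in> word_ball G F s"
  then show "\<iota> g \<in> carrier A" using ballc by simp
  fix h i j r assume h: "h \<in> word_ball G F r" and r: "r + i + j \<le> m"
  have "mon (g \<otimes>\<^bsub>G\<^esub> h, i, j) \<in> filt F (s + m)"
    by (rule filt_base[OF G.ball_mult[OF F g h]]) (use r in simp)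
  then show "\<iota> g \<otimes>\<^bsub>A\<^esub> mon (h, i, j) \<in> filt F (s + m)" using ballc g h by (simp add: iota_mon)
qed

lemma filt_x: "v \<in> filt F m \<Longrightarrow> x \<otimes>\<^bsub>A\<^esub> v \<in> filt F (1 + m)"
proof (rule filt_left_mult)
  fix h i j r assume h: "h \<in> word_ball G F r" and r: "r + i + j \<le> m"
  have "mon (h, Suc i, j) \<in> filt F (1 + m)" by (rule filt_base[OF h]) (use r in simp)
  then show "x \<otimes>\<^bsub>A\<^esub> mon (h, i, j) \<in> filt F (1 + m)" using filtD(4) ballc[OF h] by (simp add: x_mon)
qed simp

lemma filt_y: "v \<in> filt F m \<Longrightarrow> y \<otimes>\<^bsub>A\<^esub> v \<in> filt F (1 + m)"
proof (rule filt_left_mult)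
  have one: "y \<otimes>\<^bsub>A\<^esub> mon (\<one>\<^bsub>G\<^esub>, i, j) \<in> filt F (1 + i + j)" for i j
  proof (induction i)
    case 0
    show ?case unfolding y_mon_zero by (rule filt_base[OF G.ball_one[of F 0]]) simp
  next
    case (Suc i)
    have "x \<otimes>\<^bsub>A\<^esub> (y \<otimes>\<^bsub>A\<^esub> mon (\<one>\<^bsub>G\<^esub>, i, j)) \<in> filt F (1 + Suc i + j)" using filt_x[OF Suc] by simp
    moreover have "mon (\<one>\<^bsub>G\<^esub>, i, j) \<in> filt F (1 + Suc i + j)" by (rule filt_base[OF G.ball_one[of F 0]]) simp
    moreover have "mon (c \<otimes>\<^bsub>G\<^esub> b, i, j) \<in> filt F (1 + Suc i + j)" by (rule filt_base[OF G.ball_base[OF cb F]]) simp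
    ultimately show ?case unfolding y_mon_Suc by (intro filtD(3,4) A.submodule_diff[OF filt_submodule])
  qed
  fix h i j r assume h: "h \<in> word_ball G F r" and r: "r + i + j \<le> m"
  have "\<iota> h \<otimes>\<^bsub>A\<^esub> (y \<otimes>\<^bsub>A\<^esub> mon (\<one>\<^bsub>G\<^esub>, i, j)) \<in> filt F (r + (1 + i + j))" by (rule filt_iota[OF h one])
  then have "\<iota> h \<otimes>\<^bsub>A\<^esub> (y \<otimes>\<^bsub>A\<^esub> mon (\<one>\<^bsub>G\<^esub>, i, j)) \<in> filt F (1 + m)" using filt_mono[of "r + (1 + i + j)" "1 + m"] r by auto
  then show "y \<otimes>\<^bsub>A\<^esub> mon (h, i, j) \<in> filt F (1 + m)" unfolding y_mon[OF ballc[OF h]] by (rule filtD(4))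
qed simp

lemma filt_pow:
  assumes "w \<in> carrier A" "\<And>m v. v \<in> filt F m \<Longrightarrow> w \<otimes>\<^bsub>A\<^esub> v \<in> filt F (1 + m)" "v \<in> filt F m"
  shows "w [^]\<^bsub>A\<^esub> (i::nat) \<otimes>\<^bsub>A\<^esub> v \<in> filt F (i + m)"
proof (induction i)
  case 0
  then show ?case using assms(3) filt_carrier by simp
next
  case (Suc i)
  have "w [^]\<^bsub>A\<^esub> Suc i \<otimes>\<^bsub>A\<^esub> v = w \<otimes>\<^bsub>A\<^esub> (w [^]\<^bsub>A\<^esub> i \<otimes>\<^bsub>A\<^esub> v)"
    using assms(1) filt_carrier[OF assms(3)] A.pow_commute[OF assms(1), of i] by (simp flip: A.m_assoc)
  then show ?case using assms(2)[OF Suc] by simp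
qed

text \<open>The left factor is decomposed into generators, each of which raises the level by its own
  weight.\<close>

lemma filt_mult:
  assumes "u \<in> filt F m" "v \<in> filt F m'"
  shows "u \<otimes>\<^bsub>A\<^esub> v \<in> filt F (m + m')"
proof -
  have vc: "v \<in> carrier A" using filt_carrier[OF assms(2)] .
  interpret R: k_linear A A "\<lambda>u. u \<otimes>\<^bsub>A\<^esub> v" by (rule k_linearI[OF A.k_algebra A.k_algebra A.mult_linear(2)[OF vc]])
  show ?thesis
  proof (rule R.span_into[OF mon_weights_carrier filt_submodule _ assms(1)])
    fix s assume "s \<in> mon ` weights F m"
    then obtain g i j r where s: "s = mon (g, i, j)" "g \<in> word_ball G F r" "r + i + j \<le> m" by (auto simp: weights_def)
    have "s \<otimes>\<^bsub>A\<^esub> v = \<iota> g \<otimes>\<^bsub>A\<^esub> (x [^]\<^bsub>A\<^esub> i \<otimes>\<^bsub>A\<^esub> (y [^]\<^bsub>A\<^esub> j \<otimes>\<^bsub>A\<^esub> v))"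
      using s ballc vc by (simp add: mon_def A.m_assoc)
    also have "\<dots> \<in> filt F (r + (i + (j + m')))"
      by (intro filt_iota[OF s(2)] filt_pow[OF x_closed filt_x] filt_pow[OF y_closed filt_y] assms(2))
    finally show "s \<otimes>\<^bsub>A\<^esub> v \<in> filt F (m + m')" using filt_mono[of "r + (i + (j + m'))" "m + m'"] s(3) by auto
  qed
qed

lemma power_space_filt: "V \<subseteq> filt F k \<Longrightarrow> power_space A V n \<subseteq> filt F (k * n)"
proof (rule A.power_space_filtration[of "filt F"])
  show "\<one>\<^bsub>A\<^esub> \<in> filt F 0" using filt_base[OF G.ball_one[of F 0], of 0 0 0] by (simp add: mon_def iota_one)
qed (use filt_mono filt_mult filt_submodule in auto)

end

lemma finite_dimension_in_filt:
  assumes "A.finite_dimension M.K V"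
  obtains F k where "finite F" "F \<subseteq> carrier G" "c \<otimes>\<^bsub>G\<^esub> b \<in> F" "k \<ge> 1" "V \<subseteq> filt F k"
proof -
  obtain J where J: "finite J" "J \<subseteq> Ind" "V \<subseteq> k_span A (mon ` J)"
    using M.finite_dimension_in_basis_span[OF assms] .
  \<comment> \<open>All group elements that occur are put into \<open>F\<close>, so each has word
    length 1; this is the summand 1 in \<open>k\<close>, and the sum bounds every i + j.\<close>
  define F where "F = insert (c \<otimes>\<^bsub>G\<^esub> b) (fst ` J)"
  define k where "k = 1 + (\<Sum>t\<in>J. fst (snd t) + snd (snd t))"
  have F: "finite F" "F \<subseteq> carrier G" "c \<otimes>\<^bsub>G\<^esub> b \<in> F" using J by (auto simp: F_def)
  have "mon ` J \<subseteq> mon ` weights F k"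
  proof (rule image_mono, rule subsetI)
    fix t assume t: "t \<in> J"
    obtain g i j where e: "t = (g, i, j)" by (cases t)
    have "i + j \<le> (\<Sum>t\<in>J. fst (snd t) + snd (snd t))" using member_le_sum[OF t, of "\<lambda>t. fst (snd t) + snd (snd t)"] J(1) e by simp
    moreover have "g \<in> word_ball G F 1" using G.ball_base[of g F] F(2) t e by (force simp: F_def)
    ultimately show "t \<in> weights F k" unfolding weights_def e k_def by auto
  qed
  then have "V \<subseteq> filt F k" using J(3) A.k_span_mono by blast
  then show thesis using that[of F k] F by (simp add: k_def)
qed

lemma GKdim_upper:
  assumes growth: "\<And>F. finite F \<Longrightarrow> F \<subseteq> carrier G \<Longrightarrow> growth (\<lambda>n. card (word_ball G F n)) \<le> ereal d"
  shows "GKdim A \<le> ereal (d + 2)"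
  unfolding GKdim_eq
proof (rule SUP_least)
  fix V assume "V \<in> {V. submodule V scalar_ring A \<and> A.finite_dimension (scalars A) V}"
  then have V: "submodule V scalar_ring A" "A.finite_dimension M.K V" by auto
  obtain F k where F: "finite F" "F \<subseteq> carrier G" "c \<otimes>\<^bsub>G\<^esub> b \<in> F" "k \<ge> 1" "V \<subseteq> filt F k"
    using finite_dimension_in_filt[OF V(2)] .
  have Vc: "V \<subseteq> carrier A" by (rule A.submoduleD(1)[OF V(1)])
  show "growth (\<lambda>n. A.dim M.K (power_space A V n)) \<le> ereal (d + 2)"
  proof (rule growth_le[OF growth[OF F(1,2)] G.card_ball_pos[OF F(1)] F(4)])
    fix n
    have "A.dim M.K (power_space A V n) \<le> card (mon ` weights F (k * n))"
      by (rule M.dim_le_card[OF A.power_space_submodule[OF Vc] power_space_filt[OF F(2,3,5)]])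
        (use finite_weights[OF F(1)] mon_weights_carrier[OF F(2,3)] in auto)
    also have "\<dots> \<le> card (weights F (k * n))" by (rule card_image_le[OF finite_weights[OF F(1)]])
    also have "\<dots> \<le> card (word_ball G F (k * n)) * (k * n + 1)\<^sup>2" by (rule card_weights[OF F(1)])
    finally show "A.dim M.K (power_space A V n) \<le> card (word_ball G F (k * n)) * (k * n + 1)\<^sup>2" .
  qed
qed

text \<open>Take V spanned by F, x and y. For g in the ball of radius n and i, j \<le> n the
  monomial is a word of length at most 3 n, which puts card(ball) times (n + 1)^2 basis elements
  into one power space.\<close>

lemma GKdim_lower:
  assumes F: "finite F" "F \<subseteq> carrier G" and r: "ereal r < growth (\<lambda>n. card (word_ball G F n))"
  shows "ereal (r + 2) \<le> GKdim A"
proof -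
  let ?S = "insert x (insert y (\<iota> ` F))"
  let ?V = "k_span A ?S"
  have S: "?S \<subseteq> carrier A" "finite ?S" using F by auto
  have V: "submodule ?V scalar_ring A" "?V \<subseteq> carrier A" using A.k_span_submodule[OF S(1)] A.k_span_carrier[OF S(1)] by auto
  have fd: "A.finite_dimension M.K ?V" by (rule M.finite_dimension_span[OF S(2,1)])
  have words: "mon (g, i, j) \<in> power_space A ?V (3 * n)" if gb: "g \<in> word_ball G F n" and ij: "i \<le> n" "j \<le> n" for g i j n
  proof -
    obtain vs where vs: "g = foldr (\<otimes>\<^bsub>G\<^esub>) vs \<one>\<^bsub>G\<^esub>" "set vs \<subseteq> F" "length vs \<le> n" using gb by (auto simp: word_ball_def)
    have rep: "foldr (\<otimes>\<^bsub>A\<^esub>) (replicate m w) \<one>\<^bsub>A\<^esub> = w [^]\<^bsub>A\<^esub> m" if w: "w \<in> carrier A" for w m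
      by (induction m) (simp_all add: A.pow_commute[OF w])
    have io: "foldr (\<otimes>\<^bsub>A\<^esub>) (map \<iota> vs) \<one>\<^bsub>A\<^esub> = \<iota> g" if "set vs \<subseteq> carrier G" "g = foldr (\<otimes>\<^bsub>G\<^esub>) vs \<one>\<^bsub>G\<^esub>" for vs g
      using that
    proof (induction vs arbitrary: g)
      case (Cons v vs)
      then show ?case using G.ball_word_closed[of vs] by (simp add: iota_mult)
    qed (simp add: iota_one)
    have app: "foldr (\<otimes>\<^bsub>A\<^esub>) (us @ ws) \<one>\<^bsub>A\<^esub> = foldr (\<otimes>\<^bsub>A\<^esub>) us \<one>\<^bsub>A\<^esub> \<otimes>\<^bsub>A\<^esub> foldr (\<otimes>\<^bsub>A\<^esub>) ws \<one>\<^bsub>A\<^esub>"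
      if "set us \<subseteq> carrier A" "set ws \<subseteq> carrier A" for us ws
      using A.foldr_mult_append[OF that(1) A.ball_word_closed[OF that(2)]] by simp
    let ?w = "map \<iota> vs @ (replicate i x @ replicate j y)"
    have vc: "set (map \<iota> vs) \<subseteq> carrier A" using vs(2) F(2) by auto
    have "foldr (\<otimes>\<^bsub>A\<^esub>) ?w \<one>\<^bsub>A\<^esub> = \<iota> g \<otimes>\<^bsub>A\<^esub> (x [^]\<^bsub>A\<^esub> i \<otimes>\<^bsub>A\<^esub> y [^]\<^bsub>A\<^esub> j)"
      using io[OF order_trans[OF vs(2) F(2)] vs(1)] vc
      by (subst app; (subst app)?) (auto simp: rep simp del: foldr_replicate)
    moreover have "g \<in> carrier G" using gb G.ball_carrier[OF F(2)] by blast
    ultimately have "mon (g, i, j) = foldr (\<otimes>\<^bsub>A\<^esub>) ?w \<one>\<^bsub>A\<^esub>" by (simp add: mon_eq)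
    moreover have "set ?w \<subseteq> ?V" using vs(2) A.k_span_base[of _ ?S] by auto
    moreover have "length ?w \<le> 3 * n" using vs(3) ij by simp
    ultimately show ?thesis using A.power_space_base[of ?w ?V "3 * n"] by simp
  qed
  have "ereal (r + 2) \<le> growth (\<lambda>n. A.dim M.K (power_space A ?V n))"
  proof (rule growth_ge[OF r G.card_ball_pos[OF F(1)]])
    fix n
    let ?J = "word_ball G F n \<times> {..n} \<times> {..n}"
    \<comment> \<open>Counting from below presupposes finite dimension, for which any filtration
      level containing the power space is good enough.\<close>
    obtain F' k where F': "finite F'" "F' \<subseteq> carrier G" "c \<otimes>\<^bsub>G\<^esub> b \<in> F'" "k \<ge> 1" "?V \<subseteq> filt F' k"
      using finite_dimension_in_filt[OF fd] .
    have "card ?J \<le> A.dim M.K (power_space A ?V (3 * n))"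
    proof (rule M.card_le_dim)
      show "A.finite_dimension M.K (power_space A ?V (3 * n))"
        by (rule M.finite_dimension_subspace[OF A.power_space_submodule[OF V(2)] power_space_filt[OF F'(2,3,5)]])
          (use finite_weights[OF F'(1)] mon_weights_carrier[OF F'(2,3)] in auto)
      show "finite ?J" using G.finite_ball[OF F(1)] by simp
      show "?J \<subseteq> Ind" using G.ball_carrier[OF F(2)] by blast
      show "mon ` ?J \<subseteq> power_space A ?V (3 * n)" using words by auto
    qed
    then show "card (word_ball G F n) * (n + 1)\<^sup>2 \<le> A.dim M.K (power_space A ?V (3 * n))"
      by (simp add: card_cartesian_product power2_eq_square)
  qed
  also have "\<dots> \<le> GKdim A" unfolding GKdim_eq using V(1) fd by (intro SUP_upper) simp
  finally show ?thesis .
qed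

lemma GKdim_presentation:
  assumes "GKdim (monoid_algebra G :: ('k, 'g \<Rightarrow>\<^sub>0 'k) module) = ereal d"
  shows "GKdim A = ereal (d + 2)"
proof (rule antisym)
  show "GKdim A \<le> ereal (d + 2)" by (rule GKdim_upper) (rule G.GKdim_group_algebra(1)[OF assms])
  show "ereal (d + 2) \<le> GKdim A"
  \<comment> \<open>The supremum over finite sets F need not be attained, hence the
    \<epsilon>.\<close>
  proof (rule ereal_le_epsilon2)
    fix \<epsilon> :: real assume "\<epsilon> > 0"
    then obtain F where "finite F" "F \<subseteq> carrier G" "ereal (d - \<epsilon>) < growth (\<lambda>n. card (word_ball G F n))"
      using G.GKdim_group_algebra(2)[OF assms, of "d - \<epsilon>"] by auto
    from GKdim_lower[OF this] have "ereal (d - \<epsilon> + 2) + ereal \<epsilon> \<le> GKdim A + ereal \<epsilon>" by (rule add_right_mono)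
    then show "ereal (d + 2) \<le> GKdim A + ereal \<epsilon>" by simp
  qed
qed

lemma affine:
  assumes "finitely_generated_group G"
  shows "affine_algebra A"
proof -
  obtain S where S: "S \<subseteq> carrier G" "finite S" "generate G S = carrier G" using assms by (auto simp: finitely_generated_group_def)
  \<comment> \<open>Inverses of the group generators are listed separately, since a subalgebra is
    closed under products only.\<close>
  let ?S = "\<iota> ` S \<union> \<iota> ` ((\<lambda>g. inv\<^bsub>G\<^esub> g) ` S) \<union> {x, y}"
  have "B = carrier A" if B: "subring B A" "submodule B scalar_ring A" "?S \<subseteq> B" for B
  proof
    note D = A.submoduleD[OF B(2)]
    show "B \<subseteq> carrier A" by (rule D(1))
    have mult: "u \<otimes>\<^bsub>A\<^esub> v \<in> B" if "u \<in> B" "v \<in> B" for u v using subringE(6)[OF B(1) that] .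
    have one: "\<one>\<^bsub>A\<^esub> \<in> B" using subringE(3)[OF B(1)] .
    have gen: "\<iota> g \<in> B" if "g \<in> generate G S" for g
      using that
    proof (induction rule: generate.induct)
      case (eng g h)
      then have "g \<in> carrier G" "h \<in> carrier G" using S(3) by auto
      then show ?case using mult[OF eng(3,4)] by (simp add: iota_mult)
    qed (use B(3) one in \<open>auto simp: iota_one\<close>)
    show "carrier A \<subseteq> B"
    proof
      fix h assume "h \<in> carrier A"
      then show "h \<in> B"
        by (induction rule: generators_induct) (use gen S(3) B(3) D mult in auto)
    qed
  qed
  moreover have "?S \<subseteq> carrier A" "finite ?S" using S by auto
  ultimately show ?thesis unfolding affine_algebra_def by blast
qed

end

section \<open>The isomorphism classes\<close>

text \<open>\<open>H_hopf\<close> extends the record \<open>H_algebra\<close>; bases, tensor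
  products and homomorphisms depend only on the common operations.\<close>

locale same_ops =
  fixes A :: "('k::field, 'a, 'm) module_scheme" and B :: "('k, 'a, 'n) module_scheme"
  assumes ops: "carrier B = carrier A" "monoid.mult B = monoid.mult A" "one B = one A" "ring.zero B = ring.zero A"
    "add B = add A" "module.smult B = module.smult A"
begin

lemma same_lin_comb: "lin_comb B = lin_comb A"
  by (simp add: fun_eq_iff lin_comb_def finsum_def finprod_def ops)

lemma same_basis: "is_k_basis B e I = is_k_basis A e I"
  by (simp add: is_k_basis_def same_lin_comb ops)

lemma same_pow: "u [^]\<^bsub>B\<^esub> (n::nat) = u [^]\<^bsub>A\<^esub> n"
  by (simp add: nat_pow_def ops)

lemma same_minus: "u \<ominus>\<^bsub>B\<^esub> v = u \<ominus>\<^bsub>A\<^esub> v"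
  by (simp add: a_minus_def a_inv_def m_inv_def ops)

lemma same_tensor_cover: "tensor_cover B B = tensor_cover A A"
  by (simp add: tensor_cover_def DirProd_def ops)

lemma same_tensor_ideal: "tensor_ideal B B = tensor_ideal A A"
  by (simp add: tensor_ideal_def same_tensor_cover bilinearity_relations_def ops)

lemma same_tensor: "tensor_algebra B B = tensor_algebra A A" "pure_tensor B B = pure_tensor A A"
  by (simp_all add: tensor_algebra_def pure_tensor_def same_tensor_cover same_tensor_ideal fun_eq_iff)

lemma same_homs: "k_algebra_homs B C = k_algebra_homs A C"
  by (simp add: k_algebra_homs_def k_linear_maps_def ring_hom_def ops)

lemma same_domain: "k_algebra A \<Longrightarrow> nc_domain B = nc_domain A"
  using k_algebra_same_ops[OF _ ops] by (simp add: nc_domain_def k_algebra_def ops)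

lemma same_presentation:
  assumes "H_presentation G A \<chi> \<eta> b c \<beta> \<iota> x y"
  shows "H_presentation G B \<chi> \<eta> b c \<beta> \<iota> x y"
proof -
  interpret H_presentation G A \<chi> \<eta> b c \<beta> \<iota> x y by fact
  show ?thesis
  proof (intro H_presentation.intro H_presentation_axioms.intro k_alg.intro k_algebra_same_ops[OF A.k_algebra ops])
    show "is_k_basis B (\<lambda>(g, i :: nat, j :: nat). \<iota> g \<otimes>\<^bsub>B\<^esub> x [^]\<^bsub>B\<^esub> i \<otimes>\<^bsub>B\<^esub> y [^]\<^bsub>B\<^esub> j) (carrier G \<times> UNIV \<times> UNIV)"
      using monomial_basis by (simp only: same_basis same_pow ops)
  qed (use chi_character eta_character b_central c_central eta_b iota_one iota_mult x_iota y_iota y_x G.is_group in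
      \<open>auto simp: same_minus ops\<close>)
qed

end

text \<open>In y (x g) the factor \<chi>(g) \<eta>(g) multiplies the \<beta>-term as well, whereas
  in (y x) g the central element c b lets g pass through it unchanged. Comparing the coefficients of
  g gives \<chi>(g) \<eta>(g) \<beta> = \<beta>.\<close>

lemma (in H_presentation) chi_eta_inverse:
  assumes \<beta>: "\<beta> \<noteq> 0" and cb: "c \<otimes>\<^bsub>G\<^esub> b \<noteq> \<one>\<^bsub>G\<^esub>" and g: "g \<in> carrier G"
  shows "\<eta> g = inverse (\<chi> g)"
proof -
  let ?cb = "c \<otimes>\<^bsub>G\<^esub> b"
  let ?q = "\<chi> g * \<eta> g"
  note [simp del] = UNIV_Times_UNIV
  note L = A.mult_smult_left A.mult_smult_right A.smult_smult A.smult_add_right A.l_distr A.r_distr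
  let ?m = "mon (g, 1, 1)" and ?d = "\<iota> g \<oplus>\<^bsub>A\<^esub> (-1) \<odot>\<^bsub>A\<^esub> \<iota> (g \<otimes>\<^bsub>G\<^esub> ?cb)"
  have m: "?m = \<iota> g \<otimes>\<^bsub>A\<^esub> (x \<otimes>\<^bsub>A\<^esub> y)" using g by (simp add: mon_eq)
  have cg: "?cb \<otimes>\<^bsub>G\<^esub> g = g \<otimes>\<^bsub>G\<^esub> ?cb" using g b_commute[OF g] c_commute[OF g]
    by (metis G.m_assoc b_closed c_closed)
  have yx: "y \<otimes>\<^bsub>A\<^esub> x = \<eta> b \<odot>\<^bsub>A\<^esub> (x \<otimes>\<^bsub>A\<^esub> y) \<oplus>\<^bsub>A\<^esub> \<beta> \<odot>\<^bsub>A\<^esub> (\<one>\<^bsub>A\<^esub> \<oplus>\<^bsub>A\<^esub> (-1) \<odot>\<^bsub>A\<^esub> \<iota> ?cb)"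
    using y_x by (simp add: a_minus_def A.minus_eq_smult)
  have "y \<otimes>\<^bsub>A\<^esub> (x \<otimes>\<^bsub>A\<^esub> \<iota> g) = ?q \<odot>\<^bsub>A\<^esub> (\<iota> g \<otimes>\<^bsub>A\<^esub> (y \<otimes>\<^bsub>A\<^esub> x))"
  proof -
    have "y \<otimes>\<^bsub>A\<^esub> (x \<otimes>\<^bsub>A\<^esub> \<iota> g) = \<chi> g \<odot>\<^bsub>A\<^esub> ((y \<otimes>\<^bsub>A\<^esub> \<iota> g) \<otimes>\<^bsub>A\<^esub> x)"
      unfolding x_iota[OF g] using g by (simp add: A.mult_smult_right A.m_assoc)
    then show ?thesis unfolding y_iota[OF g] using g by (simp add: A.mult_smult_left A.smult_smult A.m_assoc)
  qed
  also have "\<iota> g \<otimes>\<^bsub>A\<^esub> (y \<otimes>\<^bsub>A\<^esub> x) = \<eta> b \<odot>\<^bsub>A\<^esub> ?m \<oplus>\<^bsub>A\<^esub> \<beta> \<odot>\<^bsub>A\<^esub> ?d"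
    unfolding yx m using g by (simp add: A.mult_smult_right A.r_distr iota_mult)
  finally have 1: "y \<otimes>\<^bsub>A\<^esub> (x \<otimes>\<^bsub>A\<^esub> \<iota> g) = ?q \<odot>\<^bsub>A\<^esub> (\<eta> b \<odot>\<^bsub>A\<^esub> ?m \<oplus>\<^bsub>A\<^esub> \<beta> \<odot>\<^bsub>A\<^esub> ?d)" .
  have xyg: "(x \<otimes>\<^bsub>A\<^esub> y) \<otimes>\<^bsub>A\<^esub> \<iota> g = ?q \<odot>\<^bsub>A\<^esub> ?m"
  proof -
    have "(x \<otimes>\<^bsub>A\<^esub> y) \<otimes>\<^bsub>A\<^esub> \<iota> g = \<eta> g \<odot>\<^bsub>A\<^esub> ((x \<otimes>\<^bsub>A\<^esub> \<iota> g) \<otimes>\<^bsub>A\<^esub> y)"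
      using g by (simp add: A.m_assoc y_iota A.mult_smult_right)
    then show ?thesis unfolding x_iota[OF g] m using g
      by (simp add: A.mult_smult_left A.smult_smult A.m_assoc mult.commute)
  qed
  have "y \<otimes>\<^bsub>A\<^esub> (x \<otimes>\<^bsub>A\<^esub> \<iota> g) = (y \<otimes>\<^bsub>A\<^esub> x) \<otimes>\<^bsub>A\<^esub> \<iota> g" using g by (simp add: A.m_assoc)
  also have "\<dots> = \<eta> b \<odot>\<^bsub>A\<^esub> (?q \<odot>\<^bsub>A\<^esub> ?m) \<oplus>\<^bsub>A\<^esub> \<beta> \<odot>\<^bsub>A\<^esub> ?d"
    unfolding yx xyg[symmetric] using g by (simp add: A.mult_smult_left A.l_distr cg flip: iota_mult)
  finally have 2: "y \<otimes>\<^bsub>A\<^esub> (x \<otimes>\<^bsub>A\<^esub> \<iota> g) = \<eta> b \<odot>\<^bsub>A\<^esub> (?q \<odot>\<^bsub>A\<^esub> ?m) \<oplus>\<^bsub>A\<^esub> \<beta> \<odot>\<^bsub>A\<^esub> ?d" .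
  have coords: "M.coord (\<iota> h) = Poly_Mapping.single (h, 0, 0) 1" if "h \<in> carrier G" for h
    using M.coord_basis[of "(h, 0, 0)"] mon_generators(1)[OF that] that by simp
  have "(g, 1, 1) \<in> Ind" using g by blast
  then have cm: "M.coord ?m = Poly_Mapping.single (g, 1, 1) 1" "?m \<in> carrier A"
    by (rule M.coord_basis, rule M.basis_closed)
  \<comment> \<open>Since c b differs from 1, the two terms of g (1 - c b) cannot cancel at
    g.\<close>
  have "g \<otimes>\<^bsub>G\<^esub> ?cb \<noteq> g" using g cb by simp
  then have cd: "lookup (M.coord ?d) (g, 0, 0) = 1" "?d \<in> carrier A"
    using g by (simp_all add: M.coord_add M.coord_smult coords lookup_add lookup_single)
  have "lookup (M.coord (?q \<odot>\<^bsub>A\<^esub> (\<eta> b \<odot>\<^bsub>A\<^esub> ?m \<oplus>\<^bsub>A\<^esub> \<beta> \<odot>\<^bsub>A\<^esub> ?d))) (g, 0, 0) = ?q * \<beta>"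
    using cm(2) cd by (simp add: M.coord_add M.coord_smult lookup_add cm(1)[unfolded One_nat_def] lookup_single)
  moreover have "lookup (M.coord (\<eta> b \<odot>\<^bsub>A\<^esub> (?q \<odot>\<^bsub>A\<^esub> ?m) \<oplus>\<^bsub>A\<^esub> \<beta> \<odot>\<^bsub>A\<^esub> ?d)) (g, 0, 0) = \<beta>"
    using cm(2) cd by (simp add: M.coord_add M.coord_smult lookup_add cm(1)[unfolded One_nat_def] lookup_single)
  ultimately have "?q * \<beta> = \<beta>" using 1 2 by simp
  then show ?thesis using \<beta> chi_simps(1)[OF g] by (simp add: field_simps)
qed

text \<open>Scaling y by \<kappa> scales both sides of its relations and turns \<beta>' into
  \<kappa> \<beta>'. The characters are compared on G only, because g \<mapsto> \<chi>(g)^-1 may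
  differ from \<eta> off the carrier.\<close>

lemma rescale_hom:
  assumes A: "H_presentation G A \<chi> \<eta> b c \<beta> \<iota> x y" and B: "H_presentation G B \<chi> \<eta>' b c \<beta>' \<iota>' x' y'"
    and \<eta>: "\<And>g. g \<in> carrier G \<Longrightarrow> \<eta>' g = \<eta> g" and \<kappa>: "\<beta> = \<kappa> * \<beta>'"
  obtains F where "F \<in> k_algebra_homs A B" "\<And>g. g \<in> carrier G \<Longrightarrow> F (\<iota> g) = \<iota>' g" "F x = x'" "F y = \<kappa> \<odot>\<^bsub>B\<^esub> y'"
proof -
  interpret A: H_presentation G A \<chi> \<eta> b c \<beta> \<iota> x y by fact
  interpret B: H_presentation G B \<chi> \<eta>' b c \<beta>' \<iota>' x' y' by fact
  let ?cb = "c \<otimes>\<^bsub>G\<^esub> b"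
  show thesis
  proof (rule A.hom_extension[of B \<iota>' x' "\<kappa> \<odot>\<^bsub>B\<^esub> y'"])
    show "\<kappa> \<odot>\<^bsub>B\<^esub> y' \<otimes>\<^bsub>B\<^esub> \<iota>' g = \<eta> g \<odot>\<^bsub>B\<^esub> (\<iota>' g \<otimes>\<^bsub>B\<^esub> (\<kappa> \<odot>\<^bsub>B\<^esub> y'))" if "g \<in> carrier G" for g
      using that B.y_iota[OF that] \<eta>[OF that]
      by (simp add: B.A.mult_smult_left B.A.mult_smult_right B.A.smult_smult mult.commute)
    have "\<kappa> \<odot>\<^bsub>B\<^esub> y' \<otimes>\<^bsub>B\<^esub> x' = \<kappa> \<odot>\<^bsub>B\<^esub> (y' \<otimes>\<^bsub>B\<^esub> x')" by (simp add: B.A.mult_smult_left)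
    also have "\<dots> = (\<kappa> * \<eta>' b) \<odot>\<^bsub>B\<^esub> (x' \<otimes>\<^bsub>B\<^esub> y') \<oplus>\<^bsub>B\<^esub> \<beta> \<odot>\<^bsub>B\<^esub> (\<one>\<^bsub>B\<^esub> \<ominus>\<^bsub>B\<^esub> \<iota>' ?cb)"
      unfolding B.y_x by (simp add: B.A.smult_add_right B.A.smult_smult \<kappa>)
    also have "(\<kappa> * \<eta>' b) \<odot>\<^bsub>B\<^esub> (x' \<otimes>\<^bsub>B\<^esub> y') = \<eta> b \<odot>\<^bsub>B\<^esub> (x' \<otimes>\<^bsub>B\<^esub> (\<kappa> \<odot>\<^bsub>B\<^esub> y'))"
      using \<eta>[OF A.b_closed] by (simp add: B.A.mult_smult_right B.A.smult_smult mult.commute)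
    finally show "\<kappa> \<odot>\<^bsub>B\<^esub> y' \<otimes>\<^bsub>B\<^esub> x' = \<eta> b \<odot>\<^bsub>B\<^esub> (x' \<otimes>\<^bsub>B\<^esub> (\<kappa> \<odot>\<^bsub>B\<^esub> y')) \<oplus>\<^bsub>B\<^esub> \<beta> \<odot>\<^bsub>B\<^esub> (\<one>\<^bsub>B\<^esub> \<ominus>\<^bsub>B\<^esub> \<iota>' ?cb)" .
  qed (use that B.iota_one B.iota_mult B.x_iota B.A.k_algebra in auto)
qed

text \<open>The inverse arises from the same construction with \<kappa>^-1. Scaling respects
  \<Delta> and \<epsilon> because y is skew-primitive and both are linear.\<close>

lemma hopf_isomorphic_rescale:
  assumes A: "H_hopf_presentation G A \<chi> \<eta> b c \<beta> \<iota> x y" and B: "H_hopf_presentation G B \<chi> \<eta>' b c \<beta>' \<iota>' x' y'"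
    and \<eta>: "\<And>g. g \<in> carrier G \<Longrightarrow> \<eta>' g = \<eta> g" and \<kappa>: "\<kappa> \<noteq> 0" "\<beta> = \<kappa> * \<beta>'"
  shows "hopf_isomorphic A B"
proof -
  interpret A: H_hopf_presentation G A \<chi> \<eta> b c \<beta> \<iota> x y by fact
  interpret B: H_hopf_presentation G B \<chi> \<eta>' b c \<beta>' \<iota>' x' y' by fact
  obtain F where F: "F \<in> k_algebra_homs A B" "\<And>g. g \<in> carrier G \<Longrightarrow> F (\<iota> g) = \<iota>' g" "F x = x'" "F y = \<kappa> \<odot>\<^bsub>B\<^esub> y'"
    using rescale_hom[OF A.H_presentation_axioms B.H_presentation_axioms \<eta> \<kappa>(2)] by blast
  have "\<beta>' = inverse \<kappa> * \<beta>" using \<kappa> by simp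
  then obtain F' where F': "F' \<in> k_algebra_homs B A" "\<And>g. g \<in> carrier G \<Longrightarrow> F' (\<iota>' g) = \<iota> g" "F' x' = x"
    "F' y' = inverse \<kappa> \<odot>\<^bsub>A\<^esub> y"
    using rescale_hom[OF B.H_presentation_axioms A.H_presentation_axioms, of "inverse \<kappa>"] \<eta> by metis
  note FD = k_algebra_homsD[OF F(1)] and FD' = k_algebra_homsD[OF F'(1)]
  have idA: "(\<lambda>u. u) \<in> k_algebra_homs A A" and idB: "(\<lambda>u. u) \<in> k_algebra_homs B B"
    by (auto intro!: k_algebra_homsI k_linear_mapsI)
  have "F' (F h) = h" if "h \<in> carrier A" for h
    by (rule A.hom_unique[OF k_algebra_homs_comp[OF F(1) F'(1)] idA _ _ _ that])
      (use \<kappa> in \<open>simp_all add: F F' FD' A.A.smult_smult\<close>)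
  moreover have "F (F' h) = h" if "h \<in> carrier B" for h
    by (rule B.hom_unique[OF k_algebra_homs_comp[OF F'(1) F(1)] idB _ _ _ that])
      (use \<kappa> in \<open>simp_all add: F F' FD B.A.smult_smult\<close>)
  ultimately have "bij_betw F (carrier A) (carrier B)"
    using FD(2) FD'(2) by (intro bij_betw_byWitness[of _ F']) auto
  moreover have "tensor_lift B.TA (\<lambda>u v. B.p (F u) (F v)) (comult A h) = comult B (F h)" if h: "h \<in> carrier A" for h
  proof -
    let ?\<phi> = "\<lambda>u v. B.p (F u) (F v)"
    have W: "k_algebra B.TA" by (rule B.T.tensor_k_algebra)
    have bil: "k_bilinear A A B.TA ?\<phi>"
      by (rule k_bilinearI) (simp_all add: FD B.T.pure_closed B.p_linear)
    have th: "tensor_lift B.TA ?\<phi> \<in> k_algebra_homs A.TA B.TA"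
      by (rule A.T.tensor_lift_hom[OF W bil]) (simp_all add: FD B.T.pure_mult B.T.pure_one)
    note P = A.T.tensor_lift_pure[OF W bil] and L = k_algebra_homsD[OF th]
    show ?thesis
    proof (rule A.hom_unique[OF k_algebra_homs_comp[OF A.comult_hom th] k_algebra_homs_comp[OF F(1) B.comult_hom] _ _ _ h])
      show "tensor_lift B.TA ?\<phi> (comult A y) = comult B (F y)"
        by (simp add: A.comult_y L A.T.pure_closed P F FD B.Delta B.comult_y B.p_linear B.T.pure_closed B.T.T.smult_add_right)
    qed (simp_all add: A.comult_iota A.comult_x L A.T.pure_closed P F FD B.comult_iota B.comult_x)
  qed
  moreover have "counit B (F h) = counit A h" if h: "h \<in> carrier A" for h
    by (rule A.hom_unique[OF k_algebra_homs_comp[OF F(1) B.counit_hom] A.counit_hom _ _ _ h])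
      (simp_all add: F A.counit_iota B.counit_iota A.counit_x B.counit_x A.counit_y B.counit_y B.counit_simps)
  ultimately show ?thesis unfolding hopf_isomorphic_def using F(1) by blast
qed

text \<open>Matches the two-part description of the counit in \<open>H_hopf\<close> with algebra
  maps into the ground field.\<close>

lemma hom_scalar_algebra_iff:
  fixes A :: "('k::field, 'a, 'm) module_scheme"
  shows "\<epsilon> \<in> k_algebra_homs A scalar_algebra \<longleftrightarrow>
    \<epsilon> \<in> ring_hom A scalar_ring \<and> (\<forall>k. \<forall>h\<in>carrier A. \<epsilon> (k \<odot>\<^bsub>A\<^esub> h) = k * \<epsilon> h)"
  by (auto simp: k_algebra_homs_def k_linear_maps_def ring_hom_def)

section \<open>The Hopf algebra of a datum and its normal forms\<close>

context H_datum
begin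

abbreviation "HH \<equiv> H_hopf G \<chi> \<eta> b c \<beta>"

lemma H_hopf_ops: "carrier HH = carrier HA" "monoid.mult HH = monoid.mult HA" "one HH = one HA"
    "ring.zero HH = ring.zero HA" "add HH = add HA" "module.smult HH = module.smult HA"
  by (simp_all add: H_hopf_def Let_def module.defs)

sublocale same: same_ops HA HH
  by unfold_locales (rule H_hopf_ops)+

text \<open>The existence results turn the two choice operators into maps with the prescribed values
  on generators.\<close>

lemma H_hopf_presentation:
  "H_hopf_presentation G HH \<chi> \<eta> b c \<beta> (H_group_elt G \<chi>) (H_x G \<chi>) (H_y G \<chi>)"
proof -
  interpret P: H_presentation G HA \<chi> \<eta> b c \<beta> "H_group_elt G \<chi>" "H_x G \<chi>" "H_y G \<chi>" by (rule H_presentation)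
  let ?gg = "H_group_elt G \<chi>" and ?x = "H_x G \<chi>" and ?y = "H_y G \<chi>"
  let ?C = "\<lambda>\<Delta>. \<Delta> \<in> k_algebra_homs HA P.TA \<and> (\<forall>g\<in>carrier G. \<Delta> (?gg g) = P.p (?gg g) (?gg g)) \<and>
    \<Delta> ?x = P.p ?x \<one>\<^bsub>HA\<^esub> \<oplus>\<^bsub>P.TA\<^esub> P.p (?gg b) ?x \<and> \<Delta> ?y = P.p ?y \<one>\<^bsub>HA\<^esub> \<oplus>\<^bsub>P.TA\<^esub> P.p (?gg c) ?y"
  let ?E = "\<lambda>\<epsilon>. \<epsilon> \<in> ring_hom HA scalar_ring \<and> (\<forall>k. \<forall>h\<in>carrier HA. \<epsilon> (k \<odot>\<^bsub>HA\<^esub> h) = k * \<epsilon> h) \<and>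
    (\<forall>g\<in>carrier G. \<epsilon> (?gg g) = 1) \<and> \<epsilon> ?x = 0 \<and> \<epsilon> ?y = 0"
  have ex: "\<exists>\<Delta>. ?C \<Delta>" by (rule P.comult_exists) blast
  have eq: "comult HH = Eps ?C" by (simp add: H_hopf_def Let_def module.defs bialgebra.defs)
  have C: "?C (comult HH)" unfolding eq by (rule someI_ex[of ?C, OF ex])
  have ex: "\<exists>\<epsilon>. ?E \<epsilon>" by (rule P.counit_exists) (unfold hom_scalar_algebra_iff, blast)
  have eq: "counit HH = Eps ?E" by (simp add: H_hopf_def Let_def module.defs bialgebra.defs)
  have E: "?E (counit HH)" unfolding eq by (rule someI_ex[of ?E, OF ex])
  show ?thesis
  proof (intro H_hopf_presentation.intro same.same_presentation[OF H_presentation] H_hopf_presentation_axioms.intro)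
    show "counit HH \<in> k_algebra_homs HH scalar_algebra" using E by (simp add: same.same_homs hom_scalar_algebra_iff)
  qed (use C E in \<open>simp_all add: same.same_tensor same.same_homs H_hopf_ops\<close>)
qed

lemma beta_elt_eq: "beta_elt G b c \<beta> =
    Poly_Mapping.map ((*) \<beta>) (Poly_Mapping.single \<one> 1 - Poly_Mapping.single (c \<otimes> b) (1 :: 'k))"
proof -
  have "Poly_Mapping.single (c \<otimes> b) 1 \<in> carrier (KG :: ('k, 'a \<Rightarrow>\<^sub>0 'k) module)"
    using center_closed[OF b_central] center_closed[OF c_central] by (simp add: monoid_algebra_simps)
  then show ?thesis unfolding beta_elt_def a_minus_def
    by (simp add: base.B.R.minus_eq_smult) (simp add: monoid_algebra_simps map_mult_poly_mapping single_uminus)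
qed

lemma beta_elt_zero_iff: "beta_elt G b c \<beta> = 0 \<longleftrightarrow> \<beta> = 0 \<or> c = inv b"
proof -
  have bc: "b \<in> carrier G" "c \<in> carrier G" using center_closed[OF b_central] center_closed[OF c_central] .
  have "beta_elt G b c \<beta> = 0 \<longleftrightarrow> \<beta> = 0 \<or> c \<otimes> b = \<one>"
  proof (cases "c \<otimes> b = \<one>")
    case False
    \<comment> \<open>When c b differs from 1, the coefficient at the identity isolates
      \<beta>.\<close>
    then have "lookup (beta_elt G b c \<beta>) \<one> = \<beta>" by (simp add: beta_elt_eq lookup_minus lookup_single)
    then show ?thesis using False by (auto simp: beta_elt_eq poly_mapping_eq_iff fun_eq_iff)
  qed (simp add: beta_elt_eq map_mult_poly_mapping)
  also have "c \<otimes> b = \<one> \<longleftrightarrow> c = inv b" using bc by (metis inv_equality l_inv)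
  finally show ?thesis .
qed

text \<open>The data \<beta> and 0 admit the same derivations, because \<beta> enters them only
  through \<open>beta_elt\<close>. The same choices are made, and the two Hopf algebras are equal,
  not merely isomorphic.\<close>

lemma beta_zero:
  assumes "beta_elt G b c \<beta> = 0"
  shows "H_datum G \<chi> \<eta> b c 0" "hopf_isomorphic HH (H_hopf G \<chi> \<eta> b c 0)"
proof -
  have "beta_elt G b c 0 = (0 :: 'a \<Rightarrow>\<^sub>0 'k)"
    by (simp add: beta_elt_def monoid_algebra_simps poly_mapping_eq_iff fun_eq_iff)
  then have der: "H_derivations G \<chi> \<eta> b c \<beta> = H_derivations G \<chi> \<eta> b c 0" using assms by (simp add: H_derivations_def)
  show "H_datum G \<chi> \<eta> b c 0"
    by unfold_locales (use chi_character eta_character b_central c_central eta_b derivation_exists der in auto)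
  have "H_algebra G \<chi> \<eta> b c \<beta> = H_algebra G \<chi> \<eta> b c 0" by (simp add: H_algebra_def der)
  then have eq: "HH = H_hopf G \<chi> \<eta> b c 0" by (simp add: H_hopf_def)
  show "hopf_isomorphic HH (H_hopf G \<chi> \<eta> b c 0)"
    unfolding eq[symmetric] by (rule hopf_isomorphic_rescale[OF H_hopf_presentation H_hopf_presentation, of 1]) auto
qed

text \<open>The datum with parameter 1 needs a derivation of its own; it is \<beta>^-1 \<delta>. The
  isomorphism is then the rescaling with \<kappa> = \<beta>.\<close>

lemma beta_nonzero:
  assumes "beta_elt G b c \<beta> \<noteq> 0"
  shows "\<And>g. g \<in> carrier G \<Longrightarrow> \<eta> g = inverse (\<chi> g)" "H_datum G \<chi> (\<lambda>g. inverse (\<chi> g)) b c 1"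
    "hopf_isomorphic HH (H_hopf G \<chi> (\<lambda>g. inverse (\<chi> g)) b c 1)"
proof -
  interpret P: H_presentation G HA \<chi> \<eta> b c \<beta> "H_group_elt G \<chi>" "H_x G \<chi>" "H_y G \<chi>" by (rule H_presentation)
  have bc: "b \<in> carrier G" "c \<in> carrier G" by simp_all
  have nz: "\<beta> \<noteq> 0" "c \<otimes> b \<noteq> \<one>" using assms bc unfolding beta_elt_zero_iff by (auto dest: inv_equality)
  show \<eta>: "\<eta> g = inverse (\<chi> g)" if "g \<in> carrier G" for g by (rule P.chi_eta_inverse[OF nz that])
  let ?\<eta> = "\<lambda>g. inverse (\<chi> g)" and ?R = "H_base G \<chi>"
  \<comment> \<open>The two characters agree only on G, but elements of the carrier are supported
    there, so the twists agree on the carrier.\<close>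
  have tw: "H_twist ?\<eta> b u = H_twist \<eta> b u" if "u \<in> carrier ?R" for u
  proof
    fix i
    have "u i \<in> carrier (KG :: ('k, 'a \<Rightarrow>\<^sub>0 'k) module)" using that base.B.up_closed by (simp add: base.B.ore_simps)
    then have "twist ?\<eta> (u i) = twist \<eta> (u i)"
      by (intro poly_mapping_eqI) (auto simp: monoid_algebra_simps in_keys_iff \<eta> subset_iff)
    then show "H_twist ?\<eta> b u i = H_twist \<eta> b u i" by (simp add: H_twist_def \<eta>[OF bc(1)])
  qed
  obtain \<delta> where "\<delta> \<in> H_derivations G \<chi> \<eta> b c \<beta>" using derivation_exists by blast
  note D = this[unfolded H_derivations_def skew_derivations_def, simplified]
  let ?\<delta> = "\<lambda>u. inverse \<beta> \<odot>\<^bsub>?R\<^esub> \<delta> u"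
  have dl: "\<delta> \<in> k_linear_maps ?R ?R" using D by blast
  note dD = k_linear_mapsD[OF dl]
  have "H_twist \<eta> b u \<in> carrier ?R" if "u \<in> carrier ?R" for u
    using k_algebra_homsD(2)[OF base.H_twist_hom[OF eta_character] that] .
  note twc = this
  have "?\<delta> \<in> H_derivations G \<chi> ?\<eta> b c 1"
    unfolding H_derivations_def skew_derivations_def
  proof (intro CollectI conjI ballI)
    show "?\<delta> \<in> k_linear_maps ?R ?R"
      by (rule k_linear_mapsI) (simp_all add: dD base.B.E.smult_add_right base.B.E.smult_left_commute)
    show "?\<delta> (u \<otimes>\<^bsub>?R\<^esub> v) = (H_twist ?\<eta> b u \<otimes>\<^bsub>?R\<^esub> ?\<delta> v) \<oplus>\<^bsub>?R\<^esub> (?\<delta> u \<otimes>\<^bsub>?R\<^esub> v)"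
      if "u \<in> carrier ?R" "v \<in> carrier ?R" for u v
      using that D twc by (simp add: tw dD base.B.E.mult_smult_left base.B.E.mult_smult_right base.B.E.smult_add_right)
    show "?\<delta> (ore_const KG (Poly_Mapping.single g 1)) = \<zero>\<^bsub>?R\<^esub>" if "g \<in> carrier G" for g using that D by simp
    have "beta_elt G b c 1 = Poly_Mapping.map ((*) (inverse \<beta>)) (beta_elt G b c \<beta>)"
      unfolding beta_elt_def using nz(1)
      by (simp add: monoid_algebra_simps poly_mapping_eq_iff fun_eq_iff)
    then show "?\<delta> (ore_var KG) = ore_const KG (beta_elt G b c 1)" using D
      by (auto simp: base.B.ore_simps monoid_algebra_simps ore_const_def fun_eq_iff map_mult_poly_mapping)
  qed
  moreover have "?\<eta> \<in> characters G" using eta_character \<eta> by (auto simp: hom_def Pi_iff)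
  ultimately show D': "H_datum G \<chi> ?\<eta> b c 1"
    by unfold_locales (use chi_character b_central c_central eta_b \<eta>[OF bc(1)] in auto)
  show "hopf_isomorphic HH (H_hopf G \<chi> ?\<eta> b c 1)"
    by (rule hopf_isomorphic_rescale[OF H_hopf_presentation H_datum.H_hopf_presentation[OF D'], of \<beta>])
      (use nz \<eta> in auto)
qed

end

theorem theorem4p3:
  fixes G :: "('g, 'm) monoid_scheme"
    and \<chi> \<eta> :: "'g \<Rightarrow> 'k::{alg_closed_field, field_char_0}"
    and b c :: 'g and \<beta> :: 'k
  assumes datum: "H_datum G \<chi> \<eta> b c \<beta>"
    and H: "H = H_hopf G \<chi> \<eta> b c \<beta>"
    and x: "x = H_x G \<chi>"
    and y: "y = H_y G \<chi>"
    and \<iota>: "\<iota> = H_group_elt G \<chi>"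
    and S: "S = antipode H"
    and KG: "KG = (monoid_algebra G :: ('k, 'g \<Rightarrow>\<^sub>0 'k) module)"
  shows
   "\<comment> \<open>1\<close>
    is_k_basis H (\<lambda>(g, i :: nat, j :: nat). \<iota> g \<otimes>\<^bsub>H\<^esub> x [^]\<^bsub>H\<^esub> i \<otimes>\<^bsub>H\<^esub> y [^]\<^bsub>H\<^esub> j)
      (carrier G \<times> UNIV \<times> UNIV) \<and>
    \<comment> \<open>2\<close>
    (beta_elt G b c \<beta> = \<zero>\<^bsub>KG\<^esub> \<longleftrightarrow> \<beta> = 0 \<or> c = inv\<^bsub>G\<^esub> b) \<and>
    (beta_elt G b c \<beta> = \<zero>\<^bsub>KG\<^esub> \<longrightarrow>
       H_datum G \<chi> \<eta> b c 0 \<and> hopf_isomorphic H (H_hopf G \<chi> \<eta> b c 0)) \<and>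
    (beta_elt G b c \<beta> \<noteq> \<zero>\<^bsub>KG\<^esub> \<longrightarrow>
       (\<forall>g\<in>carrier G. \<eta> g = inverse (\<chi> g)) \<and>
       H_datum G \<chi> (\<lambda>g. inverse (\<chi> g)) b c 1 \<and>
       hopf_isomorphic H (H_hopf G \<chi> (\<lambda>g. inverse (\<chi> g)) b c 1)) \<and>
    \<comment> \<open>3\<close>
    (polycyclic_by_finite G \<longrightarrow> nc_noetherian H) \<and>
    \<comment> \<open>4\<close>
    (nc_domain H \<longleftrightarrow> nc_domain KG) \<and>
    \<comment> \<open>5\<close>
    (\<forall>d :: real. finitely_generated_group G \<and> GKdim KG = ereal d \<longrightarrow>
       affine_algebra H \<and> GKdim H = ereal (d + 2)) \<and>
    \<comment> \<open>6\<close>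
    (\<forall>g\<in>carrier G. S (S (\<iota> g)) = \<iota> g) \<and>
    S (S x) = \<chi> b \<odot>\<^bsub>H\<^esub> x \<and>
    S (S y) = \<eta> c \<odot>\<^bsub>H\<^esub> y \<and>
    (finite_order_on (carrier H) S \<longleftrightarrow> root_of_unity (\<chi> b) \<and> root_of_unity (\<eta> c)) \<and>
    \<comment> \<open>7\<close>
    is_hopf_algebra H \<and> pointed H \<and> group_likes H = \<iota> ` carrier G"
proof -
  interpret D: H_datum G \<chi> \<eta> b c \<beta> by fact
  interpret P: H_hopf_presentation G H \<chi> \<eta> b c \<beta> \<iota> x y
    unfolding H \<iota> x y by (rule D.H_hopf_presentation)
  have zero: "\<zero>\<^bsub>KG\<^esub> = 0" by (simp add: KG monoid_algebra_simps)
  \<comment> \<open>The chosen antipode is known only on the carrier, so the inner value must be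
    seen to lie there.\<close>
  have SS: "S (S h) = P.S0 (P.S0 h)" if "h \<in> carrier H" for h
    using that by (simp add: S P.antipode_eq P.S0_simps)
  have "nc_domain H \<longleftrightarrow> nc_domain KG"
    unfolding H KG using D.same.same_domain[OF D.H.ore_k_algebra] D.H_domain_iff by simp
  then show ?thesis
    unfolding zero
    using P.monomial_basis D.beta_elt_zero_iff D.beta_zero D.beta_nonzero P.noetherian P.affine
      P.GKdim_presentation P.S0_S0 P.antipode_finite_order_iff P.hopf_algebra P.pointed P.group_likes_eq
    by (simp add: SS H[symmetric]) (simp add: KG S)
qed

end
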